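(* Let $f$ and $A_0$ be as in the context and, for $\rho>0$, let $\mathcal S(\varphi,\psi)=(\varphi+\rho f(\varphi,\psi),A_0\psi)$. Let $h$ and $\overline h$ be the functions, defined in the context, describing respectively the conjugation of $\mathcal S$ to its linearization around its invariant manifold and the conjugation of the averaged map to its linearization. There exist $\rho_*>0$ and a constant $C_7$, independent of $\rho$, such that for all $\rho\in(0,\rho_* )$ and all $\varphi\in\mathcal U$ $$\bigl|\langle h(\varphi,\cdot)-\overline h(\varphi)\rangle\bigr|\le C_7\rho,\qquad \bigl\langle(h(\varphi,\cdot)-\overline h(\varphi))^2\bigr\rangle\le C_7\rho,$$ $$\bigl|\langle\partial_\varphi h(\varphi,\cdot)-\partial_\varphi\overline h(\varphi)\rangle\bigr|\le C_7\rho,\qquad \bigl\langle(\partial_\varphi h(\varphi,\cdot)-\partial_\varphi\overline h(\varphi))^2\bigr\rangle\le C_7\rho .$$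
   Context: $\mathbb T=\mathbb R/2\pi\mathbb Z$. $A_0$ is an Anosov (hyperbolic linear) automorphism of $\mathbb T^2$. $\langle g\rangle=\int_{\mathbb T^2}g(\psi)\,d\psi/(2\pi)^2$. For $\alpha\in(0,1]$, $k\ge1$, and $g(\varphi,\psi)$: $|g|_\alpha=\sup|g(\varphi,\psi')-g(\varphi,\psi)|/|\psi'-\psi|^\alpha$, and $\mathscr B_{\alpha,k}$ is the space of functions $k$ times continuously differentiable in $\varphi$ with $|||g|||_{\alpha,k}=\sum_{n=0}^k\|\partial_\varphi^ng\|_\infty+\alpha\sum_{n=0}^{k-1}|\partial_\varphi^ng|_\alpha<\infty$. Standing assumptions: $f\in\mathscr B_{\alpha_0,6}(\mathbb T\times\mathbb T^2,\mathbb R)$ for some $\alpha_0\in(0,1]$, $|||f|||_{\alpha_0,6}=1$; there is a closed interval $\mathcal U=[\phi_m,\phi_M]\subsetneq\mathbb T$, $\phi_m<\phi_M$ (identified with an interval of $\mathbb R$), with $\Omega=\mathcal U\times\mathbb T^2$, such that $f(\phi_m,\psi)>0>f(\phi_M,\psi)$ for all $\psi$; for every $\psi$ there is a unique $S(\psi)\in\operatorname{int}\mathcal U$ with $f(S(\psi),\psi)=0$; with $S_m=\inf_\psi S$, $S_M=\sup_\psi S$, $\Lambda=[S_m,S_M]\times\mathbb T^2$, one has $\gamma:=-\sup_{\Lambda}\partial_\varphi f>0$. The parametrization of $\mathbb T$ is such that $0\in[S_m,S_M]$ is the unique zero in $\mathcal U$ of $\overline f(\varphi):=\langle f(\varphi,\cdot)\rangle$.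 The parameter $\rho$ is taken smaller than a suitable $\rho_*>0$ depending on $f$, such that in particular $1+\rho\,\partial_\varphi f>0$ on $\Omega$. Then $\mathcal S(\Omega)\subset\Omega$, and there is a unique $W:\mathbb T^2\to\mathbb R$ with graph in $\Lambda$ and $\mathcal S(W(\psi),\psi)=(W(A_0\psi),A_0\psi)$ for all $\psi$. Conjugations: set $\kappa(\psi)=1+\rho\,\partial_\varphi f(W(\psi),\psi)$. There is a unique bounded continuous $h:\Omega\to\mathbb R$ such that $\mathcal H(\varphi,\psi)=\varphi-W(\psi)+(\varphi-W(\psi))^2h(\varphi,\psi)$ satisfies $\mathcal H(\mathcal S(\varphi,\psi))=\kappa(\psi)\mathcal H(\varphi,\psi)$ on $\Omega$; it is $C^1$ in $\varphi$. Averaged map: $\overline G(\varphi)=\varphi+\rho\overline f(\varphi)$ on $\mathcal U$, $\overline\mu=1+\rho\,\partial_\varphi\overline f(0)$. There is a unique bounded continuous $\overline h:\mathcal U\to\mathbb R$ such that $\overline{\mathcal H}(\varphi)=\varphi+\varphi^2\overline h(\varphi)$ satisfies $\overline{\mathcal H}(\overline G(\varphi))=\overline\mu\,\overline{\mathcal H}(\varphi)$; it is $C^1$. *)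

theory Defs
  imports "HOL-Analysis.Analysis"
begin

text \<open>
  Functions on the circle \<open>\<real> / 2\<pi>\<int>\<close> and on the two-torus \<open>(\<real> / 2\<pi>\<int>)\<^sup>2\<close> are represented by their
  \<open>2\<pi>\<close>-periodic lifts to \<^typ>\<open>real\<close> and \<^typ>\<open>real^2\<close>. A function \<open>g(\<phi>, \<psi>)\<close> is curried.
\<close>

definition torus_fun :: "(real^2 \<Rightarrow> real) \<Rightarrow> bool" where
  "torus_fun g \<longleftrightarrow> (\<forall>\<psi> i. g (\<psi> + axis i (2 * pi)) = g \<psi>)"

definition torus_avg :: "(real^2 \<Rightarrow> real) \<Rightarrow> real" where
  "torus_avg g = (LINT \<psi>:cbox 0 (\<chi> i. 2 * pi)|lborel. g \<psi>) / (2 * pi)\<^sup>2"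

text \<open>
  An automorphism of the torus is induced by an integer matrix of determinant \<open>\<plusminus>1\<close>; it is
  hyperbolic when no complex eigenvalue lies on the unit circle.
\<close>

definition anosov_automorphism :: "real^2^2 \<Rightarrow> bool" where
  "anosov_automorphism A \<longleftrightarrow>
     (\<forall>i j. A $ i $ j \<in> \<int>) \<and> \<bar>det A\<bar> = 1 \<and>
     (\<forall>(z::complex) v. v \<noteq> 0 \<and> (\<chi> i j. complex_of_real (A $ i $ j)) *v v = z *s v \<longrightarrow> cmod z \<noteq> 1)"

definition phi_deriv :: "nat \<Rightarrow> (real \<Rightarrow> real^2 \<Rightarrow> real) \<Rightarrow> real \<Rightarrow> real^2 \<Rightarrow> real" where
  "phi_deriv n g \<phi> \<psi> = (deriv ^^ n) (\<lambda>x. g x \<psi>) \<phi>"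

text \<open>One-sided at the end points of \<open>U\<close>, as needed for functions defined on \<open>U\<close> only.\<close>

definition phi_deriv_within ::
    "real set \<Rightarrow> (real \<Rightarrow> real^2 \<Rightarrow> real) \<Rightarrow> real \<Rightarrow> real^2 \<Rightarrow> real" where
  "phi_deriv_within U g \<phi> \<psi> = vector_derivative (\<lambda>x. g x \<psi>) (at \<phi> within U)"

definition sup_norm :: "(real \<Rightarrow> real^2 \<Rightarrow> real) \<Rightarrow> ereal" where
  "sup_norm g = (SUP \<phi>. SUP \<psi>. ereal \<bar>g \<phi> \<psi>\<bar>)"

text \<open>
  For periodic \<open>g\<close> the supremum over lifts with the Euclidean distance equals the supremum over
  the torus with the flat distance, since the quotient is largest at closest representatives.
\<close>

definition holder_seminorm :: "real \<Rightarrow> (real \<Rightarrow> real^2 \<Rightarrow> real) \<Rightarrow> ereal" where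
  "holder_seminorm \<alpha> g =
     (SUP \<phi>. SUP \<psi>. SUP \<psi>'\<in>- {\<psi>}. ereal (\<bar>g \<phi> \<psi>' - g \<phi> \<psi>\<bar> / dist \<psi>' \<psi> powr \<alpha>))"

definition B_norm :: "real \<Rightarrow> nat \<Rightarrow> (real \<Rightarrow> real^2 \<Rightarrow> real) \<Rightarrow> ereal" where
  "B_norm \<alpha> k g =
     (\<Sum>n\<le>k. sup_norm (phi_deriv n g)) + ereal \<alpha> * (\<Sum>n<k. holder_seminorm \<alpha> (phi_deriv n g))"

definition B_space :: "real \<Rightarrow> nat \<Rightarrow> (real \<Rightarrow> real^2 \<Rightarrow> real) set" where
  "B_space \<alpha> k =
     {g. (\<forall>\<phi> \<psi>. g (\<phi> + 2 * pi) \<psi> = g \<phi> \<psi>) \<and> (\<forall>\<phi>. torus_fun (g \<phi>)) \<and>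
         (\<forall>\<psi>. (\<forall>n<k. \<forall>\<phi>. (\<lambda>x. phi_deriv n g x \<psi>) field_differentiable (at \<phi>)) \<and>
               continuous_on UNIV (\<lambda>x. phi_deriv k g x \<psi>)) \<and>
         B_norm \<alpha> k g < \<infinity>}"

definition skew_map ::
    "(real \<Rightarrow> real^2 \<Rightarrow> real) \<Rightarrow> real^2^2 \<Rightarrow> real \<Rightarrow> real \<times> (real^2) \<Rightarrow> real \<times> (real^2)" where
  "skew_map f A \<rho> = (\<lambda>(\<phi>, \<psi>). (\<phi> + \<rho> * f \<phi> \<psi>, A *v \<psi>))"

definition invariant_graph ::
    "(real \<Rightarrow> real^2 \<Rightarrow> real) \<Rightarrow> real^2^2 \<Rightarrow> real \<Rightarrow> real set \<Rightarrow> (real^2 \<Rightarrow> real) \<Rightarrow> bool" where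
  "invariant_graph f A \<rho> I W \<longleftrightarrow>
     torus_fun W \<and> (\<forall>\<psi>. W \<psi> \<in> I) \<and>
     (\<forall>\<psi>. skew_map f A \<rho> (W \<psi>, \<psi>) = (W (A *v \<psi>), A *v \<psi>))"

definition conj_map ::
    "(real^2 \<Rightarrow> real) \<Rightarrow> (real \<Rightarrow> real^2 \<Rightarrow> real) \<Rightarrow> real \<times> (real^2) \<Rightarrow> real" where
  "conj_map W h = (\<lambda>(\<phi>, \<psi>). (\<phi> - W \<psi>) + (\<phi> - W \<psi>)\<^sup>2 * h \<phi> \<psi>)"

definition conj_remainder ::
    "(real \<Rightarrow> real^2 \<Rightarrow> real) \<Rightarrow> real^2^2 \<Rightarrow> real \<Rightarrow> real set \<Rightarrow> (real^2 \<Rightarrow> real) \<Rightarrow>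
     (real \<Rightarrow> real^2 \<Rightarrow> real) \<Rightarrow> bool" where
  "conj_remainder f A \<rho> U W h \<longleftrightarrow>
     (\<forall>\<phi>\<in>U. torus_fun (h \<phi>)) \<and>
     bounded ((\<lambda>(\<phi>, \<psi>). h \<phi> \<psi>) ` (U \<times> UNIV)) \<and>
     continuous_on (U \<times> UNIV) (\<lambda>(\<phi>, \<psi>). h \<phi> \<psi>) \<and>
     (\<forall>\<phi>\<in>U. \<forall>\<psi>. conj_map W h (skew_map f A \<rho> (\<phi>, \<psi>)) =
        (1 + \<rho> * phi_deriv 1 f (W \<psi>) \<psi>) * conj_map W h (\<phi>, \<psi>))"

definition avg_field :: "(real \<Rightarrow> real^2 \<Rightarrow> real) \<Rightarrow> real \<Rightarrow> real" where
  "avg_field f \<phi> = torus_avg (f \<phi>)"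

definition avg_map :: "(real \<Rightarrow> real^2 \<Rightarrow> real) \<Rightarrow> real \<Rightarrow> real \<Rightarrow> real" where
  "avg_map f \<rho> \<phi> = \<phi> + \<rho> * avg_field f \<phi>"

definition avg_conj_map :: "(real \<Rightarrow> real) \<Rightarrow> real \<Rightarrow> real" where
  "avg_conj_map hb \<phi> = \<phi> + \<phi>\<^sup>2 * hb \<phi>"

definition avg_conj_remainder ::
    "(real \<Rightarrow> real^2 \<Rightarrow> real) \<Rightarrow> real \<Rightarrow> real set \<Rightarrow> (real \<Rightarrow> real) \<Rightarrow> bool" where
  "avg_conj_remainder f \<rho> U hb \<longleftrightarrow>
     bounded (hb ` U) \<and> continuous_on U hb \<and>
     (\<forall>\<phi>\<in>U. avg_conj_map hb (avg_map f \<rho> \<phi>) =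
        (1 + \<rho> * deriv (avg_field f) 0) * avg_conj_map hb \<phi>)"

end

theory Submission
  imports Defs
begin

text \<open>
  A unit segment in the unstable direction of \<open>A\<close> becomes equidistributed exponentially fast under
  iteration, while quantities driven by the past of \<open>\<psi>\<close> with increments of size \<open>\<rho>\<close> vary by \<open>O(\<rho>)\<close>
  along it. Hence sums \<open>\<Sum>n. \<rho> r\<^sup>n \<Gamma> n (A\<^sup>n \<psi>)\<close> of such observables, with mean zero in the fast variable and
  \<open>1 - r\<close> of order \<open>\<rho>\<close>, are \<open>O(\<rho>)\<close> in mean and in mean square.

  The functions \<open>h\<close> and \<open>hb\<close> are both compared with the corresponding remainder \<open>hc\<close> of the map that
  linearizes the averaged flow \<open>x' = fb x\<close>, which does not depend on \<open>\<rho>\<close>. The linearization of the skew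
  map is the limit of \<open>(X n - W (A\<^sup>n \<psi>)) / \<Prod> \<kappa>\<close> along the slow orbit \<open>X\<close>, and its logarithmic derivatives
  in \<open>\<phi>\<close> are sums along the orbit. Subtracting a telescoping sum of the same derivative for the averaged
  flow, evaluated along the orbit, leaves observables with mean zero up to \<open>O(\<rho>\<^sup>2)\<close>. The averaged map is
  the special case of a field that does not depend on \<open>\<psi>\<close>.
\<close>

section \<open>Averages over the torus\<close>

text \<open>The sums may fluctuate on the scale of the square root of \<rho>, so a pointwise
  comparison cannot give means of size O(\<rho>). Bias and variance are therefore carried together:
  in a second-order Taylor expansion the linear term transports the bias, and the remainder is
  bounded by the variance.

  Nothing is differentiable in \<psi>. The only regularity used in the fast variable is a Hoelder
  bound; for slow quantities it is taken along the unstable line and rescaled to the current time,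
  where its constant is O(\<rho>).

  Away from [\<open>Sm\<close>, \<open>SM\<close>] a slow step may expand, so the decay of its
  derivative has to come from a weight.

  The conjugation is a limit, whereas the estimates concern finite sums. They are uniform in the
  number \<open>N\<close> of terms once \<open>decay \<rho> ^ N \<le> \<rho>\<close>; hence the
  families are indexed by tuples containing \<open>N\<close>, and \<open>N\<close> may depend on the
  solution.

  The number of derivatives is fixed by the estimate for \<partial>h: telescoping for
  \<open>T\<close> expands \<open>M1\<close> to second order, which involves \<open>M3\<close> and
  thereby the fifth derivative of the averaged field, whose continuity comes from a bound on the
  sixth.\<close>

definition torus_cont :: "(real^2 \<Rightarrow> real) \<Rightarrow> bool" where
  "torus_cont g \<longleftrightarrow> continuous_on UNIV g \<and> torus_fun g"

abbreviation periods :: "real^2" where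
  "periods \<equiv> \<chi> i. 2 * pi"

lemma torus_contI: "continuous_on UNIV g \<Longrightarrow> torus_fun g \<Longrightarrow> torus_cont g"
  by (simp add: torus_cont_def)

lemma torus_cont_const [simp]: "torus_cont (\<lambda>\<psi>. c)"
  by (simp add: torus_cont_def torus_fun_def)

lemma torus_cont_add: "torus_cont g \<Longrightarrow> torus_cont k \<Longrightarrow> torus_cont (\<lambda>\<psi>. g \<psi> + k \<psi>)"
  by (auto simp: torus_cont_def torus_fun_def intro!: continuous_intros)

lemma torus_cont_diff: "torus_cont g \<Longrightarrow> torus_cont k \<Longrightarrow> torus_cont (\<lambda>\<psi>. g \<psi> - k \<psi>)"
  by (auto simp: torus_cont_def torus_fun_def intro!: continuous_intros)

lemma torus_cont_mult: "torus_cont g \<Longrightarrow> torus_cont k \<Longrightarrow> torus_cont (\<lambda>\<psi>. g \<psi> * k \<psi>)"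
  by (auto simp: torus_cont_def torus_fun_def intro!: continuous_intros)

lemma torus_cont_power: "torus_cont g \<Longrightarrow> torus_cont (\<lambda>\<psi>. g \<psi> ^ n)"
  by (auto simp: torus_cont_def torus_fun_def intro!: continuous_intros)

lemma torus_cont_abs: "torus_cont g \<Longrightarrow> torus_cont (\<lambda>\<psi>. \<bar>g \<psi>\<bar>)"
  by (auto simp: torus_cont_def torus_fun_def intro!: continuous_intros)

lemma torus_cont_sum: "(\<And>i. i \<in> I \<Longrightarrow> torus_cont (g i)) \<Longrightarrow> torus_cont (\<lambda>\<psi>. \<Sum>i\<in>I. g i \<psi>)"
  by (auto simp: torus_cont_def torus_fun_def intro!: continuous_intros)

lemma torus_cont_comp:
  "torus_cont g \<Longrightarrow> (\<And>\<psi>. g \<psi> \<in> D) \<Longrightarrow> continuous_on D k \<Longrightarrow> torus_cont (\<lambda>\<psi>. k (g \<psi>))"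
  by (auto simp: torus_cont_def torus_fun_def intro: continuous_on_compose2[where g=k])

lemma torus_cont_shift: "torus_cont g \<Longrightarrow> torus_cont (\<lambda>\<psi>. g (\<psi> + v))"
proof -
  assume g: "torus_cont g"
  have "g (\<psi> + axis i (2 * pi) + v) = g (\<psi> + v)" for \<psi> i
    using g add.commute[of "axis i (2 * pi)" v] by (metis add.assoc torus_cont_def torus_fun_def)
  then have "torus_fun (\<lambda>\<psi>. g (\<psi> + v))" unfolding torus_fun_def by blast
  moreover have "continuous_on UNIV (\<lambda>\<psi>. g (\<psi> + v))"
    using g continuous_on_compose2[of UNIV g UNIV "\<lambda>\<psi>. \<psi> + v"]
    by (simp add: torus_cont_def continuous_intros)
  ultimately show ?thesis by (simp add: torus_cont_def)
qed

lemmas torus_cont_intros =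
  torus_cont_const torus_cont_add torus_cont_diff torus_cont_mult torus_cont_power
  torus_cont_abs torus_cont_sum

text \<open>Passes from the Lebesgue integral of the definition to the gauge integral, whose rules
  for shifting, splitting and swapping are the ones applied below.\<close>

lemma torus_avg_integral:
  assumes "continuous_on UNIV g"
  shows "torus_avg g = integral (cbox 0 periods) g / (2 * pi)\<^sup>2"
proof -
  have "set_integrable lborel (cbox 0 periods) g"
    unfolding set_integrable_def
    by (rule borel_integrable_compact) (auto intro: continuous_on_subset[OF assms])
  then show ?thesis
    by (simp add: torus_avg_def set_borel_integral_eq_integral)
qed

lemma torus_cont_integrable:
  "torus_cont g \<Longrightarrow> g integrable_on cbox a b"
  by (auto simp: torus_cont_def intro: integrable_continuous continuous_on_subset)

lemma measure_period_cell: "measure lborel (cbox 0 periods) = (2 * pi)\<^sup>2"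
proof -
  have "cbox 0 periods \<noteq> {}" by (simp add: interval_ne_empty_cart)
  then show ?thesis by (simp add: content_cbox_cart power2_eq_square UNIV_2)
qed

lemma torus_avg_const [simp]: "torus_avg (\<lambda>\<psi>. c) = c"
proof -
  have "measure lborel (cbox 0 periods) = (2 * pi)\<^sup>2" by (rule measure_period_cell)
  then show ?thesis by (simp add: torus_avg_integral integral_const)
qed

text \<open>Versions for continuous integrands without periodicity. They serve averages over
  \<open>v\<close> of functions of \<open>cu v\<close>: the unstable coordinate is linear in
  \<open>v\<close>, so such integrands are continuous but in general not periodic.\<close>

lemma torus_avg_diff_continuous:
  "continuous_on UNIV g \<Longrightarrow> continuous_on UNIV k \<Longrightarrow>
    torus_avg (\<lambda>\<psi>. g \<psi> - k \<psi>) = torus_avg g - torus_avg k"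
  using integrable_continuous[OF continuous_on_subset[of UNIV g "cbox 0 periods"]]
    integrable_continuous[OF continuous_on_subset[of UNIV k "cbox 0 periods"]]
  by (simp add: torus_avg_integral continuous_on_diff integral_diff diff_divide_distrib)

lemma torus_avg_cmult_continuous:
  "continuous_on UNIV g \<Longrightarrow> torus_avg (\<lambda>\<psi>. c * g \<psi>) = c * torus_avg g"
  by (simp add: torus_avg_integral continuous_on_mult continuous_on_const)

lemma torus_avg_abs_le_continuous:
  assumes "continuous_on UNIV g" "\<And>\<psi>. \<psi> \<in> cbox 0 periods \<Longrightarrow> \<bar>g \<psi>\<bar> \<le> B"
  shows "\<bar>torus_avg g\<bar> \<le> B"
proof -
  have ne: "(0::real^2) \<in> cbox 0 periods" by (simp add: mem_box_cart)
  then have "0 \<le> B" using assms(2)[of 0] by linarith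
  then have "norm (integral (cbox 0 periods) g) \<le> B * (2 * pi)\<^sup>2"
    using has_integral_bound[OF _ integrable_integral[OF integrable_continuous], of B 0 periods g] assms
    by (auto simp: measure_period_cell intro: continuous_on_subset)
  then show ?thesis
    by (simp add: torus_avg_integral[OF assms(1)] field_simps)
qed

lemma torus_avg_add:
  "torus_cont g \<Longrightarrow> torus_cont k \<Longrightarrow> torus_avg (\<lambda>\<psi>. g \<psi> + k \<psi>) = torus_avg g + torus_avg k"
  using torus_cont_add[of g k] torus_cont_integrable[of g 0 periods] torus_cont_integrable[of k 0 periods]
  by (simp add: torus_avg_integral torus_cont_def integral_add add_divide_distrib)

lemma torus_avg_cmult: "torus_cont g \<Longrightarrow> torus_avg (\<lambda>\<psi>. c * g \<psi>) = c * torus_avg g"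
  using torus_cont_mult[of "\<lambda>_. c" g] by (simp add: torus_avg_integral torus_cont_def)

lemma torus_avg_diff:
  "torus_cont g \<Longrightarrow> torus_cont k \<Longrightarrow> torus_avg (\<lambda>\<psi>. g \<psi> - k \<psi>) = torus_avg g - torus_avg k"
  using torus_avg_add[of g "\<lambda>\<psi>. -1 * k \<psi>"] torus_avg_cmult[of k "-1"] torus_cont_mult[of "\<lambda>_. -1" k] by simp

lemma torus_avg_sum:
  "finite I \<Longrightarrow> (\<And>i. i \<in> I \<Longrightarrow> torus_cont (g i)) \<Longrightarrow>
    torus_avg (\<lambda>\<psi>. \<Sum>i\<in>I. g i \<psi>) = (\<Sum>i\<in>I. torus_avg (g i))"
  by (induction I rule: finite_induct) (auto simp: torus_avg_add torus_cont_sum)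

lemma torus_avg_mono:
  "torus_cont g \<Longrightarrow> torus_cont k \<Longrightarrow> (\<And>\<psi>. g \<psi> \<le> k \<psi>) \<Longrightarrow> torus_avg g \<le> torus_avg k"
  using torus_cont_integrable[of g 0 periods] torus_cont_integrable[of k 0 periods]
  by (simp add: torus_avg_integral torus_cont_def divide_right_mono integral_le)

lemma torus_avg_abs_le:
  assumes "torus_cont g" "\<And>\<psi>. \<bar>g \<psi>\<bar> \<le> B"
  shows "\<bar>torus_avg g\<bar> \<le> B"
proof -
  have "- B \<le> g \<psi>" for \<psi> using assms(2)[of \<psi>] by linarith
  moreover have "g \<psi> \<le> B" for \<psi> using assms(2)[of \<psi>] by linarith
  ultimately have "torus_avg (\<lambda>_. - B) \<le> torus_avg g" "torus_avg g \<le> torus_avg (\<lambda>_. B)"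
    using assms(1) by (intro torus_avg_mono torus_cont_const; blast)+
  then show ?thesis by simp
qed

text \<open>The box enlarged by \<open>s\<close> in direction \<open>i\<close> is cut once at height
  \<open>w $ i + s\<close> and once at \<open>w $ i + 2 * pi\<close>. Each cut leaves one full
  period box and one slab of thickness \<open>s\<close>; the two slabs are translates by a period
  and carry the same integral.\<close>

lemma integral_period_shift_axis:
  assumes g: "torus_cont g" and s: "s \<ge> 0"
  shows "integral (cbox (w + axis i s) (w + axis i s + periods)) g = integral (cbox w (w + periods)) g"
proof -
  let ?b = "w + axis i s + periods" and ?low = "w + axis i s + periods - axis i (2 * pi)"
  have k: "axis i (1::real) \<in> (Basis :: (real^2) set)" by (rule axis_in_Basis_iff[THEN iffD2]) simp
  have ga: "g integrable_on cbox w ?b" by (rule torus_cont_integrable[OF g])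
  have ax: "axis i c $ j = (if j = i then c else 0)" for c :: real and j by (simp add: axis_def)
  have inner_axis_one: "x \<bullet> axis i 1 = x $ i" for x :: "real^2" by (simp add: inner_axis)
  have split_le: "cbox u v \<inter> {x. x $ i \<le> c} = cbox u (\<chi> j. if j = i then min (v$i) c else v$j)" for u v :: "real^2" and c
    by (simp add: interval_split_cart interval_cbox_cart[symmetric] del: interval_cbox_cart)
  have split_ge: "cbox u v \<inter> {x. x $ i \<ge> c} = cbox (\<chi> j. if j = i then max (u$i) c else u$j) v" for u v :: "real^2" and c
    unfolding interval_split_cart(2) by (simp add: interval_cbox_cart)
  have i1: "cbox w ?b \<inter> {x. x \<bullet> axis i 1 \<le> w $ i + s} = cbox w ?low"
    unfolding inner_axis_one split_le split_ge using s pi_gt_zero by (intro arg_cong2[where f=cbox]) (auto simp: vec_eq_iff ax)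
  have i2: "cbox w ?b \<inter> {x. x \<bullet> axis i 1 \<ge> w $ i + s} = cbox (w + axis i s) ?b"
    unfolding inner_axis_one split_le split_ge using s pi_gt_zero by (intro arg_cong2[where f=cbox]) (auto simp: vec_eq_iff ax)
  have i3: "cbox w ?b \<inter> {x. x \<bullet> axis i 1 \<le> w $ i + 2 * pi} = cbox w (w + periods)"
    unfolding inner_axis_one split_le split_ge using s pi_gt_zero by (intro arg_cong2[where f=cbox]) (auto simp: vec_eq_iff ax)
  have i4: "cbox w ?b \<inter> {x. x \<bullet> axis i 1 \<ge> w $ i + 2 * pi} = cbox (w + axis i (2 * pi)) ?b"
    unfolding inner_axis_one split_le split_ge using s pi_gt_zero by (intro arg_cong2[where f=cbox]) (auto simp: vec_eq_iff ax)
  have "integral (cbox w ?low) g = integral (cbox w ?low) (\<lambda>x. g (x + axis i (2 * pi)))"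
    using g by (simp add: torus_cont_def torus_fun_def)
  also have "\<dots> = integral (cbox (w + axis i (2 * pi)) ?b) g"
    using integral_shift_cbox[of "w + axis i (2 * pi)" "axis i (2 * pi)" ?b g] by simp
  finally have e: "integral (cbox w ?low) g = integral (cbox (w + axis i (2 * pi)) ?b) g" .
  show ?thesis
    using integral_split[OF ga k, of "w $ i + s"] integral_split[OF ga k, of "w $ i + 2 * pi"]
    unfolding i1 i2 i3 i4 e by simp
qed

lemma torus_avg_shift:
  assumes g: "torus_cont g"
  shows "torus_avg (\<lambda>\<psi>. g (\<psi> + v)) = torus_avg g"
proof -
  let ?J = "\<lambda>w. integral (cbox w (w + periods)) g"
  have ax: "?J (w + axis i s) = ?J w" for w i s
  proof (cases "s \<ge> 0")
    case True
    then show ?thesis using integral_period_shift_axis[OF g True, of w i] by (simp add: algebra_simps)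
  next
    case False
    have "axis i s + axis i (- s) = (0::real^2)" by (auto simp: axis_def vec_eq_iff)
    then show ?thesis
      using False integral_period_shift_axis[OF g, of "- s" "w + axis i s" i] by (simp add: algebra_simps)
  qed
  have "v = axis 1 (v $ 1) + axis 2 (v $ 2)"
    by (auto simp: axis_def vec_eq_iff forall_2)
  then have "?J v = ?J 0" using ax[of 0 1 "v $ 1"] ax[of "axis 1 (v $ 1)" 2 "v $ 2"] by simp
  moreover have "integral (cbox 0 periods) (\<lambda>\<psi>. g (\<psi> + v)) = ?J v"
    using integral_shift_cbox[of v v "v + periods" g] by simp
  ultimately show ?thesis
    using g torus_cont_shift[OF g, of v] by (simp add: torus_avg_integral torus_cont_def)
qed

lemma continuous_on_sections:
  assumes "continuous_on UNIV (\<lambda>(x, y). g x y)"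
  shows "continuous_on UNIV (g x)" "continuous_on UNIV (\<lambda>x. g x y)"
  using continuous_on_compose2[OF assms continuous_on_Pair[OF continuous_on_const[of _ x] continuous_on_id]]
    continuous_on_compose2[OF assms continuous_on_Pair[OF continuous_on_id continuous_on_const[of _ y]]]
  by auto

lemma torus_avg_swap:
  fixes g :: "real^2 \<Rightarrow> real^2 \<Rightarrow> real"
  assumes "continuous_on UNIV (\<lambda>(x, y). g x y)"
  shows "torus_avg (\<lambda>x. torus_avg (g x)) = torus_avg (\<lambda>y. torus_avg (\<lambda>x. g x y))"
proof -
  let ?Q = "cbox 0 periods"
  have c1: "continuous_on UNIV (g x)" for x
    by (rule continuous_on_sections[OF assms])
  have c2: "continuous_on UNIV (\<lambda>x. g x y)" for y
    by (rule continuous_on_sections[OF assms])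
  have "continuous_on UNIV (\<lambda>p. (\<lambda>(x, y). g x y) (snd p, fst p))"
    by (rule continuous_on_compose2[OF assms]) (auto intro!: continuous_intros)
  then have c3: "continuous_on UNIV (\<lambda>(y, x). g x y)"
    by (simp add: split_beta)
  have d1: "continuous_on UNIV (\<lambda>x. integral ?Q (g x))"
    by (rule integral_continuous_on_param) (rule continuous_on_subset[OF assms], simp)
  have d2: "continuous_on UNIV (\<lambda>y. integral ?Q (\<lambda>x. g x y))"
    by (rule integral_continuous_on_param) (rule continuous_on_subset[OF c3], simp)
  show ?thesis
    unfolding torus_avg_integral[OF c1] torus_avg_integral[OF c2]
    using integral_swap_continuous[OF continuous_on_subset[OF assms subset_UNIV], where a=0 and c=0 and b=periods and d=periods]
    by (simp add: torus_avg_integral continuous_on_divide continuous_on_const d1 d2)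
qed

text \<open>Shift invariance allows the base point to be smeared by \<open>s v\<close>: average over
  \<open>v\<close> as well and swap the two averages. It then suffices to bound the mean over
  \<open>v\<close> for each fixed \<open>\<psi>\<close>, which is where equidistribution of unstable
  segments enters.\<close>

lemma torus_avg_le_shift_avg:
  assumes g: "torus_cont g" and s: "continuous_on UNIV s"
    and b: "\<And>\<psi>. \<bar>torus_avg (\<lambda>v. g (\<psi> + s v))\<bar> \<le> B"
  shows "\<bar>torus_avg g\<bar> \<le> B"
proof -
  have c: "continuous_on UNIV (\<lambda>(\<psi>, v). g (\<psi> + s v))"
    unfolding split_beta
  proof (rule continuous_on_compose2[where g=g and t=UNIV])
    show "continuous_on UNIV (\<lambda>x. fst x + s (snd x))"
      by (intro continuous_intros continuous_on_compose2[OF s]) auto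
  qed (use g in \<open>auto simp: torus_cont_def\<close>)
  have per: "torus_cont (\<lambda>\<psi>. torus_avg (\<lambda>v. g (\<psi> + s v)))"
  proof (rule torus_contI)
    have c1: "continuous_on UNIV (\<lambda>v. g (\<psi> + s v))" for \<psi>
      by (rule continuous_on_sections[OF c])
    show "continuous_on UNIV (\<lambda>\<psi>. torus_avg (\<lambda>v. g (\<psi> + s v)))"
      unfolding torus_avg_integral[OF c1]
      by (intro continuous_intros integral_continuous_on_param continuous_on_subset[OF c]) auto
    have "g (\<psi> + axis i (2 * pi) + s v) = g (\<psi> + s v)" for \<psi> i v
      using torus_cont_shift[OF g, of "s v"] by (simp add: torus_cont_def torus_fun_def)
    then show "torus_fun (\<lambda>\<psi>. torus_avg (\<lambda>v. g (\<psi> + s v)))"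
      by (simp add: torus_fun_def)
  qed
  have "torus_avg g = torus_avg (\<lambda>v. torus_avg (\<lambda>\<psi>. g (\<psi> + s v)))"
    using torus_avg_shift[OF g] by simp
  also have "\<dots> = torus_avg (\<lambda>\<psi>. torus_avg (\<lambda>v. g (\<psi> + s v)))"
    using torus_avg_swap[OF c] by simp
  also have "\<bar>\<dots>\<bar> \<le> B"
    by (rule torus_avg_abs_le[OF per b])
  finally show ?thesis .
qed

section \<open>Hyperbolic splitting and equidistribution of unstable segments\<close>

text \<open>A kernel vector of \<open>B - z\<close> can be read off from a nonzero off-diagonal
  entry; the vanishing determinant takes care of the other row. Stated over a field because it is
  applied both to the complexified matrix and to the real one.\<close>

lemma root_imp_eigenvector:
  fixes B :: "'a::field^2^2"
  assumes "z^2 - (B$1$1 + B$2$2) * z + (B$1$1 * B$2$2 - B$1$2 * B$2$1) = 0"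
  obtains v where "v \<noteq> 0" "B *v v = z *s v"
proof -
  have mv: "B *v v = z *s v \<longleftrightarrow>
      B$1$1 * v$1 + B$1$2 * v$2 = z * v$1 \<and> B$2$1 * v$1 + B$2$2 * v$2 = z * v$2" for v
    by (simp add: vec_eq_iff matrix_vector_mult_def forall_2 sum_2)
  have ne: "v \<noteq> 0 \<longleftrightarrow> v$1 \<noteq> 0 \<or> v$2 \<noteq> 0" for v :: "'a^2"
    by (auto simp: vec_eq_iff forall_2)
  have fac: "(z - B$1$1) * (z - B$2$2) = B$1$2 * B$2$1"
    using assms by (simp add: algebra_simps power2_eq_square)
  consider (b) "B$1$2 \<noteq> 0" | (c) "B$1$2 = 0" "B$2$1 \<noteq> 0" | (d) "B$1$2 = 0" "B$2$1 = 0" "z = B$1$1"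
    | (e) "B$1$2 = 0" "B$2$1 = 0" "z = B$2$2"
    using fac by fastforce
  then show ?thesis
  proof cases
    case b
    show ?thesis
      by (rule that[of "vector [B$1$2, z - B$1$1]"], unfold mv ne)
         (use b fac in \<open>auto simp: algebra_simps\<close>)
  next
    case c
    show ?thesis
      by (rule that[of "vector [z - B$2$2, B$2$1]"], unfold mv ne)
         (use c fac in \<open>auto simp: algebra_simps\<close>)
  next
    case d
    show ?thesis by (rule that[of "vector [1, 0]"], unfold mv ne) (use d in auto)
  next
    case e
    show ?thesis by (rule that[of "vector [0, 1]"], unfold mv ne) (use e in auto)
  qed
qed

text \<open>\<open>cu\<close> and \<open>cs\<close> are the coordinates in the eigenbasis
  \<open>eu\<close>, \<open>es\<close>. The Hoelder exponent belongs to the locale because the rate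
  of mixing depends on it.\<close>

locale hyperbolic_splitting =
  fixes A :: "real^2^2" and lam mu :: real and eu es :: "real^2" and cu cs :: "real^2 \<Rightarrow> real"
    and \<alpha> :: real
  assumes integral_entries: "A $ i $ j \<in> \<int>"
    and eu: "A *v eu = lam *\<^sub>R eu" and es: "A *v es = mu *\<^sub>R es"
    and splitting: "v = cu v *\<^sub>R eu + cs v *\<^sub>R es"
    and linear_cu: "linear cu" and linear_cs: "linear cs"
    and lam: "\<bar>lam\<bar> > 1" and mu: "\<bar>mu\<bar> * \<bar>lam\<bar> = 1"
    and alpha: "\<alpha> > 0"

text \<open>The characteristic polynomial has constant term \<plusminus>1 and no root of modulus
  one. Non-real roots would be conjugate with product 1, so both roots are real; their product has
  modulus one, hence one of them exceeds 1 in modulus.\<close>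

lemma anosov_hyperbolic_splitting:
  assumes "anosov_automorphism A" "\<alpha> > 0"
  obtains lam mu eu es cu cs where "hyperbolic_splitting A lam mu eu es cu cs \<alpha>"
proof -
  define t where "t = A$1$1 + A$2$2"
  define D where "D = A$1$1 * A$2$2 - A$1$2 * A$2$1"
  let ?C = "(\<chi> i j. complex_of_real (A $ i $ j)) :: complex^2^2"
  have D: "\<bar>D\<bar> = 1" using assms by (simp add: anosov_automorphism_def det_2 D_def)
  have nounit: "cmod z \<noteq> 1" if "z^2 - of_real t * z + of_real D = 0" for z
  proof -
    have "z^2 - (?C$1$1 + ?C$2$2) * z + (?C$1$1 * ?C$2$2 - ?C$1$2 * ?C$2$1) = 0"
      using that by (simp add: t_def D_def)
    from root_imp_eigenvector[OF this] obtain v where "v \<noteq> 0" "?C *v v = z *s v" .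
    then show ?thesis using assms unfolding anosov_automorphism_def by blast
  qed
  have nounit_real: "\<bar>x\<bar> \<noteq> 1" if "x^2 - t * x + D = 0" for x :: real
  proof -
    have "(of_real x)^2 - of_real t * of_real x + of_real D = (of_real (x^2 - t * x + D) :: complex)"
      by simp
    then show ?thesis using nounit[of "of_real x"] that by (metis norm_of_real of_real_0)
  qed
  have disc: "t^2 - 4 * D \<ge> 0"
  proof (rule ccontr)
    assume neg: "\<not> ?thesis"
    define z where "z = Complex (t / 2) (sqrt (4 * D - t^2) / 2)"
    have sq: "(sqrt (4 * D - t^2))^2 = 4 * D - t^2" using neg by simp
    have "z^2 - of_real t * z + of_real D = 0"
      using sq by (simp add: z_def complex_eq_iff power2_eq_square field_simps)
    moreover have "D = 1" using neg D zero_le_power2[of t] by linarith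
    then have "cmod z = 1" using sq by (simp add: z_def cmod_def power_divide add_divide_distrib[symmetric])
    ultimately show False using nounit by blast
  qed
  define s where "s = sqrt (t^2 - 4 * D)"
  have s: "s^2 = t^2 - 4 * D" using disc by (simp add: s_def)
  define x where "x = (t + s) / 2"
  define y where "y = (t - s) / 2"
  have rx: "x^2 - t * x + D = 0" and ry: "y^2 - t * y + D = 0" and xy: "x * y = D"
    using s by (simp_all add: x_def y_def power2_eq_square field_simps)
  have absxy: "\<bar>x\<bar> * \<bar>y\<bar> = 1" using xy D by (simp flip: abs_mult)
  have gt: "\<bar>x\<bar> > 1 \<or> \<bar>y\<bar> > 1"
  proof (rule ccontr)
    assume "\<not> ?thesis"
    then have "\<bar>x\<bar> < 1" "\<bar>y\<bar> < 1" using nounit_real[OF rx] nounit_real[OF ry] by auto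
    then have "\<bar>x\<bar> * \<bar>y\<bar> < 1" using mult_strict_mono'[of "\<bar>x\<bar>" 1 "\<bar>y\<bar>" 1] by simp
    then show False using absxy by simp
  qed
  obtain l m where lm: "l^2 - t * l + D = 0" "m^2 - t * m + D = 0" "\<bar>l\<bar> > 1" "\<bar>m\<bar> * \<bar>l\<bar> = 1"
    using gt rx ry absxy by (metis mult.commute)
  have "m \<noteq> l" using lm by (metis less_1_mult less_irrefl)
  obtain u where u: "u \<noteq> 0" "A *v u = l *\<^sub>R u"
    using root_imp_eigenvector[of l A] lm(1) by (auto simp: t_def D_def scalar_mult_eq_scaleR)
  obtain v where v: "v \<noteq> 0" "A *v v = m *\<^sub>R v"
    using root_imp_eigenvector[of m A] lm(2) by (auto simp: t_def D_def scalar_mult_eq_scaleR)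
  define E where "E = u$1 * v$2 - u$2 * v$1"
  have "E \<noteq> 0"
  proof
    assume E0: "E = 0"
    have "(v $ i) *\<^sub>R u = (u $ i) *\<^sub>R v" for i
      using E0 exhaust_2[of i] by (auto simp: vec_eq_iff forall_2 E_def mult.commute)
    moreover have "c = 0" if "c *\<^sub>R u = d *\<^sub>R v" for c d
    proof -
      have "c *\<^sub>R (l *\<^sub>R u) = A *v (c *\<^sub>R u)"
        by (simp add: u(2)[symmetric] matrix_vector_mult_scaleR)
      also have "\<dots> = m *\<^sub>R (c *\<^sub>R u)"
        unfolding that by (simp add: v(2) matrix_vector_mult_scaleR mult.commute)
      finally have "(c * (l - m)) *\<^sub>R u = 0" by (simp add: algebra_simps)
      then show ?thesis using u(1) \<open>m \<noteq> l\<close> by simp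
    qed
    ultimately have "v $ i = 0" for i by blast
    then show False using v(1) by (simp add: vec_eq_iff)
  qed
  \<comment> \<open>Cramer's rule in the basis \<open>u\<close>, \<open>v\<close>, with determinant
    \<open>E\<close>.\<close>
  define cu where "cu = (\<lambda>w::real^2. (w$1 * v$2 - w$2 * v$1) / E)"
  define cs where "cs = (\<lambda>w::real^2. (u$1 * w$2 - u$2 * w$1) / E)"
  have "w = cu w *\<^sub>R u + cs w *\<^sub>R v" for w
  proof -
    have "w $ 1 = ((w$1 * v$2 - w$2 * v$1) * u$1 + (u$1 * w$2 - u$2 * w$1) * v$1) / E"
      "w $ 2 = ((w$1 * v$2 - w$2 * v$1) * u$2 + (u$1 * w$2 - u$2 * w$1) * v$2) / E"
      using \<open>E \<noteq> 0\<close> by (simp_all add: nonzero_eq_divide_eq, simp_all add: E_def algebra_simps)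
    then show ?thesis
      by (simp add: vec_eq_iff forall_2 cu_def cs_def add_divide_distrib)
  qed
  note split = this
  have "linear cu" "linear cs"
    by (simp_all add: linear_iff cu_def cs_def ring_distribs add_divide_distrib diff_divide_distrib mult_ac)
  with split have "hyperbolic_splitting A l m u v cu cs \<alpha>"
  proof (intro hyperbolic_splitting.intro)
    show "A $ i $ j \<in> \<int>" for i j using assms by (simp add: anosov_automorphism_def)
  qed (use u v lm assms in blast)+
  then show ?thesis by (rule that)
qed

section \<open>The automorphism acting on periodic functions\<close>

lemma torus_fun_int_period:
  assumes g: "torus_fun g" and k: "k \<in> \<int>"
  shows "g (\<psi> + axis i (2 * pi * k)) = g \<psi>"
proof -
  have nat: "g (\<psi> + axis i (2 * pi * real n)) = g \<psi>" for n \<psi>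
  proof (induction n)
    case (Suc n)
    have "\<psi> + axis i (2 * pi * real (Suc n)) = (\<psi> + axis i (2 * pi * real n)) + axis i (2 * pi)"
      by (simp add: vec_eq_iff axis_def algebra_simps)
    then show ?case using g Suc unfolding torus_fun_def by metis
  qed (simp add: axis_def zero_vec_def[symmetric])
  obtain z where z: "k = of_int z" using k Ints_cases by blast
  show ?thesis
  proof (cases "z \<ge> 0")
    case True
    then show ?thesis using nat[of \<psi> "nat z"] z by simp
  next
    case False
    have "(\<psi> + axis i (2 * pi * k)) + axis i (2 * pi * real (nat (- z))) = \<psi>"
      using False z by (simp add: vec_eq_iff axis_def)
    then show ?thesis using nat[of "\<psi> + axis i (2 * pi * k)" "nat (- z)"] by metis
  qed
qed

context hyperbolic_splitting
begin

definition iter :: "nat \<Rightarrow> real^2 \<Rightarrow> real^2" where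
  "iter n = ((*v) A) ^^ n"

lemma iter_0 [simp]: "iter 0 \<psi> = \<psi>" by (simp add: iter_def)

lemma iter_Suc: "iter (Suc n) \<psi> = A *v iter n \<psi>" by (simp add: iter_def)

lemma iter_Suc_inner: "iter (Suc n) \<psi> = iter n (A *v \<psi>)" by (simp add: iter_def funpow_swap1)

lemma iter_add_vec: "iter n (x + y) = iter n x + iter n y"
  by (induction n) (simp_all add: iter_Suc matrix_vector_right_distrib)

lemma iter_scaleR: "iter n (c *\<^sub>R x) = c *\<^sub>R iter n x"
  by (induction n) (simp_all add: iter_Suc matrix_vector_mult_scaleR)

lemma iter_eu: "iter n eu = lam ^ n *\<^sub>R eu"
  by (induction n) (simp_all add: iter_Suc matrix_vector_mult_scaleR eu)

lemma iter_es: "iter n es = mu ^ n *\<^sub>R es"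
  by (induction n) (simp_all add: iter_Suc matrix_vector_mult_scaleR es)

lemma lam_nz: "lam \<noteq> 0" and mu_nz: "mu \<noteq> 0" and abs_mu: "\<bar>mu\<bar> = 1 / \<bar>lam\<bar>"
  using lam mu by (auto simp: field_simps)

lemma surj_A: "\<exists>\<psi>'. \<psi> = A *v \<psi>'"
proof
  show "\<psi> = A *v ((cu \<psi> / lam) *\<^sub>R eu + (cs \<psi> / mu) *\<^sub>R es)"
    using splitting[of \<psi>] lam_nz mu_nz
    by (simp add: matrix_vector_right_distrib matrix_vector_mult_scaleR eu es)
qed

lemma continuous_on_A: "continuous_on S ((*v) A)"
  by (rule linear_continuous_on) (rule matrix_vector_mul_bounded_linear)

lemma continuous_on_iter: "continuous_on S (iter n)"
proof (induction n)
  case 0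
  then show ?case by (simp add: iter_def)
next
  case (Suc n)
  have "continuous_on S (\<lambda>x. A *v iter n x)"
    by (rule continuous_on_compose2[OF continuous_on_A[of UNIV] Suc]) auto
  then show ?case by (simp add: iter_Suc)
qed

lemma torus_fun_A: "torus_fun g \<Longrightarrow> torus_fun (\<lambda>\<psi>. g (A *v \<psi>))"
proof -
  assume g: "torus_fun g"
  have "g (A *v (\<psi> + axis i (2 * pi))) = g (A *v \<psi>)" for \<psi> i
  proof -
    have "A *v (\<psi> + axis i (2 * pi)) =
        (A *v \<psi> + axis 1 (2 * pi * A $ 1 $ i)) + axis 2 (2 * pi * A $ 2 $ i)"
      using exhaust_2[of i]
      by (auto simp: vec_eq_iff matrix_vector_mult_def axis_def forall_2 sum_2 algebra_simps)
    then show ?thesis using torus_fun_int_period[OF g integral_entries] by simp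
  qed
  then show ?thesis by (simp add: torus_fun_def)
qed

lemma torus_cont_A: "torus_cont g \<Longrightarrow> torus_cont (\<lambda>\<psi>. g (A *v \<psi>))"
  using continuous_on_compose2[of UNIV g UNIV "(*v) A"]
  by (simp add: torus_cont_def torus_fun_A continuous_on_A)

lemma torus_cont_iter: "torus_cont g \<Longrightarrow> torus_cont (\<lambda>\<psi>. g (iter n \<psi>))"
proof (induction n arbitrary: g)
  case (Suc n)
  then show ?case using torus_cont_A[of "\<lambda>\<psi>. g (iter n \<psi>)"] by (simp add: iter_Suc_inner)
qed simp

text \<open>The double average of \<open>g (A *v \<psi> + v)\<close> is evaluated in both orders.
  For fixed \<open>\<psi>\<close> the integrand is a shift of \<open>g\<close>; for fixed
  \<open>v\<close>, surjectivity writes \<open>v\<close> as \<open>A *v w\<close> and the shift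
  moves inside \<open>A\<close>. This replaces a change of variables in the integral.\<close>

lemma torus_avg_A:
  assumes g: "torus_cont g"
  shows "torus_avg (\<lambda>\<psi>. g (A *v \<psi>)) = torus_avg g"
proof -
  have sh: "torus_avg (\<lambda>\<psi>. g (A *v \<psi> + v)) = torus_avg (\<lambda>\<psi>. g (A *v \<psi>))" for v
  proof -
    obtain w where "v = A *v w" using surj_A by blast
    then show ?thesis
      using torus_avg_shift[OF torus_cont_A[OF g], of w] by (simp add: matrix_vector_right_distrib)
  qed
  have "continuous_on UNIV (\<lambda>(\<psi>, v). g (A *v \<psi> + v))"
    unfolding split_beta
  proof (rule continuous_on_compose2[where g=g and t=UNIV])
    show "continuous_on UNIV (\<lambda>x. A *v fst x + snd x)"
      by (intro continuous_intros continuous_on_compose2[OF continuous_on_A[of UNIV]]) auto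
  qed (use g in \<open>auto simp: torus_cont_def\<close>)
  from torus_avg_swap[OF this]
  have "torus_avg (\<lambda>\<psi>. torus_avg (\<lambda>v. g (A *v \<psi> + v))) = torus_avg (\<lambda>\<psi>. g (A *v \<psi>))"
    by (simp only: sh torus_avg_const)
  moreover have "torus_avg (\<lambda>v. g (A *v \<psi> + v)) = torus_avg g" for \<psi>
    using torus_avg_shift[OF g, of "A *v \<psi>"] by (simp add: add.commute)
  ultimately show ?thesis by simp
qed

lemma torus_avg_iter: "torus_cont g \<Longrightarrow> torus_avg (\<lambda>\<psi>. g (iter n \<psi>)) = torus_avg g"
proof (induction n arbitrary: g)
  case (Suc n)
  then show ?case using torus_avg_A[of "\<lambda>\<psi>. g (iter n \<psi>)"] torus_cont_iter[of g n]
    by (simp add: iter_Suc_inner)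
qed simp

text \<open>Controls how far the fundamental cell extends along the unstable and the stable line; it
  enters all mixing estimates through \<open>mixing_const\<close>.\<close>

definition cell_bound :: real where
  "cell_bound = (SOME B. B > 0 \<and> (\<forall>v\<in>cbox 0 periods. \<bar>cu v\<bar> \<le> B \<and> \<bar>cs v\<bar> * norm es \<le> B))"

lemma cell_bound: "cell_bound > 0"
    "v \<in> cbox 0 periods \<Longrightarrow> \<bar>cu v\<bar> \<le> cell_bound"
    "v \<in> cbox 0 periods \<Longrightarrow> \<bar>cs v\<bar> * norm es \<le> cell_bound"
proof -
  have "compact (cu ` cbox 0 periods)" "compact (cs ` cbox 0 periods)"
    using linear_cu linear_cs
    by (auto intro!: compact_continuous_image linear_continuous_on simp: linear_conv_bounded_linear)
  then obtain B1 B2 where B: "\<And>v. v \<in> cbox 0 periods \<Longrightarrow> \<bar>cu v\<bar> \<le> B1"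
      "\<And>v. v \<in> cbox 0 periods \<Longrightarrow> \<bar>cs v\<bar> \<le> B2" "B1 > 0" "B2 > 0"
    by (metis bounded_pos compact_imp_bounded imageI real_norm_def)
  have "\<exists>B. B > 0 \<and> (\<forall>v\<in>cbox 0 periods. \<bar>cu v\<bar> \<le> B \<and> \<bar>cs v\<bar> * norm es \<le> B)"
  proof (intro exI conjI ballI)
    show "B1 + B2 * norm es > 0" using B by (simp add: add_pos_nonneg)
    fix v :: "real^2" assume v: "v \<in> cbox 0 periods"
    show "\<bar>cu v\<bar> \<le> B1 + B2 * norm es" using B(1)[OF v] B(4) by (simp add: add_increasing2)
    show "\<bar>cs v\<bar> * norm es \<le> B1 + B2 * norm es"
      using mult_right_mono[OF B(2)[OF v], of "norm es"] B(3) by simp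
  qed
  then have "cell_bound > 0 \<and> (\<forall>v\<in>cbox 0 periods. \<bar>cu v\<bar> \<le> cell_bound \<and> \<bar>cs v\<bar> * norm es \<le> cell_bound)"
    unfolding cell_bound_def by (rule someI_ex)
  then show "cell_bound > 0"
    "v \<in> cbox 0 periods \<Longrightarrow> \<bar>cu v\<bar> \<le> cell_bound"
    "v \<in> cbox 0 periods \<Longrightarrow> \<bar>cs v\<bar> * norm es \<le> cell_bound" by auto
qed

lemma continuous_on_cu: "continuous_on S cu"
  using linear_cu by (simp add: linear_continuous_on linear_conv_bounded_linear)

definition holder :: "(real^2 \<Rightarrow> real) \<Rightarrow> real \<Rightarrow> bool" where
  "holder g H \<longleftrightarrow> (\<forall>x y. \<bar>g x - g y\<bar> \<le> H * dist x y powr \<alpha>)"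

lemma holder_continuous:
  assumes "holder g H"
  shows "continuous_on UNIV g"
proof -
  have "(g \<longlongrightarrow> g x) (at x)" for x
  proof -
    have "((\<lambda>y. H * dist y x powr \<alpha>) \<longlongrightarrow> H * 0 powr \<alpha>) (at x)"
      by (intro tendsto_intros tendsto_powr') (use alpha in \<open>auto intro!: tendsto_eq_intros simp: dist_norm\<close>)
    then have z: "((\<lambda>y. H * dist y x powr \<alpha>) \<longlongrightarrow> 0) (at x)" by simp
    have "((\<lambda>y. g y - g x) \<longlongrightarrow> 0) (at x)"
      by (rule Lim_null_comparison[OF _ z]) (use assms in \<open>auto simp: holder_def\<close>)
    then show ?thesis by (simp add: LIM_zero_iff)
  qed
  then show ?thesis by (simp add: continuous_on_def)
qed

text \<open>
  Averaging \<open>G (p + A\<^sup>k v)\<close> over \<open>v\<close> in a fundamental cell gives the mean of \<open>G\<close> exactly, and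
  \<open>A\<^sup>k v\<close> differs from its unstable component only by a vector of length \<open>O (\<bar>mu\<bar>\<^sup>k)\<close>.
\<close>

lemma unstable_equidistribution:
  assumes G: "torus_fun G" "holder G H" and H: "H \<ge> 0"
  shows "\<bar>torus_avg (\<lambda>v. G (p + (lam ^ k * cu v) *\<^sub>R eu)) - torus_avg G\<bar>
    \<le> H * (\<bar>mu\<bar> ^ k * cell_bound) powr \<alpha>"
proof -
  have Gc: "continuous_on UNIV G" by (rule holder_continuous[OF G(2)])
  have tc: "torus_cont G" using G Gc by (simp add: torus_cont_def)
  have it: "iter k v = (lam ^ k * cu v) *\<^sub>R eu + (mu ^ k * cs v) *\<^sub>R es" for v
    by (subst splitting[of v]) (simp add: iter_add_vec iter_scaleR iter_eu iter_es mult.commute)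
  have "torus_avg (\<lambda>v. G (p + iter k v)) = torus_avg G"
    using torus_avg_iter[OF torus_cont_shift[OF tc, of p], of k] torus_avg_shift[OF tc]
    by (simp add: add.commute)
  moreover have c1: "continuous_on UNIV (\<lambda>v. G (p + iter k v))"
    by (intro continuous_on_compose2[OF Gc] continuous_intros continuous_on_iter) auto
  moreover have c2: "continuous_on UNIV (\<lambda>v. G (p + (lam ^ k * cu v) *\<^sub>R eu))"
    by (intro continuous_on_compose2[OF Gc] continuous_intros continuous_on_cu) auto
  ultimately have "torus_avg (\<lambda>v. G (p + (lam ^ k * cu v) *\<^sub>R eu)) - torus_avg G =
      torus_avg (\<lambda>v. G (p + (lam ^ k * cu v) *\<^sub>R eu) - G (p + iter k v))"
    by (simp add: torus_avg_diff_continuous)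
  also have "\<bar>\<dots>\<bar> \<le> H * (\<bar>mu\<bar> ^ k * cell_bound) powr \<alpha>"
  proof (rule torus_avg_abs_le_continuous)
    fix v :: "real^2" assume v: "v \<in> cbox 0 periods"
    have "dist (p + (lam ^ k * cu v) *\<^sub>R eu) (p + iter k v) = \<bar>mu\<bar> ^ k * (\<bar>cs v\<bar> * norm es)"
      by (simp add: it dist_norm abs_mult power_abs)
    also have "\<dots> \<le> \<bar>mu\<bar> ^ k * cell_bound"
      using cell_bound(3)[OF v] by (simp add: mult_left_mono)
    finally have "H * dist (p + (lam ^ k * cu v) *\<^sub>R eu) (p + iter k v) powr \<alpha>
        \<le> H * (\<bar>mu\<bar> ^ k * cell_bound) powr \<alpha>"
      using H alpha by (intro mult_left_mono powr_mono2) auto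
    then show "\<bar>G (p + (lam ^ k * cu v) *\<^sub>R eu) - G (p + iter k v)\<bar> \<le> H * (\<bar>mu\<bar> ^ k * cell_bound) powr \<alpha>"
      using G(2) unfolding holder_def by (meson order_trans)
  qed (intro continuous_intros c1 c2)
  finally show ?thesis .
qed

end

section \<open>Decay of correlations along slow observables\<close>

lemma sum_powers_le:
  fixes x :: real
  assumes "0 \<le> x" "x < 1"
  shows "(\<Sum>i<n. x ^ i) \<le> 1 / (1 - x)"
proof -
  have "(\<Sum>i<n. x ^ i) = (1 - x ^ n) / (1 - x)" using assms by (simp add: sum_gp_strict)
  also have "\<dots> \<le> 1 / (1 - x)" using assms by (intro divide_right_mono) auto
  finally show ?thesis .
qed

lemma abs_mult_add_le: "\<bar>a * b + c * d\<bar> \<le> \<bar>a\<bar> * \<bar>b\<bar> + \<bar>c\<bar> * \<bar>d\<bar>" for a b c d :: real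
  using abs_triangle_ineq[of "a * b" "c * d"] by (simp add: abs_mult)

context hyperbolic_splitting
begin

text \<open>The quarter leaves room for two losses: half of the elapsed time is spent on freezing
  the slow arguments and half on equidistribution, and of the resulting
  \<open>rate ^ (2 * n)\<close> one factor \<open>rate ^ n\<close> is traded against powers of
  \<open>\<theta>\<close> when increments are summed.\<close>

definition rate :: real where "rate = \<bar>mu\<bar> powr (\<alpha> / 4)"

text \<open>Three errors are added: freezing the first factor, freezing the slow argument of the
  second, and equidistribution. The division by \<open>rate\<^sup>2\<close> compensates for rounding
  when the elapsed time is halved.\<close>

definition mixing_const :: real where
  "mixing_const = 3 * cell_bound powr \<alpha> / rate\<^sup>2"

text \<open>The factor 2 covers the two terms of an increment, \<open>1 - rate\<close> comes from
  the geometric series of the increments, and the remaining \<open>rate\<close> from the offset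
  between the times \<open>i\<close> and \<open>Suc i\<close>.\<close>

definition corr_const :: real where
  "corr_const = 2 * mixing_const / (rate * (1 - rate))"

lemma abs_mu_less_1: "\<bar>mu\<bar> < 1" and abs_mu_pos: "0 < \<bar>mu\<bar>"
  using lam mu_nz by (auto simp: abs_mu)

lemma rate: "0 < rate" "rate < 1"
  using abs_mu_pos abs_mu_less_1 alpha powr_less_mono2[of "\<alpha> / 4" "\<bar>mu\<bar>" 1] by (auto simp: rate_def)

lemma mu_power_powr: "(\<bar>mu\<bar> ^ k) powr \<alpha> = rate ^ (4 * k)"
proof -
  have "(\<bar>mu\<bar> ^ k) powr \<alpha> = \<bar>mu\<bar> powr (real k * \<alpha>)"
    using abs_mu_pos by (simp add: powr_realpow[symmetric] powr_powr)
  also have "\<dots> = rate ^ (4 * k)"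
    using abs_mu_pos by (simp add: rate_def powr_realpow[symmetric] powr_powr mult.commute)
  finally show ?thesis .
qed

lemma mixing_const_pos: "mixing_const > 0"
  using cell_bound(1) rate by (simp add: mixing_const_def)

lemma corr_const_ge: "mixing_const \<le> corr_const" and corr_const_pos: "corr_const > 0"
proof -
  have "rate * (1 - rate) \<le> 1" using rate mult_le_one[of rate "1 - rate"] by simp
  then have "mixing_const * (rate * (1 - rate)) \<le> 2 * mixing_const"
    using mixing_const_pos rate mult_left_le[of "rate * (1 - rate)" mixing_const] by linarith
  then show "mixing_const \<le> corr_const"
    using rate by (simp add: corr_const_def pos_le_divide_eq)
  then show "corr_const > 0" using mixing_const_pos by linarith
qed

text \<open>The base point is smeared along an unstable segment of length about
  \<open>1 / \<bar>lam\<bar> ^ (l + j)\<close>, with \<open>j\<close> half of \<open>n - l\<close>.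
  Seen at time \<open>l\<close> the segment is as short as \<open>\<bar>mu\<bar> ^ j\<close>, so
  \<open>F\<close> and the slow argument of \<open>G\<close> hardly move; at time \<open>n\<close>
  it is as long as \<open>\<bar>lam\<bar> ^ k\<close>, so the fast argument equidistributes and the
  zero mean of \<open>G\<close> takes effect.\<close>

lemma frozen_average:
  assumes gc: "torus_cont (\<lambda>\<psi>. F \<psi> * G \<psi> (iter n \<psi>))"
    and Fb: "\<And>\<psi>. \<bar>F \<psi>\<bar> \<le> CF"
    and Fs: "\<And>\<psi> s. \<bar>F (\<psi> + s *\<^sub>R eu) - F \<psi>\<bar> \<le> CF * (\<bar>lam\<bar> ^ l * \<bar>s\<bar>) powr \<alpha>"
    and Gb: "\<And>\<psi> x. \<bar>G \<psi> x\<bar> \<le> CG"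
    and Gs: "\<And>\<psi> x s. \<bar>G (\<psi> + s *\<^sub>R eu) x - G \<psi> x\<bar> \<le> CG * (\<bar>lam\<bar> ^ l * \<bar>s\<bar>) powr \<alpha>"
    and Gh: "\<And>\<psi>. holder (G \<psi>) CG" and Gp: "\<And>\<psi>. torus_fun (G \<psi>)"
    and G0: "\<And>\<psi>. torus_avg (G \<psi>) = 0"
    and l: "l \<le> n"
  shows "\<bar>torus_avg (\<lambda>\<psi>. F \<psi> * G \<psi> (iter n \<psi>))\<bar> \<le> CF * CG * mixing_const * rate ^ (2 * (n - l))"
proof -
  define j where "j = (n - l) div 2"
  define k where "k = n - l - j"
  have jk: "n = l + j + k" "j \<le> k" "2 * (n - l) \<le> 4 * j + 2" using l by (auto simp: j_def k_def)
  define s where "s v = cu v / lam ^ (l + j)" for v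
  let ?g = "\<lambda>\<psi>. F \<psi> * G \<psi> (iter n \<psi>)"
  let ?b = "cell_bound powr \<alpha>"
  have CF: "0 \<le> CF" and CG: "0 \<le> CG" using Fb[of 0] Gb[of 0 0] by linarith+
  have sc: "continuous_on S s" for S
    using lam_nz by (auto simp: s_def intro!: continuous_intros continuous_on_cu)
  have bound: "\<bar>torus_avg (\<lambda>v. ?g (\<psi> + s v *\<^sub>R eu))\<bar> \<le> CF * CG * (3 * ?b * rate ^ (4 * j))" for \<psi>
  proof -
    let ?p = "\<lambda>v. iter n \<psi> + (lam ^ k * cu v) *\<^sub>R eu"
    have it: "iter n (\<psi> + s v *\<^sub>R eu) = ?p v" for v
      using lam_nz by (simp add: iter_add_vec iter_scaleR iter_eu s_def jk(1) power_add)
    have c1: "continuous_on UNIV (\<lambda>v. ?g (\<psi> + s v *\<^sub>R eu))"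
      by (rule continuous_on_compose2[where g="?g" and t=UNIV])
        (use gc in \<open>auto simp: torus_cont_def intro!: continuous_intros sc\<close>)
    have c0: "continuous_on UNIV (\<lambda>v. G \<psi> (?p v))"
      by (rule continuous_on_compose2[OF holder_continuous[OF Gh]])
        (auto intro!: continuous_intros continuous_on_cu)
    have c2: "continuous_on UNIV (\<lambda>v. F \<psi> * G \<psi> (?p v))" by (intro continuous_intros c0)
    have "\<bar>torus_avg (\<lambda>v. ?g (\<psi> + s v *\<^sub>R eu) - F \<psi> * G \<psi> (?p v))\<bar> \<le> CF * CG * (2 * ?b * rate ^ (4 * j))"
    proof (rule torus_avg_abs_le_continuous)
      fix v :: "real^2" assume v: "v \<in> cbox 0 periods"
      have "\<bar>lam\<bar> ^ l * \<bar>s v\<bar> = \<bar>mu\<bar> ^ j * \<bar>cu v\<bar>"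
        using lam_nz by (simp add: s_def abs_mu power_abs[symmetric] abs_mult power_add field_simps)
      also have "\<dots> \<le> \<bar>mu\<bar> ^ j * cell_bound"
        using cell_bound(2)[OF v] by (simp add: mult_left_mono)
      finally have "(\<bar>lam\<bar> ^ l * \<bar>s v\<bar>) powr \<alpha> \<le> (\<bar>mu\<bar> ^ j * cell_bound) powr \<alpha>"
        using alpha by (intro powr_mono2) auto
      also have "\<dots> = rate ^ (4 * j) * ?b"
        using cell_bound(1) by (simp add: powr_mult mu_power_powr)
      finally have le: "(\<bar>lam\<bar> ^ l * \<bar>s v\<bar>) powr \<alpha> \<le> rate ^ (4 * j) * ?b" .
      let ?\<psi> = "\<psi> + s v *\<^sub>R eu"
      have "?g ?\<psi> - F \<psi> * G \<psi> (?p v) = (F ?\<psi> - F \<psi>) * G ?\<psi> (?p v) + F \<psi> * (G ?\<psi> (?p v) - G \<psi> (?p v))"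
        by (simp add: it algebra_simps)
      also have "\<bar>\<dots>\<bar> \<le> \<bar>F ?\<psi> - F \<psi>\<bar> * \<bar>G ?\<psi> (?p v)\<bar> + \<bar>F \<psi>\<bar> * \<bar>G ?\<psi> (?p v) - G \<psi> (?p v)\<bar>"
        by (rule abs_mult_add_le)
      also have "\<dots> \<le> (CF * (rate ^ (4 * j) * ?b)) * CG + CF * (CG * (rate ^ (4 * j) * ?b))"
        by (intro add_mono mult_mono Fb Gb order_trans[OF Fs] order_trans[OF Gs] mult_left_mono le)
          (use CF CG rate in auto)
      finally show "\<bar>?g ?\<psi> - F \<psi> * G \<psi> (?p v)\<bar> \<le> CF * CG * (2 * ?b * rate ^ (4 * j))"
        by (simp add: algebra_simps)
    qed (intro continuous_intros c1 c2)
    moreover have "\<bar>torus_avg (\<lambda>v. F \<psi> * G \<psi> (?p v))\<bar> \<le> CF * CG * (?b * rate ^ (4 * j))"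
    proof -
      have "(\<bar>mu\<bar> ^ k * cell_bound) powr \<alpha> = rate ^ (4 * k) * ?b"
        using cell_bound(1) by (simp add: powr_mult mu_power_powr)
      also have "\<dots> \<le> rate ^ (4 * j) * ?b"
        using rate jk by (intro mult_right_mono power_decreasing) auto
      finally have "CG * (\<bar>mu\<bar> ^ k * cell_bound) powr \<alpha> \<le> CG * (rate ^ (4 * j) * ?b)"
        using CG by (intro mult_left_mono)
      then have "\<bar>torus_avg (\<lambda>v. G \<psi> (?p v))\<bar> \<le> CG * (rate ^ (4 * j) * ?b)"
        using unstable_equidistribution[OF Gp Gh CG, of \<psi> "iter n \<psi>" k] unfolding G0 by simp
      then have "\<bar>F \<psi>\<bar> * \<bar>torus_avg (\<lambda>v. G \<psi> (?p v))\<bar> \<le> CF * (CG * (rate ^ (4 * j) * ?b))"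
        by (intro mult_mono Fb) (use CF in auto)
      then show ?thesis
        unfolding torus_avg_cmult_continuous[OF c0] abs_mult by (simp add: mult_ac)
    qed
    ultimately show ?thesis
      unfolding torus_avg_diff_continuous[OF c1 c2] by (simp add: algebra_simps)
  qed
  have "\<bar>torus_avg ?g\<bar> \<le> CF * CG * (3 * ?b * rate ^ (4 * j))"
    by (rule torus_avg_le_shift_avg[OF gc _ bound]) (intro continuous_intros sc)
  also have "\<dots> \<le> CF * CG * (mixing_const * rate ^ (2 * (n - l)))"
  proof (rule mult_left_mono)
    have "rate ^ (4 * j + 2) \<le> rate ^ (2 * (n - l))"
      using rate jk by (intro power_decreasing) auto
    then have "rate ^ (4 * j) \<le> rate ^ (2 * (n - l)) / rate\<^sup>2"
      using rate by (simp add: pos_le_divide_eq power_add power2_eq_square mult_ac)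
    then have "3 * ?b * rate ^ (4 * j) \<le> 3 * ?b * (rate ^ (2 * (n - l)) / rate\<^sup>2)"
      by (intro mult_left_mono) auto
    then show "3 * ?b * rate ^ (4 * j) \<le> mixing_const * rate ^ (2 * (n - l))"
      by (simp add: mixing_const_def)
  qed (use CF CG in simp)
  finally show ?thesis by (simp add: mult.assoc)
qed

text \<open>
  \<open>observable C \<rho> \<theta> \<Gamma>\<close>: the second argument of \<open>\<Gamma> n\<close> is the fast variable \<open>A\<^sup>n \<psi>\<close>; the dependence
  on the first one is through quantities determined by \<open>\<psi>, \<dots>, A\<^sup>n\<^sup>-\<^sup>1 \<psi>\<close>, which change by \<open>O(\<rho>)\<close>
  in one step and, seen from time \<open>n\<close>, are Hoelder along the unstable direction with constant \<open>O(\<rho>)\<close>.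
\<close>

definition observable :: "real \<Rightarrow> real \<Rightarrow> real \<Rightarrow> (nat \<Rightarrow> real^2 \<Rightarrow> real^2 \<Rightarrow> real) \<Rightarrow> bool" where
  "observable C \<rho> \<theta> \<Gamma> \<longleftrightarrow>
     (\<forall>n \<psi>. torus_fun (\<Gamma> n \<psi>)) \<and> (\<forall>n m. torus_cont (\<lambda>\<psi>. \<Gamma> n \<psi> (iter m \<psi>))) \<and>
     (\<forall>n \<psi> x. \<bar>\<Gamma> n \<psi> x\<bar> \<le> C * \<theta> ^ n) \<and>
     (\<forall>n \<psi>. holder (\<Gamma> n \<psi>) (C * \<theta> ^ n)) \<and>
     (\<forall>n \<psi> x. \<bar>\<Gamma> (Suc n) \<psi> x - \<Gamma> n \<psi> x\<bar> \<le> C * \<rho> * \<theta> ^ n) \<and>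
     (\<forall>n \<psi>. holder (\<lambda>x. \<Gamma> (Suc n) \<psi> x - \<Gamma> n \<psi> x) (C * \<rho> * \<theta> ^ n)) \<and>
     (\<forall>n \<psi> x s. \<bar>\<Gamma> n (\<psi> + s *\<^sub>R eu) x - \<Gamma> n \<psi> x\<bar> \<le> C * \<rho> * \<theta> ^ n * (\<bar>lam\<bar> ^ n * \<bar>s\<bar>) powr \<alpha>)"

lemma holder_mono: "holder g H \<Longrightarrow> H \<le> K \<Longrightarrow> holder g K"
  unfolding holder_def by (meson mult_right_mono order_trans powr_ge_zero)

lemma lam_powr_mono:
  "m \<le> n \<Longrightarrow> (\<bar>lam\<bar> ^ m * \<bar>s\<bar>) powr \<alpha> \<le> (\<bar>lam\<bar> ^ n * \<bar>s\<bar>) powr \<alpha>"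
  using lam alpha by (intro powr_mono2 mult_right_mono power_increasing) auto

text \<open>
  The slow argument is moved back from time \<open>n\<close> to time \<open>m\<close> one step at a time; each increment is
  \<open>O(\<rho>)\<close> and decorrelates from the fast variable at time \<open>n\<close> exponentially in the elapsed time.
\<close>

lemma correlation_decay:
  assumes obs: "observable C \<rho> \<theta> \<Gamma>" and mean: "\<And>n \<psi>. torus_avg (\<Gamma> n \<psi>) = 0"
    and F: "torus_cont F" and Fb: "\<And>\<psi>. \<bar>F \<psi>\<bar> \<le> CF"
    and Fs: "\<And>\<psi> s. \<bar>F (\<psi> + s *\<^sub>R eu) - F \<psi>\<bar> \<le> CF * (\<bar>lam\<bar> ^ m * \<bar>s\<bar>) powr \<alpha>"
    and m: "m \<le> n" and \<rho>: "0 \<le> \<rho>" "\<rho> \<le> 1" and \<theta>: "rate \<le> \<theta>" "\<theta> \<le> 1" and C: "0 \<le> C"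
  shows "\<bar>torus_avg (\<lambda>\<psi>. F \<psi> * \<Gamma> n \<psi> (iter n \<psi>))\<bar>
      \<le> corr_const * CF * C * (\<rho> * \<theta> ^ n + \<theta> ^ m * rate ^ (2 * (n - m)))"
proof -
  note O = obs[unfolded observable_def]
  have per: "\<And>n \<psi>. torus_fun (\<Gamma> n \<psi>)" and cont: "\<And>n m. torus_cont (\<lambda>\<psi>. \<Gamma> n \<psi> (iter m \<psi>))"
    and bd: "\<And>n \<psi> x. \<bar>\<Gamma> n \<psi> x\<bar> \<le> C * \<theta> ^ n" and ho: "\<And>n \<psi>. holder (\<Gamma> n \<psi>) (C * \<theta> ^ n)"
    and ibd: "\<And>n \<psi> x. \<bar>\<Gamma> (Suc n) \<psi> x - \<Gamma> n \<psi> x\<bar> \<le> C * \<rho> * \<theta> ^ n"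
    and iho: "\<And>n \<psi>. holder (\<lambda>x. \<Gamma> (Suc n) \<psi> x - \<Gamma> n \<psi> x) (C * \<rho> * \<theta> ^ n)"
    and sh: "\<And>n \<psi> x s. \<bar>\<Gamma> n (\<psi> + s *\<^sub>R eu) x - \<Gamma> n \<psi> x\<bar> \<le> C * \<rho> * \<theta> ^ n * (\<bar>lam\<bar> ^ n * \<bar>s\<bar>) powr \<alpha>"
    using O by blast+
  have th: "0 < \<theta>" using \<theta> rate by linarith
  have CF: "0 \<le> CF" using Fb[of 0] by linarith
  define I where "I i \<psi> x = \<Gamma> (Suc i) \<psi> x - \<Gamma> i \<psi> x" for i \<psi> x
  have tc: "torus_cont (\<Gamma> n \<psi>)" for n \<psi>
    using per holder_continuous[OF ho] by (simp add: torus_cont_def)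
  have Ic: "torus_cont (\<lambda>\<psi>. F \<psi> * I i \<psi> (iter n \<psi>))" for i
    unfolding I_def by (intro torus_cont_intros F cont)
  have Gc: "torus_cont (\<lambda>\<psi>. F \<psi> * \<Gamma> i \<psi> (iter n \<psi>))" for i
    by (intro torus_cont_intros F cont)
  \<comment> \<open>An increment contains \<open>\<Gamma> (Suc i)\<close> and hence has the Hoelder
    scale of time \<open>Suc i\<close>. Only \<open>n - Suc i\<close> steps of mixing remain, and
    doubling the constant covers both terms of the difference.\<close>
  have Ibound: "\<bar>torus_avg (\<lambda>\<psi>. F \<psi> * I i \<psi> (iter n \<psi>))\<bar>
      \<le> CF * (2 * (C * \<rho> * \<theta> ^ i)) * mixing_const * rate ^ (2 * (n - Suc i))" if i: "m \<le> i" "i < n" for i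
  proof (rule frozen_average[where F=F and G="I i" and n=n, OF Ic Fb])
    have pos: "0 \<le> C * \<rho> * \<theta> ^ i" using C \<rho> th by simp
    show "\<bar>F (\<psi> + s *\<^sub>R eu) - F \<psi>\<bar> \<le> CF * (\<bar>lam\<bar> ^ Suc i * \<bar>s\<bar>) powr \<alpha>" for \<psi> s
      using i by (intro order_trans[OF Fs mult_left_mono[OF lam_powr_mono CF]]) simp
    show "\<bar>I i \<psi> x\<bar> \<le> 2 * (C * \<rho> * \<theta> ^ i)" for \<psi> x
      using ibd[of i \<psi> x] pos by (simp add: I_def)
    show "holder (I i \<psi>) (2 * (C * \<rho> * \<theta> ^ i))" for \<psi>
      unfolding I_def by (rule holder_mono[OF iho]) (use pos in simp)
    show "torus_fun (I i \<psi>)" for \<psi> using per by (simp add: I_def torus_fun_def)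
    show "torus_avg (I i \<psi>) = 0" for \<psi> unfolding I_def[abs_def] using torus_avg_diff[OF tc tc, of "Suc i" \<psi> i \<psi>] mean by simp
    show "Suc i \<le> n" using i by simp
    show "\<bar>I i (\<psi> + s *\<^sub>R eu) x - I i \<psi> x\<bar> \<le> 2 * (C * \<rho> * \<theta> ^ i) * (\<bar>lam\<bar> ^ Suc i * \<bar>s\<bar>) powr \<alpha>" for \<psi> x s
    proof -
      have "\<bar>I i (\<psi> + s *\<^sub>R eu) x - I i \<psi> x\<bar> \<le>
          C * \<rho> * \<theta> ^ Suc i * (\<bar>lam\<bar> ^ Suc i * \<bar>s\<bar>) powr \<alpha> + C * \<rho> * \<theta> ^ i * (\<bar>lam\<bar> ^ i * \<bar>s\<bar>) powr \<alpha>"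
        unfolding I_def using sh[of "Suc i" \<psi> s x] sh[of i \<psi> s x] by linarith
      also have "\<dots> \<le> C * \<rho> * \<theta> ^ i * (\<bar>lam\<bar> ^ Suc i * \<bar>s\<bar>) powr \<alpha> + C * \<rho> * \<theta> ^ i * (\<bar>lam\<bar> ^ Suc i * \<bar>s\<bar>) powr \<alpha>"
        using C \<rho> th \<theta> lam_powr_mono[of i "Suc i" s]
        by (intro add_mono mult_right_mono mult_left_mono lam_powr_mono)
          (auto intro: mult_left_le_one_le)
      finally show ?thesis by (simp add: algebra_simps)
    qed
  qed
  have Mbound: "\<bar>torus_avg (\<lambda>\<psi>. F \<psi> * \<Gamma> m \<psi> (iter n \<psi>))\<bar>
      \<le> CF * (C * \<theta> ^ m) * mixing_const * rate ^ (2 * (n - m))"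
  proof (rule frozen_average[where F=F and G="\<Gamma> m" and n=n, OF Gc Fb Fs bd _ ho per mean m])
    fix \<psi> x s
    have "C * \<rho> * \<theta> ^ m \<le> C * \<theta> ^ m"
      using C \<rho> th by (intro mult_right_mono mult_left_le) auto
    then show "\<bar>\<Gamma> m (\<psi> + s *\<^sub>R eu) x - \<Gamma> m \<psi> x\<bar> \<le> C * \<theta> ^ m * (\<bar>lam\<bar> ^ m * \<bar>s\<bar>) powr \<alpha>"
      by (intro order_trans[OF sh]) (rule mult_right_mono, auto)
  qed
  have tel: "F \<psi> * \<Gamma> n \<psi> x = F \<psi> * \<Gamma> m \<psi> x + (\<Sum>i\<in>{m..<n}. F \<psi> * I i \<psi> x)" for \<psi> x
  proof -
    have "(\<Sum>i\<in>{m..<n}. F \<psi> * I i \<psi> x) = (\<Sum>i\<in>{m..<n}. F \<psi> * \<Gamma> (Suc i) \<psi> x - F \<psi> * \<Gamma> i \<psi> x)"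
      by (simp add: I_def algebra_simps)
    then show ?thesis using sum_Suc_diff'[OF m, of "\<lambda>i. F \<psi> * \<Gamma> i \<psi> x"] by simp
  qed
  \<comment> \<open>One of the two factors \<open>rate ^ (n - Suc i)\<close> turns
    \<open>\<theta> ^ i\<close> into \<open>\<theta> ^ n\<close>, because
    \<open>rate \<le> \<theta>\<close>; the other one stays summable in \<open>i\<close>.\<close>
  have pw: "\<theta> ^ i * rate ^ (2 * (n - Suc i)) \<le> (\<theta> ^ n / rate) * rate ^ (n - Suc i)" if "i < n" for i
  proof -
    have n: "n = i + (n - Suc i) + 1" using that by simp
    have "rate * rate ^ (n - Suc i) \<le> \<theta> * \<theta> ^ (n - Suc i)"
      using rate \<theta> by (intro mult_mono power_mono) auto
    then have "\<theta> ^ i * (rate * rate ^ (n - Suc i)) \<le> \<theta> ^ i * (\<theta> * \<theta> ^ (n - Suc i))"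
      using th by (intro mult_left_mono) auto
    also have "\<dots> = \<theta> ^ (i + (n - Suc i) + 1)" by (simp add: power_add)
    finally have "\<theta> ^ i * rate ^ (n - Suc i) \<le> \<theta> ^ n / rate"
      using rate n by (simp add: pos_le_divide_eq mult_ac)
    then have "\<theta> ^ i * rate ^ (n - Suc i) * rate ^ (n - Suc i) \<le> \<theta> ^ n / rate * rate ^ (n - Suc i)"
      using rate by (intro mult_right_mono) auto
    then show ?thesis by (simp add: mult_2 power_add mult.assoc)
  qed
  have "(\<Sum>i\<in>{m..<n}. rate ^ (n - Suc i)) \<le> (\<Sum>i<n. rate ^ (n - Suc i))"
    using rate by (intro sum_mono2) auto
  also have "\<dots> = (\<Sum>i<n. rate ^ i)" by (rule sum.nat_diff_reindex)
  also have "\<dots> \<le> 1 / (1 - rate)" using rate by (intro sum_powers_le) auto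
  finally have geo: "(\<Sum>i\<in>{m..<n}. rate ^ (n - Suc i)) \<le> 1 / (1 - rate)" .
  have "\<bar>\<Sum>i\<in>{m..<n}. torus_avg (\<lambda>\<psi>. F \<psi> * I i \<psi> (iter n \<psi>))\<bar>
      \<le> (\<Sum>i\<in>{m..<n}. \<bar>torus_avg (\<lambda>\<psi>. F \<psi> * I i \<psi> (iter n \<psi>))\<bar>)" by (rule sum_abs)
  also have "\<dots> \<le> (\<Sum>i\<in>{m..<n}. CF * (2 * C * \<rho>) * mixing_const * (\<theta> ^ n / rate) * rate ^ (n - Suc i))"
  proof (rule sum_mono)
    fix i assume i: "i \<in> {m..<n}"
    have "CF * (2 * (C * \<rho> * \<theta> ^ i)) * mixing_const * rate ^ (2 * (n - Suc i)) =
        (CF * (2 * C * \<rho>) * mixing_const) * (\<theta> ^ i * rate ^ (2 * (n - Suc i)))"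
      by (simp add: algebra_simps)
    also have "\<dots> \<le> (CF * (2 * C * \<rho>) * mixing_const) * ((\<theta> ^ n / rate) * rate ^ (n - Suc i))"
      using i CF C \<rho> mixing_const_pos by (intro mult_left_mono pw) auto
    finally show "\<bar>torus_avg (\<lambda>\<psi>. F \<psi> * I i \<psi> (iter n \<psi>))\<bar>
        \<le> CF * (2 * C * \<rho>) * mixing_const * (\<theta> ^ n / rate) * rate ^ (n - Suc i)"
      using Ibound[of i] i by (simp add: mult.assoc)
  qed
  also have "\<dots> \<le> CF * (2 * C * \<rho>) * mixing_const * (\<theta> ^ n / rate) * (1 / (1 - rate))"
    unfolding sum_distrib_left[symmetric]
    using CF C \<rho> mixing_const_pos th rate by (intro mult_left_mono geo) auto
  also have "\<dots> = corr_const * CF * C * (\<rho> * \<theta> ^ n)"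
    by (simp add: corr_const_def field_simps)
  finally have "\<bar>\<Sum>i\<in>{m..<n}. torus_avg (\<lambda>\<psi>. F \<psi> * I i \<psi> (iter n \<psi>))\<bar> \<le> corr_const * CF * C * (\<rho> * \<theta> ^ n)" .
  moreover have "CF * (C * \<theta> ^ m) * mixing_const * rate ^ (2 * (n - m))
      \<le> corr_const * CF * C * (\<theta> ^ m * rate ^ (2 * (n - m)))"
    using mult_right_mono[OF corr_const_ge, of "CF * C * (\<theta> ^ m * rate ^ (2 * (n - m)))"] CF C th rate
    by (simp add: mult_ac)
  moreover have "torus_avg (\<lambda>\<psi>. F \<psi> * \<Gamma> n \<psi> (iter n \<psi>)) =
      torus_avg (\<lambda>\<psi>. F \<psi> * \<Gamma> m \<psi> (iter n \<psi>)) + (\<Sum>i\<in>{m..<n}. torus_avg (\<lambda>\<psi>. F \<psi> * I i \<psi> (iter n \<psi>)))"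
    unfolding tel using Ic Gc by (simp add: torus_avg_add torus_cont_sum torus_avg_sum)
  ultimately show ?thesis using Mbound by (simp add: distrib_left)
qed

end

lemma torus_avg_square_sum:
  fixes N :: nat
  assumes "\<And>n. n < N \<Longrightarrow> torus_cont (Z n)"
  shows "torus_avg (\<lambda>\<psi>. (\<Sum>n<N. Z n \<psi>)\<^sup>2) = (\<Sum>m<N. \<Sum>n<N. torus_avg (\<lambda>\<psi>. Z m \<psi> * Z n \<psi>))"
proof -
  have "torus_avg (\<lambda>\<psi>. (\<Sum>n<N. Z n \<psi>)\<^sup>2) = torus_avg (\<lambda>\<psi>. \<Sum>m<N. \<Sum>n<N. Z m \<psi> * Z n \<psi>)"
    by (simp add: power2_eq_square sum_product)
  also have "\<dots> = (\<Sum>m<N. torus_avg (\<lambda>\<psi>. \<Sum>n<N. Z m \<psi> * Z n \<psi>))"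
    using assms by (intro torus_avg_sum torus_cont_intros finite_lessThan) auto
  also have "\<dots> = (\<Sum>m<N. \<Sum>n<N. torus_avg (\<lambda>\<psi>. Z m \<psi> * Z n \<psi>))"
    using assms by (intro sum.cong torus_avg_sum torus_cont_intros finite_lessThan) auto
  finally show ?thesis .
qed

text \<open>The first part of the bound factorizes into two geometric series, while the second
  decays away from the diagonal, so that one of its two sums costs only \<open>1 / (1 - r)\<close>.
  With \<open>1 - \<theta>\<close> proportional to \<rho> and a prefactor
  \<open>\<rho>\<^sup>2\<close>, both parts become O(\<rho>).\<close>

lemma sum_correlation_bound:
  fixes a :: "nat \<Rightarrow> nat \<Rightarrow> real" and r \<theta> B \<rho> :: real
  assumes a: "\<And>m n. m \<le> n \<Longrightarrow> n < N \<Longrightarrow> \<bar>a m n\<bar> \<le> B * (\<rho> * \<theta> ^ m * \<theta> ^ n + \<theta> ^ m * r ^ (n - m))"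
    and sym: "\<And>m n. a m n = a n m"
    and r: "0 < r" "r < 1" and \<theta>: "0 < \<theta>" "\<theta> < 1" and B: "0 \<le> B" "0 \<le> \<rho>"
  shows "\<bar>\<Sum>m<N. \<Sum>n<N. a m n\<bar> \<le> B * (\<rho> / (1 - \<theta>)\<^sup>2 + 2 / ((1 - \<theta>) * (1 - r)))"
proof -
  \<comment> \<open>Supported on one side of the diagonal; together with its transpose it covers all
    pairs, the diagonal twice.\<close>
  define u where "u m n = (if m \<le> n then \<theta> ^ m * r ^ (n - m) else 0)" for m n
  have u0: "0 \<le> u m n" for m n using r \<theta> by (simp add: u_def)
  have bound: "\<bar>a m n\<bar> \<le> B * (\<rho> * (\<theta> ^ m * \<theta> ^ n) + (u m n + u n m))" if "m < N" "n < N" for m n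
  proof (cases "m \<le> n")
    case True
    then have "B * (\<rho> * \<theta> ^ m * \<theta> ^ n + \<theta> ^ m * r ^ (n - m)) \<le> B * (\<rho> * (\<theta> ^ m * \<theta> ^ n) + (u m n + u n m))"
      using B u0[of n m] by (intro mult_left_mono) (auto simp: u_def)
    then show ?thesis using a[OF True that(2)] by linarith
  next
    case False
    then have "B * (\<rho> * \<theta> ^ n * \<theta> ^ m + \<theta> ^ n * r ^ (m - n)) \<le> B * (\<rho> * (\<theta> ^ m * \<theta> ^ n) + (u m n + u n m))"
      using B u0[of m n] by (intro mult_left_mono) (auto simp: u_def mult_ac)
    then show ?thesis using a[of n m] False that(1) sym[of m n] by linarith
  qed
  have S: "(\<Sum>n<N. \<theta> ^ n) \<le> 1 / (1 - \<theta>)" using \<theta> by (intro sum_powers_le) auto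
  have S0: "0 \<le> (\<Sum>n<N. \<theta> ^ n)" using \<theta> by (intro sum_nonneg) auto
  have row: "(\<Sum>n<N. u m n) \<le> \<theta> ^ m * (1 / (1 - r))" for m
  proof -
    have "(\<Sum>n<N. u m n) = (\<Sum>n\<in>{m..<N}. \<theta> ^ m * r ^ (n - m))"
      unfolding u_def by (subst sum.inter_filter[symmetric]) (auto intro!: sum.cong)
    also have "\<dots> = \<theta> ^ m * (\<Sum>n\<in>{m..<N}. r ^ (n - m))" by (simp add: sum_distrib_left)
    also have "(\<Sum>n\<in>{m..<N}. r ^ (n - m)) = (\<Sum>k<N - m. r ^ k)"
      by (rule sum.reindex_bij_witness[of _ "\<lambda>k. k + m" "\<lambda>n. n - m"]) auto
    also have "\<theta> ^ m * \<dots> \<le> \<theta> ^ m * (1 / (1 - r))"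
      using r \<theta> by (intro mult_left_mono sum_powers_le) auto
    finally show ?thesis .
  qed
  have "(\<Sum>m<N. \<Sum>n<N. u m n) \<le> (\<Sum>m<N. \<theta> ^ m * (1 / (1 - r)))" by (intro sum_mono row)
  also have "\<dots> = (\<Sum>m<N. \<theta> ^ m) * (1 / (1 - r))" by (rule sum_distrib_right[symmetric])
  also have "\<dots> \<le> 1 / (1 - \<theta>) * (1 / (1 - r))"
    using r by (intro mult_right_mono S) auto
  finally have U: "(\<Sum>m<N. \<Sum>n<N. u m n) \<le> 1 / ((1 - \<theta>) * (1 - r))" by simp
  have U': "(\<Sum>m<N. \<Sum>n<N. u n m) = (\<Sum>m<N. \<Sum>n<N. u m n)" by (rule sum.swap)
  have "\<bar>\<Sum>m<N. \<Sum>n<N. a m n\<bar> \<le> (\<Sum>m<N. \<Sum>n<N. \<bar>a m n\<bar>)"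
    by (rule order_trans[OF sum_abs sum_mono[OF sum_abs]])
  also have "\<dots> \<le> (\<Sum>m<N. \<Sum>n<N. B * (\<rho> * (\<theta> ^ m * \<theta> ^ n) + (u m n + u n m)))"
    by (intro sum_mono bound) auto
  also have "\<dots> = B * (\<rho> * ((\<Sum>n<N. \<theta> ^ n) * (\<Sum>n<N. \<theta> ^ n)) + ((\<Sum>m<N. \<Sum>n<N. u m n) + (\<Sum>m<N. \<Sum>n<N. u n m)))"
    by (simp add: sum_distrib_left[symmetric] sum.distrib sum_product)
  also have "\<dots> \<le> B * (\<rho> * (1 / (1 - \<theta>) * (1 / (1 - \<theta>))) + (1 / ((1 - \<theta>) * (1 - r)) + 1 / ((1 - \<theta>) * (1 - r))))"
    unfolding U' using B S S0 U \<theta> by (intro mult_left_mono add_mono mult_mono) auto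
  finally show ?thesis by (simp add: power2_eq_square)
qed

context hyperbolic_splitting
begin

text \<open>Makes \<open>\<Gamma> m\<close> along the orbit eligible as the factor \<open>F\<close>
  in \<open>correlation_decay\<close>. The slow argument contributes O(\<rho>), which is bounded by
  a constant here; the fast one moves by the stretched segment and produces the term with
  \<open>norm eu\<close>.\<close>

lemma observable_shift_bound:
  assumes obs: "observable C \<rho> \<theta> \<Gamma>" and C: "0 \<le> C" and \<rho>: "0 \<le> \<rho>" "\<rho> \<le> 1" and \<theta>: "0 \<le> \<theta>"
  shows "\<bar>\<Gamma> n (\<psi> + s *\<^sub>R eu) (iter n (\<psi> + s *\<^sub>R eu)) - \<Gamma> n \<psi> (iter n \<psi>)\<bar>
    \<le> C * \<theta> ^ n * (1 + norm eu powr \<alpha>) * (\<bar>lam\<bar> ^ n * \<bar>s\<bar>) powr \<alpha>"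
proof -
  let ?\<psi> = "\<psi> + s *\<^sub>R eu" and ?d = "(\<bar>lam\<bar> ^ n * \<bar>s\<bar>) powr \<alpha>"
  have "\<bar>\<Gamma> n ?\<psi> (iter n ?\<psi>) - \<Gamma> n \<psi> (iter n ?\<psi>)\<bar> \<le> C * \<rho> * \<theta> ^ n * ?d"
    using obs unfolding observable_def by blast
  also have "\<dots> \<le> C * \<theta> ^ n * ?d"
    using C \<rho> \<theta> by (intro mult_right_mono mult_left_le) auto
  finally have 1: "\<bar>\<Gamma> n ?\<psi> (iter n ?\<psi>) - \<Gamma> n \<psi> (iter n ?\<psi>)\<bar> \<le> C * \<theta> ^ n * ?d" .
  have "dist (iter n ?\<psi>) (iter n \<psi>) = \<bar>lam\<bar> ^ n * \<bar>s\<bar> * norm eu"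
    by (simp add: iter_add_vec iter_scaleR iter_eu dist_norm abs_mult power_abs)
  then have "dist (iter n ?\<psi>) (iter n \<psi>) powr \<alpha> = ?d * norm eu powr \<alpha>"
    by (simp add: powr_mult)
  then have 2: "\<bar>\<Gamma> n \<psi> (iter n ?\<psi>) - \<Gamma> n \<psi> (iter n \<psi>)\<bar> \<le> C * \<theta> ^ n * (?d * norm eu powr \<alpha>)"
    using obs unfolding observable_def holder_def by metis
  have "\<bar>\<Gamma> n ?\<psi> (iter n ?\<psi>) - \<Gamma> n \<psi> (iter n \<psi>)\<bar> \<le> C * \<theta> ^ n * ?d + C * \<theta> ^ n * (?d * norm eu powr \<alpha>)"
    using 1 2 by linarith
  also have "\<dots> = C * \<theta> ^ n * (1 + norm eu powr \<alpha>) * ?d" by (simp add: algebra_simps)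
  finally show ?thesis .
qed

text \<open>Decorrelation from the constant 1 gives each term a mean of order
  \<open>\<rho> * \<theta> ^ n + rate ^ n\<close>. The first part sums to a constant because
  \<open>1 - \<theta> = c * \<rho>\<close>, the second is a convergent series independent of \<rho>,
  and the weight \<open>\<rho>\<close> of the terms remains.\<close>

lemma observable_sum_mean:
  assumes obs: "observable C \<rho> \<theta> \<Gamma>" and mean: "\<And>n \<psi>. torus_avg (\<Gamma> n \<psi>) = 0"
    and C: "0 \<le> C" and \<rho>: "0 < \<rho>" "\<rho> \<le> 1" and c: "0 < c"
    and \<theta>: "\<theta> = 1 - c * \<rho>" "rate \<le> \<theta>"
  shows "\<bar>torus_avg (\<lambda>\<psi>. \<Sum>n<N. \<rho> * \<Gamma> n \<psi> (iter n \<psi>))\<bar> \<le> corr_const * C * (1 / c + 1 / (1 - rate)) * \<rho>"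
proof -
  have th: "0 < \<theta>" "\<theta> < 1" using \<theta> rate c \<rho> by auto
  have tc: "torus_cont (\<lambda>\<psi>. \<Gamma> n \<psi> (iter n \<psi>))" for n using obs unfolding observable_def by blast
  have b: "\<bar>torus_avg (\<lambda>\<psi>. \<Gamma> n \<psi> (iter n \<psi>))\<bar> \<le> corr_const * C * (\<rho> * \<theta> ^ n + rate ^ n)" for n
  proof -
    have "\<bar>torus_avg (\<lambda>\<psi>. 1 * \<Gamma> n \<psi> (iter n \<psi>))\<bar>
        \<le> corr_const * 1 * C * (\<rho> * \<theta> ^ n + \<theta> ^ 0 * rate ^ (2 * (n - 0)))"
      by (rule correlation_decay[where F="\<lambda>_. 1" and \<Gamma>=\<Gamma> and m=0, OF obs mean]) (use C \<rho> th \<theta> in auto)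
    also have "\<dots> \<le> corr_const * 1 * C * (\<rho> * \<theta> ^ n + rate ^ n)"
      using corr_const_pos C rate by (intro mult_left_mono add_left_mono) (auto intro!: power_decreasing)
    finally show ?thesis by simp
  qed
  have "torus_avg (\<lambda>\<psi>. \<Sum>n<N. \<rho> * \<Gamma> n \<psi> (iter n \<psi>)) = (\<Sum>n<N. \<rho> * torus_avg (\<lambda>\<psi>. \<Gamma> n \<psi> (iter n \<psi>)))"
    by (subst torus_avg_sum) (auto intro!: torus_cont_intros tc simp: torus_avg_cmult[OF tc])
  also have "\<bar>\<dots>\<bar> \<le> (\<Sum>n<N. \<rho> * (corr_const * C * (\<rho> * \<theta> ^ n + rate ^ n)))"
  proof (rule order_trans[OF sum_abs sum_mono])
    fix n
    show "\<bar>\<rho> * torus_avg (\<lambda>\<psi>. \<Gamma> n \<psi> (iter n \<psi>))\<bar> \<le> \<rho> * (corr_const * C * (\<rho> * \<theta> ^ n + rate ^ n))"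
      using mult_left_mono[OF b, of \<rho> n] \<rho> by (simp add: abs_mult)
  qed
  also have "\<dots> = \<rho> * (corr_const * C * (\<rho> * (\<Sum>n<N. \<theta> ^ n) + (\<Sum>n<N. rate ^ n)))"
    by (simp add: sum_distrib_left[symmetric] sum.distrib)
  also have "\<dots> \<le> \<rho> * (corr_const * C * (\<rho> * (1 / (1 - \<theta>)) + 1 / (1 - rate)))"
    using corr_const_pos C \<rho> th rate
    by (intro mult_left_mono add_mono sum_powers_le) auto
  also have "\<dots> = corr_const * C * (1 / c + 1 / (1 - rate)) * \<rho>"
    using \<theta> \<rho> c by (simp add: mult_ac)
  finally show ?thesis .
qed

text \<open>About \<open>1 / \<rho>\<close> terms of size \<rho> contribute only O(\<rho>) to the
  mean square: a pair of observables correlates at order one only within a bounded time distance,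
  and beyond it at order \<rho>.\<close>

lemma observable_sum_square:
  assumes obs: "observable C \<rho> \<theta> \<Gamma>" and mean: "\<And>n \<psi>. torus_avg (\<Gamma> n \<psi>) = 0"
    and C: "0 \<le> C" and \<rho>: "0 < \<rho>" "\<rho> \<le> 1" and c: "0 < c"
    and \<theta>: "\<theta> = 1 - c * \<rho>" "rate \<le> \<theta>"
  shows "torus_avg (\<lambda>\<psi>. (\<Sum>n<N. \<rho> * \<Gamma> n \<psi> (iter n \<psi>))\<^sup>2)
    \<le> corr_const * C\<^sup>2 * (1 + norm eu powr \<alpha>) * (1 / c\<^sup>2 + 2 / (c * (1 - rate))) * \<rho>"
proof -
  have th: "0 < \<theta>" "\<theta> < 1" using \<theta> rate c \<rho> by auto
  have tc: "torus_cont (\<lambda>\<psi>. \<Gamma> n \<psi> (iter n \<psi>))" for n using obs unfolding observable_def by blast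
  let ?e = "1 + norm eu powr \<alpha>"
  let ?B = "corr_const * C\<^sup>2 * ?e"
  define a where "a m n = torus_avg (\<lambda>\<psi>. \<Gamma> m \<psi> (iter m \<psi>) * \<Gamma> n \<psi> (iter n \<psi>))" for m n
  have ab: "\<bar>a m n\<bar> \<le> ?B * (\<rho> * \<theta> ^ m * \<theta> ^ n + \<theta> ^ m * rate ^ (n - m))" if mn: "m \<le> n" for m n
  proof -
    have "\<bar>a m n\<bar> \<le> corr_const * (C * \<theta> ^ m * ?e) * C * (\<rho> * \<theta> ^ n + \<theta> ^ m * rate ^ (2 * (n - m)))"
      unfolding a_def
    proof (rule correlation_decay[where F="\<lambda>\<psi>. \<Gamma> m \<psi> (iter m \<psi>)" and \<Gamma>=\<Gamma> and m=m, OF obs mean tc])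
      show "\<bar>\<Gamma> m \<psi> (iter m \<psi>)\<bar> \<le> C * \<theta> ^ m * ?e" for \<psi>
      proof -
        have "C * \<theta> ^ m * 1 \<le> C * \<theta> ^ m * ?e" using C th by (intro mult_left_mono) auto
        then show ?thesis using obs unfolding observable_def by (metis mult.right_neutral order_trans)
      qed
    qed (use observable_shift_bound[OF obs C] \<rho> th \<theta> C mn in auto)
    also have "\<dots> = ?B * (\<rho> * \<theta> ^ m * \<theta> ^ n + \<theta> ^ m * (\<theta> ^ m * rate ^ (2 * (n - m))))"
      by (simp add: power2_eq_square algebra_simps)
    also have "\<dots> \<le> ?B * (\<rho> * \<theta> ^ m * \<theta> ^ n + \<theta> ^ m * rate ^ (n - m))"
    proof (intro mult_left_mono add_left_mono)
      have "\<theta> ^ m * rate ^ (2 * (n - m)) \<le> 1 * rate ^ (n - m)"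
        using th rate by (intro mult_mono power_le_one power_decreasing) auto
      then show "\<theta> ^ m * rate ^ (2 * (n - m)) \<le> rate ^ (n - m)" by simp
    qed (use corr_const_pos th in auto)
    finally show ?thesis .
  qed
  have "torus_avg (\<lambda>\<psi>. (\<Sum>n<N. \<rho> * \<Gamma> n \<psi> (iter n \<psi>))\<^sup>2) =
      torus_avg (\<lambda>\<psi>. \<rho>\<^sup>2 * (\<Sum>n<N. \<Gamma> n \<psi> (iter n \<psi>))\<^sup>2)"
    by (simp add: sum_distrib_left[symmetric] power_mult_distrib)
  also have "\<dots> = \<rho>\<^sup>2 * (\<Sum>m<N. \<Sum>n<N. a m n)"
    by (simp add: torus_avg_cmult torus_cont_intros tc torus_avg_square_sum a_def)
  also have "\<dots> \<le> \<rho>\<^sup>2 * (?B * (\<rho> / (1 - \<theta>)\<^sup>2 + 2 / ((1 - \<theta>) * (1 - rate))))"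
  proof (rule mult_left_mono)
    have "\<bar>\<Sum>m<N. \<Sum>n<N. a m n\<bar> \<le> ?B * (\<rho> / (1 - \<theta>)\<^sup>2 + 2 / ((1 - \<theta>) * (1 - rate)))"
      by (rule sum_correlation_bound)
        (use ab th rate \<rho> corr_const_pos in \<open>auto simp: a_def mult.commute\<close>)
    then show "(\<Sum>m<N. \<Sum>n<N. a m n) \<le> ?B * (\<rho> / (1 - \<theta>)\<^sup>2 + 2 / ((1 - \<theta>) * (1 - rate)))"
      by linarith
  qed simp
  also have "\<dots> = ?B * (1 / c\<^sup>2 + 2 / (c * (1 - rate))) * \<rho>"
  proof -
    have "x\<^sup>2 * (B * (x / (c * x)\<^sup>2 + 2 / (c * x * k))) = B * (1 / c\<^sup>2 + 2 / (c * k)) * x"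
      if "x > 0" "k > 0" for x k B
      using that c by (simp add: divide_simps) (simp add: algebra_simps power2_eq_square)
    from this[of \<rho> "1 - rate" ?B] show ?thesis using \<theta>(1) \<rho> rate by simp
  qed
  finally show ?thesis .
qed

lemma observable_sum_abs:
  assumes obs: "observable C \<rho> \<theta> \<Gamma>" and C: "0 \<le> C" and \<rho>: "0 < \<rho>" and c: "0 < c"
    and \<theta>: "\<theta> = 1 - c * \<rho>" "0 \<le> \<theta>"
  shows "\<bar>\<Sum>n<N. \<rho> * \<Gamma> n \<psi> (iter n \<psi>)\<bar> \<le> C / c"
proof -
  have th: "\<theta> < 1" using \<theta> c \<rho> by auto
  have "\<bar>\<Sum>n<N. \<rho> * \<Gamma> n \<psi> (iter n \<psi>)\<bar> \<le> (\<Sum>n<N. \<rho> * (C * \<theta> ^ n))"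
    by (rule order_trans[OF sum_abs sum_mono])
      (use obs \<rho> in \<open>auto simp: abs_mult observable_def intro!: mult_left_mono\<close>)
  also have "\<dots> = \<rho> * (C * (\<Sum>n<N. \<theta> ^ n))" by (simp add: sum_distrib_left)
  also have "\<dots> \<le> \<rho> * (C * (1 / (1 - \<theta>)))"
    using \<rho> C th \<theta> by (intro mult_left_mono sum_powers_le) auto
  also have "\<dots> = C / c" using \<theta>(1) \<rho> c by simp
  finally show ?thesis .
qed

end

section \<open>Concentration of families of functions\<close>

text \<open>
  \<open>concentrated I \<rho> \<xi> c\<close>: uniformly over the family, \<open>\<xi>\<close> equals the constant \<open>c\<close> up to \<open>O(\<rho>)\<close> in
  mean and up to \<open>O(\<rho>)\<close> in mean square. Since fluctuations then enter nonlinear functions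
  quadratically, the notion is stable under products, smooth functions and parameter integrals.
\<close>

definition concentrated ::
    "'i set \<Rightarrow> ('i \<Rightarrow> real) \<Rightarrow> ('i \<Rightarrow> real^2 \<Rightarrow> real) \<Rightarrow> ('i \<Rightarrow> real) \<Rightarrow> bool" where
  "concentrated I \<rho> \<xi> c \<longleftrightarrow> (\<forall>i\<in>I. 0 \<le> \<rho> i \<and> \<rho> i \<le> 1 \<and> torus_cont (\<xi> i)) \<and>
     (\<exists>C\<ge>0. \<forall>i\<in>I. \<bar>torus_avg (\<xi> i) - c i\<bar> \<le> C * \<rho> i \<and>
        torus_avg (\<lambda>\<psi>. (\<xi> i \<psi> - c i)\<^sup>2) \<le> C * \<rho> i \<and> (\<forall>\<psi>. \<bar>\<xi> i \<psi>\<bar> \<le> C) \<and> \<bar>c i\<bar> \<le> C)"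

lemma concentratedE:
  assumes "concentrated I \<rho> \<xi> c"
  obtains C where "C \<ge> 0"
    "\<And>i. i \<in> I \<Longrightarrow> \<bar>torus_avg (\<xi> i) - c i\<bar> \<le> C * \<rho> i"
    "\<And>i. i \<in> I \<Longrightarrow> torus_avg (\<lambda>\<psi>. (\<xi> i \<psi> - c i)\<^sup>2) \<le> C * \<rho> i"
    "\<And>i \<psi>. i \<in> I \<Longrightarrow> \<bar>\<xi> i \<psi>\<bar> \<le> C" "\<And>i. i \<in> I \<Longrightarrow> \<bar>c i\<bar> \<le> C"
    "\<And>i. i \<in> I \<Longrightarrow> torus_cont (\<xi> i)" "\<And>i. i \<in> I \<Longrightarrow> 0 \<le> \<rho> i" "\<And>i. i \<in> I \<Longrightarrow> \<rho> i \<le> 1"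
  using assms unfolding concentrated_def by blast

lemma concentratedI:
  assumes "\<And>i. i \<in> I \<Longrightarrow> torus_cont (\<xi> i)" "\<And>i. i \<in> I \<Longrightarrow> 0 \<le> \<rho> i" "\<And>i. i \<in> I \<Longrightarrow> \<rho> i \<le> 1"
    and "\<And>i. i \<in> I \<Longrightarrow> \<bar>torus_avg (\<xi> i) - c i\<bar> \<le> C1 * \<rho> i"
    and "\<And>i. i \<in> I \<Longrightarrow> torus_avg (\<lambda>\<psi>. (\<xi> i \<psi> - c i)\<^sup>2) \<le> C2 * \<rho> i"
    and "\<And>i \<psi>. i \<in> I \<Longrightarrow> \<bar>\<xi> i \<psi>\<bar> \<le> C3" "\<And>i. i \<in> I \<Longrightarrow> \<bar>c i\<bar> \<le> C4"
  shows "concentrated I \<rho> \<xi> c"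
  unfolding concentrated_def
proof (intro conjI ballI allI exI[of _ "max (max 0 (max C1 C2)) (max C3 C4)"])
  let ?C = "max (max 0 (max C1 C2)) (max C3 C4)"
  fix i assume i: "i \<in> I"
  have "C1 * \<rho> i \<le> ?C * \<rho> i" "C2 * \<rho> i \<le> ?C * \<rho> i"
    using assms(2)[OF i] by (intro mult_right_mono; simp)+
  then show "\<bar>torus_avg (\<xi> i) - c i\<bar> \<le> ?C * \<rho> i" "torus_avg (\<lambda>\<psi>. (\<xi> i \<psi> - c i)\<^sup>2) \<le> ?C * \<rho> i"
    using assms(4,5)[OF i] by linarith+
  show "\<bar>\<xi> i \<psi>\<bar> \<le> ?C" for \<psi> using assms(6)[OF i, of \<psi>] by linarith
  show "\<bar>c i\<bar> \<le> ?C" using assms(7)[OF i] by linarith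
qed (use assms in auto)

lemma torus_avg_le:
  assumes "torus_cont g" "\<And>\<psi>. g \<psi> \<le> B"
  shows "torus_avg g \<le> B"
  using torus_avg_mono[OF assms(1) torus_cont_const assms(2)] by simp

lemma torus_avg_nonneg:
  assumes "torus_cont g" "\<And>\<psi>. 0 \<le> g \<psi>"
  shows "0 \<le> torus_avg g"
  using torus_avg_mono[OF torus_cont_const assms] by simp

lemma torus_avg_dev:
  "torus_cont \<xi> \<Longrightarrow> torus_avg (\<lambda>\<psi>. \<xi> \<psi> - c) = torus_avg \<xi> - c"
  by (simp add: torus_avg_diff)

lemma concentrated_const:
  assumes "\<And>i. i \<in> I \<Longrightarrow> 0 \<le> \<rho> i" "\<And>i. i \<in> I \<Longrightarrow> \<rho> i \<le> 1" "\<And>i. i \<in> I \<Longrightarrow> \<bar>c i\<bar> \<le> C"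
  shows "concentrated I \<rho> (\<lambda>i \<psi>. c i) c"
  by (rule concentratedI[where ?C1.0=0 and ?C2.0=0 and ?C3.0=C and ?C4.0=C]) (use assms in auto)

lemma concentrated_reindex:
  assumes "concentrated I \<rho> \<xi> c" "\<And>j. j \<in> J \<Longrightarrow> f j \<in> I"
  shows "concentrated J (\<lambda>j. \<rho> (f j)) (\<lambda>j. \<xi> (f j)) (\<lambda>j. c (f j))"
  using assms unfolding concentrated_def by blast

lemma concentrated_cong:
  assumes "concentrated I \<rho> \<xi> c" "\<And>i. i \<in> I \<Longrightarrow> \<rho>' i = \<rho> i"
    "\<And>i \<psi>. i \<in> I \<Longrightarrow> \<xi>' i \<psi> = \<xi> i \<psi>" "\<And>i. i \<in> I \<Longrightarrow> c' i = c i"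
  shows "concentrated I \<rho>' \<xi>' c'"
proof -
  have "\<xi>' i = \<xi> i" if "i \<in> I" for i using assms(3)[OF that] by auto
  then show ?thesis using assms unfolding concentrated_def by simp
qed

lemma concentrated_add:
  assumes "concentrated I \<rho> \<xi> c" "concentrated I \<rho> \<eta> d"
  shows "concentrated I \<rho> (\<lambda>i \<psi>. \<xi> i \<psi> + \<eta> i \<psi>) (\<lambda>i. c i + d i)"
proof -
  obtain C where C: "C \<ge> 0"
    "\<And>i. i \<in> I \<Longrightarrow> \<bar>torus_avg (\<xi> i) - c i\<bar> \<le> C * \<rho> i"
    "\<And>i. i \<in> I \<Longrightarrow> torus_avg (\<lambda>\<psi>. (\<xi> i \<psi> - c i)\<^sup>2) \<le> C * \<rho> i"
    "\<And>i \<psi>. i \<in> I \<Longrightarrow> \<bar>\<xi> i \<psi>\<bar> \<le> C" "\<And>i. i \<in> I \<Longrightarrow> \<bar>c i\<bar> \<le> C"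
    "\<And>i. i \<in> I \<Longrightarrow> torus_cont (\<xi> i)" "\<And>i. i \<in> I \<Longrightarrow> 0 \<le> \<rho> i" "\<And>i. i \<in> I \<Longrightarrow> \<rho> i \<le> 1"
    using assms(1) unfolding concentrated_def by blast
  obtain D where D: "D \<ge> 0"
    "\<And>i. i \<in> I \<Longrightarrow> \<bar>torus_avg (\<eta> i) - d i\<bar> \<le> D * \<rho> i"
    "\<And>i. i \<in> I \<Longrightarrow> torus_avg (\<lambda>\<psi>. (\<eta> i \<psi> - d i)\<^sup>2) \<le> D * \<rho> i"
    "\<And>i \<psi>. i \<in> I \<Longrightarrow> \<bar>\<eta> i \<psi>\<bar> \<le> D" "\<And>i. i \<in> I \<Longrightarrow> \<bar>d i\<bar> \<le> D"
    "\<And>i. i \<in> I \<Longrightarrow> torus_cont (\<eta> i)" "\<And>i. i \<in> I \<Longrightarrow> 0 \<le> \<rho> i" "\<And>i. i \<in> I \<Longrightarrow> \<rho> i \<le> 1"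
    using assms(2) unfolding concentrated_def by blast
  show ?thesis
  proof (rule concentratedI[where ?C1.0="C + D" and ?C2.0="2 * C + 2 * D" and ?C3.0="C + D" and ?C4.0="C + D"])
    fix i assume i: "i \<in> I"
    note tc = C(6)[OF i] D(6)[OF i]
    show "torus_cont (\<lambda>\<psi>. \<xi> i \<psi> + \<eta> i \<psi>)" by (intro torus_cont_intros tc)
    show "\<bar>torus_avg (\<lambda>\<psi>. \<xi> i \<psi> + \<eta> i \<psi>) - (c i + d i)\<bar> \<le> (C + D) * \<rho> i"
      using C(2)[OF i] D(2)[OF i] by (simp add: torus_avg_add tc algebra_simps)
    have "torus_avg (\<lambda>\<psi>. (\<xi> i \<psi> + \<eta> i \<psi> - (c i + d i))\<^sup>2)
        \<le> torus_avg (\<lambda>\<psi>. 2 * (\<xi> i \<psi> - c i)\<^sup>2 + 2 * (\<eta> i \<psi> - d i)\<^sup>2)"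
    proof (rule torus_avg_mono)
      fix \<psi>
      show "(\<xi> i \<psi> + \<eta> i \<psi> - (c i + d i))\<^sup>2 \<le> 2 * (\<xi> i \<psi> - c i)\<^sup>2 + 2 * (\<eta> i \<psi> - d i)\<^sup>2"
        using sum_squares_ge_zero[of "\<xi> i \<psi> - c i - (\<eta> i \<psi> - d i)" 0]
        by (simp add: power2_eq_square algebra_simps)
    qed (intro torus_cont_intros tc)+
    also have "\<dots> = 2 * torus_avg (\<lambda>\<psi>. (\<xi> i \<psi> - c i)\<^sup>2) + 2 * torus_avg (\<lambda>\<psi>. (\<eta> i \<psi> - d i)\<^sup>2)"
      by (simp add: torus_avg_add torus_avg_cmult torus_cont_intros tc)
    finally show "torus_avg (\<lambda>\<psi>. (\<xi> i \<psi> + \<eta> i \<psi> - (c i + d i))\<^sup>2) \<le> (2 * C + 2 * D) * \<rho> i"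
      using C(3)[OF i] D(3)[OF i] by (simp add: algebra_simps)
    show "\<bar>\<xi> i \<psi> + \<eta> i \<psi>\<bar> \<le> C + D" for \<psi> using C(4)[OF i, of \<psi>] D(4)[OF i, of \<psi>] by linarith
    show "\<bar>c i + d i\<bar> \<le> C + D" using C(5)[OF i] D(5)[OF i] by linarith
  qed (use C in auto)
qed

text \<open>After subtracting \<open>c i\<close> and \<open>d i\<close>, the only new contribution
  to the mean is the product of two fluctuations, bounded by the sum of their mean squares. The mean
  square of the product is reduced to those of the factors by the uniform bounds.\<close>

lemma concentrated_mult:
  assumes "concentrated I \<rho> \<xi> c" "concentrated I \<rho> \<eta> d"
  shows "concentrated I \<rho> (\<lambda>i \<psi>. \<xi> i \<psi> * \<eta> i \<psi>) (\<lambda>i. c i * d i)"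
proof -
  obtain C where C: "C \<ge> 0"
    "\<And>i. i \<in> I \<Longrightarrow> \<bar>torus_avg (\<xi> i) - c i\<bar> \<le> C * \<rho> i"
    "\<And>i. i \<in> I \<Longrightarrow> torus_avg (\<lambda>\<psi>. (\<xi> i \<psi> - c i)\<^sup>2) \<le> C * \<rho> i"
    "\<And>i \<psi>. i \<in> I \<Longrightarrow> \<bar>\<xi> i \<psi>\<bar> \<le> C" "\<And>i. i \<in> I \<Longrightarrow> \<bar>c i\<bar> \<le> C"
    "\<And>i. i \<in> I \<Longrightarrow> torus_cont (\<xi> i)" "\<And>i. i \<in> I \<Longrightarrow> 0 \<le> \<rho> i" "\<And>i. i \<in> I \<Longrightarrow> \<rho> i \<le> 1"
    using assms(1) unfolding concentrated_def by blast
  obtain D where D: "D \<ge> 0"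
    "\<And>i. i \<in> I \<Longrightarrow> \<bar>torus_avg (\<eta> i) - d i\<bar> \<le> D * \<rho> i"
    "\<And>i. i \<in> I \<Longrightarrow> torus_avg (\<lambda>\<psi>. (\<eta> i \<psi> - d i)\<^sup>2) \<le> D * \<rho> i"
    "\<And>i \<psi>. i \<in> I \<Longrightarrow> \<bar>\<eta> i \<psi>\<bar> \<le> D" "\<And>i. i \<in> I \<Longrightarrow> \<bar>d i\<bar> \<le> D"
    "\<And>i. i \<in> I \<Longrightarrow> torus_cont (\<eta> i)" "\<And>i. i \<in> I \<Longrightarrow> 0 \<le> \<rho> i" "\<And>i. i \<in> I \<Longrightarrow> \<rho> i \<le> 1"
    using assms(2) unfolding concentrated_def by blast
  show ?thesis
  proof (rule concentratedI[where ?C1.0="C + D + 2 * C * D" and ?C2.0="2 * D\<^sup>2 * C + 2 * C\<^sup>2 * D"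
        and ?C3.0="C * D" and ?C4.0="C * D"])
    fix i assume i: "i \<in> I"
    note tc = C(6)[OF i] D(6)[OF i]
    let ?x = "\<lambda>\<psi>. \<xi> i \<psi> - c i" and ?y = "\<lambda>\<psi>. \<eta> i \<psi> - d i"
    show "torus_cont (\<lambda>\<psi>. \<xi> i \<psi> * \<eta> i \<psi>)" by (intro torus_cont_intros tc)
    have tx: "torus_cont ?x" "torus_cont ?y" by (intro torus_cont_intros tc)+
    have "torus_avg (\<lambda>\<psi>. \<xi> i \<psi> * \<eta> i \<psi>) - c i * d i
        = torus_avg (\<lambda>\<psi>. ?x \<psi> * ?y \<psi> + (c i * ?y \<psi> + d i * ?x \<psi>))"
    proof -
      have "torus_avg (\<lambda>\<psi>. \<xi> i \<psi> * \<eta> i \<psi>) - c i * d i = torus_avg (\<lambda>\<psi>. \<xi> i \<psi> * \<eta> i \<psi> - c i * d i)"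
        by (intro torus_avg_dev[symmetric] torus_cont_intros tc)
      also have "(\<lambda>\<psi>. \<xi> i \<psi> * \<eta> i \<psi> - c i * d i) = (\<lambda>\<psi>. ?x \<psi> * ?y \<psi> + (c i * ?y \<psi> + d i * ?x \<psi>))"
        by (simp add: fun_eq_iff algebra_simps)
      finally show ?thesis .
    qed
    also have "\<dots> = torus_avg (\<lambda>\<psi>. ?x \<psi> * ?y \<psi>) + (c i * torus_avg ?y + d i * torus_avg ?x)"
      by (simp only: torus_avg_add torus_avg_cmult torus_cont_intros tx)
    also have "\<bar>\<dots>\<bar> \<le> (C + D) * \<rho> i + (C * (D * \<rho> i) + D * (C * \<rho> i))"
    proof -
      have "\<bar>torus_avg (\<lambda>\<psi>. ?x \<psi> * ?y \<psi>)\<bar> \<le> torus_avg (\<lambda>\<psi>. (?x \<psi>)\<^sup>2 + (?y \<psi>)\<^sup>2)"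
      proof -
        have xy: "\<bar>a * b\<bar> \<le> a\<^sup>2 + b\<^sup>2" for a b :: real
        proof -
          have "0 \<le> (\<bar>a\<bar> - \<bar>b\<bar>)\<^sup>2" "0 \<le> \<bar>a\<bar> * \<bar>b\<bar>" by simp_all
          then show ?thesis unfolding power2_diff abs_mult power2_abs by linarith
        qed
        have "torus_avg (\<lambda>\<psi>. ?x \<psi> * ?y \<psi>) \<le> torus_avg (\<lambda>\<psi>. (?x \<psi>)\<^sup>2 + (?y \<psi>)\<^sup>2)"
          by (intro torus_avg_mono torus_cont_intros tc order_trans[OF abs_ge_self xy])
        moreover have "torus_avg (\<lambda>\<psi>. -1 * (?x \<psi> * ?y \<psi>)) \<le> torus_avg (\<lambda>\<psi>. (?x \<psi>)\<^sup>2 + (?y \<psi>)\<^sup>2)"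
        proof (intro torus_avg_mono torus_cont_intros tc)
          fix \<psi> show "-1 * (?x \<psi> * ?y \<psi>) \<le> (?x \<psi>)\<^sup>2 + (?y \<psi>)\<^sup>2" using xy[of "?x \<psi>" "?y \<psi>"] by linarith
        qed
        ultimately show ?thesis
          unfolding torus_avg_cmult[OF torus_cont_mult[OF tx]] by linarith
      qed
      also have "\<dots> = torus_avg (\<lambda>\<psi>. (?x \<psi>)\<^sup>2) + torus_avg (\<lambda>\<psi>. (?y \<psi>)\<^sup>2)"
        by (intro torus_avg_add torus_cont_intros tc)
      finally have 1: "\<bar>torus_avg (\<lambda>\<psi>. ?x \<psi> * ?y \<psi>)\<bar> \<le> (C + D) * \<rho> i"
        using C(3)[OF i] D(3)[OF i] by (simp add: distrib_right)
      have 2: "\<bar>c i * torus_avg ?y\<bar> \<le> C * (D * \<rho> i)" "\<bar>d i * torus_avg ?x\<bar> \<le> D * (C * \<rho> i)"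
        unfolding abs_mult torus_avg_dev[OF tc(1)] torus_avg_dev[OF tc(2)]
        using C(2,5)[OF i] D(2,5)[OF i] C(1) D(1) by (auto intro!: mult_mono)
      show ?thesis using 1 2 by linarith
    qed
    finally show "\<bar>torus_avg (\<lambda>\<psi>. \<xi> i \<psi> * \<eta> i \<psi>) - c i * d i\<bar> \<le> (C + D + 2 * C * D) * \<rho> i"
      by (simp add: algebra_simps)
    have "torus_avg (\<lambda>\<psi>. (\<xi> i \<psi> * \<eta> i \<psi> - c i * d i)\<^sup>2)
        \<le> torus_avg (\<lambda>\<psi>. 2 * D\<^sup>2 * (?x \<psi>)\<^sup>2 + 2 * C\<^sup>2 * (?y \<psi>)\<^sup>2)"
    proof (intro torus_avg_mono torus_cont_intros tc)
      fix \<psi>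
      have "(\<xi> i \<psi> * \<eta> i \<psi> - c i * d i)\<^sup>2 = (\<eta> i \<psi> * ?x \<psi> + c i * ?y \<psi>)\<^sup>2" by (simp add: algebra_simps)
      also have "\<dots> \<le> 2 * (\<eta> i \<psi> * ?x \<psi>)\<^sup>2 + 2 * (c i * ?y \<psi>)\<^sup>2"
        using zero_le_power2[of "\<eta> i \<psi> * ?x \<psi> - c i * ?y \<psi>"]
        unfolding power2_diff power2_sum by linarith
      also have "\<dots> \<le> 2 * (D\<^sup>2 * (?x \<psi>)\<^sup>2) + 2 * (C\<^sup>2 * (?y \<psi>)\<^sup>2)"
        unfolding power_mult_distrib using D(4)[OF i, of \<psi>] C(5)[OF i]
        by (intro add_mono mult_left_mono mult_right_mono abs_le_square_iff[THEN iffD1]) auto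
      finally show "(\<xi> i \<psi> * \<eta> i \<psi> - c i * d i)\<^sup>2 \<le> 2 * D\<^sup>2 * (?x \<psi>)\<^sup>2 + 2 * C\<^sup>2 * (?y \<psi>)\<^sup>2" by simp
    qed
    also have "\<dots> = 2 * D\<^sup>2 * torus_avg (\<lambda>\<psi>. (?x \<psi>)\<^sup>2) + 2 * C\<^sup>2 * torus_avg (\<lambda>\<psi>. (?y \<psi>)\<^sup>2)"
      by (simp only: torus_avg_add torus_avg_cmult torus_cont_intros tx)
    also have "\<dots> \<le> 2 * D\<^sup>2 * (C * \<rho> i) + 2 * C\<^sup>2 * (D * \<rho> i)"
      using C(3)[OF i] D(3)[OF i] by (intro add_mono mult_left_mono) auto
    finally show "torus_avg (\<lambda>\<psi>. (\<xi> i \<psi> * \<eta> i \<psi> - c i * d i)\<^sup>2) \<le> (2 * D\<^sup>2 * C + 2 * C\<^sup>2 * D) * \<rho> i"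
      by (simp add: algebra_simps)
    show "\<bar>\<xi> i \<psi> * \<eta> i \<psi>\<bar> \<le> C * D" for \<psi>
      by (auto simp: abs_mult intro!: mult_mono C D i)
    show "\<bar>c i * d i\<bar> \<le> C * D"
      by (auto simp: abs_mult intro!: mult_mono C D i)
  qed (use C in auto)
qed

text \<open>A uniform error O(\<rho>) has mean O(\<rho>) and mean square of order
  \<open>\<rho>\<^sup>2\<close>. This absorbs the remainders of the telescoping sums and the passage
  from truncations to limits.\<close>

lemma concentrated_perturb:
  assumes "concentrated I \<rho> \<xi> c" "\<And>i. i \<in> I \<Longrightarrow> torus_cont (\<eta> i)"
    and K: "\<And>i \<psi>. i \<in> I \<Longrightarrow> \<bar>\<eta> i \<psi> - \<xi> i \<psi>\<bar> \<le> K * \<rho> i"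
  shows "concentrated I \<rho> \<eta> c"
proof -
  obtain C where C: "\<And>i. i \<in> I \<Longrightarrow> torus_cont (\<xi> i)" "\<And>i. i \<in> I \<Longrightarrow> 0 \<le> \<rho> i" "\<And>i. i \<in> I \<Longrightarrow> \<rho> i \<le> 1"
    using concentratedE[OF assms(1)] by metis
  let ?d = "\<lambda>i \<psi>. \<eta> i \<psi> - \<xi> i \<psi>"
  have "concentrated I \<rho> ?d (\<lambda>i. 0)"
  proof (rule concentratedI[where ?C1.0=K and ?C2.0="K\<^sup>2" and ?C3.0="\<bar>K\<bar>" and ?C4.0=0])
    fix i assume i: "i \<in> I"
    show tc: "torus_cont (?d i)" by (intro torus_cont_intros assms(2) C(1) i)
    show "\<bar>torus_avg (?d i) - 0\<bar> \<le> K * \<rho> i" using torus_avg_abs_le[OF tc K[OF i]] by simp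
    have sq: "(?d i \<psi>)\<^sup>2 \<le> K\<^sup>2 * \<rho> i" for \<psi>
    proof -
      have "(?d i \<psi>)\<^sup>2 \<le> (K * \<rho> i)\<^sup>2" using K[OF i, of \<psi>] abs_le_square_iff by fastforce
      also have "\<dots> \<le> K\<^sup>2 * \<rho> i" using C(2,3)[OF i]
        by (auto simp: power_mult_distrib power2_eq_square[of "\<rho> i"] intro!: mult_left_mono mult_left_le)
      finally show ?thesis .
    qed
    then show "torus_avg (\<lambda>\<psi>. (?d i \<psi> - 0)\<^sup>2) \<le> K\<^sup>2 * \<rho> i"
      using torus_avg_le[OF torus_cont_power[OF tc, of 2] sq] by simp
    show "\<bar>?d i \<psi>\<bar> \<le> \<bar>K\<bar>" for \<psi>
    proof -
      have "K * \<rho> i \<le> \<bar>K\<bar> * 1" using C(2,3)[OF i] by (intro mult_mono) auto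
      then show ?thesis using K[OF i, of \<psi>] by linarith
    qed
  qed (use C in auto)
  from concentrated_add[OF assms(1) this] show ?thesis by (simp add: concentrated_cong)
qed

lemma deriv_bound_diff:
  fixes g g1 :: "real \<Rightarrow> real"
  assumes "\<And>x. x \<in> {a..b} \<Longrightarrow> (g has_real_derivative g1 x) (at x within {a..b})"
    and "\<And>x. x \<in> {a..b} \<Longrightarrow> \<bar>g1 x\<bar> \<le> K" and "x \<in> {a..b}" "y \<in> {a..b}"
  shows "\<bar>g x - g y\<bar> \<le> K * \<bar>x - y\<bar>"
  using field_differentiable_bound[of "{a..b}" g g1 K x y] assms by auto

text \<open>The mean value inequality is used twice, for \<open>g1\<close> and for \<open>g\<close>
  minus its tangent; the constant is therefore \<open>K\<close> instead of
  \<open>K / 2\<close>.\<close>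

lemma deriv_bound_taylor:
  fixes g g1 g2 :: "real \<Rightarrow> real"
  assumes "\<And>x. x \<in> {a..b} \<Longrightarrow> (g has_real_derivative g1 x) (at x within {a..b})"
    and "\<And>x. x \<in> {a..b} \<Longrightarrow> (g1 has_real_derivative g2 x) (at x within {a..b})"
    and "\<And>x. x \<in> {a..b} \<Longrightarrow> \<bar>g2 x\<bar> \<le> K" and x: "x \<in> {a..b}" and y: "y \<in> {a..b}"
  shows "\<bar>g y - g x - g1 x * (y - x)\<bar> \<le> K * (y - x)\<^sup>2"
proof -
  have K: "0 \<le> K" using assms(3)[OF x] by linarith
  have sub: "{min x y..max x y} \<subseteq> {a..b}" using x y by auto
  have "\<bar>(g y - g1 x * y) - (g x - g1 x * x)\<bar> \<le> (K * \<bar>y - x\<bar>) * \<bar>y - x\<bar>"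
  proof (rule deriv_bound_diff[where a="min x y" and b="max x y" and ?g1.0="\<lambda>z. g1 z - g1 x"])
    fix z assume z: "z \<in> {min x y..max x y}"
    then have zab: "z \<in> {a..b}" using sub by auto
    show "((\<lambda>z. g z - g1 x * z) has_real_derivative g1 z - g1 x) (at z within {min x y..max x y})"
      by (auto intro!: derivative_eq_intros DERIV_subset[OF assms(1)[OF zab] sub])
    have "\<bar>g1 z - g1 x\<bar> \<le> K * \<bar>z - x\<bar>"
      by (rule deriv_bound_diff[OF assms(2,3) zab x])
    also have "\<dots> \<le> K * \<bar>y - x\<bar>" using z K by (intro mult_left_mono) auto
    finally show "\<bar>g1 z - g1 x\<bar> \<le> K * \<bar>y - x\<bar>" .
  qed auto
  then show ?thesis by (simp add: algebra_simps power2_eq_square abs_mult[symmetric])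
qed

lemma neg_le_abs: "-1 * x \<le> \<bar>x\<bar>" for x :: real
  by simp

text \<open>In the Taylor expansion at \<open>c i\<close> the linear term carries the bias of
  \<open>\<xi>\<close>, and the remainder is dominated by the squared fluctuation, whose mean is
  O(\<rho>).\<close>

lemma concentrated_compose:
  fixes g g1 g2 :: "real \<Rightarrow> real"
  assumes "concentrated I \<rho> \<xi> c"
    and dg: "\<And>x. x \<in> {a..b} \<Longrightarrow> (g has_real_derivative g1 x) (at x within {a..b})"
    and dg1: "\<And>x. x \<in> {a..b} \<Longrightarrow> (g1 has_real_derivative g2 x) (at x within {a..b})"
    and K: "\<And>x. x \<in> {a..b} \<Longrightarrow> \<bar>g x\<bar> \<le> K" "\<And>x. x \<in> {a..b} \<Longrightarrow> \<bar>g1 x\<bar> \<le> K"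
      "\<And>x. x \<in> {a..b} \<Longrightarrow> \<bar>g2 x\<bar> \<le> K"
    and in_ab: "\<And>i \<psi>. i \<in> I \<Longrightarrow> \<xi> i \<psi> \<in> {a..b}" "\<And>i. i \<in> I \<Longrightarrow> c i \<in> {a..b}"
  shows "concentrated I \<rho> (\<lambda>i \<psi>. g (\<xi> i \<psi>)) (\<lambda>i. g (c i))"
proof -
  obtain C where C: "C \<ge> 0"
    "\<And>i. i \<in> I \<Longrightarrow> \<bar>torus_avg (\<xi> i) - c i\<bar> \<le> C * \<rho> i"
    "\<And>i. i \<in> I \<Longrightarrow> torus_avg (\<lambda>\<psi>. (\<xi> i \<psi> - c i)\<^sup>2) \<le> C * \<rho> i"
    "\<And>i \<psi>. i \<in> I \<Longrightarrow> \<bar>\<xi> i \<psi>\<bar> \<le> C" "\<And>i. i \<in> I \<Longrightarrow> \<bar>c i\<bar> \<le> C"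
    "\<And>i. i \<in> I \<Longrightarrow> torus_cont (\<xi> i)" "\<And>i. i \<in> I \<Longrightarrow> 0 \<le> \<rho> i" "\<And>i. i \<in> I \<Longrightarrow> \<rho> i \<le> 1"
    using assms(1) unfolding concentrated_def by blast
  have gc: "continuous_on {a..b} g" using dg by (rule DERIV_continuous_on)
  show ?thesis
  proof (rule concentratedI[where ?C1.0="2 * K * C" and ?C2.0="K\<^sup>2 * C" and ?C3.0=K and ?C4.0=K])
    fix i assume i: "i \<in> I"
    note tc = C(6)[OF i]
    have K0: "0 \<le> K" using K(1)[OF in_ab(2)[OF i]] by linarith
    show tg: "torus_cont (\<lambda>\<psi>. g (\<xi> i \<psi>))" by (rule torus_cont_comp[OF tc in_ab(1)[OF i] gc])
    let ?r = "\<lambda>\<psi>. g (\<xi> i \<psi>) - g (c i) - g1 (c i) * (\<xi> i \<psi> - c i)"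
    have tr: "torus_cont ?r" by (intro torus_cont_intros tg tc)
    have rb: "\<bar>?r \<psi>\<bar> \<le> K * (\<xi> i \<psi> - c i)\<^sup>2" for \<psi>
      by (rule deriv_bound_taylor[OF dg dg1 K(3) in_ab(2)[OF i] in_ab(1)[OF i]])
    have t2: "torus_cont (\<lambda>\<psi>. K * (\<xi> i \<psi> - c i)\<^sup>2)" by (intro torus_cont_intros tc)
    have t3: "torus_cont (\<lambda>\<psi>. \<xi> i \<psi> - c i)" by (intro torus_cont_intros tc)
    have rmean: "\<bar>torus_avg ?r\<bar> \<le> K * (C * \<rho> i)"
    proof -
      have "torus_avg ?r \<le> torus_avg (\<lambda>\<psi>. K * (\<xi> i \<psi> - c i)\<^sup>2)"
        by (intro torus_avg_mono tr t2 order_trans[OF abs_ge_self rb])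
      moreover have "torus_avg (\<lambda>\<psi>. -1 * ?r \<psi>) \<le> torus_avg (\<lambda>\<psi>. K * (\<xi> i \<psi> - c i)\<^sup>2)"
      proof (intro torus_avg_mono t2 torus_cont_mult torus_cont_const tr)
        show "-1 * ?r \<psi> \<le> K * (\<xi> i \<psi> - c i)\<^sup>2" for \<psi> by (rule order_trans[OF neg_le_abs rb])
      qed
      moreover have "torus_avg (\<lambda>\<psi>. K * (\<xi> i \<psi> - c i)\<^sup>2) \<le> K * (C * \<rho> i)"
        using C(3)[OF i] K0 by (simp add: torus_avg_cmult torus_cont_power t3 mult_left_mono)
      ultimately show ?thesis unfolding torus_avg_cmult[OF tr] by linarith
    qed
    have "torus_avg ?r = torus_avg (\<lambda>\<psi>. g (\<xi> i \<psi>)) - g (c i) - g1 (c i) * (torus_avg (\<xi> i) - c i)"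
      by (simp add: torus_avg_diff torus_avg_cmult torus_cont_intros tg tc)
    then have "\<bar>torus_avg (\<lambda>\<psi>. g (\<xi> i \<psi>)) - g (c i)\<bar> \<le> \<bar>torus_avg ?r\<bar> + \<bar>g1 (c i)\<bar> * \<bar>torus_avg (\<xi> i) - c i\<bar>"
      unfolding abs_mult[symmetric] by linarith
    also have "\<dots> \<le> K * (C * \<rho> i) + K * (C * \<rho> i)"
      using K(2)[OF in_ab(2)[OF i]] C(2)[OF i] K0 by (intro add_mono rmean mult_mono) auto
    finally show "\<bar>torus_avg (\<lambda>\<psi>. g (\<xi> i \<psi>)) - g (c i)\<bar> \<le> 2 * K * C * \<rho> i"
      by (simp add: mult_ac)
    have "torus_avg (\<lambda>\<psi>. (g (\<xi> i \<psi>) - g (c i))\<^sup>2) \<le> torus_avg (\<lambda>\<psi>. K\<^sup>2 * (\<xi> i \<psi> - c i)\<^sup>2)"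
    proof (intro torus_avg_mono torus_cont_intros tg tc)
      fix \<psi>
      have "\<bar>g (\<xi> i \<psi>) - g (c i)\<bar> \<le> \<bar>K * (\<xi> i \<psi> - c i)\<bar>"
        using deriv_bound_diff[OF dg K(2) in_ab(1)[OF i] in_ab(2)[OF i]] K0 by (simp add: abs_mult)
      then show "(g (\<xi> i \<psi>) - g (c i))\<^sup>2 \<le> K\<^sup>2 * (\<xi> i \<psi> - c i)\<^sup>2"
        unfolding power_mult_distrib[symmetric] by (rule abs_le_square_iff[THEN iffD1])
    qed
    also have "\<dots> \<le> K\<^sup>2 * (C * \<rho> i)"
      using C(3)[OF i] by (simp add: torus_avg_cmult torus_cont_power t3 mult_left_mono)
    finally show "torus_avg (\<lambda>\<psi>. (g (\<xi> i \<psi>) - g (c i))\<^sup>2) \<le> K\<^sup>2 * C * \<rho> i" by simp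
  qed (use C K in_ab in auto)
qed

lemma torus_avg_integral_swap:
  fixes g :: "real \<Rightarrow> real^2 \<Rightarrow> real"
  assumes "continuous_on ({0..1} \<times> UNIV) (\<lambda>(t, \<psi>). g t \<psi>)"
  shows "continuous_on UNIV (\<lambda>\<psi>. integral {0..1} (\<lambda>t. g t \<psi>))"
    and "continuous_on {0..1} (\<lambda>t. torus_avg (g t))"
    and "torus_avg (\<lambda>\<psi>. integral {0..1} (\<lambda>t. g t \<psi>)) = integral {0..1} (\<lambda>t. torus_avg (g t))"
proof -
  let ?Q = "cbox 0 periods"
  have "continuous_on (UNIV \<times> {0..1}) (\<lambda>p. (\<lambda>(t, \<psi>). g t \<psi>) (snd p, fst p))"
    by (rule continuous_on_compose2[OF assms]) (auto intro!: continuous_intros)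
  then have c: "continuous_on (UNIV \<times> cbox 0 1) (\<lambda>(\<psi>, t). g t \<psi>)" by (simp add: split_beta)
  show c1: "continuous_on UNIV (\<lambda>\<psi>. integral {0..1} (\<lambda>t. g t \<psi>))"
    using integral_continuous_on_param[OF c] by simp
  have ct: "continuous_on UNIV (g t)" if "t \<in> {0..1}" for t
  proof -
    have "continuous_on UNIV (\<lambda>\<psi>. (\<lambda>(t, \<psi>). g t \<psi>) (t, \<psi>))"
      by (rule continuous_on_compose2[OF assms]) (use that in \<open>auto intro!: continuous_intros\<close>)
    then show ?thesis by simp
  qed
  have c2: "continuous_on {0..1} (\<lambda>t. integral ?Q (g t))"
    by (rule integral_continuous_on_param) (rule continuous_on_subset[OF assms], auto)
  have "continuous_on {0..1} (\<lambda>t. integral ?Q (g t) / (2 * pi)\<^sup>2)"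
    by (intro continuous_intros c2) simp
  then show "continuous_on {0..1} (\<lambda>t. torus_avg (g t))"
    by (rule continuous_on_eq) (simp add: torus_avg_integral ct)
  have "integral ?Q (\<lambda>\<psi>. integral (cbox 0 1) (\<lambda>t. g t \<psi>)) = integral (cbox 0 1) (\<lambda>t. integral ?Q (g t))"
  proof (rule integral_swap_continuous)
    show "continuous_on (cbox (0, 0) (periods, 1)) (\<lambda>(x, y). g y x)"
      by (rule continuous_on_subset[OF c]) (auto simp: cbox_Pair_eq)
  qed
  moreover have "integral {0..1} (\<lambda>t. torus_avg (g t)) = integral {0..1} (\<lambda>t. integral ?Q (g t) / (2 * pi)\<^sup>2)"
    using ct by (intro integral_cong) (simp add: torus_avg_integral)
  ultimately show "torus_avg (\<lambda>\<psi>. integral {0..1} (\<lambda>t. g t \<psi>)) = integral {0..1} (\<lambda>t. torus_avg (g t))"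
    by (simp add: torus_avg_integral c1)
qed

text \<open>Expands the variance of \<open>u\<close> on the unit interval, which is
  nonnegative.\<close>

lemma integral_square_le:
  fixes u :: "real \<Rightarrow> real"
  assumes "continuous_on {0..1} u"
  shows "(integral {0..1} u)\<^sup>2 \<le> integral {0..1} (\<lambda>t. (u t)\<^sup>2)"
proof -
  define m where "m = integral {0..1} u"
  have i1: "u integrable_on {0..1}" and i2: "(\<lambda>t. (u t)\<^sup>2) integrable_on {0..1}"
    using assms by (auto intro!: integrable_continuous_real continuous_intros)
  have "0 \<le> integral {0..1} (\<lambda>t. (u t - m)\<^sup>2)"
    by (intro integral_nonneg integrable_continuous_real continuous_intros assms) auto
  also have "(\<lambda>t. (u t - m)\<^sup>2) = (\<lambda>t. (u t)\<^sup>2 - (2 * m * u t - m\<^sup>2))"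
    by (auto simp: power2_eq_square algebra_simps)
  also have "integral {0..1} \<dots> = integral {0..1} (\<lambda>t. (u t)\<^sup>2) - (2 * m * m - m\<^sup>2)"
  proof (intro integral_unique has_integral_diff has_integral_mult_right)
    show "((\<lambda>t. (u t)\<^sup>2) has_integral integral {0..1} (\<lambda>t. (u t)\<^sup>2)) {0..1}"
      using i2 by (rule integrable_integral)
    show "(u has_integral m) {0..1}" unfolding m_def using i1 by (rule integrable_integral)
    show "((\<lambda>t. m\<^sup>2) has_integral m\<^sup>2) {0..1::real}" using has_integral_const_real[of "m\<^sup>2" 0 1] by simp
  qed
  finally show ?thesis by (simp add: m_def power2_eq_square)
qed

lemma integral_01_abs_le:
  fixes u :: "real \<Rightarrow> real"
  assumes "continuous_on {0..1} u" "\<And>t. t \<in> {0..1} \<Longrightarrow> \<bar>u t\<bar> \<le> B"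
  shows "\<bar>integral {0..1} u\<bar> \<le> B"
  using integral_bound[of 0 1 u B] assms by simp

text \<open>The integration variable is part of the index, so the bounds are uniform in it and pass
  through the integral; for the mean square, the square is first moved inside the integral.\<close>

lemma concentrated_integral:
  fixes \<xi> :: "'j \<times> real \<Rightarrow> real^2 \<Rightarrow> real" and c :: "'j \<times> real \<Rightarrow> real"
  assumes "concentrated {(j, t). j \<in> J \<and> t \<in> {0..1}} (\<lambda>(j, t). \<rho> j) \<xi> c"
    and cont: "\<And>j. j \<in> J \<Longrightarrow> continuous_on ({0..1} \<times> UNIV) (\<lambda>(t, \<psi>). \<xi> (j, t) \<psi>)"
    and cc: "\<And>j. j \<in> J \<Longrightarrow> continuous_on {0..1} (\<lambda>t. c (j, t))"
  shows "concentrated J \<rho> (\<lambda>j \<psi>. integral {0..1} (\<lambda>t. \<xi> (j, t) \<psi>)) (\<lambda>j. integral {0..1} (\<lambda>t. c (j, t)))"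
proof -
  let ?I = "{(j, t). j \<in> J \<and> t \<in> {0..1::real}}" and ?\<rho> = "\<lambda>(j, t). \<rho> j"
  obtain C where C0: "\<forall>i\<in>?I. 0 \<le> ?\<rho> i \<and> ?\<rho> i \<le> 1 \<and> torus_cont (\<xi> i)"
      "\<forall>i\<in>?I. \<bar>torus_avg (\<xi> i) - c i\<bar> \<le> C * ?\<rho> i \<and>
        torus_avg (\<lambda>\<psi>. (\<xi> i \<psi> - c i)\<^sup>2) \<le> C * ?\<rho> i \<and> (\<forall>\<psi>. \<bar>\<xi> i \<psi>\<bar> \<le> C) \<and> \<bar>c i\<bar> \<le> C"
    using assms(1) unfolding concentrated_def by (elim conjE exE) simp
  have C: "\<bar>torus_avg (\<xi> (j, t)) - c (j, t)\<bar> \<le> C * \<rho> j"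
    "torus_avg (\<lambda>\<psi>. (\<xi> (j, t) \<psi> - c (j, t))\<^sup>2) \<le> C * \<rho> j"
    "\<bar>\<xi> (j, t) \<psi>\<bar> \<le> C" "\<bar>c (j, t)\<bar> \<le> C" "torus_cont (\<xi> (j, t))" "0 \<le> \<rho> j" "\<rho> j \<le> 1"
    if "j \<in> J" "t \<in> {0..1}" for j t \<psi>
    using C0[THEN bspec, of "(j, t)"] that by auto
  show ?thesis
  proof (rule concentratedI[where ?C1.0=C and ?C2.0=C and ?C3.0=C and ?C4.0=C])
    fix j assume j: "j \<in> J"
    let ?x = "\<lambda>\<psi>. integral {0..1} (\<lambda>t. \<xi> (j, t) \<psi>)" and ?c = "integral {0..1} (\<lambda>t. c (j, t))"
    have cpsi: "continuous_on {0..1} (\<lambda>t. \<xi> (j, t) \<psi>)" for \<psi>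
    proof -
      have "continuous_on {0..1} (\<lambda>t. (\<lambda>(t, \<psi>). \<xi> (j, t) \<psi>) (t, \<psi>))"
        by (rule continuous_on_compose2[OF cont[OF j]]) (auto intro!: continuous_intros)
      then show ?thesis by simp
    qed
    have contd: "continuous_on ({0..1} \<times> UNIV) (\<lambda>(t, \<psi>). (\<xi> (j, t) \<psi> - c (j, t))\<^sup>2)"
    proof -
      have "continuous_on ({0..1} \<times> UNIV) (\<lambda>p. c (j, fst p))"
        by (rule continuous_on_compose2[OF cc[OF j]]) (auto intro!: continuous_intros)
      then show ?thesis
        using cont[OF j] unfolding split_beta by (intro continuous_intros)
    qed
    show "torus_cont ?x"
    proof (rule torus_contI)
      show "continuous_on UNIV ?x" by (rule torus_avg_integral_swap(1)[OF cont[OF j]])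
      show "torus_fun ?x"
        using C(5)[OF j] unfolding torus_fun_def torus_cont_def by (auto intro!: integral_cong)
    qed
    have "torus_avg ?x - ?c = integral {0..1} (\<lambda>t. torus_avg (\<xi> (j, t)) - c (j, t))"
      unfolding torus_avg_integral_swap(3)[OF cont[OF j]]
      by (intro integral_diff[symmetric] integrable_continuous_real torus_avg_integral_swap(2)[OF cont[OF j]] cc j)
    also have "\<bar>\<dots>\<bar> \<le> C * \<rho> j"
      by (intro integral_01_abs_le continuous_intros torus_avg_integral_swap(2)[OF cont[OF j]] cc j C)
    finally show "\<bar>torus_avg ?x - ?c\<bar> \<le> C * \<rho> j" .
    have sq: "(?x \<psi> - ?c)\<^sup>2 \<le> integral {0..1} (\<lambda>t. (\<xi> (j, t) \<psi> - c (j, t))\<^sup>2)" for \<psi>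
    proof -
      have "?x \<psi> - ?c = integral {0..1} (\<lambda>t. \<xi> (j, t) \<psi> - c (j, t))"
        by (intro integral_diff[symmetric] integrable_continuous_real cpsi cc j)
      then show ?thesis
        using integral_square_le[OF continuous_on_diff[OF cpsi[of \<psi>] cc[OF j]]] by simp
    qed
    have tsq: "torus_cont (\<lambda>\<psi>. (?x \<psi> - ?c)\<^sup>2)" using \<open>torus_cont ?x\<close> by (intro torus_cont_intros)
    have tsq2: "torus_cont (\<lambda>\<psi>. integral {0..1} (\<lambda>t. (\<xi> (j, t) \<psi> - c (j, t))\<^sup>2))"
    proof (rule torus_contI)
      show "continuous_on UNIV (\<lambda>\<psi>. integral {0..1} (\<lambda>t. (\<xi> (j, t) \<psi> - c (j, t))\<^sup>2))"
        by (rule torus_avg_integral_swap(1)[OF contd])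
      show "torus_fun (\<lambda>\<psi>. integral {0..1} (\<lambda>t. (\<xi> (j, t) \<psi> - c (j, t))\<^sup>2))"
        using C(5)[OF j] unfolding torus_fun_def torus_cont_def by (auto intro!: integral_cong)
    qed
    have "torus_avg (\<lambda>\<psi>. (?x \<psi> - ?c)\<^sup>2) \<le> torus_avg (\<lambda>\<psi>. integral {0..1} (\<lambda>t. (\<xi> (j, t) \<psi> - c (j, t))\<^sup>2))"
      by (rule torus_avg_mono[OF tsq tsq2 sq])
    also have "\<dots> = integral {0..1} (\<lambda>t. torus_avg (\<lambda>\<psi>. (\<xi> (j, t) \<psi> - c (j, t))\<^sup>2))"
      by (rule torus_avg_integral_swap(3)[OF contd])
    also have "\<dots> \<le> C * \<rho> j"
    proof (rule order_trans[OF abs_ge_self integral_01_abs_le[OF torus_avg_integral_swap(2)[OF contd]]])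
      fix t :: real assume t: "t \<in> {0..1}"
      have "0 \<le> torus_avg (\<lambda>\<psi>. (\<xi> (j, t) \<psi> - c (j, t))\<^sup>2)"
        by (intro torus_avg_nonneg torus_cont_intros C j t) simp
      then show "\<bar>torus_avg (\<lambda>\<psi>. (\<xi> (j, t) \<psi> - c (j, t))\<^sup>2)\<bar> \<le> C * \<rho> j"
        using C(2)[OF j t] by simp
    qed
    finally show "torus_avg (\<lambda>\<psi>. (?x \<psi> - ?c)\<^sup>2) \<le> C * \<rho> j" .
    show "\<bar>?x \<psi>\<bar> \<le> C" for \<psi> by (intro integral_01_abs_le cpsi C j)
    show "\<bar>?c\<bar> \<le> C" by (intro integral_01_abs_le cc C j)
    show "0 \<le> \<rho> j" "\<rho> j \<le> 1" using C(6,7)[OF j, of 0] by auto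
  qed
qed

section \<open>Algebra of slow quantities and observables\<close>

context hyperbolic_splitting
begin

text \<open>The bounds of \<open>observable\<close> for a quantity without fast argument, such as
  the slow orbit and its derivatives. The factor \<open>\<bar>lam\<bar> ^ n * \<bar>s\<bar>\<close>
  measures, up to the length of \<open>eu\<close>, what an initial displacement by \<open>s\<close>
  along the unstable line has become at time \<open>n\<close>.\<close>

definition slow :: "real \<Rightarrow> real \<Rightarrow> real \<Rightarrow> (nat \<Rightarrow> real^2 \<Rightarrow> real) \<Rightarrow> bool" where
  "slow C \<rho> \<theta> Z \<longleftrightarrow> (\<forall>n. torus_cont (Z n)) \<and> (\<forall>n \<psi>. \<bar>Z n \<psi>\<bar> \<le> C * \<theta> ^ n) \<and>
     (\<forall>n \<psi>. \<bar>Z (Suc n) \<psi> - Z n \<psi>\<bar> \<le> C * \<rho> * \<theta> ^ n) \<and>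
     (\<forall>n \<psi> s. \<bar>Z n (\<psi> + s *\<^sub>R eu) - Z n \<psi>\<bar> \<le> C * \<rho> * \<theta> ^ n * (\<bar>lam\<bar> ^ n * \<bar>s\<bar>) powr \<alpha>)"

lemma slowD:
  assumes "slow C \<rho> \<theta> Z"
  shows "torus_cont (Z n)" "\<bar>Z n \<psi>\<bar> \<le> C * \<theta> ^ n" "\<bar>Z (Suc n) \<psi> - Z n \<psi>\<bar> \<le> C * \<rho> * \<theta> ^ n"
    "\<bar>Z n (\<psi> + s *\<^sub>R eu) - Z n \<psi>\<bar> \<le> C * \<rho> * \<theta> ^ n * (\<bar>lam\<bar> ^ n * \<bar>s\<bar>) powr \<alpha>"
  using assms unfolding slow_def by blast+

lemma observableD:
  assumes "observable C \<rho> \<theta> \<Gamma>"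
  shows "torus_fun (\<Gamma> n \<psi>)" "torus_cont (\<lambda>\<psi>. \<Gamma> n \<psi> (iter m \<psi>))" "\<bar>\<Gamma> n \<psi> x\<bar> \<le> C * \<theta> ^ n"
    "\<bar>\<Gamma> n \<psi> x - \<Gamma> n \<psi> y\<bar> \<le> C * \<theta> ^ n * dist x y powr \<alpha>"
    "\<bar>\<Gamma> (Suc n) \<psi> x - \<Gamma> n \<psi> x\<bar> \<le> C * \<rho> * \<theta> ^ n"
    "\<bar>(\<Gamma> (Suc n) \<psi> x - \<Gamma> n \<psi> x) - (\<Gamma> (Suc n) \<psi> y - \<Gamma> n \<psi> y)\<bar> \<le> C * \<rho> * \<theta> ^ n * dist x y powr \<alpha>"
    "\<bar>\<Gamma> n (\<psi> + s *\<^sub>R eu) x - \<Gamma> n \<psi> x\<bar> \<le> C * \<rho> * \<theta> ^ n * (\<bar>lam\<bar> ^ n * \<bar>s\<bar>) powr \<alpha>"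
  using assms unfolding observable_def holder_def by simp_all

lemma abs_diff_mult_le:
  fixes a b c d :: real
  assumes "\<bar>a - c\<bar> \<le> A1" "\<bar>b\<bar> \<le> B1" "\<bar>c\<bar> \<le> A2" "\<bar>b - d\<bar> \<le> B2"
  shows "\<bar>a * b - c * d\<bar> \<le> A1 * B1 + A2 * B2"
proof -
  have "\<bar>a * b - c * d\<bar> = \<bar>(a - c) * b + c * (b - d)\<bar>" by (simp add: algebra_simps)
  also have "\<dots> \<le> \<bar>a - c\<bar> * \<bar>b\<bar> + \<bar>c\<bar> * \<bar>b - d\<bar>" by (rule abs_mult_add_le)
  also have "\<dots> \<le> A1 * B1 + A2 * B2" using assms by (intro add_mono mult_mono) auto
  finally show ?thesis .
qed

text \<open>Only \<open>Z\<close> has to decay. This lets the bounded \<open>R\<close> multiply the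
  decaying \<open>P\<close> and, after \<open>slow_weaken\<close>, allows \<open>P\<close> to be
  multiplied by itself.\<close>

lemma slow_mult:
  assumes Z: "slow C \<rho> \<theta> Z" and Y: "slow D \<rho> 1 Y" and pos: "0 \<le> C" "0 \<le> D" "0 \<le> \<theta>" "0 \<le> \<rho>"
  shows "slow (2 * C * D) \<rho> \<theta> (\<lambda>n \<psi>. Z n \<psi> * Y n \<psi>)"
  unfolding slow_def
proof (intro conjI allI)
  note Y' = slowD[OF Y, simplified]
  fix n \<psi> s
  show "torus_cont (\<lambda>\<psi>. Z n \<psi> * Y n \<psi>)" by (intro torus_cont_intros slowD[OF Z] Y')
  have "\<bar>Z n \<psi> * Y n \<psi>\<bar> \<le> (C * \<theta> ^ n) * D"
    unfolding abs_mult using pos by (intro mult_mono slowD[OF Z] Y') auto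
  also have "\<dots> \<le> 2 * C * D * \<theta> ^ n" using pos by simp
  finally show "\<bar>Z n \<psi> * Y n \<psi>\<bar> \<le> 2 * C * D * \<theta> ^ n" .
  have "\<bar>Z (Suc n) \<psi> * Y (Suc n) \<psi> - Z n \<psi> * Y n \<psi>\<bar> \<le> (C * \<rho> * \<theta> ^ n) * D + (C * \<theta> ^ n) * (D * \<rho>)"
    by (intro abs_diff_mult_le slowD[OF Z] Y')
  then show "\<bar>Z (Suc n) \<psi> * Y (Suc n) \<psi> - Z n \<psi> * Y n \<psi>\<bar> \<le> 2 * C * D * \<rho> * \<theta> ^ n"
    by (simp add: algebra_simps)
  let ?d = "(\<bar>lam\<bar> ^ n * \<bar>s\<bar>) powr \<alpha>"
  have "\<bar>Z n (\<psi> + s *\<^sub>R eu) * Y n (\<psi> + s *\<^sub>R eu) - Z n \<psi> * Y n \<psi>\<bar>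
      \<le> (C * \<rho> * \<theta> ^ n * ?d) * D + (C * \<theta> ^ n) * (D * \<rho> * ?d)"
    by (intro abs_diff_mult_le slowD[OF Z] Y')
  then show "\<bar>Z n (\<psi> + s *\<^sub>R eu) * Y n (\<psi> + s *\<^sub>R eu) - Z n \<psi> * Y n \<psi>\<bar> \<le> 2 * C * D * \<rho> * \<theta> ^ n * ?d"
    by (simp add: algebra_simps)
qed

lemma slow_weaken:
  assumes Z: "slow C \<rho> \<theta> Z" and pos: "0 \<le> C" "0 \<le> \<theta>" "\<theta> \<le> 1" "0 \<le> \<rho>"
  shows "slow C \<rho> 1 Z"
  unfolding slow_def
proof (intro conjI allI)
  have 1: "C * \<theta> ^ n \<le> C * 1 ^ n" "C * \<rho> * \<theta> ^ n \<le> C * \<rho> * 1 ^ n" for n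
    using pos by (auto intro!: mult_left_le simp: power_le_one)
  fix n \<psi> s
  show "torus_cont (Z n)" by (rule slowD[OF Z])
  show "\<bar>Z n \<psi>\<bar> \<le> C * 1 ^ n" by (rule order_trans[OF slowD(2)[OF Z] 1(1)])
  show "\<bar>Z (Suc n) \<psi> - Z n \<psi>\<bar> \<le> C * \<rho> * 1 ^ n" by (rule order_trans[OF slowD(3)[OF Z] 1(2)])
  show "\<bar>Z n (\<psi> + s *\<^sub>R eu) - Z n \<psi>\<bar> \<le> C * \<rho> * 1 ^ n * (\<bar>lam\<bar> ^ n * \<bar>s\<bar>) powr \<alpha>"
    by (rule order_trans[OF slowD(4)[OF Z] mult_right_mono[OF 1(2)]]) simp
qed

lemma observable_mult:
  assumes Z: "slow C \<rho> \<theta> Z" and G: "observable D \<rho> 1 \<Gamma>" and pos: "0 \<le> C" "0 \<le> D" "0 \<le> \<theta>" "0 \<le> \<rho>"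
  shows "observable (2 * C * D) \<rho> \<theta> (\<lambda>n \<psi> x. Z n \<psi> * \<Gamma> n \<psi> x)"
  unfolding observable_def holder_def
proof (intro conjI allI)
  note G' = observableD[OF G, simplified]
  fix n m \<psi> x y s
  show "torus_fun (\<lambda>x. Z n \<psi> * \<Gamma> n \<psi> x)" using G'(1)[of n \<psi>] by (simp add: torus_fun_def)
  show "torus_cont (\<lambda>\<psi>. Z n \<psi> * \<Gamma> n \<psi> (iter m \<psi>))" by (intro torus_cont_intros slowD[OF Z] G')
  have "\<bar>Z n \<psi> * \<Gamma> n \<psi> x\<bar> \<le> (C * \<theta> ^ n) * D"
    unfolding abs_mult using pos by (intro mult_mono slowD[OF Z] G') auto
  also have "\<dots> \<le> 2 * C * D * \<theta> ^ n" using pos by simp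
  finally show "\<bar>Z n \<psi> * \<Gamma> n \<psi> x\<bar> \<le> 2 * C * D * \<theta> ^ n" .
  have "\<bar>Z n \<psi> * \<Gamma> n \<psi> x - Z n \<psi> * \<Gamma> n \<psi> y\<bar> = \<bar>Z n \<psi>\<bar> * \<bar>\<Gamma> n \<psi> x - \<Gamma> n \<psi> y\<bar>"
    by (simp add: right_diff_distrib[symmetric] abs_mult)
  also have "\<dots> \<le> (C * \<theta> ^ n) * (D * dist x y powr \<alpha>)"
    using pos by (intro mult_mono slowD[OF Z] G') auto
  also have "\<dots> \<le> 2 * C * D * \<theta> ^ n * dist x y powr \<alpha>" using pos by simp
  finally show "\<bar>Z n \<psi> * \<Gamma> n \<psi> x - Z n \<psi> * \<Gamma> n \<psi> y\<bar> \<le> 2 * C * D * \<theta> ^ n * dist x y powr \<alpha>" .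
  have "\<bar>Z (Suc n) \<psi> * \<Gamma> (Suc n) \<psi> x - Z n \<psi> * \<Gamma> n \<psi> x\<bar> \<le> (C * \<rho> * \<theta> ^ n) * D + (C * \<theta> ^ n) * (D * \<rho>)"
    by (intro abs_diff_mult_le slowD[OF Z] G')
  then show "\<bar>Z (Suc n) \<psi> * \<Gamma> (Suc n) \<psi> x - Z n \<psi> * \<Gamma> n \<psi> x\<bar> \<le> 2 * C * D * \<rho> * \<theta> ^ n"
    by (simp add: algebra_simps)
  have "\<bar>(Z (Suc n) \<psi> * \<Gamma> (Suc n) \<psi> x - Z n \<psi> * \<Gamma> n \<psi> x) - (Z (Suc n) \<psi> * \<Gamma> (Suc n) \<psi> y - Z n \<psi> * \<Gamma> n \<psi> y)\<bar>
      = \<bar>(Z (Suc n) \<psi> - Z n \<psi>) * (\<Gamma> (Suc n) \<psi> x - \<Gamma> (Suc n) \<psi> y)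
        + Z n \<psi> * ((\<Gamma> (Suc n) \<psi> x - \<Gamma> n \<psi> x) - (\<Gamma> (Suc n) \<psi> y - \<Gamma> n \<psi> y))\<bar>"
    by (simp add: algebra_simps)
  also have "\<dots> \<le> (C * \<rho> * \<theta> ^ n) * (D * dist x y powr \<alpha>) + (C * \<theta> ^ n) * (D * \<rho> * dist x y powr \<alpha>)"
    using pos by (intro order_trans[OF abs_mult_add_le] add_mono mult_mono slowD[OF Z] G') auto
  finally show "\<bar>(Z (Suc n) \<psi> * \<Gamma> (Suc n) \<psi> x - Z n \<psi> * \<Gamma> n \<psi> x) - (Z (Suc n) \<psi> * \<Gamma> (Suc n) \<psi> y - Z n \<psi> * \<Gamma> n \<psi> y)\<bar>
      \<le> 2 * C * D * \<rho> * \<theta> ^ n * dist x y powr \<alpha>"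
    by (simp add: algebra_simps)
  let ?d = "(\<bar>lam\<bar> ^ n * \<bar>s\<bar>) powr \<alpha>"
  have "\<bar>Z n (\<psi> + s *\<^sub>R eu) * \<Gamma> n (\<psi> + s *\<^sub>R eu) x - Z n \<psi> * \<Gamma> n \<psi> x\<bar>
      \<le> (C * \<rho> * \<theta> ^ n * ?d) * D + (C * \<theta> ^ n) * (D * \<rho> * ?d)"
    by (intro abs_diff_mult_le slowD[OF Z] G')
  then show "\<bar>Z n (\<psi> + s *\<^sub>R eu) * \<Gamma> n (\<psi> + s *\<^sub>R eu) x - Z n \<psi> * \<Gamma> n \<psi> x\<bar> \<le> 2 * C * D * \<rho> * \<theta> ^ n * ?d"
    by (simp add: algebra_simps)
qed

lemma observable_add:
  assumes "observable C \<rho> \<theta> \<Gamma>" "observable D \<rho> \<theta> \<Delta>"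
  shows "observable (C + D) \<rho> \<theta> (\<lambda>n \<psi> x. \<Gamma> n \<psi> x + \<Delta> n \<psi> x)"
  unfolding observable_def holder_def
proof (intro conjI allI)
  note G = observableD[OF assms(1)] and D = observableD[OF assms(2)]
  fix n m \<psi> x y s
  show "torus_fun (\<lambda>x. \<Gamma> n \<psi> x + \<Delta> n \<psi> x)" using G(1)[of n \<psi>] D(1)[of n \<psi>] by (simp add: torus_fun_def)
  show "torus_cont (\<lambda>\<psi>. \<Gamma> n \<psi> (iter m \<psi>) + \<Delta> n \<psi> (iter m \<psi>))" by (intro torus_cont_intros G D)
  show "\<bar>\<Gamma> n \<psi> x + \<Delta> n \<psi> x\<bar> \<le> (C + D) * \<theta> ^ n"
    using G(3)[of n \<psi> x] D(3)[of n \<psi> x] by (simp add: distrib_right)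
  show "\<bar>\<Gamma> n \<psi> x + \<Delta> n \<psi> x - (\<Gamma> n \<psi> y + \<Delta> n \<psi> y)\<bar> \<le> (C + D) * \<theta> ^ n * dist x y powr \<alpha>"
    using G(4)[of n \<psi> x y] D(4)[of n \<psi> x y] by (simp add: distrib_right)
  show "\<bar>\<Gamma> (Suc n) \<psi> x + \<Delta> (Suc n) \<psi> x - (\<Gamma> n \<psi> x + \<Delta> n \<psi> x)\<bar> \<le> (C + D) * \<rho> * \<theta> ^ n"
    using G(5)[of n \<psi> x] D(5)[of n \<psi> x] by (simp add: distrib_right)
  show "\<bar>\<Gamma> (Suc n) \<psi> x + \<Delta> (Suc n) \<psi> x - (\<Gamma> n \<psi> x + \<Delta> n \<psi> x) -
      (\<Gamma> (Suc n) \<psi> y + \<Delta> (Suc n) \<psi> y - (\<Gamma> n \<psi> y + \<Delta> n \<psi> y))\<bar> \<le> (C + D) * \<rho> * \<theta> ^ n * dist x y powr \<alpha>"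
    using G(6)[of n \<psi> x y] D(6)[of n \<psi> x y] by (simp add: distrib_right)
  show "\<bar>\<Gamma> n (\<psi> + s *\<^sub>R eu) x + \<Delta> n (\<psi> + s *\<^sub>R eu) x - (\<Gamma> n \<psi> x + \<Delta> n \<psi> x)\<bar>
      \<le> (C + D) * \<rho> * \<theta> ^ n * (\<bar>lam\<bar> ^ n * \<bar>s\<bar>) powr \<alpha>"
    using G(7)[of n \<psi> s x] D(7)[of n \<psi> s x] unfolding distrib_right by linarith
qed

text \<open>The mixed hypothesis \<open>glh\<close> is what gives the time increments a Hoelder
  constant O(\<rho>) in the fast variable; Lipschitz dependence on \<open>x\<close> and Hoelder
  dependence on \<open>p\<close> separately would only give a bounded one.\<close>

lemma observable_compose:
  assumes X: "slow C \<rho> 1 X" and XU: "\<And>n \<psi>. X n \<psi> \<in> U" and K: "0 \<le> K" "0 \<le> C" "0 \<le> \<rho>"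
    and gb: "\<And>x p. x \<in> U \<Longrightarrow> \<bar>g x p\<bar> \<le> K"
    and gh: "\<And>x. x \<in> U \<Longrightarrow> holder (g x) K"
    and gl: "\<And>x y p. x \<in> U \<Longrightarrow> y \<in> U \<Longrightarrow> \<bar>g x p - g y p\<bar> \<le> K * \<bar>x - y\<bar>"
    and glh: "\<And>x y. x \<in> U \<Longrightarrow> y \<in> U \<Longrightarrow> holder (\<lambda>p. g x p - g y p) (K * \<bar>x - y\<bar>)"
    and gp: "\<And>x. x \<in> U \<Longrightarrow> torus_fun (g x)"
    and gc: "continuous_on (U \<times> UNIV) (\<lambda>(x, p). g x p)"
  shows "observable (K * (C + 1)) \<rho> 1 (\<lambda>n \<psi> p. g (X n \<psi>) p)"
  unfolding observable_def
proof (intro conjI allI)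
  note X' = slowD[OF X, simplified]
  have le: "K \<le> K * (C + 1) * 1 ^ n" "K * (C * \<rho>) \<le> K * (C + 1) * \<rho> * 1 ^ n" for n :: nat
    using K by (auto simp: algebra_simps)
  fix n m \<psi> p s
  show "torus_fun (g (X n \<psi>))" by (intro gp XU)
  show "torus_cont (\<lambda>\<psi>. g (X n \<psi>) (iter m \<psi>))"
  proof (rule torus_contI)
    have "continuous_on UNIV (\<lambda>\<psi>. (\<lambda>(x, p). g x p) (X n \<psi>, iter m \<psi>))"
      by (rule continuous_on_compose2[OF gc])
        (use X'(1)[of n] XU continuous_on_iter in \<open>auto simp: torus_cont_def intro!: continuous_intros\<close>)
    then show "continuous_on UNIV (\<lambda>\<psi>. g (X n \<psi>) (iter m \<psi>))" by simp
    show "torus_fun (\<lambda>\<psi>. g (X n \<psi>) (iter m \<psi>))"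
      unfolding torus_fun_def
    proof (intro allI)
      fix \<psi> i
      have "torus_cont (g (X n \<psi>))" using gp[OF XU] holder_continuous[OF gh[OF XU]] by (simp add: torus_cont_def)
      then have "g (X n \<psi>) (iter m (\<psi> + axis i (2 * pi))) = g (X n \<psi>) (iter m \<psi>)"
        using torus_cont_iter[of "g (X n \<psi>)" m] by (simp add: torus_cont_def torus_fun_def)
      moreover have "X n (\<psi> + axis i (2 * pi)) = X n \<psi>"
        using X'(1)[of n] by (simp add: torus_cont_def torus_fun_def)
      ultimately show "g (X n (\<psi> + axis i (2 * pi))) (iter m (\<psi> + axis i (2 * pi))) = g (X n \<psi>) (iter m \<psi>)"
        by simp
    qed
  qed
  show "\<bar>g (X n \<psi>) p\<bar> \<le> K * (C + 1) * 1 ^ n" by (rule order_trans[OF gb[OF XU] le(1)])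
  show "holder (g (X n \<psi>)) (K * (C + 1) * 1 ^ n)" by (rule holder_mono[OF gh[OF XU] le(1)])
  have inc: "K * \<bar>X (Suc n) \<psi> - X n \<psi>\<bar> \<le> K * (C + 1) * \<rho> * 1 ^ n"
    by (rule order_trans[OF mult_left_mono[OF X'(3)] le(2)]) (use K in auto)
  show "\<bar>g (X (Suc n) \<psi>) p - g (X n \<psi>) p\<bar> \<le> K * (C + 1) * \<rho> * 1 ^ n"
    by (rule order_trans[OF gl[OF XU XU] inc])
  show "holder (\<lambda>x. g (X (Suc n) \<psi>) x - g (X n \<psi>) x) (K * (C + 1) * \<rho> * 1 ^ n)"
    by (rule holder_mono[OF glh[OF XU XU] inc])
  let ?d = "(\<bar>lam\<bar> ^ n * \<bar>s\<bar>) powr \<alpha>"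
  have "\<bar>g (X n (\<psi> + s *\<^sub>R eu)) p - g (X n \<psi>) p\<bar> \<le> K * (C * \<rho> * ?d)"
    by (rule order_trans[OF gl[OF XU XU] mult_left_mono[OF X'(4) K(1)]])
  also have "\<dots> \<le> K * (C + 1) * \<rho> * 1 ^ n * ?d"
    using mult_right_mono[OF le(2)[of n], of ?d] by (simp add: mult_ac)
  finally show "\<bar>g (X n (\<psi> + s *\<^sub>R eu)) p - g (X n \<psi>) p\<bar> \<le> K * (C + 1) * \<rho> * 1 ^ n * ?d" .
qed

text \<open>Under \<open>A\<close> unstable \<open>\<alpha>\<close>-Hoelder scales grow by the factor \<open>\<bar>lam\<bar>\<^sup>\<alpha>\<close>, which beats \<open>1 + O(\<rho>)\<close>.\<close>

lemma holder_gronwall: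
  fixes \<delta> :: "nat \<Rightarrow> real"
  assumes step: "\<And>n. \<delta> (Suc n) \<le> (1 + a * \<rho>) * \<delta> n + b * \<rho> * (\<bar>lam\<bar> ^ n * \<bar>s\<bar>) powr \<alpha>"
    and 0: "\<delta> 0 \<le> c0 * \<rho> * \<bar>s\<bar> powr \<alpha>"
    and a: "0 \<le> a" "2 * a * \<rho> \<le> \<bar>lam\<bar> powr \<alpha> - 1" and \<rho>: "0 \<le> \<rho>"
    and c: "c0 \<le> c" "2 * b \<le> c * (\<bar>lam\<bar> powr \<alpha> - 1)" "0 \<le> c"
  shows "\<delta> n \<le> c * \<rho> * (\<bar>lam\<bar> ^ n * \<bar>s\<bar>) powr \<alpha>"
proof (induction n)
  case 0
  show ?case using assms(2) mult_right_mono[OF c(1), of "\<rho> * \<bar>s\<bar> powr \<alpha>"] \<rho> by (simp add: mult_ac)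
next
  case (Suc n)
  let ?Q = "\<bar>lam\<bar> powr \<alpha>" and ?d = "(\<bar>lam\<bar> ^ n * \<bar>s\<bar>) powr \<alpha>"
  have d: "(\<bar>lam\<bar> ^ Suc n * \<bar>s\<bar>) powr \<alpha> = ?Q * ?d" by (simp add: powr_mult mult.assoc)
  have "\<delta> (Suc n) \<le> (1 + a * \<rho>) * (c * \<rho> * ?d) + b * \<rho> * ?d"
    by (rule order_trans[OF step add_right_mono[OF mult_left_mono[OF Suc]]]) (use a \<rho> in simp)
  also have "\<dots> = ((1 + a * \<rho>) * c + b) * (\<rho> * ?d)" by (simp add: algebra_simps)
  also have "\<dots> \<le> (c * ?Q) * (\<rho> * ?d)"
  proof (rule mult_right_mono)
    \<comment> \<open>Half of the gap \<open>?Q - 1\<close> pays for the growth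
      \<open>a * \<rho>\<close>, the other half for the inhomogeneity \<open>b\<close>.\<close>
    have "2 * (a * \<rho> * c) \<le> (?Q - 1) * c" using mult_right_mono[OF a(2) c(3)] by simp
    then show "(1 + a * \<rho>) * c + b \<le> c * ?Q" using c(2) by (simp add: algebra_simps)
  qed (use \<rho> in simp)
  finally show ?case unfolding d by (simp only: mult_ac)
qed

lemma dist_iter_shift:
  "dist (iter n (\<psi> + s *\<^sub>R eu)) (iter n \<psi>) powr \<alpha> = norm eu powr \<alpha> * (\<bar>lam\<bar> ^ n * \<bar>s\<bar>) powr \<alpha>"
  by (simp add: iter_add_vec iter_scaleR iter_eu dist_norm abs_mult power_abs powr_mult mult_ac)

lemma inj_A: "A *v x = A *v y \<Longrightarrow> x = y"
proof -
  have "surj ((*v) A)" using surj_A by (metis surjI)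
  then have "inj ((*v) A)"
    by (metis matrix_left_right_inverse matrix_left_invertible_injective matrix_right_invertible_surjective)
  then show "A *v x = A *v y \<Longrightarrow> x = y" by (simp add: inj_def)
qed

end

section \<open>The slow-fast system and its derivatives\<close>

lemma torus_cont_divide:
  "torus_cont g \<Longrightarrow> torus_cont k \<Longrightarrow> (\<And>\<psi>. k \<psi> \<noteq> 0) \<Longrightarrow> torus_cont (\<lambda>\<psi>. g \<psi> / k \<psi>)"
  by (auto simp: torus_cont_def torus_fun_def intro!: continuous_intros)

text \<open>
  \<open>F n\<close> plays the role of the \<open>n\<close>-th derivative of the slow field in \<open>\<phi>\<close>. The conditions are also
  satisfied by the averaged field, regarded as a function independent of \<open>\<psi>\<close>.
\<close>

locale slow_fast = hyperbolic_splitting +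
  fixes F :: "nat \<Rightarrow> real \<Rightarrow> real^2 \<Rightarrow> real" and K pm pM Sm SM \<epsilon> \<kappa> \<gamma> :: real
  assumes F_deriv: "n < 5 \<Longrightarrow> ((\<lambda>x. F n x \<psi>) has_real_derivative F (Suc n) x \<psi>) (at x)"
    and F_bound: "n \<le> 5 \<Longrightarrow> \<bar>F n x \<psi>\<bar> \<le> K"
    and F_lipschitz: "n \<le> 5 \<Longrightarrow> \<bar>F n x \<psi> - F n y \<psi>\<bar> \<le> K * \<bar>x - y\<bar>"
    and F_holder: "n \<le> 5 \<Longrightarrow> holder (F n x) K"
    and F_torus_fun: "n \<le> 5 \<Longrightarrow> torus_fun (F n x)"
    and order: "pm < Sm - \<epsilon>" "Sm \<le> 0" "0 \<le> SM" "SM + \<epsilon> < pM" and pos: "0 < \<epsilon>" "0 < \<kappa>" "0 < \<gamma>" "0 < K"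
    and left: "x \<in> {pm..Sm} \<Longrightarrow> 0 \<le> F 0 x \<psi>" and right: "x \<in> {SM..pM} \<Longrightarrow> F 0 x \<psi> \<le> 0"
    and far_left: "x \<in> {pm..Sm - \<epsilon>} \<Longrightarrow> \<kappa> \<le> F 0 x \<psi>"
    and far_right: "x \<in> {SM + \<epsilon>..pM} \<Longrightarrow> F 0 x \<psi> \<le> - \<kappa>"
    and contracting: "x \<in> {Sm - \<epsilon>..SM + \<epsilon>} \<Longrightarrow> F 1 x \<psi> \<le> - \<gamma>"
    and mean_zero: "torus_avg (F 0 0) = 0"
begin

abbreviation U :: "real set" where "U \<equiv> {pm..pM}"

text \<open>Apart from \<open>0 < \<rho> \<le> 1\<close>, the bounds in turn keep the growth factor
  at least 1/2, prevent a step from jumping over the margin around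
  [\<open>Sm\<close>, \<open>SM\<close>], make the contraction factor
  \<open>1 - \<gamma> * \<rho>\<close> nonnegative, keep \<open>decay \<rho>\<close> at least as
  large as the mixing rate, and let unstable stretching dominate the growth of slow
  differences.\<close>

definition small :: "real \<Rightarrow> bool" where
  "small \<rho> \<longleftrightarrow> 0 < \<rho> \<and> \<rho> \<le> 1 \<and> 2 * K * \<rho> \<le> 1 \<and> K * \<rho> \<le> \<epsilon> \<and> \<gamma> * \<rho> \<le> 1 \<and> \<gamma> / 2 * \<rho> \<le> 1 - rate \<and>
     8 * K * \<rho> \<le> \<bar>lam\<bar> powr \<alpha> - 1"

lemma smallD:
  assumes "small \<rho>"
  shows "0 < \<rho>" "\<rho> \<le> 1" "2 * K * \<rho> \<le> 1" "K * \<rho> \<le> \<epsilon>" "\<gamma> * \<rho> \<le> 1" "\<gamma> / 2 * \<rho> \<le> 1 - rate"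
    "8 * K * \<rho> \<le> \<bar>lam\<bar> powr \<alpha> - 1"
  using assms unfolding small_def by auto

text \<open>Half of the rate \<open>\<gamma>\<close> is given up: far from
  [\<open>Sm\<close>, \<open>SM\<close>] the available factor is
  \<open>exp (- (\<gamma> * \<rho>))\<close>, which exceeds \<open>1 - \<gamma> * \<rho>\<close> but
  not \<open>1 - \<gamma> / 2 * \<rho>\<close>.\<close>

definition decay :: "real \<Rightarrow> real" where "decay \<rho> = 1 - \<gamma> / 2 * \<rho>"

lemma decay:
  assumes "small \<rho>"
  shows "0 < decay \<rho>" "decay \<rho> < 1" "rate \<le> decay \<rho>" "1 - decay \<rho> = \<gamma> / 2 * \<rho>"
  using smallD[OF assms] rate pos by (auto simp: decay_def)

lemma decay_power: "small \<rho> \<Longrightarrow> 0 < decay \<rho> ^ n" "small \<rho> \<Longrightarrow> decay \<rho> ^ n \<le> 1"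
  using decay(1,2)[of \<rho>] by (simp_all add: power_le_one less_imp_le)

lemma F_continuous: "n \<le> 5 \<Longrightarrow> continuous_on S (\<lambda>(x, p). F n x p)"
proof -
  assume n: "n \<le> 5"
  have "((\<lambda>z. F n (fst z) (snd z)) \<longlongrightarrow> F n (fst z0) (snd z0)) (at z0)" for z0 :: "real \<times> (real^2)"
  proof -
    have "((\<lambda>z. K * \<bar>fst z - fst z0\<bar> + K * dist (snd z) (snd z0) powr \<alpha>)
        \<longlongrightarrow> K * \<bar>fst z0 - fst z0\<bar> + K * dist (snd z0) (snd z0) powr \<alpha>) (at z0)"
      by (intro tendsto_intros tendsto_powr') (use alpha in auto)
    then have z: "((\<lambda>z. K * \<bar>fst z - fst z0\<bar> + K * dist (snd z) (snd z0) powr \<alpha>) \<longlongrightarrow> 0) (at z0)" by simp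
    have "((\<lambda>z. F n (fst z) (snd z) - F n (fst z0) (snd z0)) \<longlongrightarrow> 0) (at z0)"
    proof (rule Lim_null_comparison[OF _ z], rule always_eventually, rule allI)
      fix z :: "real \<times> (real^2)"
      have "\<bar>F n (fst z0) (snd z) - F n (fst z0) (snd z0)\<bar> \<le> K * dist (snd z) (snd z0) powr \<alpha>"
        using F_holder[OF n] by (simp add: holder_def)
      then show "norm (F n (fst z) (snd z) - F n (fst z0) (snd z0)) \<le>
          K * \<bar>fst z - fst z0\<bar> + K * dist (snd z) (snd z0) powr \<alpha>"
        using F_lipschitz[OF n, of "fst z" "snd z" "fst z0"] by simp
    qed
    then show ?thesis by (simp add: LIM_zero_iff)
  qed
  then have "continuous_on UNIV (\<lambda>z. F n (fst z) (snd z))" by (simp add: continuous_on_def)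
  then show ?thesis by (auto simp: split_beta intro: continuous_on_subset)
qed

lemma torus_cont_F_iter:
  assumes n: "n \<le> 5" and \<xi>: "torus_cont \<xi>"
  shows "torus_cont (\<lambda>\<psi>. F n (\<xi> \<psi>) (iter m \<psi>))"
proof (rule torus_contI)
  have "continuous_on UNIV (\<lambda>\<psi>. (\<lambda>(x, p). F n x p) (\<xi> \<psi>, iter m \<psi>))"
    by (rule continuous_on_compose2[OF F_continuous[OF n, of UNIV]])
      (use \<xi> continuous_on_iter in \<open>auto simp: torus_cont_def intro!: continuous_intros\<close>)
  then show "continuous_on UNIV (\<lambda>\<psi>. F n (\<xi> \<psi>) (iter m \<psi>))" by simp
  show "torus_fun (\<lambda>\<psi>. F n (\<xi> \<psi>) (iter m \<psi>))"
    unfolding torus_fun_def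
  proof (intro allI)
    fix \<psi> i
    have "torus_cont (F n x)" for x
      using F_torus_fun[OF n] holder_continuous[OF F_holder[OF n]] by (simp add: torus_cont_def)
    then have "F n (\<xi> \<psi>) (iter m (\<psi> + axis i (2 * pi))) = F n (\<xi> \<psi>) (iter m \<psi>)"
      using torus_cont_iter[of "F n (\<xi> \<psi>)" m] by (simp add: torus_cont_def torus_fun_def)
    moreover have "\<xi> (\<psi> + axis i (2 * pi)) = \<xi> \<psi>"
      using \<xi> by (simp add: torus_cont_def torus_fun_def)
    ultimately show "F n (\<xi> (\<psi> + axis i (2 * pi))) (iter m (\<psi> + axis i (2 * pi))) = F n (\<xi> \<psi>) (iter m \<psi>)"
      by simp
  qed
qed

section \<open>One step of the slow map and its weighted contraction\<close>

lemma growth_factor: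
  assumes "small \<rho>"
  shows "1 / 2 \<le> 1 + \<rho> * F 1 x \<psi>" "1 + \<rho> * F 1 x \<psi> \<le> 1 + K * \<rho>" "1 - K * \<rho> \<le> 1 + \<rho> * F 1 x \<psi>"
proof -
  have "\<bar>\<rho> * F 1 x \<psi>\<bar> \<le> \<rho> * K"
    unfolding abs_mult using F_bound[of 1 x \<psi>] smallD(1)[OF assms] by (intro mult_mono) auto
  then show "1 / 2 \<le> 1 + \<rho> * F 1 x \<psi>" "1 + \<rho> * F 1 x \<psi> \<le> 1 + K * \<rho>" "1 - K * \<rho> \<le> 1 + \<rho> * F 1 x \<psi>"
    using smallD(3)[OF assms] by (auto simp: mult_ac abs_le_iff)
qed

lemma step_mono:
  assumes "small \<rho>" "x \<le> y"
  shows "x + \<rho> * F 0 x \<psi> \<le> y + \<rho> * F 0 y \<psi>"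
proof -
  have "\<rho> * \<bar>F 0 x \<psi> - F 0 y \<psi>\<bar> \<le> \<rho> * (K * \<bar>x - y\<bar>)"
    using smallD(1)[OF assms(1)] by (intro mult_left_mono F_lipschitz) auto
  also have "\<dots> \<le> 1 * \<bar>x - y\<bar>"
    using mult_right_mono[OF smallD(3)[OF assms(1)], of "\<bar>x - y\<bar>"] smallD(1)[OF assms(1)] pos by (simp add: mult_ac)
  finally have "\<bar>\<rho> * F 0 x \<psi> - \<rho> * F 0 y \<psi>\<bar> \<le> y - x"
    using assms smallD(1)[OF assms(1)] by (simp add: right_diff_distrib[symmetric] abs_mult)
  then show ?thesis by linarith
qed

lemma step_in_U:
  assumes \<rho>: "small \<rho>" and x: "x \<in> U"
  shows "x + \<rho> * F 0 x \<psi> \<in> U"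
proof -
  have "0 \<le> F 0 pm \<psi>" "F 0 pM \<psi> \<le> 0" using order pos by (auto intro!: left right)
  then have "0 \<le> \<rho> * F 0 pm \<psi>" "\<rho> * F 0 pM \<psi> \<le> 0"
    using smallD(1)[OF \<rho>] by (auto simp: mult_nonneg_nonpos)
  then show ?thesis using step_mono[OF \<rho>, of pm x \<psi>] step_mono[OF \<rho>, of x pM \<psi>] x by auto
qed

lemma step_le_SM: "small \<rho> \<Longrightarrow> x \<le> SM \<Longrightarrow> x + \<rho> * F 0 x \<psi> \<le> SM"
  and step_ge_Sm: "small \<rho> \<Longrightarrow> Sm \<le> x \<Longrightarrow> Sm \<le> x + \<rho> * F 0 x \<psi>"
proof -
  assume \<rho>: "small \<rho>"
  have "0 \<le> F 0 Sm \<psi>" "F 0 SM \<psi> \<le> 0" using order pos by (auto intro!: left right)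
  then have *: "0 \<le> \<rho> * F 0 Sm \<psi>" "\<rho> * F 0 SM \<psi> \<le> 0"
    using smallD(1)[OF \<rho>] by (auto simp: mult_nonneg_nonpos)
  show "x + \<rho> * F 0 x \<psi> \<le> SM" if "x \<le> SM" using step_mono[OF \<rho> that, of \<psi>] * by linarith
  show "Sm \<le> x + \<rho> * F 0 x \<psi>" if "Sm \<le> x" using step_mono[OF \<rho> that, of \<psi>] * by linarith
qed

text \<open>The distance from \<open>x\<close> to [\<open>Sm\<close>, \<open>SM\<close>].\<close>

definition gap :: "real \<Rightarrow> real" where
  "gap x = max 0 (max (Sm - x) (x - SM))"

text \<open>
  Far from \<open>[Sm, SM]\<close> the derivative of the step may exceed \<open>1\<close>, but the drift towards \<open>[Sm, SM]\<close>
  is bounded below there; the weight \<open>lyapunov\<close> trades one for the other.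
\<close>

definition lyapunov :: "real \<Rightarrow> real" where
  "lyapunov x = exp ((K + \<gamma>) / \<kappa> * gap x)"

lemma lyapunov_ge_1: "1 \<le> lyapunov x"
  using pos by (simp add: lyapunov_def gap_def)

definition lyap_max :: real where "lyap_max = exp ((K + \<gamma>) / \<kappa> * (pM - pm))"

lemma lyap_max_ge: "1 \<le> lyap_max"
  using pos order by (simp add: lyap_max_def)

lemma lyapunov_le: "x \<in> U \<Longrightarrow> lyapunov x \<le> lyap_max"
  unfolding lyapunov_def lyap_max_def exp_le_cancel_iff
  by (rule mult_left_mono) (use pos order in \<open>auto simp: gap_def\<close>)

lemma lyapunov_mono: "gap x \<le> gap y \<Longrightarrow> lyapunov x \<le> lyapunov y"
  unfolding lyapunov_def exp_le_cancel_iff by (rule mult_left_mono) (use pos in auto)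

text \<open>Near [\<open>Sm\<close>, \<open>SM\<close>] the weight does not increase, since the
  drift points inwards, and the derivative contracts. Far from it the derivative is at most
  \<open>1 + K * \<rho>\<close>, but \<open>gap\<close> drops by \<open>\<rho> * \<kappa>\<close>,
  so the weight gains \<open>exp (- ((K + \<gamma>) * \<rho>))\<close>; the exponent in
  \<open>lyapunov\<close> is chosen for this.\<close>

lemma lyapunov_step:
  assumes \<rho>: "small \<rho>" and x: "x \<in> U"
  shows "lyapunov (x + \<rho> * F 0 x \<psi>) * (1 + \<rho> * F 1 x \<psi>) \<le> decay \<rho> * lyapunov x"
proof (cases "x \<in> {Sm - \<epsilon>..SM + \<epsilon>}")
  case True
  let ?y = "x + \<rho> * F 0 x \<psi>"
  note r = smallD[OF \<rho>]
  have "gap ?y \<le> gap x"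
  proof -
    have "Sm \<le> ?y" if "Sm \<le> x" using step_ge_Sm[OF \<rho> that] .
    moreover have "?y \<le> SM" if "x \<le> SM" using step_le_SM[OF \<rho> that] .
    moreover have "x \<le> ?y" if "x \<le> Sm" using left[of x \<psi>] that x r(1) by simp
    moreover have "?y \<le> x" if "SM \<le> x" using right[of x \<psi>] that x r(1) by (simp add: mult_nonneg_nonpos)
    ultimately show ?thesis using order by (auto simp: gap_def max_def not_le)
  qed
  then have "lyapunov ?y \<le> lyapunov x" by (rule lyapunov_mono)
  moreover have "1 + \<rho> * F 1 x \<psi> \<le> decay \<rho>"
  proof -
    have "\<rho> * F 1 x \<psi> \<le> \<rho> * - \<gamma>" using r(1) by (intro mult_left_mono contracting True) auto
    moreover have "0 < \<gamma> * \<rho>" using r(1) pos by simp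
    ultimately show ?thesis by (simp add: decay_def mult_ac del: One_nat_def)
  qed
  ultimately have "lyapunov ?y * (1 + \<rho> * F 1 x \<psi>) \<le> lyapunov x * decay \<rho>"
    using growth_factor(1)[OF \<rho>, of x \<psi>] lyapunov_ge_1[of x] by (intro mult_mono) auto
  then show ?thesis by (simp add: mult.commute)
next
  case False
  let ?y = "x + \<rho> * F 0 x \<psi>"
  note r = smallD[OF \<rho>]
  \<comment> \<open>A step of length at most \<open>\<epsilon>\<close> cannot pass the nearest end
    point of [\<open>Sm\<close>, \<open>SM\<close>], so the whole drift is seen by
    \<open>gap\<close>.\<close>
  have b: "\<bar>\<rho> * F 0 x \<psi>\<bar> \<le> \<epsilon>"
  proof -
    have "\<bar>\<rho> * F 0 x \<psi>\<bar> \<le> \<rho> * K"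
      unfolding abs_mult using r(1) F_bound[of 0 x \<psi>] by (intro mult_mono) auto
    then show ?thesis using r(4) by (simp add: mult.commute)
  qed
  have g: "gap ?y \<le> gap x - \<rho> * \<kappa>"
  proof (cases "x < Sm")
    case l: True
    then have "\<rho> * \<kappa> \<le> \<rho> * F 0 x \<psi>" using False x order r(1) by (intro mult_left_mono far_left) auto
    then show ?thesis using l False b order by (auto simp: gap_def)
  next
    case rr: False
    then have "\<rho> * F 0 x \<psi> \<le> \<rho> * (- \<kappa>)" using False x order pos r(1) by (intro mult_left_mono far_right) auto
    then show ?thesis using rr False b order by (auto simp: gap_def)
  qed
  have "lyapunov ?y \<le> exp ((K + \<gamma>) / \<kappa> * (gap x - \<rho> * \<kappa>))"
    unfolding lyapunov_def exp_le_cancel_iff by (rule mult_left_mono[OF g]) (use pos in auto)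
  also have "(K + \<gamma>) / \<kappa> * (gap x - \<rho> * \<kappa>) = (K + \<gamma>) / \<kappa> * gap x - (K + \<gamma>) * \<rho>"
    using pos by (simp add: field_simps)
  also have "exp \<dots> = lyapunov x * exp (- ((K + \<gamma>) * \<rho>))"
    unfolding lyapunov_def exp_add[symmetric] by simp
  finally have 1: "lyapunov ?y \<le> lyapunov x * exp (- ((K + \<gamma>) * \<rho>))" .
  have "1 + \<rho> * F 1 x \<psi> \<le> exp (K * \<rho>)"
    using growth_factor(2)[OF \<rho>, of x \<psi>] exp_ge_add_one_self[of "K * \<rho>"] by linarith
  then have "lyapunov ?y * (1 + \<rho> * F 1 x \<psi>) \<le> lyapunov x * exp (- ((K + \<gamma>) * \<rho>)) * exp (K * \<rho>)"
    using growth_factor(1)[OF \<rho>, of x \<psi>] lyapunov_ge_1[of x] by (intro mult_mono 1) auto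
  also have "\<dots> = lyapunov x * exp (- (\<gamma> * \<rho>))"
  proof -
    have "exp (- ((K + \<gamma>) * \<rho>)) * exp (K * \<rho>) = exp (- (\<gamma> * \<rho>))"
      unfolding exp_add[symmetric] by (simp add: distrib_right)
    then show ?thesis by (simp only: mult.assoc)
  qed
  also have "\<dots> \<le> lyapunov x * decay \<rho>"
  proof (rule mult_left_mono)
    let ?t = "\<gamma> * \<rho>"
    have t: "0 \<le> ?t" "?t \<le> 1" using r pos by auto
    \<comment> \<open>Valid for \<open>?t\<close> in [0, 1]; it turns
      \<open>1 + ?t \<le> exp ?t\<close> into \<open>exp (- ?t) \<le> 1 - ?t / 2\<close>.\<close>
    have "1 \<le> (1 + ?t) * (1 - ?t / 2)"
      using mult_left_mono[OF t(2,1)] by (simp add: algebra_simps)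
    also have "\<dots> \<le> exp ?t * (1 - ?t / 2)"
      using exp_ge_add_one_self[of ?t] t by (intro mult_right_mono) auto
    finally have "exp (- ?t) * 1 \<le> exp (- ?t) * (exp ?t * (1 - ?t / 2))" by (rule mult_left_mono) simp
    also have "exp (- ?t) * (exp ?t * (1 - ?t / 2)) = 1 - ?t / 2"
      unfolding mult.assoc[symmetric] exp_add[symmetric] by simp
    finally show "exp (- ?t) \<le> decay \<rho>" by (simp add: decay_def)
  qed (use lyapunov_ge_1[of x] in simp)
  finally show ?thesis by (simp add: mult.commute)
qed

text \<open>
  \<open>X\<close> is the slow orbit, \<open>P\<close> its derivative in the initial value, \<open>R\<close> the logarithmic derivative of
  \<open>P\<close>, and \<open>T\<close> the derivative of \<open>R\<close>.
\<close>

definition k0 :: "real \<Rightarrow> real \<Rightarrow> real^2 \<Rightarrow> real" where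
  "k0 \<rho> x p = F 2 x p / (1 + \<rho> * F 1 x p)"

text \<open>\<open>\<rho> * k0\<close> is the logarithmic derivative in \<open>x\<close> of the
  one-step growth factor, and \<open>k1\<close> is the derivative of \<open>k0\<close> in
  \<open>x\<close>.\<close>

definition k1 :: "real \<Rightarrow> real \<Rightarrow> real^2 \<Rightarrow> real" where
  "k1 \<rho> x p = (F 3 x p * (1 + \<rho> * F 1 x p) - \<rho> * (F 2 x p)\<^sup>2) / (1 + \<rho> * F 1 x p)\<^sup>2"

primrec X :: "real \<Rightarrow> nat \<Rightarrow> real \<Rightarrow> real^2 \<Rightarrow> real" where
  "X \<rho> 0 = (\<lambda>x \<psi>. x)"
| "X \<rho> (Suc n) = (\<lambda>x \<psi>. X \<rho> n x \<psi> + \<rho> * F 0 (X \<rho> n x \<psi>) (iter n \<psi>))"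

primrec P :: "real \<Rightarrow> nat \<Rightarrow> real \<Rightarrow> real^2 \<Rightarrow> real" where
  "P \<rho> 0 = (\<lambda>x \<psi>. 1)"
| "P \<rho> (Suc n) = (\<lambda>x \<psi>. P \<rho> n x \<psi> * (1 + \<rho> * F 1 (X \<rho> n x \<psi>) (iter n \<psi>)))"

primrec R :: "real \<Rightarrow> nat \<Rightarrow> real \<Rightarrow> real^2 \<Rightarrow> real" where
  "R \<rho> 0 = (\<lambda>x \<psi>. 0)"
| "R \<rho> (Suc n) = (\<lambda>x \<psi>. R \<rho> n x \<psi> + \<rho> * (P \<rho> n x \<psi> * k0 \<rho> (X \<rho> n x \<psi>) (iter n \<psi>)))"

primrec T :: "real \<Rightarrow> nat \<Rightarrow> real \<Rightarrow> real^2 \<Rightarrow> real" where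
  "T \<rho> 0 = (\<lambda>x \<psi>. 0)"
| "T \<rho> (Suc n) = (\<lambda>x \<psi>. T \<rho> n x \<psi> + \<rho> * (P \<rho> n x \<psi> * R \<rho> n x \<psi> * k0 \<rho> (X \<rho> n x \<psi>) (iter n \<psi>)
      + (P \<rho> n x \<psi>)\<^sup>2 * k1 \<rho> (X \<rho> n x \<psi>) (iter n \<psi>)))"

section \<open>Bounds and derivatives along the slow orbit, uniform in the number of steps\<close>

lemma growth_factor_pos: "small \<rho> \<Longrightarrow> 0 < 1 + \<rho> * F 1 x \<psi>"
  using growth_factor(1)[of \<rho> x \<psi>] by linarith

lemma growth_factor_nz: "small \<rho> \<Longrightarrow> 1 + \<rho> * F 1 x \<psi> \<noteq> 0"
  using growth_factor_pos[of \<rho> x \<psi>] by linarith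

lemma X_in_U: "small \<rho> \<Longrightarrow> x \<in> U \<Longrightarrow> X \<rho> n x \<psi> \<in> U"
  by (induction n) (auto simp del: atLeastAtMost_iff intro: step_in_U)

lemma P_pos: "small \<rho> \<Longrightarrow> 0 < P \<rho> n x \<psi>"
  by (induction n) (auto simp del: One_nat_def intro!: mult_pos_pos growth_factor_pos)

lemma P_lyapunov:
  assumes \<rho>: "small \<rho>" and x: "x \<in> U"
  shows "lyapunov (X \<rho> n x \<psi>) * P \<rho> n x \<psi> \<le> decay \<rho> ^ n * lyapunov x"
proof (induction n)
  case (Suc n)
  let ?X = "X \<rho> n x \<psi>" and ?q = "iter n \<psi>"
  have "lyapunov (X \<rho> (Suc n) x \<psi>) * P \<rho> (Suc n) x \<psi>
      = (lyapunov (?X + \<rho> * F 0 ?X ?q) * (1 + \<rho> * F 1 ?X ?q)) * P \<rho> n x \<psi>" by simp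
  also have "\<dots> \<le> (decay \<rho> * lyapunov ?X) * P \<rho> n x \<psi>"
    by (intro mult_right_mono lyapunov_step \<rho> X_in_U x less_imp_le P_pos)
  also have "\<dots> \<le> decay \<rho> * (decay \<rho> ^ n * lyapunov x)"
    using mult_left_mono[OF Suc, of "decay \<rho>"] decay[OF \<rho>] by (simp add: mult_ac)
  finally show ?case by simp
qed simp

lemma P_le:
  assumes \<rho>: "small \<rho>" and x: "x \<in> U"
  shows "P \<rho> n x \<psi> \<le> lyap_max * decay \<rho> ^ n"
proof -
  have "1 * P \<rho> n x \<psi> \<le> lyapunov (X \<rho> n x \<psi>) * P \<rho> n x \<psi>"
    by (intro mult_right_mono lyapunov_ge_1 less_imp_le P_pos \<rho>)
  also have "\<dots> \<le> decay \<rho> ^ n * lyapunov x" by (rule P_lyapunov[OF \<rho> x])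
  also have "\<dots> \<le> decay \<rho> ^ n * lyap_max"
    using decay_power[OF \<rho>, of n] by (intro mult_left_mono lyapunov_le x) auto
  finally show ?thesis by (simp add: mult.commute)
qed

lemma k0_bound: "small \<rho> \<Longrightarrow> \<bar>k0 \<rho> x p\<bar> \<le> 2 * K"
proof -
  assume \<rho>: "small \<rho>"
  have "\<bar>k0 \<rho> x p\<bar> = \<bar>F 2 x p\<bar> / (1 + \<rho> * F 1 x p)"
    using growth_factor_pos[OF \<rho>, of x p] by (simp add: k0_def abs_divide)
  also have "\<dots> \<le> K / (1 / 2)"
    by (rule frac_le[OF _ F_bound _ growth_factor(1)[OF \<rho>]]) (use pos in auto)
  finally show ?thesis by simp
qed

lemma k1_bound: "small \<rho> \<Longrightarrow> \<bar>k1 \<rho> x p\<bar> \<le> 8 * K"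
proof -
  assume \<rho>: "small \<rho>"
  note r = smallD[OF \<rho>]
  let ?g = "1 + \<rho> * F 1 x p"
  have g: "1 / 2 \<le> ?g" "\<bar>?g\<bar> \<le> 3 / 2" using growth_factor[OF \<rho>, of x p] r(3) by (simp_all only: abs_le_iff, linarith+)
  have "\<bar>F 3 x p * ?g - \<rho> * (F 2 x p)\<^sup>2\<bar> \<le> \<bar>F 3 x p\<bar> * \<bar>?g\<bar> + \<rho> * (\<bar>F 2 x p\<bar> * \<bar>F 2 x p\<bar>)"
    using abs_triangle_ineq4[of "F 3 x p * ?g" "\<rho> * (F 2 x p)\<^sup>2"] r
    by (simp add: abs_mult power2_eq_square)
  also have "\<dots> \<le> K * (3 / 2) + \<rho> * (K * K)"
    using r pos g(2) by (intro add_mono mult_mono mult_left_mono F_bound) auto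
  also have "\<dots> \<le> 2 * K"
  proof -
    have "K * (2 * K * \<rho>) \<le> K * 1" using r(3) pos by (intro mult_left_mono) auto
    then show ?thesis by (simp add: algebra_simps)
  qed
  finally have n: "\<bar>F 3 x p * ?g - \<rho> * (F 2 x p)\<^sup>2\<bar> \<le> 2 * K" .
  have d: "1 / 4 \<le> ?g\<^sup>2" using power_mono[OF g(1), of 2] by (simp add: power2_eq_square)
  have "\<bar>k1 \<rho> x p\<bar> \<le> 2 * K / (1 / 4)"
    unfolding k1_def abs_divide using n d pos by (intro frac_le) auto
  then show ?thesis by simp
qed

text \<open>The increments carry a factor \<rho>, which cancels against
  \<open>1 - decay \<rho>\<close> in the geometric series. Hence quantities with such increments
  stay bounded independently of \<rho> and of the number of steps.\<close>

lemma geometric_tail: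
  assumes \<rho>: "small \<rho>" and B: "0 \<le> B" and z: "\<And>n. \<bar>z (Suc n) - z n\<bar> \<le> B * \<rho> * decay \<rho> ^ n"
  shows "\<bar>z (n + k) - z n\<bar> \<le> 2 * B / \<gamma> * decay \<rho> ^ n"
proof -
  have "\<bar>z (n + k) - z n\<bar> \<le> (\<Sum>j<k. B * \<rho> * decay \<rho> ^ (n + j))"
  proof (induction k)
    case (Suc k)
    then show ?case using z[of "n + k"] by simp
  qed simp
  also have "\<dots> = B * \<rho> * decay \<rho> ^ n * (\<Sum>j<k. decay \<rho> ^ j)"
    by (simp add: sum_distrib_left power_add mult_ac)
  also have "\<dots> \<le> B * \<rho> * decay \<rho> ^ n * (1 / (1 - decay \<rho>))"
    using decay[OF \<rho>] smallD(1)[OF \<rho>] B decay_power[OF \<rho>, of n]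
    by (intro mult_left_mono sum_powers_le) auto
  also have "\<dots> = 2 * B / \<gamma> * decay \<rho> ^ n"
    unfolding decay(4)[OF \<rho>] using smallD(1)[OF \<rho>] pos by simp
  finally show ?thesis .
qed

definition CR :: real where "CR = 2 * (2 * K * lyap_max) / \<gamma>"

text \<open>\<open>CR\<close> bounds the values of \<open>R\<close>, whereas \<open>CT\<close>
  bounds the increments of \<open>T\<close> relative to
  \<open>\<rho> * decay \<rho> ^ n\<close>.\<close>

definition CT :: real where "CT = 2 * K * lyap_max * CR + 8 * K * lyap_max\<^sup>2"

lemma CR_pos: "0 \<le> CR" and CT_pos: "0 \<le> CT"
  using pos lyap_max_ge by (auto simp: CR_def CT_def)

lemma R_step:
  assumes \<rho>: "small \<rho>" and x: "x \<in> U"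
  shows "\<bar>R \<rho> (Suc n) x \<psi> - R \<rho> n x \<psi>\<bar> \<le> 2 * K * lyap_max * \<rho> * decay \<rho> ^ n"
proof -
  have "\<bar>R \<rho> (Suc n) x \<psi> - R \<rho> n x \<psi>\<bar> = \<rho> * (P \<rho> n x \<psi> * \<bar>k0 \<rho> (X \<rho> n x \<psi>) (iter n \<psi>)\<bar>)"
    using smallD(1)[OF \<rho>] P_pos[OF \<rho>, of n x \<psi>] by (simp add: abs_mult)
  also have "\<dots> \<le> \<rho> * ((lyap_max * decay \<rho> ^ n) * (2 * K))"
    using smallD(1)[OF \<rho>] pos P_pos[OF \<rho>, of n x \<psi>] lyap_max_ge decay_power[OF \<rho>, of n]
    by (intro mult_left_mono mult_mono P_le \<rho> x k0_bound) auto
  finally show ?thesis by (simp add: mult_ac)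
qed

lemma R_bound: "small \<rho> \<Longrightarrow> x \<in> U \<Longrightarrow> \<bar>R \<rho> n x \<psi>\<bar> \<le> CR"
  using geometric_tail[where z="\<lambda>n. R \<rho> n x \<psi>" and n=0 and k=n, OF _ _ R_step] pos lyap_max_ge
  by (simp add: CR_def)

lemma T_step:
  assumes \<rho>: "small \<rho>" and x: "x \<in> U"
  shows "\<bar>T \<rho> (Suc n) x \<psi> - T \<rho> n x \<psi>\<bar> \<le> CT * \<rho> * decay \<rho> ^ n"
proof -
  let ?p = "P \<rho> n x \<psi>" and ?r = "R \<rho> n x \<psi>"
  let ?k0 = "k0 \<rho> (X \<rho> n x \<psi>) (iter n \<psi>)" and ?k1 = "k1 \<rho> (X \<rho> n x \<psi>) (iter n \<psi>)"
  note p = P_pos[OF \<rho>, of n x \<psi>] P_le[OF \<rho> x, of n \<psi>]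
  note d = decay_power[OF \<rho>, of n]
  have p2: "?p\<^sup>2 \<le> lyap_max\<^sup>2 * decay \<rho> ^ n"
  proof -
    have "?p * ?p \<le> (lyap_max * decay \<rho> ^ n) * (lyap_max * 1)"
      using p d lyap_max_ge by (intro mult_mono order_trans[OF p(2) mult_left_mono[OF d(2)]]) auto
    then show ?thesis by (simp add: power2_eq_square mult_ac)
  qed
  have "\<bar>?p * ?r * ?k0 + ?p\<^sup>2 * ?k1\<bar> \<le> ?p * \<bar>?r\<bar> * \<bar>?k0\<bar> + ?p\<^sup>2 * \<bar>?k1\<bar>"
    using abs_mult_add_le[of "?p * ?r" ?k0 "?p\<^sup>2" ?k1] p by (simp add: abs_mult)
  also have "\<dots> \<le> (lyap_max * decay \<rho> ^ n) * CR * (2 * K) + (lyap_max\<^sup>2 * decay \<rho> ^ n) * (8 * K)"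
    using p d lyap_max_ge CR_pos pos
    by (intro add_mono mult_mono R_bound k0_bound k1_bound p2 \<rho> x mult_nonneg_nonneg) auto
  also have "\<dots> = CT * decay \<rho> ^ n" by (simp add: CT_def algebra_simps)
  finally have "\<rho> * \<bar>?p * ?r * ?k0 + ?p\<^sup>2 * ?k1\<bar> \<le> \<rho> * (CT * decay \<rho> ^ n)"
    using smallD(1)[OF \<rho>] by (intro mult_left_mono) auto
  then show ?thesis using smallD(1)[OF \<rho>] by (simp add: abs_mult mult_ac)
qed

lemma T_bound: "small \<rho> \<Longrightarrow> x \<in> U \<Longrightarrow> \<bar>T \<rho> n x \<psi>\<bar> \<le> 2 * CT / \<gamma>"
  using geometric_tail[where z="\<lambda>n. T \<rho> n x \<psi>" and n=0 and k=n, OF _ _ T_step] CT_pos by simp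

lemma F_DERIV_compose:
  assumes "n < 5" "(g has_real_derivative g') (at x)"
  shows "((\<lambda>x. F n (g x) p) has_real_derivative F (Suc n) (g x) p * g') (at x)"
  using DERIV_chain2[OF F_deriv[OF assms(1)] assms(2)] .

lemma X_deriv: "((\<lambda>x. X \<rho> n x \<psi>) has_real_derivative P \<rho> n x \<psi>) (at x)"
proof (induction n)
  case (Suc n)
  have "((\<lambda>x. X \<rho> n x \<psi> + \<rho> * F 0 (X \<rho> n x \<psi>) (iter n \<psi>)) has_real_derivative
      P \<rho> n x \<psi> + \<rho> * (F (Suc 0) (X \<rho> n x \<psi>) (iter n \<psi>) * P \<rho> n x \<psi>)) (at x)"
    by (intro DERIV_add DERIV_cmult F_DERIV_compose Suc) simp
  then show ?case by (simp add: algebra_simps)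
qed simp

lemma P_deriv: 
  assumes \<rho>: "small \<rho>"
  shows "((\<lambda>x. P \<rho> n x \<psi>) has_real_derivative P \<rho> n x \<psi> * R \<rho> n x \<psi>) (at x)"
proof (induction n)
  case (Suc n)
  let ?g = "1 + \<rho> * F 1 (X \<rho> n x \<psi>) (iter n \<psi>)"
  have "((\<lambda>x. P \<rho> n x \<psi> * (1 + \<rho> * F 1 (X \<rho> n x \<psi>) (iter n \<psi>))) has_real_derivative
      P \<rho> n x \<psi> * R \<rho> n x \<psi> * ?g + (0 + \<rho> * (F (Suc 1) (X \<rho> n x \<psi>) (iter n \<psi>) * P \<rho> n x \<psi>)) * P \<rho> n x \<psi>) (at x)"
    by (intro DERIV_mult DERIV_add DERIV_const DERIV_cmult F_DERIV_compose X_deriv Suc) simp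
  moreover have "k0 \<rho> (X \<rho> n x \<psi>) (iter n \<psi>) * ?g = F 2 (X \<rho> n x \<psi>) (iter n \<psi>)"
    using growth_factor_nz[OF \<rho>] by (simp add: k0_def)
  moreover have "P \<rho> n x \<psi> * R \<rho> n x \<psi> * ?g + (0 + \<rho> * (F (Suc 1) (X \<rho> n x \<psi>) (iter n \<psi>) * P \<rho> n x \<psi>)) * P \<rho> n x \<psi>
      = P \<rho> (Suc n) x \<psi> * R \<rho> (Suc n) x \<psi>"
    if "k0 \<rho> (X \<rho> n x \<psi>) (iter n \<psi>) * ?g = F 2 (X \<rho> n x \<psi>) (iter n \<psi>)"
  proof -
    have 2: "F (Suc 1) (X \<rho> n x \<psi>) (iter n \<psi>) = k0 \<rho> (X \<rho> n x \<psi>) (iter n \<psi>) * ?g"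
      using that by (simp add: numeral_2_eq_2)
    show ?thesis unfolding 2 by (simp add: algebra_simps)
  qed
  ultimately show ?case by simp
qed simp

lemma R_deriv:
  assumes \<rho>: "small \<rho>"
  shows "((\<lambda>x. R \<rho> n x \<psi>) has_real_derivative T \<rho> n x \<psi>) (at x)"
proof (induction n)
  case (Suc n)
  let ?q = "iter n \<psi>" and ?X = "X \<rho> n x \<psi>" and ?P = "P \<rho> n x \<psi>"
  let ?g = "1 + \<rho> * F 1 ?X ?q"
  have k: "((\<lambda>x. k0 \<rho> (X \<rho> n x \<psi>) ?q) has_real_derivative k1 \<rho> ?X ?q * ?P) (at x)"
  proof -
    have "((\<lambda>x. k0 \<rho> (X \<rho> n x \<psi>) ?q) has_real_derivative
        ((F (Suc 2) ?X ?q * ?P) * ?g - F 2 ?X ?q * (0 + \<rho> * (F (Suc 1) ?X ?q * ?P))) / (?g * ?g)) (at x)"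
      unfolding k0_def
      by (intro DERIV_divide DERIV_add DERIV_const DERIV_cmult F_DERIV_compose X_deriv growth_factor_nz \<rho>) simp_all
    moreover have "((F (Suc 2) ?X ?q * ?P) * ?g - F 2 ?X ?q * (0 + \<rho> * (F (Suc 1) ?X ?q * ?P))) / (?g * ?g)
        = k1 \<rho> ?X ?q * ?P"
      unfolding k1_def by (simp add: numeral_2_eq_2[symmetric] numeral_3_eq_3[symmetric] power2_eq_square algebra_simps del: One_nat_def)
    ultimately show ?thesis by simp
  qed
  have "((\<lambda>x. R \<rho> n x \<psi> + \<rho> * (P \<rho> n x \<psi> * k0 \<rho> (X \<rho> n x \<psi>) ?q)) has_real_derivative
      T \<rho> n x \<psi> + \<rho> * (?P * R \<rho> n x \<psi> * k0 \<rho> ?X ?q + k1 \<rho> ?X ?q * ?P * ?P)) (at x)"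
    by (intro DERIV_mult DERIV_add DERIV_cmult k P_deriv \<rho> Suc)
  then show ?case by (simp add: power2_eq_square mult_ac)
qed simp

lemma X_continuous: "continuous_on S (\<lambda>(x, \<psi>). X \<rho> n x \<psi>)"
proof -
  have "continuous_on S (\<lambda>z. X \<rho> n (fst z) (snd z))" for S
  proof (induction n)
    case (Suc n)
    have "continuous_on S (\<lambda>z. (\<lambda>(x, p). F 0 x p) (X \<rho> n (fst z) (snd z), iter n (snd z)))"
      by (intro continuous_on_compose2[OF F_continuous[of 0 UNIV]] continuous_intros Suc
          continuous_on_compose2[OF continuous_on_iter[of UNIV]]) auto
    then show ?case by (auto intro!: continuous_intros Suc)
  qed (auto intro: continuous_intros)
  then show ?thesis by (simp add: split_beta)
qed

lemma F_X_continuous: "k \<le> 5 \<Longrightarrow> continuous_on S (\<lambda>z. F k (X \<rho> n (fst z) (snd z)) (iter n (snd z)))"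
proof -
  assume k: "k \<le> 5"
  have "continuous_on S (\<lambda>z. (\<lambda>(x, p). F k x p) (X \<rho> n (fst z) (snd z), iter n (snd z)))"
    by (intro continuous_on_compose2[OF F_continuous[OF k, of UNIV]] continuous_intros
        X_continuous[unfolded split_beta]
        continuous_on_compose2[OF continuous_on_iter[of UNIV]]) auto
  then show ?thesis by simp
qed

lemma P_continuous: "continuous_on S (\<lambda>(x, \<psi>). P \<rho> n x \<psi>)"
  unfolding split_beta by (induction n) (auto intro!: continuous_intros F_X_continuous)

lemma R_continuous: "small \<rho> \<Longrightarrow> continuous_on S (\<lambda>(x, \<psi>). R \<rho> n x \<psi>)"
  unfolding split_beta
  by (induction n) (auto simp: k0_def growth_factor_nz simp del: One_nat_def
      intro!: continuous_intros F_X_continuous P_continuous[unfolded split_beta])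

lemma T_continuous: "small \<rho> \<Longrightarrow> continuous_on S (\<lambda>(x, \<psi>). T \<rho> n x \<psi>)"
  unfolding split_beta
  by (induction n) (auto simp: k0_def k1_def growth_factor_nz simp del: One_nat_def
      intro!: continuous_intros F_X_continuous P_continuous[unfolded split_beta] R_continuous[unfolded split_beta])

section \<open>Concentration of the slow variables\<close>

text \<open>Initial points may depend on \<open>\<psi>\<close>, because they are taken between
  \<open>\<phi>\<close> and the invariant graph. The Hoelder bound asks of them what
  \<open>slow\<close> asks of the orbit at time 0.\<close>

definition admissible :: "real \<Rightarrow> real \<Rightarrow> (real^2 \<Rightarrow> real) \<Rightarrow> bool" where
  "admissible c0 \<rho> X0 \<longleftrightarrow> torus_cont X0 \<and> (\<forall>\<psi>. X0 \<psi> \<in> U) \<and>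
     (\<forall>\<psi> s. \<bar>X0 (\<psi> + s *\<^sub>R eu) - X0 \<psi>\<bar> \<le> c0 * \<rho> * \<bar>s\<bar> powr \<alpha>)"

lemma admissibleD:
  assumes "admissible c0 \<rho> X0"
  shows "torus_cont X0" "X0 \<psi> \<in> U" "\<bar>X0 (\<psi> + s *\<^sub>R eu) - X0 \<psi>\<bar> \<le> c0 * \<rho> * \<bar>s\<bar> powr \<alpha>"
  using assms unfolding admissible_def by blast+

lemma torus_cont_X: "torus_cont X0 \<Longrightarrow> torus_cont (\<lambda>\<psi>. X \<rho> n (X0 \<psi>) \<psi>)"
  by (induction n) (auto intro!: torus_cont_add torus_cont_mult torus_cont_F_iter)

lemma torus_cont_P: "torus_cont X0 \<Longrightarrow> torus_cont (\<lambda>\<psi>. P \<rho> n (X0 \<psi>) \<psi>)"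
  by (induction n) (auto intro!: torus_cont_add torus_cont_mult torus_cont_F_iter torus_cont_X)

lemma torus_cont_R: "small \<rho> \<Longrightarrow> torus_cont X0 \<Longrightarrow> torus_cont (\<lambda>\<psi>. R \<rho> n (X0 \<psi>) \<psi>)"
  by (induction n) (auto simp: k0_def growth_factor_nz simp del: One_nat_def
      intro!: torus_cont_add torus_cont_mult torus_cont_divide torus_cont_F_iter torus_cont_X torus_cont_P)

lemma torus_cont_T: "small \<rho> \<Longrightarrow> torus_cont X0 \<Longrightarrow> torus_cont (\<lambda>\<psi>. T \<rho> n (X0 \<psi>) \<psi>)"
  by (induction n) (auto simp: k0_def k1_def growth_factor_nz simp del: One_nat_def
      intro!: torus_cont_add torus_cont_diff torus_cont_mult torus_cont_power torus_cont_divide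
        torus_cont_F_iter torus_cont_X torus_cont_P torus_cont_R)

lemma lam_powr_gt_1: "1 < \<bar>lam\<bar> powr \<alpha>"
  using lam alpha by (rule gr_one_powr)

lemma F_iter_diff:
  assumes "n \<le> 5"
  shows "\<bar>F n x (iter m (\<psi> + s *\<^sub>R eu)) - F n y (iter m \<psi>)\<bar>
    \<le> K * \<bar>x - y\<bar> + K * norm eu powr \<alpha> * (\<bar>lam\<bar> ^ m * \<bar>s\<bar>) powr \<alpha>"
proof -
  have "\<bar>F n y (iter m (\<psi> + s *\<^sub>R eu)) - F n y (iter m \<psi>)\<bar>
      \<le> K * dist (iter m (\<psi> + s *\<^sub>R eu)) (iter m \<psi>) powr \<alpha>"
    using F_holder[OF assms] by (simp add: holder_def)
  then show ?thesis
    using F_lipschitz[OF assms, of x "iter m (\<psi> + s *\<^sub>R eu)" y] unfolding dist_iter_shift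
    by (simp add: mult.assoc)
qed

text \<open>The constant is obtained before \<rho> and the initial points, hence is uniform in both.
  A difference along the unstable line is amplified by at most \<open>1 + K * \<rho>\<close> per
  step and receives \<rho> times a Hoelder bound on the displacement of the fast variable, so
  \<open>holder_gronwall\<close> applies.\<close>

lemma slow_X:
  assumes c0: "0 \<le> c0"
  obtains C where "0 \<le> C"
    "\<And>\<rho> X0. small \<rho> \<Longrightarrow> admissible c0 \<rho> X0 \<Longrightarrow> slow C \<rho> 1 (\<lambda>n \<psi>. X \<rho> n (X0 \<psi>) \<psi>)"
proof -
  let ?Q = "\<bar>lam\<bar> powr \<alpha>" and ?e = "norm eu powr \<alpha>"
  define c where "c = c0 + 2 * (K * ?e) / (?Q - 1)"
  have Q: "0 < ?Q - 1" using lam_powr_gt_1 by simp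
  have c: "c0 \<le> c" "2 * (K * ?e) \<le> c * (?Q - 1)" "0 \<le> c"
    using Q c0 pos by (auto simp: c_def distrib_right)
  define C where "C = \<bar>pm\<bar> + \<bar>pM\<bar> + K + c"
  have "slow C \<rho> 1 (\<lambda>n \<psi>. X \<rho> n (X0 \<psi>) \<psi>)" if \<rho>: "small \<rho>" and X0: "admissible c0 \<rho> X0" for \<rho> X0
    unfolding slow_def power_one mult_1_right
  proof (intro conjI allI)
    note r = smallD[OF \<rho>] and a = admissibleD[OF X0]
    fix n \<psi> s
    show "torus_cont (\<lambda>\<psi>. X \<rho> n (X0 \<psi>) \<psi>)" by (intro torus_cont_X a)
    show "\<bar>X \<rho> n (X0 \<psi>) \<psi>\<bar> \<le> C"
      using X_in_U[OF \<rho> a(2), of n \<psi> \<psi>] c(3) pos by (auto simp: C_def)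
    have "\<bar>X \<rho> (Suc n) (X0 \<psi>) \<psi> - X \<rho> n (X0 \<psi>) \<psi>\<bar> \<le> \<rho> * K"
      using r(1) by (auto simp: abs_mult intro!: mult_left_mono F_bound)
    also have "\<dots> \<le> C * \<rho>" using r(1) c(3) by (simp add: C_def mult_right_mono mult.commute)
    finally show "\<bar>X \<rho> (Suc n) (X0 \<psi>) \<psi> - X \<rho> n (X0 \<psi>) \<psi>\<bar> \<le> C * \<rho>" .
    let ?\<psi> = "\<psi> + s *\<^sub>R eu"
    have "\<bar>X \<rho> n (X0 ?\<psi>) ?\<psi> - X \<rho> n (X0 \<psi>) \<psi>\<bar> \<le> c * \<rho> * (\<bar>lam\<bar> ^ n * \<bar>s\<bar>) powr \<alpha>"
    proof (rule holder_gronwall[where \<delta>="\<lambda>n. \<bar>X \<rho> n (X0 ?\<psi>) ?\<psi> - X \<rho> n (X0 \<psi>) \<psi>\<bar>" and a=K and b="K * ?e"])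
      fix n
      let ?x = "X \<rho> n (X0 ?\<psi>) ?\<psi>" and ?y = "X \<rho> n (X0 \<psi>) \<psi>"
      have "\<bar>\<rho> * (F 0 ?x (iter n ?\<psi>) - F 0 ?y (iter n \<psi>))\<bar>
          \<le> \<rho> * (K * \<bar>?x - ?y\<bar> + K * ?e * (\<bar>lam\<bar> ^ n * \<bar>s\<bar>) powr \<alpha>)"
        unfolding abs_mult using r(1) F_iter_diff[of 0 ?x n \<psi> s ?y] by (intro mult_mono) auto
      then show "\<bar>X \<rho> (Suc n) (X0 ?\<psi>) ?\<psi> - X \<rho> (Suc n) (X0 \<psi>) \<psi>\<bar>
          \<le> (1 + K * \<rho>) * \<bar>?x - ?y\<bar> + K * ?e * \<rho> * (\<bar>lam\<bar> ^ n * \<bar>s\<bar>) powr \<alpha>"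
        by (simp add: algebra_simps)
    next
      have "0 \<le> K * \<rho>" using r(1) pos by simp
      then show "2 * K * \<rho> \<le> ?Q - 1" using r(7) by linarith
    qed (use a(3) c pos r in auto)
    also have "\<dots> \<le> C * \<rho> * (\<bar>lam\<bar> ^ n * \<bar>s\<bar>) powr \<alpha>"
      using r(1) pos by (intro mult_right_mono) (auto simp: C_def)
    finally show "\<bar>X \<rho> n (X0 ?\<psi>) ?\<psi> - X \<rho> n (X0 \<psi>) \<psi>\<bar> \<le> C * \<rho> * (\<bar>lam\<bar> ^ n * \<bar>s\<bar>) powr \<alpha>" .
  qed
  moreover have "0 \<le> C" using c pos by (simp add: C_def)
  ultimately show ?thesis by (rule that[rotated])
qed

text \<open>The difference is estimated relative to \<open>P\<close> itself: the ratio obeys a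
  recursion of the form in \<open>holder_gronwall\<close>, and multiplying back by \<open>P\<close>
  restores the factor \<open>decay \<rho> ^ n\<close>, which a direct estimate of the difference
  would lose.\<close>

lemma slow_P:
  assumes c0: "0 \<le> c0"
  obtains C where "0 \<le> C"
    "\<And>\<rho> X0. small \<rho> \<Longrightarrow> admissible c0 \<rho> X0 \<Longrightarrow> slow C \<rho> (decay \<rho>) (\<lambda>n \<psi>. P \<rho> n (X0 \<psi>) \<psi>)"
proof -
  obtain D where D: "0 \<le> D"
    and sX: "\<And>\<rho> X0. small \<rho> \<Longrightarrow> admissible c0 \<rho> X0 \<Longrightarrow> slow D \<rho> 1 (\<lambda>n \<psi>. X \<rho> n (X0 \<psi>) \<psi>)"
    using slow_X[OF c0] by blast
  let ?Q = "\<bar>lam\<bar> powr \<alpha>" and ?e = "norm eu powr \<alpha>"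
  define b where "b = 2 * K * (D + ?e)"
  define c where "c = 2 * b / (?Q - 1)"
  have Q: "0 < ?Q - 1" using lam_powr_gt_1 by simp
  have b: "0 \<le> b" using D pos by (simp add: b_def)
  have c: "0 \<le> c" "2 * b \<le> c * (?Q - 1)" using Q b by (auto simp: c_def)
  define C where "C = lyap_max * (1 + K + c)"
  have L: "lyap_max \<le> C" "lyap_max * K \<le> C" "lyap_max * c \<le> C"
    using lyap_max_ge c pos by (auto simp: C_def intro: mult_left_mono mult_left_le)
  have "slow C \<rho> (decay \<rho>) (\<lambda>n \<psi>. P \<rho> n (X0 \<psi>) \<psi>)" if \<rho>: "small \<rho>" and X0: "admissible c0 \<rho> X0" for \<rho> X0
    unfolding slow_def
  proof (intro conjI allI)
    note r = smallD[OF \<rho>] and a = admissibleD[OF X0] and d = decay_power[OF \<rho>]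
    note sx = slowD[OF sX[OF \<rho> X0], unfolded power_one mult_1_right]
    fix n \<psi> s
    note Pn = P_le[OF \<rho> a(2), of n \<psi> \<psi>] P_pos[OF \<rho>, of n "X0 \<psi>" \<psi>]
    show "torus_cont (\<lambda>\<psi>. P \<rho> n (X0 \<psi>) \<psi>)" by (intro torus_cont_P a)
    show "\<bar>P \<rho> n (X0 \<psi>) \<psi>\<bar> \<le> C * decay \<rho> ^ n"
      using order_trans[OF Pn(1) mult_right_mono[OF L(1) less_imp_le[OF d(1)]]] Pn(2) by simp
    have "\<bar>P \<rho> (Suc n) (X0 \<psi>) \<psi> - P \<rho> n (X0 \<psi>) \<psi>\<bar> = P \<rho> n (X0 \<psi>) \<psi> * (\<rho> * \<bar>F 1 (X \<rho> n (X0 \<psi>) \<psi>) (iter n \<psi>)\<bar>)"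
      using Pn(2) r(1) by (simp add: abs_mult algebra_simps del: One_nat_def)
    also have "\<dots> \<le> (lyap_max * decay \<rho> ^ n) * (\<rho> * K)"
      using Pn r(1) d[of n] lyap_max_ge by (intro mult_mono mult_left_mono F_bound) auto
    also have "\<dots> = (lyap_max * K) * (\<rho> * decay \<rho> ^ n)" by simp
    also have "\<dots> \<le> C * (\<rho> * decay \<rho> ^ n)" using r(1) d[of n] by (intro mult_right_mono L) auto
    finally show "\<bar>P \<rho> (Suc n) (X0 \<psi>) \<psi> - P \<rho> n (X0 \<psi>) \<psi>\<bar> \<le> C * \<rho> * decay \<rho> ^ n" by simp
    let ?\<psi> = "\<psi> + s *\<^sub>R eu"
    have "\<bar>P \<rho> n (X0 ?\<psi>) ?\<psi> - P \<rho> n (X0 \<psi>) \<psi>\<bar> / P \<rho> n (X0 \<psi>) \<psi> \<le> c * \<rho> * (\<bar>lam\<bar> ^ n * \<bar>s\<bar>) powr \<alpha>"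
    proof (rule holder_gronwall[where \<delta>="\<lambda>n. \<bar>P \<rho> n (X0 ?\<psi>) ?\<psi> - P \<rho> n (X0 \<psi>) \<psi>\<bar> / P \<rho> n (X0 \<psi>) \<psi>"
          and a="4 * K" and b=b and ?c0.0=0])
      fix n
      let ?x = "X \<rho> n (X0 ?\<psi>) ?\<psi>" and ?y = "X \<rho> n (X0 \<psi>) \<psi>"
      let ?p' = "P \<rho> n (X0 ?\<psi>) ?\<psi>" and ?p = "P \<rho> n (X0 \<psi>) \<psi>"
      let ?g' = "1 + \<rho> * F 1 ?x (iter n ?\<psi>)" and ?g = "1 + \<rho> * F 1 ?y (iter n \<psi>)"
      let ?d = "(\<bar>lam\<bar> ^ n * \<bar>s\<bar>) powr \<alpha>"
      have p: "0 < ?p" by (rule P_pos[OF \<rho>])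
      have g: "1 / 2 \<le> ?g" "0 < ?g" "0 < ?g'" by (rule growth_factor[OF \<rho>] growth_factor_pos[OF \<rho>])+
      \<comment> \<open>With \<open>k = K * \<rho> \<le> 1 / 2\<close> one has
        \<open>1 + k \<le> (1 + 4 * k) * (1 - k)\<close>. This growth rate is the origin of the 8 in
        \<open>small\<close>.\<close>
      have gg: "?g' / ?g \<le> 1 + 4 * K * \<rho>"
      proof -
        have k: "0 \<le> K * \<rho>" using r(1) pos by simp
        have "?g' \<le> 1 + K * \<rho>" by (rule growth_factor[OF \<rho>])
        also have "\<dots> \<le> (1 + 4 * (K * \<rho>)) * (1 - K * \<rho>)"
          using mult_left_mono[of "2 * (K * \<rho>)" 1 "K * \<rho>"] r(3) k by (simp add: algebra_simps)
        also have "\<dots> \<le> (1 + 4 * (K * \<rho>)) * ?g"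
          by (rule mult_left_mono[OF growth_factor(3)[OF \<rho>]]) (use k in linarith)
        finally show ?thesis using g by (simp add: pos_divide_le_eq mult.assoc)
      qed
      have "\<bar>?g' - ?g\<bar> = \<rho> * \<bar>F 1 ?x (iter n ?\<psi>) - F 1 ?y (iter n \<psi>)\<bar>"
        using r(1) by (simp add: right_diff_distrib[symmetric] abs_mult del: One_nat_def)
      also have "\<dots> \<le> \<rho> * (K * \<bar>?x - ?y\<bar> + K * ?e * ?d)"
        using r(1) by (intro mult_left_mono F_iter_diff) auto
      also have "\<dots> \<le> \<rho> * (K * (D * 1 * ?d) + K * ?e * ?d)"
      proof -
        have "\<bar>?x - ?y\<bar> \<le> D * \<rho> * ?d" by (rule sx)
        also have "\<dots> \<le> D * 1 * ?d" using r D by (intro mult_right_mono mult_left_mono) auto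
        finally show ?thesis using r(1) pos by (intro mult_left_mono add_right_mono) auto
      qed
      also have "\<dots> = b / 2 * \<rho> * ?d" by (simp add: b_def algebra_simps)
      finally have "\<bar>?g' - ?g\<bar> / ?g \<le> (b / 2 * \<rho> * ?d) / (1 / 2)"
        using g b r(1) by (intro frac_le) auto
      then have g2: "\<bar>?g' - ?g\<bar> / ?g \<le> b * \<rho> * ?d" by simp
      have "\<bar>?p' * ?g' - ?p * ?g\<bar> \<le> \<bar>?p' - ?p\<bar> * ?g' + ?p * \<bar>?g' - ?g\<bar>"
        using abs_mult_add_le[of "?p' - ?p" ?g' ?p "?g' - ?g"] p g by (simp add: algebra_simps del: One_nat_def)
      then have "\<bar>?p' * ?g' - ?p * ?g\<bar> / (?p * ?g) \<le> (\<bar>?p' - ?p\<bar> * ?g' + ?p * \<bar>?g' - ?g\<bar>) / (?p * ?g)"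
        using p g by (intro divide_right_mono) auto
      also have "\<dots> = (\<bar>?p' - ?p\<bar> / ?p) * (?g' / ?g) + \<bar>?g' - ?g\<bar> / ?g"
      proof -
        have "(a * g' + q * e) / (q * g) = a / q * (g' / g) + e / g" if "q > 0" "g > 0" for a g' q e g :: real
          using that by (simp add: field_simps)
        from this[OF p g(2)] show ?thesis .
      qed
      also have "\<dots> \<le> (\<bar>?p' - ?p\<bar> / ?p) * (1 + 4 * K * \<rho>) + b * \<rho> * ?d"
        using p by (intro add_mono mult_left_mono gg g2) auto
      finally show "\<bar>P \<rho> (Suc n) (X0 ?\<psi>) ?\<psi> - P \<rho> (Suc n) (X0 \<psi>) \<psi>\<bar> / P \<rho> (Suc n) (X0 \<psi>) \<psi>
          \<le> (1 + 4 * K * \<rho>) * (\<bar>?p' - ?p\<bar> / ?p) + b * \<rho> * ?d" by (simp add: mult.commute)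
    next
      show "2 * (4 * K) * \<rho> \<le> ?Q - 1" using r(7) by simp
    qed (use c pos r in auto)
    then have "\<bar>P \<rho> n (X0 ?\<psi>) ?\<psi> - P \<rho> n (X0 \<psi>) \<psi>\<bar> \<le> (c * \<rho> * (\<bar>lam\<bar> ^ n * \<bar>s\<bar>) powr \<alpha>) * P \<rho> n (X0 \<psi>) \<psi>"
      using Pn(2) by (simp add: pos_divide_le_eq)
    also have "\<dots> \<le> (c * \<rho> * (\<bar>lam\<bar> ^ n * \<bar>s\<bar>) powr \<alpha>) * (lyap_max * decay \<rho> ^ n)"
      using c r(1) by (intro mult_left_mono Pn) auto
    also have "\<dots> = (lyap_max * c) * (\<rho> * decay \<rho> ^ n * (\<bar>lam\<bar> ^ n * \<bar>s\<bar>) powr \<alpha>)" by simp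
    also have "\<dots> \<le> C * (\<rho> * decay \<rho> ^ n * (\<bar>lam\<bar> ^ n * \<bar>s\<bar>) powr \<alpha>)"
      using r(1) d[of n] by (intro mult_right_mono L) auto
    finally show "\<bar>P \<rho> n (X0 ?\<psi>) ?\<psi> - P \<rho> n (X0 \<psi>) \<psi>\<bar> \<le> C * \<rho> * decay \<rho> ^ n * (\<bar>lam\<bar> ^ n * \<bar>s\<bar>) powr \<alpha>"
      by (simp add: mult.assoc)
  qed
  moreover have "0 \<le> C" using L(1) lyap_max_ge by linarith
  ultimately show ?thesis by (rule that[rotated])
qed

lemma k0_diff:
  assumes \<rho>: "small \<rho>"
  shows "\<bar>k0 \<rho> x p - k0 \<rho> y q\<bar> \<le> 2 * \<bar>F 2 x p - F 2 y q\<bar> + 2 * \<bar>F 1 x p - F 1 y q\<bar>"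
proof -
  note r = smallD[OF \<rho>]
  let ?g = "1 + \<rho> * F 1 x p" and ?h = "1 + \<rho> * F 1 y q"
  have g: "1 / 2 \<le> ?g" "0 < ?g" "0 < ?h" "1 / 2 \<le> ?h"
    by (rule growth_factor[OF \<rho>] growth_factor_pos[OF \<rho>])+
  have h: "F 2 y q = k0 \<rho> y q * ?h" using g by (simp add: k0_def)
  have "k0 \<rho> x p - k0 \<rho> y q = (F 2 x p - k0 \<rho> y q * ?g) / ?g"
    using g(2) by (simp add: k0_def[of \<rho> x p] diff_divide_distrib del: One_nat_def)
  also have "F 2 x p - k0 \<rho> y q * ?g = (F 2 x p - F 2 y q) - k0 \<rho> y q * (?g - ?h)"
    unfolding h by (simp add: algebra_simps)
  also have "((F 2 x p - F 2 y q) - k0 \<rho> y q * (?g - ?h)) / ?g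
      = (F 2 x p - F 2 y q) / ?g - k0 \<rho> y q * (?g - ?h) / ?g" by (rule diff_divide_distrib)
  also have "\<bar>\<dots>\<bar> \<le> \<bar>F 2 x p - F 2 y q\<bar> / ?g + \<bar>k0 \<rho> y q * (?g - ?h)\<bar> / ?g"
    using abs_triangle_ineq4[of "(F 2 x p - F 2 y q) / ?g" "k0 \<rho> y q * (?g - ?h) / ?g"] g(2)
    by (simp only: abs_divide abs_of_pos)
  also have "\<dots> \<le> \<bar>F 2 x p - F 2 y q\<bar> / (1 / 2) + \<bar>F 1 x p - F 1 y q\<bar> / (1 / 2)"
  proof (intro add_mono frac_le)
    have "\<bar>k0 \<rho> y q * (?g - ?h)\<bar> = \<bar>k0 \<rho> y q\<bar> * (\<rho> * \<bar>F 1 x p - F 1 y q\<bar>)"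
      using r(1) by (simp add: abs_mult right_diff_distrib[symmetric] del: One_nat_def)
    also have "\<dots> \<le> (2 * K) * (\<rho> * \<bar>F 1 x p - F 1 y q\<bar>)"
      using r(1) by (intro mult_right_mono k0_bound \<rho>) auto
    also have "\<dots> \<le> 1 * \<bar>F 1 x p - F 1 y q\<bar>"
      using mult_right_mono[OF r(3), of "\<bar>F 1 x p - F 1 y q\<bar>"] by (simp add: mult.assoc)
    finally show "\<bar>k0 \<rho> y q * (?g - ?h)\<bar> \<le> \<bar>F 1 x p - F 1 y q\<bar>" by simp
  qed (use g in auto)
  finally show ?thesis by simp
qed

text \<open>\<open>R\<close> does not appear in its own increments, so
  \<open>holder_gronwall\<close> is used without growth; the differences of \<open>P\<close> and of
  \<open>k0\<close> form the inhomogeneity.\<close>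

lemma slow_R:
  assumes c0: "0 \<le> c0"
  obtains C where "0 \<le> C"
    "\<And>\<rho> X0. small \<rho> \<Longrightarrow> admissible c0 \<rho> X0 \<Longrightarrow> slow C \<rho> 1 (\<lambda>n \<psi>. R \<rho> n (X0 \<psi>) \<psi>)"
proof -
  obtain D where D: "0 \<le> D"
    and sX: "\<And>\<rho> X0. small \<rho> \<Longrightarrow> admissible c0 \<rho> X0 \<Longrightarrow> slow D \<rho> 1 (\<lambda>n \<psi>. X \<rho> n (X0 \<psi>) \<psi>)"
    using slow_X[OF c0] by blast
  obtain E where E: "0 \<le> E"
    and sP: "\<And>\<rho> X0. small \<rho> \<Longrightarrow> admissible c0 \<rho> X0 \<Longrightarrow> slow E \<rho> (decay \<rho>) (\<lambda>n \<psi>. P \<rho> n (X0 \<psi>) \<psi>)"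
    using slow_P[OF c0] by blast
  let ?Q = "\<bar>lam\<bar> powr \<alpha>" and ?e = "norm eu powr \<alpha>"
  define b where "b = E * (2 * K) + lyap_max * (4 * (K * D + K * ?e))"
  define c where "c = 2 * b / (?Q - 1)"
  have Q: "0 < ?Q - 1" using lam_powr_gt_1 by simp
  have b: "0 \<le> b" using D E pos lyap_max_ge by (simp add: b_def)
  have c: "0 \<le> c" "2 * b \<le> c * (?Q - 1)" using Q b by (auto simp: c_def)
  define C where "C = CR + 2 * K * lyap_max + c"
  have L: "CR \<le> C" "2 * K * lyap_max \<le> C" "c \<le> C"
    using lyap_max_ge c pos CR_pos by (auto simp: C_def)
  have C: "0 \<le> C" using L(1) CR_pos by linarith
  have "slow C \<rho> 1 (\<lambda>n \<psi>. R \<rho> n (X0 \<psi>) \<psi>)" if \<rho>: "small \<rho>" and X0: "admissible c0 \<rho> X0" for \<rho> X0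
    unfolding slow_def power_one mult_1_right
  proof (intro conjI allI)
    note r = smallD[OF \<rho>] and a = admissibleD[OF X0] and d = decay_power[OF \<rho>]
    note sx = slowD[OF sX[OF \<rho> X0], unfolded power_one mult_1_right]
    note sp = slowD[OF sP[OF \<rho> X0]]
    fix n \<psi> s
    show "torus_cont (\<lambda>\<psi>. R \<rho> n (X0 \<psi>) \<psi>)" by (intro torus_cont_R a \<rho>)
    show "\<bar>R \<rho> n (X0 \<psi>) \<psi>\<bar> \<le> C" by (rule order_trans[OF R_bound[OF \<rho> a(2)] L(1)])
    have "2 * K * lyap_max * \<rho> * decay \<rho> ^ n \<le> C * \<rho> * 1"
      using L(2) r(1) d[of n] C by (intro mult_mono) auto
    then show "\<bar>R \<rho> (Suc n) (X0 \<psi>) \<psi> - R \<rho> n (X0 \<psi>) \<psi>\<bar> \<le> C * \<rho>"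
      using R_step[OF \<rho> a(2), of n \<psi> \<psi>] by linarith
    let ?\<psi> = "\<psi> + s *\<^sub>R eu"
    have "\<bar>R \<rho> n (X0 ?\<psi>) ?\<psi> - R \<rho> n (X0 \<psi>) \<psi>\<bar> \<le> c * \<rho> * (\<bar>lam\<bar> ^ n * \<bar>s\<bar>) powr \<alpha>"
    proof (rule holder_gronwall[where \<delta>="\<lambda>n. \<bar>R \<rho> n (X0 ?\<psi>) ?\<psi> - R \<rho> n (X0 \<psi>) \<psi>\<bar>" and a=0 and b=b and ?c0.0=0])
      fix n
      let ?x = "X \<rho> n (X0 ?\<psi>) ?\<psi>" and ?y = "X \<rho> n (X0 \<psi>) \<psi>"
      let ?p' = "P \<rho> n (X0 ?\<psi>) ?\<psi>" and ?p = "P \<rho> n (X0 \<psi>) \<psi>"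
      let ?k' = "k0 \<rho> ?x (iter n ?\<psi>)" and ?k = "k0 \<rho> ?y (iter n \<psi>)"
      let ?d = "(\<bar>lam\<bar> ^ n * \<bar>s\<bar>) powr \<alpha>"
      have le1: "D * \<rho> * ?d \<le> D * ?d" "E * \<rho> * decay \<rho> ^ n * ?d \<le> E * ?d"
      proof -
        have "D * \<rho> \<le> D * 1" using D r by (intro mult_left_mono) auto
        then show "D * \<rho> * ?d \<le> D * ?d" by (intro mult_right_mono) auto
        have "\<rho> * decay \<rho> ^ n \<le> 1 * 1" using r d[of n] by (intro mult_mono) auto
        then have "E * (\<rho> * decay \<rho> ^ n) \<le> E * 1" using E by (intro mult_left_mono) auto
        then have "E * \<rho> * decay \<rho> ^ n \<le> E" by (simp add: mult.assoc)
        then show "E * \<rho> * decay \<rho> ^ n * ?d \<le> E * ?d" by (rule mult_right_mono) simp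
      qed
      have "\<bar>F k ?x (iter n ?\<psi>) - F k ?y (iter n \<psi>)\<bar> \<le> (K * D + K * ?e) * ?d" if "k \<le> 5" for k
      proof -
        have "K * \<bar>?x - ?y\<bar> \<le> K * (D * ?d)"
          using pos by (intro mult_left_mono order_trans[OF sx(4) le1(1)]) auto
        then show ?thesis using F_iter_diff[OF that, of ?x n \<psi> s ?y] by (simp add: algebra_simps)
      qed
      from this[of 1] this[of 2] have kd: "\<bar>?k' - ?k\<bar> \<le> 4 * (K * D + K * ?e) * ?d"
        using k0_diff[OF \<rho>, of ?x "iter n ?\<psi>" ?y "iter n \<psi>"] by (simp add: algebra_simps del: One_nat_def)
      have pb: "\<bar>?p\<bar> \<le> lyap_max"
      proof -
        have "lyap_max * decay \<rho> ^ n \<le> lyap_max * 1"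
          using d(2)[of n] lyap_max_ge by (intro mult_left_mono) auto
        then show ?thesis using P_pos[OF \<rho>, of n "X0 \<psi>" \<psi>] P_le[OF \<rho> a(2), of n \<psi> \<psi>] by linarith
      qed
      have "\<bar>?p' * ?k' - ?p * ?k\<bar> \<le> (E * ?d) * (2 * K) + lyap_max * (4 * (K * D + K * ?e) * ?d)"
        by (intro abs_diff_mult_le k0_bound \<rho> order_trans[OF sp(4) le1(2)] kd pb)
      also have "\<dots> = b * ?d" by (simp add: b_def algebra_simps)
      finally have "\<bar>\<rho> * (?p' * ?k' - ?p * ?k)\<bar> \<le> \<rho> * (b * ?d)"
        unfolding abs_mult using r(1) by (intro mult_mono) auto
      then show "\<bar>R \<rho> (Suc n) (X0 ?\<psi>) ?\<psi> - R \<rho> (Suc n) (X0 \<psi>) \<psi>\<bar>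
          \<le> (1 + 0 * \<rho>) * \<bar>R \<rho> n (X0 ?\<psi>) ?\<psi> - R \<rho> n (X0 \<psi>) \<psi>\<bar> + b * \<rho> * ?d"
        by (simp add: algebra_simps)
    qed (use c Q r in auto)
    also have "\<dots> \<le> C * \<rho> * (\<bar>lam\<bar> ^ n * \<bar>s\<bar>) powr \<alpha>"
      using r(1) L by (intro mult_right_mono) auto
    finally show "\<bar>R \<rho> n (X0 ?\<psi>) ?\<psi> - R \<rho> n (X0 \<psi>) \<psi>\<bar> \<le> C * \<rho> * (\<bar>lam\<bar> ^ n * \<bar>s\<bar>) powr \<alpha>" .
  qed
  then show ?thesis by (rule that[OF C])
qed

section \<open>The invariant graph as a limit of graph transforms\<close>

definition invariant :: "real \<Rightarrow> (real^2 \<Rightarrow> real) \<Rightarrow> bool" where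
  "invariant \<rho> W \<longleftrightarrow> torus_fun W \<and> (\<forall>\<psi>. W \<psi> \<in> {Sm..SM}) \<and> (\<forall>\<psi>. W (A *v \<psi>) = W \<psi> + \<rho> * F 0 (W \<psi>) \<psi>)"

lemma X_invariant:
  assumes "invariant \<rho> W"
  shows "X \<rho> n (W \<psi>) \<psi> = W (iter n \<psi>)"
  using assms by (induction n) (simp_all add: iter_Suc invariant_def)

lemma step_contracts:
  assumes \<rho>: "small \<rho>" and "x \<in> {Sm..SM}" "y \<in> {Sm..SM}"
  shows "\<bar>(x + \<rho> * F 0 x \<psi>) - (y + \<rho> * F 0 y \<psi>)\<bar> \<le> (1 - \<gamma> * \<rho>) * \<bar>x - y\<bar>"
proof (rule deriv_bound_diff[where ?g1.0="\<lambda>z. 1 + \<rho> * F 1 z \<psi>", OF _ _ assms(2,3)])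
  fix z assume z: "z \<in> {Sm..SM}"
  have "((\<lambda>z. z + \<rho> * F 0 z \<psi>) has_real_derivative 1 + \<rho> * F (Suc 0) z \<psi>) (at z within {Sm..SM})"
    by (intro DERIV_add DERIV_ident DERIV_cmult has_field_derivative_at_within[OF F_deriv]) simp
  then show "((\<lambda>z. z + \<rho> * F 0 z \<psi>) has_real_derivative 1 + \<rho> * F 1 z \<psi>) (at z within {Sm..SM})" by simp
  have "F 1 z \<psi> \<le> - \<gamma>" using z pos by (intro contracting) auto
  then have "\<rho> * F 1 z \<psi> \<le> \<rho> * (- \<gamma>)" using smallD(1)[OF \<rho>] by (intro mult_left_mono) auto
  then show "\<bar>1 + \<rho> * F 1 z \<psi>\<bar> \<le> 1 - \<gamma> * \<rho>"
    using growth_factor_pos[OF \<rho>, of z \<psi>] by (simp add: mult.commute del: One_nat_def)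
qed

lemma contraction_limit:
  assumes \<rho>: "small \<rho>"
  shows "(\<lambda>n. (1 - \<gamma> * \<rho>) ^ n * c) \<longlonglongrightarrow> 0"
proof -
  have "0 < \<gamma> * \<rho>" using smallD(1)[OF \<rho>] pos by simp
  then have "(\<lambda>n. (1 - \<gamma> * \<rho>) ^ n) \<longlonglongrightarrow> 0" using smallD(5)[OF \<rho>] by (intro LIMSEQ_realpow_zero) auto
  then show ?thesis by (rule tendsto_mult_left_zero)
qed

definition A_inv :: "real^2 \<Rightarrow> real^2" where
  "A_inv \<psi> = (cu \<psi> / lam) *\<^sub>R eu + (cs \<psi> / mu) *\<^sub>R es"

lemma A_A_inv: "A *v A_inv \<psi> = \<psi>"
  unfolding A_inv_def using splitting[of \<psi>, symmetric] lam_nz mu_nz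
  by (simp add: matrix_vector_right_distrib matrix_vector_mult_scaleR eu es)

lemma A_inv_shift: "A_inv (\<psi> + s *\<^sub>R eu) = A_inv \<psi> + (s / lam) *\<^sub>R eu"
  by (rule inj_A) (simp add: A_A_inv matrix_vector_right_distrib matrix_vector_mult_scaleR eu lam_nz)

lemma continuous_on_A_inv: "continuous_on S A_inv"
proof -
  have "continuous_on S cs" "continuous_on S cu"
    using linear_cs linear_cu by (auto simp: linear_continuous_on linear_conv_bounded_linear)
  then show ?thesis unfolding A_inv_def using lam_nz mu_nz by (intro continuous_intros) auto
qed

text \<open>Graph transforms of the constant graph \<open>Sm\<close>. Continuity and the Hoelder
  bound along unstable lines are established for these iterates and pass to the limit, which is
  \<open>W\<close> because the slow step contracts on
  [\<open>Sm\<close>, \<open>SM\<close>].\<close>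

primrec Wn :: "real \<Rightarrow> nat \<Rightarrow> real^2 \<Rightarrow> real" where
  "Wn \<rho> 0 = (\<lambda>\<psi>. Sm)"
| "Wn \<rho> (Suc n) = (\<lambda>\<psi>. Wn \<rho> n (A_inv \<psi>) + \<rho> * F 0 (Wn \<rho> n (A_inv \<psi>)) (A_inv \<psi>))"

lemma Wn_in: "small \<rho> \<Longrightarrow> Wn \<rho> n \<psi> \<in> {Sm..SM}"
  using order by (induction n arbitrary: \<psi>) (auto intro: step_le_SM step_ge_Sm)

lemma Wn_continuous: "continuous_on UNIV (Wn \<rho> n)"
proof (induction n)
  case (Suc n)
  have c: "continuous_on UNIV (\<lambda>\<psi>. Wn \<rho> n (A_inv \<psi>))"
    by (rule continuous_on_compose2[OF Suc continuous_on_A_inv]) auto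
  have "continuous_on UNIV (\<lambda>\<psi>. (\<lambda>(x, p). F 0 x p) (Wn \<rho> n (A_inv \<psi>), A_inv \<psi>))"
    by (rule continuous_on_compose2[OF F_continuous[of 0 UNIV]]) (auto intro!: continuous_intros c continuous_on_A_inv)
  then show ?case using c by (auto intro!: continuous_intros)
qed simp

lemma Wn_dist:
  assumes \<rho>: "small \<rho>" and W: "invariant \<rho> W"
  shows "\<bar>W \<psi> - Wn \<rho> n \<psi>\<bar> \<le> (1 - \<gamma> * \<rho>) ^ n * (SM - Sm)"
proof (induction n arbitrary: \<psi>)
  case 0
  then show ?case using W by (auto simp: invariant_def)
next
  case (Suc n)
  let ?y = "A_inv \<psi>"
  have "W \<psi> = W ?y + \<rho> * F 0 (W ?y) ?y"
    using W A_A_inv[of \<psi>] unfolding invariant_def by metis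
  then have "\<bar>W \<psi> - Wn \<rho> (Suc n) \<psi>\<bar> \<le> (1 - \<gamma> * \<rho>) * \<bar>W ?y - Wn \<rho> n ?y\<bar>"
    using step_contracts[where x="W ?y" and y="Wn \<rho> n ?y" and \<psi>="?y", OF \<rho> _ Wn_in[OF \<rho>]] W
    by (simp add: invariant_def)
  also have "\<dots> \<le> (1 - \<gamma> * \<rho>) * ((1 - \<gamma> * \<rho>) ^ n * (SM - Sm))"
    using smallD(5)[OF \<rho>] by (intro mult_left_mono Suc) auto
  finally show ?case by simp
qed

lemma Wn_LIMSEQ:
  assumes \<rho>: "small \<rho>" and W: "invariant \<rho> W"
  shows "(\<lambda>n. Wn \<rho> n \<psi>) \<longlonglongrightarrow> W \<psi>"
proof -
  have "(\<lambda>n. Wn \<rho> n \<psi> - W \<psi>) \<longlonglongrightarrow> 0"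
    by (rule Lim_null_comparison[OF _ contraction_limit[OF \<rho>, of "SM - Sm"]])
      (use Wn_dist[OF \<rho> W, of \<psi>] in \<open>auto simp: abs_minus_commute\<close>)
  then show ?thesis by (simp add: LIM_zero_iff)
qed

lemma invariant_torus_cont:
  assumes \<rho>: "small \<rho>" and W: "invariant \<rho> W"
  shows "torus_cont W"
proof (rule torus_contI)
  show "torus_fun W" using W by (simp add: invariant_def)
  have "uniform_limit UNIV (Wn \<rho>) W sequentially"
  proof (rule uniform_limitI)
    fix e :: real assume "e > 0"
    then have "\<forall>\<^sub>F n in sequentially. (1 - \<gamma> * \<rho>) ^ n * (SM - Sm) < e"
      by (rule order_tendstoD(2)[OF contraction_limit[OF \<rho>]])
    then show "\<forall>\<^sub>F n in sequentially. \<forall>\<psi>\<in>UNIV. dist (Wn \<rho> n \<psi>) (W \<psi>) < e"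
    proof eventually_elim
      case (elim n)
      then show ?case using Wn_dist[OF \<rho> W, of _ n] by (auto simp: dist_real_def abs_minus_commute intro: le_less_trans)
    qed
  qed
  then show "continuous_on UNIV W"
    by (rule uniform_limit_theorem[rotated]) (simp_all add: Wn_continuous)
qed

text \<open>Makes \<open>2 * (K * norm eu powr \<alpha>) = cW * (\<bar>lam\<bar> powr \<alpha> -
  1)\<close>: the inhomogeneity uses half of the gap, and the other half is reserved for the factor
  \<open>1 + K * \<rho>\<close>.\<close>

definition cW :: real where
  "cW = 2 * (K * norm eu powr \<alpha>) / (\<bar>lam\<bar> powr \<alpha> - 1)"

lemma cW_pos: "0 \<le> cW"
  using lam_powr_gt_1 pos by (simp add: cW_def)

text \<open>Going back one step divides the unstable displacement by \<open>lam\<close>, which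
  improves the Hoelder quantity by \<open>\<bar>lam\<bar> powr \<alpha>\<close>, more than one graph
  transform loses. The constant is the same for all iterates and survives the limit.\<close>

lemma invariant_shift:
  assumes \<rho>: "small \<rho>" and W: "invariant \<rho> W"
  shows "\<bar>W (\<psi> + s *\<^sub>R eu) - W \<psi>\<bar> \<le> cW * \<rho> * \<bar>s\<bar> powr \<alpha>"
proof -
  note r = smallD[OF \<rho>]
  let ?Q = "\<bar>lam\<bar> powr \<alpha>" and ?e = "norm eu powr \<alpha>"
  have Q: "1 < ?Q" by (rule lam_powr_gt_1)
  have c: "2 * (K * ?e) = cW * (?Q - 1)" using Q by (simp add: cW_def)
  have n: "\<bar>Wn \<rho> n (\<psi> + s *\<^sub>R eu) - Wn \<rho> n \<psi>\<bar> \<le> cW * \<rho> * \<bar>s\<bar> powr \<alpha>" for n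
  proof (induction n arbitrary: \<psi> s)
    case 0
    then show ?case using cW_pos r(1) by simp
  next
    case (Suc n)
    let ?y = "A_inv \<psi>" and ?s = "s / lam"
    let ?d = "\<bar>?s\<bar> powr \<alpha>"
    let ?w' = "Wn \<rho> n (?y + ?s *\<^sub>R eu)" and ?w = "Wn \<rho> n ?y"
    have Qd: "\<bar>s\<bar> powr \<alpha> = ?Q * ?d"
    proof -
      have "\<bar>s\<bar> = \<bar>lam\<bar> * \<bar>?s\<bar>" using lam_nz by simp
      then show ?thesis by (metis abs_ge_zero powr_mult)
    qed
    have f: "\<bar>F 0 ?w' (?y + ?s *\<^sub>R eu) - F 0 ?w ?y\<bar> \<le> K * \<bar>?w' - ?w\<bar> + K * ?e * ?d"
      using F_iter_diff[of 0 ?w' 0 ?y ?s ?w] by simp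
    have "\<bar>Wn \<rho> (Suc n) (\<psi> + s *\<^sub>R eu) - Wn \<rho> (Suc n) \<psi>\<bar>
        = \<bar>(?w' - ?w) + \<rho> * (F 0 ?w' (?y + ?s *\<^sub>R eu) - F 0 ?w ?y)\<bar>"
      by (simp add: A_inv_shift algebra_simps)
    also have "\<dots> \<le> \<bar>?w' - ?w\<bar> + \<rho> * \<bar>F 0 ?w' (?y + ?s *\<^sub>R eu) - F 0 ?w ?y\<bar>"
      using abs_triangle_ineq[of "?w' - ?w" "\<rho> * (F 0 ?w' (?y + ?s *\<^sub>R eu) - F 0 ?w ?y)"] r(1)
      by (simp add: abs_mult)
    also have "\<dots> \<le> \<bar>?w' - ?w\<bar> + \<rho> * (K * \<bar>?w' - ?w\<bar> + K * ?e * ?d)"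
      using r(1) by (intro add_left_mono mult_left_mono f) auto
    also have "\<dots> = (1 + K * \<rho>) * \<bar>?w' - ?w\<bar> + K * ?e * (\<rho> * ?d)" by (simp add: algebra_simps)
    also have "\<dots> \<le> (1 + K * \<rho>) * (cW * \<rho> * ?d) + K * ?e * (\<rho> * ?d)"
      using r(1) pos by (intro add_right_mono mult_left_mono Suc) auto
    also have "\<dots> = ((1 + K * \<rho>) * cW + cW * (?Q - 1) / 2) * (\<rho> * ?d)"
      unfolding c[symmetric] by (simp add: algebra_simps)
    also have "\<dots> \<le> (cW * ?Q) * (\<rho> * ?d)"
    proof (rule mult_right_mono)
      have k: "0 \<le> K * \<rho>" using r(1) pos by simp
      then have "2 * (K * \<rho>) \<le> ?Q - 1" using r(7) by linarith
      from mult_right_mono[OF this cW_pos] have "2 * ((K * \<rho>) * cW) \<le> (?Q - 1) * cW" by simp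
      moreover have "(1 + K * \<rho>) * cW = cW + (K * \<rho>) * cW" "cW * (?Q - 1) = (?Q - 1) * cW"
          "cW * ?Q = (?Q - 1) * cW + cW" by (simp_all add: algebra_simps)
      ultimately show "(1 + K * \<rho>) * cW + cW * (?Q - 1) / 2 \<le> cW * ?Q" by linarith
    qed (use r(1) in simp)
    finally show ?case unfolding Qd by (simp add: mult_ac)
  qed
  show ?thesis
    by (rule LIMSEQ_le_const2[OF tendsto_rabs[OF tendsto_diff[OF Wn_LIMSEQ[OF \<rho> W] Wn_LIMSEQ[OF \<rho> W]]]])
      (use n in auto)
qed

end

section \<open>The linearization of the averaged flow\<close>

lemma deriv_of_constant_within:
  fixes g :: "real \<Rightarrow> real"
  assumes "a < b" "x \<in> {a..b}" "\<And>y. y \<in> {a..b} \<Longrightarrow> g y = c"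
    and "(g has_real_derivative d) (at x within {a..b})"
  shows "d = 0"
proof -
  have "(g has_vector_derivative 0) (at x within {a..b})"
    by (rule has_vector_derivative_transform[OF assms(2) assms(3)]) auto
  moreover have "(g has_vector_derivative d) (at x within {a..b})"
    using assms(4) by (simp add: has_real_derivative_iff_has_vector_derivative)
  ultimately show ?thesis
    using vector_derivative_unique_within_closed_interval[of a b x g d 0] assms by simp
qed

context slow_fast
begin

definition fb :: "nat \<Rightarrow> real \<Rightarrow> real" where "fb n x = torus_avg (F n x)"

lemma F_torus_cont: "n \<le> 5 \<Longrightarrow> torus_cont (F n x)"
  using F_torus_fun holder_continuous[OF F_holder] by (simp add: torus_cont_def)

lemma fb_deriv:
  assumes n: "n < 5"
  shows "(fb n has_real_derivative fb (Suc n) x) (at x)"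
proof -
  have c: "continuous_on UNIV (F k x)" if "k \<le> 5" for k x
    using F_torus_cont[OF that] by (simp add: torus_cont_def)
  have "((\<lambda>x. integral (cbox 0 periods) (F n x)) has_field_derivative
      integral (cbox 0 periods) (F (Suc n) x)) (at x within UNIV)"
  proof (rule leibniz_rule_field_derivative)
    show "((\<lambda>x. F n x t) has_real_derivative F (Suc n) x t) (at x within UNIV)" for x t
      using F_deriv[OF n] by simp
    show "F n x integrable_on cbox 0 periods" for x
      using n by (intro integrable_continuous continuous_on_subset[OF c]) auto
    show "continuous_on (UNIV \<times> cbox 0 periods) (\<lambda>(x, t). F (Suc n) x t)"
      using n by (intro F_continuous) auto
  qed auto
  then show ?thesis
    using n c DERIV_cdivide[of "\<lambda>x. integral (cbox 0 periods) (F n x)" _ x UNIV "(2 * pi)\<^sup>2"]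
    by (simp add: fb_def[abs_def] torus_avg_integral)
qed

lemma fb_bound: "n \<le> 5 \<Longrightarrow> \<bar>fb n x\<bar> \<le> K"
  unfolding fb_def by (rule torus_avg_abs_le[OF F_torus_cont F_bound])

lemma fb_lipschitz: "n \<le> 5 \<Longrightarrow> \<bar>fb n x - fb n y\<bar> \<le> K * \<bar>x - y\<bar>"
  unfolding fb_def torus_avg_diff[OF F_torus_cont F_torus_cont, symmetric]
  by (rule torus_avg_abs_le[OF torus_cont_diff[OF F_torus_cont F_torus_cont] F_lipschitz])

lemma fb_continuous: "n \<le> 5 \<Longrightarrow> continuous_on S (fb n)"
proof -
  assume n: "n \<le> 5"
  have "K-lipschitz_on S (fb n)"
    using fb_lipschitz[OF n] pos by (auto intro!: lipschitz_onI simp: dist_real_def)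
  then show ?thesis by (rule lipschitz_on_continuous_on)
qed

text \<open>For \<open>j = 0\<close> and \<open>n > 0\<close> this is the divided difference at 0 of
  the preceding derivative, written so that it is smooth across 0. Each derivative in
  \<open>x\<close> brings down a factor \<open>t\<close>, which is counted by
  \<open>j\<close>.\<close>

definition mom :: "nat \<Rightarrow> nat \<Rightarrow> real \<Rightarrow> real" where
  "mom j n x = integral {0..1} (\<lambda>t. t ^ j * fb n (t * x))"

lemma mom_integrand_continuous: "n \<le> 5 \<Longrightarrow> continuous_on S (\<lambda>(x, t). t ^ j * fb n (t * x))"
  unfolding split_beta by (intro continuous_intros continuous_on_compose2[OF fb_continuous[of n UNIV]]) auto

lemma mom_continuous:
  assumes "n \<le> 5"
  shows "continuous_on S (mom j n)"
proof -
  have "continuous_on S (\<lambda>x. integral (cbox 0 1) (\<lambda>t. t ^ j * fb n (t * x)))"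
    by (rule integral_continuous_on_param[OF mom_integrand_continuous[OF assms]])
  then show ?thesis by (simp add: mom_def[abs_def])
qed

lemma mom_deriv:
  assumes n: "n < 5"
  shows "(mom j n has_real_derivative mom (Suc j) (Suc n) x) (at x)"
proof -
  have "((\<lambda>x. integral (cbox 0 1) (\<lambda>t. t ^ j * fb n (t * x))) has_field_derivative
      integral (cbox 0 1) (\<lambda>t. t ^ Suc j * fb (Suc n) (t * x))) (at x within UNIV)"
  proof (rule leibniz_rule_field_derivative)
    fix x t :: real
    have "((\<lambda>x. fb n (t * x)) has_real_derivative fb (Suc n) (t * x) * t) (at x)"
      using DERIV_chain2[OF fb_deriv[OF n] DERIV_cmult[OF DERIV_ident, of t x]] by simp
    from DERIV_cmult[OF this, of "t ^ j"]
    show "((\<lambda>x. t ^ j * fb n (t * x)) has_real_derivative t ^ Suc j * fb (Suc n) (t * x)) (at x within UNIV)"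
      by (simp add: mult_ac)
  next
    fix x :: real
    show "(\<lambda>t. t ^ j * fb n (t * x)) integrable_on cbox 0 1"
      using n by (intro integrable_continuous continuous_intros continuous_on_compose2[OF fb_continuous[of n UNIV]]) auto
    show "continuous_on (UNIV \<times> cbox 0 1) (\<lambda>(x, t). t ^ Suc j * fb (Suc n) (t * x))"
      using n by (intro mom_integrand_continuous) auto
  qed auto
  then show ?thesis by (simp add: mom_def[abs_def])
qed

lemma mom_0:
  assumes n: "n < 5"
  shows "x * mom 0 (Suc n) x = fb n x - fb n 0"
proof -
  have "((\<lambda>t. x * fb (Suc n) (t * x)) has_integral (fb n (1 * x) - fb n (0 * x))) {0..1}"
  proof (rule fundamental_theorem_of_calculus)
    fix t :: real
    have "((\<lambda>t. fb n (t * x)) has_real_derivative fb (Suc n) (t * x) * x) (at t within {0..1})"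
    proof (rule has_field_derivative_at_within)
      have d: "((\<lambda>t. t * x) has_real_derivative x) (at t)" by (auto intro!: derivative_eq_intros)
      show "((\<lambda>t. fb n (t * x)) has_real_derivative fb (Suc n) (t * x) * x) (at t)"
        by (rule DERIV_chain2[OF fb_deriv[OF n] d])
    qed
    then show "((\<lambda>t. fb n (t * x)) has_vector_derivative x * fb (Suc n) (t * x)) (at t within {0..1})"
      by (simp add: has_real_derivative_iff_has_vector_derivative mult.commute)
  qed simp
  from integral_unique[OF this] show ?thesis by (simp add: mom_def)
qed

lemma fb_0_0: "fb 0 0 = 0" by (simp add: fb_def mean_zero)

lemma fb_1_le: "x \<in> {Sm - \<epsilon>..SM + \<epsilon>} \<Longrightarrow> fb 1 x \<le> - \<gamma>"
  unfolding fb_def by (rule torus_avg_le[OF F_torus_cont contracting]) auto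

lemma mom_0_1_le:
  assumes "x \<in> {Sm - \<epsilon>..SM + \<epsilon>}"
  shows "mom 0 1 x \<le> - \<gamma>"
proof -
  have "t * x \<in> {Sm - \<epsilon>..SM + \<epsilon>}" if "t \<in> {0..1}" for t
  proof -
    have "0 \<le> t * x \<and> t * x \<le> x \<or> x \<le> t * x \<and> t * x \<le> 0"
    proof (cases "0 \<le> x")
      case True
      then show ?thesis using that mult_left_le_one_le[of x t] by simp
    next
      case False
      then show ?thesis using that mult_left_le_one_le[of "- x" t] by (simp add: mult_nonneg_nonpos)
    qed
    then show ?thesis using assms order pos by auto
  qed
  then have "integral {0..1} (\<lambda>t. t ^ 0 * fb 1 (t * x)) \<le> integral {0..1::real} (\<lambda>t. - \<gamma>)"
    by (intro integral_le integrable_continuous_real continuous_intros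
        continuous_on_compose2[OF fb_continuous[of 1 UNIV]]) (auto simp del: One_nat_def intro!: fb_1_le)
  then show ?thesis by (simp add: mom_def)
qed

text \<open>Near [\<open>Sm\<close>, \<open>SM\<close>] the integrand is negative. Elsewhere
  \<open>x * mom 0 1 x = fb 0 x\<close>, and the averaged field points towards 0. This makes the
  divisions in \<open>M0\<close> to \<open>M3\<close> legitimate on all of \<open>U\<close>.\<close>

lemma mom_0_1_neg:
  assumes x: "x \<in> U"
  shows "mom 0 1 x < 0"
proof -
  have e: "x * mom 0 1 x = fb 0 x" using mom_0[of 0 x] fb_0_0 by simp
  consider "x \<in> {Sm - \<epsilon>..SM + \<epsilon>}" | "x \<in> {pm..Sm - \<epsilon>}" | "x \<in> {SM + \<epsilon>..pM}" using x by fastforce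
  then show ?thesis
  proof cases
    case 1
    then show ?thesis using mom_0_1_le[OF 1] pos by linarith
  next
    case 2
    have "\<kappa> \<le> fb 0 x"
      unfolding fb_def using torus_avg_mono[OF torus_cont_const F_torus_cont far_left[OF 2]] by simp
    then have "0 < x * mom 0 1 x" using e pos by simp
    moreover have "x < 0" using 2 order pos by simp
    ultimately show ?thesis by (simp add: zero_less_mult_iff)
  next
    case 3
    have "fb 0 x \<le> - \<kappa>" unfolding fb_def by (rule torus_avg_le[OF F_torus_cont far_right[OF 3]]) simp
    then have "x * mom 0 1 x < 0" using e pos by simp
    moreover have "0 < x" using 3 order pos by simp
    ultimately show ?thesis by (simp add: mult_less_0_iff)
  qed
qed

text \<open>
  \<open>M0\<close> is \<open>(fb 1 0 - fb 1 x) / fb 0 x\<close> without the removable singularity at \<open>0\<close>: the logarithmic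
  derivative of the derivative of the map linearizing the averaged flow.
\<close>

definition M0 :: "real \<Rightarrow> real" where "M0 x = - mom 0 2 x / mom 0 1 x"
text \<open>\<open>M1\<close>, \<open>M2\<close>, \<open>M3\<close> are the successive derivatives
  of \<open>M0\<close>, obtained by differentiating \<open>M0 x * mom 0 1 x = - mom 0 2 x\<close>
  with the Leibniz rule and solving for the highest one.\<close>

definition M1 :: "real \<Rightarrow> real" where "M1 x = - (mom 1 3 x + M0 x * mom 1 2 x) / mom 0 1 x"
definition M2 :: "real \<Rightarrow> real" where
  "M2 x = - (mom 2 4 x + 2 * M1 x * mom 1 2 x + M0 x * mom 2 3 x) / mom 0 1 x"
definition M3 :: "real \<Rightarrow> real" where
  "M3 x = - (mom 3 5 x + 3 * M2 x * mom 1 2 x + 3 * M1 x * mom 2 3 x + M0 x * mom 3 4 x) / mom 0 1 x"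

lemma mom_derivs:
  "(mom 0 1 has_real_derivative mom 1 2 x) (at x within S)"
  "(mom 0 2 has_real_derivative mom 1 3 x) (at x within S)"
  "(mom 1 2 has_real_derivative mom 2 3 x) (at x within S)"
  "(mom 1 3 has_real_derivative mom 2 4 x) (at x within S)"
  "(mom 2 3 has_real_derivative mom 3 4 x) (at x within S)"
  "(mom 2 4 has_real_derivative mom 3 5 x) (at x within S)"
  using mom_deriv[of 1 0 x] mom_deriv[of 2 0 x] mom_deriv[of 2 1 x] mom_deriv[of 3 1 x]
    mom_deriv[of 3 2 x] mom_deriv[of 4 2 x]
  by (auto intro!: has_field_derivative_at_within simp: eval_nat_numeral)

lemma M_derivs:
  assumes x: "x \<in> U"
  shows "(M0 has_real_derivative M1 x) (at x within U)"
    "(M1 has_real_derivative M2 x) (at x within U)"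
    "(M2 has_real_derivative M3 x) (at x within U)"
proof -
  have nz: "mom 0 1 x \<noteq> 0" using mom_0_1_neg[OF x] by simp
  show 0: "(M0 has_real_derivative M1 x) (at x within U)"
    unfolding M0_def[abs_def]
    by (rule DERIV_cong[OF DERIV_divide[OF DERIV_minus[OF mom_derivs(2)] mom_derivs(1) nz]])
      (use nz in \<open>simp add: M1_def M0_def divide_simps algebra_simps\<close>)
  have e1: "M1 x * mom 0 1 x = - (mom 1 3 x + M0 x * mom 1 2 x)" using nz by (simp add: M1_def)
  show 1: "(M1 has_real_derivative M2 x) (at x within U)"
    unfolding M1_def[abs_def]
  proof (rule DERIV_cong[OF DERIV_divide[OF DERIV_minus[OF DERIV_add[OF mom_derivs(4)
          DERIV_mult[OF 0 mom_derivs(3)]]] mom_derivs(1) nz]])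
    show "(- (mom 2 4 x + (M1 x * mom 1 2 x + mom 2 3 x * M0 x)) * mom 0 1 x
        - - (mom 1 3 x + M0 x * mom 1 2 x) * mom 1 2 x) / (mom 0 1 x * mom 0 1 x) = M2 x"
      unfolding e1[symmetric] M2_def using nz by (simp add: divide_simps) (simp add: algebra_simps)
  qed
  have e2: "M2 x * mom 0 1 x = - (mom 2 4 x + 2 * M1 x * mom 1 2 x + M0 x * mom 2 3 x)"
    using nz by (simp add: M2_def)
  show "(M2 has_real_derivative M3 x) (at x within U)"
    unfolding M2_def[abs_def]
  proof (rule DERIV_cong[OF DERIV_divide[OF DERIV_minus[OF DERIV_add[OF DERIV_add[OF mom_derivs(6)
          DERIV_mult[OF DERIV_cmult[OF 1] mom_derivs(3)]] DERIV_mult[OF 0 mom_derivs(5)]]] mom_derivs(1) nz]])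
    show "(- (mom 3 5 x + (2 * M2 x * mom 1 2 x + mom 2 3 x * (2 * M1 x)) + (M1 x * mom 2 3 x + mom 3 4 x * M0 x)) * mom 0 1 x
        - - (mom 2 4 x + 2 * M1 x * mom 1 2 x + M0 x * mom 2 3 x) * mom 1 2 x) / (mom 0 1 x * mom 0 1 x) = M3 x"
      unfolding e2[symmetric] M3_def using nz by (simp add: divide_simps) (simp add: algebra_simps)
  qed
qed

lemma M_continuous: "continuous_on U M0" "continuous_on U M1" "continuous_on U M2" "continuous_on U M3"
proof -
  have nz: "mom 0 1 x \<noteq> 0" if "x \<in> U" for x using mom_0_1_neg[OF that] by simp
  show 0: "continuous_on U M0" "continuous_on U M1" "continuous_on U M2"
    using M_derivs by (blast intro: DERIV_continuous_on)+
  show "continuous_on U M3"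
    unfolding M3_def[abs_def] using nz by (intro continuous_intros mom_continuous 0) auto
qed

definition KM :: real where
  "KM = (SOME B. 0 \<le> B \<and> (\<forall>x\<in>U. \<bar>M0 x\<bar> \<le> B \<and> \<bar>M1 x\<bar> \<le> B \<and> \<bar>M2 x\<bar> \<le> B \<and> \<bar>M3 x\<bar> \<le> B))"

lemma KM: "0 \<le> KM"
    "x \<in> U \<Longrightarrow> \<bar>M0 x\<bar> \<le> KM" "x \<in> U \<Longrightarrow> \<bar>M1 x\<bar> \<le> KM" "x \<in> U \<Longrightarrow> \<bar>M2 x\<bar> \<le> KM" "x \<in> U \<Longrightarrow> \<bar>M3 x\<bar> \<le> KM"
proof -
  have bnd: "\<exists>B. \<forall>x\<in>U. \<bar>g x\<bar> \<le> B" if "continuous_on U g" for g :: "real \<Rightarrow> real"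
    using compact_imp_bounded[OF compact_continuous_image[OF that compact_Icc]]
    by (auto simp: bounded_iff)
  obtain B0 B1 B2 B3 where B: "\<forall>x\<in>U. \<bar>M0 x\<bar> \<le> B0" "\<forall>x\<in>U. \<bar>M1 x\<bar> \<le> B1" "\<forall>x\<in>U. \<bar>M2 x\<bar> \<le> B2" "\<forall>x\<in>U. \<bar>M3 x\<bar> \<le> B3"
    using bnd[OF M_continuous(1)] bnd[OF M_continuous(2)] bnd[OF M_continuous(3)] bnd[OF M_continuous(4)] by blast
  let ?B = "\<bar>B0\<bar> + \<bar>B1\<bar> + \<bar>B2\<bar> + \<bar>B3\<bar>"
  have "\<exists>B. 0 \<le> B \<and> (\<forall>x\<in>U. \<bar>M0 x\<bar> \<le> B \<and> \<bar>M1 x\<bar> \<le> B \<and> \<bar>M2 x\<bar> \<le> B \<and> \<bar>M3 x\<bar> \<le> B)"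
  proof (rule exI[of _ ?B], intro conjI ballI)
    fix x assume x: "x \<in> U"
    note Bx = bspec[OF B(1) x] bspec[OF B(2) x] bspec[OF B(3) x] bspec[OF B(4) x]
    show "\<bar>M0 x\<bar> \<le> ?B" "\<bar>M1 x\<bar> \<le> ?B" "\<bar>M2 x\<bar> \<le> ?B" "\<bar>M3 x\<bar> \<le> ?B"
      using Bx by linarith+
  qed simp
  then have "0 \<le> KM \<and> (\<forall>x\<in>U. \<bar>M0 x\<bar> \<le> KM \<and> \<bar>M1 x\<bar> \<le> KM \<and> \<bar>M2 x\<bar> \<le> KM \<and> \<bar>M3 x\<bar> \<le> KM)"
    unfolding KM_def by (rule someI_ex)
  then have k: "0 \<le> KM" "\<forall>x\<in>U. \<bar>M0 x\<bar> \<le> KM \<and> \<bar>M1 x\<bar> \<le> KM \<and> \<bar>M2 x\<bar> \<le> KM \<and> \<bar>M3 x\<bar> \<le> KM"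
    by (rule conjunct1, rule conjunct2)
  show "0 \<le> KM" by (rule k(1))
  show "\<bar>M0 x\<bar> \<le> KM" "\<bar>M1 x\<bar> \<le> KM" "\<bar>M2 x\<bar> \<le> KM" "\<bar>M3 x\<bar> \<le> KM" if "x \<in> U"
    using bspec[OF k(2) that] by simp_all
qed

text \<open>\<open>b1\<close>, \<open>b2\<close>, \<open>b3\<close> are the first three derivatives
  in \<open>x\<close> of \<open>F 1 x p + M0 x * F 0 x p\<close>. The third one controls how
  \<open>b2\<close> depends on \<open>x\<close>.\<close>

definition b1 :: "real \<Rightarrow> real^2 \<Rightarrow> real" where
  "b1 x p = F 2 x p + M1 x * F 0 x p + M0 x * F 1 x p"
definition b2 :: "real \<Rightarrow> real^2 \<Rightarrow> real" where
  "b2 x p = F 3 x p + M2 x * F 0 x p + 2 * M1 x * F 1 x p + M0 x * F 2 x p"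
definition b3 :: "real \<Rightarrow> real^2 \<Rightarrow> real" where
  "b3 x p = F 4 x p + M3 x * F 0 x p + 3 * M2 x * F 1 x p + 3 * M1 x * F 2 x p + M0 x * F 3 x p"

lemma F_derivs:
  "((\<lambda>x. F 0 x p) has_real_derivative F 1 x p) (at x within S)"
  "((\<lambda>x. F 1 x p) has_real_derivative F 2 x p) (at x within S)"
  "((\<lambda>x. F 2 x p) has_real_derivative F 3 x p) (at x within S)"
  "((\<lambda>x. F 3 x p) has_real_derivative F 4 x p) (at x within S)"
  using F_deriv[of 0 p x] F_deriv[of 1 p x] F_deriv[of 2 p x] F_deriv[of 3 p x]
  by (auto intro!: has_field_derivative_at_within simp: eval_nat_numeral)

lemma b1_deriv: "x \<in> U \<Longrightarrow> ((\<lambda>x. b1 x p) has_real_derivative b2 x p) (at x within U)"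
  unfolding b1_def
  by (rule DERIV_cong[OF DERIV_add[OF DERIV_add[OF F_derivs(3) DERIV_mult[OF M_derivs(2) F_derivs(1)]]
          DERIV_mult[OF M_derivs(1) F_derivs(2)]]]) (auto simp: b2_def algebra_simps)

lemma b2_deriv: "x \<in> U \<Longrightarrow> ((\<lambda>x. b2 x p) has_real_derivative b3 x p) (at x within U)"
  unfolding b2_def
  by (rule DERIV_cong[OF DERIV_add[OF DERIV_add[OF DERIV_add[OF F_derivs(4) DERIV_mult[OF M_derivs(3) F_derivs(1)]]
          DERIV_mult[OF DERIV_cmult[OF M_derivs(2)] F_derivs(2)]] DERIV_mult[OF M_derivs(1) F_derivs(3)]]])
    (auto simp: b3_def algebra_simps)

definition Kb :: real where "Kb = 8 * K * (1 + KM)"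

lemma Kb_pos: "0 \<le> Kb" using pos KM by (simp add: Kb_def)

text \<open>The factor 8 covers the binomial weights 1, 3, 3, 1. Keeping \<open>B\<close> general
  lets the same bounds apply to values, with \<open>B = K\<close>, and to Hoelder differences, with
  \<open>B = K * dist p q powr \<alpha>\<close>.\<close>

lemma lincomb_bound:
  fixes m0 m1 m2 m3 :: real
  assumes "\<bar>a\<bar> \<le> B" "\<bar>a0\<bar> \<le> B" "\<bar>a1\<bar> \<le> B" "\<bar>a2\<bar> \<le> B" "\<bar>a3\<bar> \<le> B"
    "\<bar>m0\<bar> \<le> KM" "\<bar>m1\<bar> \<le> KM" "\<bar>m2\<bar> \<le> KM" "\<bar>m3\<bar> \<le> KM"
  shows "\<bar>a + m3 * a0 + 3 * m2 * a1 + 3 * m1 * a2 + m0 * a3\<bar> \<le> 8 * B * (1 + KM)"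
    "\<bar>a + m2 * a0 + 2 * m1 * a1 + m0 * a2\<bar> \<le> 8 * B * (1 + KM)"
    "\<bar>a + m1 * a0 + m0 * a1\<bar> \<le> 8 * B * (1 + KM)"
proof -
  have B: "0 \<le> B" using assms(1) by linarith
  have m: "\<bar>u * v\<bar> \<le> KM * B" if "\<bar>u\<bar> \<le> KM" "\<bar>v\<bar> \<le> B" for u v
    unfolding abs_mult using that KM by (intro mult_mono) auto
  have BK: "0 \<le> KM * B" using B KM by simp
  note t = m[OF assms(9) assms(2)] m[OF assms(8) assms(3)] m[OF assms(7) assms(4)] m[OF assms(6) assms(5)]
    m[OF assms(8) assms(2)] m[OF assms(7) assms(3)] m[OF assms(6) assms(4)] m[OF assms(7) assms(2)] m[OF assms(6) assms(3)]
  have e: "8 * B * (1 + KM) = 8 * B + 8 * (KM * B)" by (simp add: algebra_simps)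
  show "\<bar>a + m3 * a0 + 3 * m2 * a1 + 3 * m1 * a2 + m0 * a3\<bar> \<le> 8 * B * (1 + KM)"
    unfolding e unfolding mult.assoc using t(1-4) BK B assms(1) by linarith
  show "\<bar>a + m2 * a0 + 2 * m1 * a1 + m0 * a2\<bar> \<le> 8 * B * (1 + KM)"
    unfolding e unfolding mult.assoc using t(5-7) BK B assms(1) by linarith
  show "\<bar>a + m1 * a0 + m0 * a1\<bar> \<le> 8 * B * (1 + KM)"
    unfolding e unfolding mult.assoc using t(8,9) BK B assms(1) by linarith
qed

lemma b_bounds:
  assumes x: "x \<in> U"
  shows "\<bar>b1 x p\<bar> \<le> Kb" "\<bar>b2 x p\<bar> \<le> Kb" "\<bar>b3 x p\<bar> \<le> Kb"
proof -
  note L = lincomb_bound[OF F_bound F_bound F_bound F_bound F_bound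
      KM(2)[OF x] KM(3)[OF x] KM(4)[OF x] KM(5)[OF x]]
  show "\<bar>b1 x p\<bar> \<le> Kb" unfolding b1_def Kb_def by (rule L(3); (rule le_refl | simp))
  show "\<bar>b2 x p\<bar> \<le> Kb" unfolding b2_def Kb_def by (rule L(2); (rule le_refl | simp))
  show "\<bar>b3 x p\<bar> \<le> Kb" unfolding b3_def Kb_def by (rule L(1); (rule le_refl | simp))
qed

lemma b_holder:
  assumes x: "x \<in> U"
  shows "holder (b1 x) Kb" "holder (b2 x) Kb" "holder (b3 x) Kb"
proof -
  have f: "\<bar>F n x p - F n x q\<bar> \<le> K * dist p q powr \<alpha>" if "n \<le> 5" for n p q
    using F_holder[OF that] by (simp add: holder_def)
  note L = lincomb_bound[OF f f f f f KM(2)[OF x] KM(3)[OF x] KM(4)[OF x] KM(5)[OF x]]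
  have e: "Kb * d = 8 * (K * d) * (1 + KM)" for d by (simp add: Kb_def)
  have "\<bar>b1 x p - b1 x q\<bar> \<le> Kb * dist p q powr \<alpha>" for p q
  proof -
    have "b1 x p - b1 x q = (F 2 x p - F 2 x q) + M1 x * (F 0 x p - F 0 x q) + M0 x * (F 1 x p - F 1 x q)"
      by (simp add: b1_def algebra_simps)
    then show ?thesis unfolding e by (simp only:) (rule L(3); (rule le_refl | simp))
  qed
  then show "holder (b1 x) Kb" by (simp add: holder_def)
  have "\<bar>b2 x p - b2 x q\<bar> \<le> Kb * dist p q powr \<alpha>" for p q
  proof -
    have "b2 x p - b2 x q = (F 3 x p - F 3 x q) + M2 x * (F 0 x p - F 0 x q) + 2 * M1 x * (F 1 x p - F 1 x q)
        + M0 x * (F 2 x p - F 2 x q)"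
      by (simp add: b2_def algebra_simps)
    then show ?thesis unfolding e by (simp only:) (rule L(2); (rule le_refl | simp))
  qed
  then show "holder (b2 x) Kb" by (simp add: holder_def)
  have "\<bar>b3 x p - b3 x q\<bar> \<le> Kb * dist p q powr \<alpha>" for p q
  proof -
    have "b3 x p - b3 x q = (F 4 x p - F 4 x q) + M3 x * (F 0 x p - F 0 x q) + 3 * M2 x * (F 1 x p - F 1 x q)
        + 3 * M1 x * (F 2 x p - F 2 x q) + M0 x * (F 3 x p - F 3 x q)"
      by (simp add: b3_def algebra_simps)
    then show ?thesis unfolding e by (simp only:) (rule L(1); (rule le_refl | simp))
  qed
  then show "holder (b3 x) Kb" by (simp add: holder_def)
qed

lemma b_continuous: "continuous_on (U \<times> UNIV) (\<lambda>(x, p). b1 x p)" "continuous_on (U \<times> UNIV) (\<lambda>(x, p). b2 x p)"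
proof -
  have M: "continuous_on (U \<times> UNIV) (\<lambda>z :: real \<times> (real^2). m (fst z))" if "continuous_on U m" for m :: "real \<Rightarrow> real"
    by (rule continuous_on_compose2[OF that]) (auto intro!: continuous_intros)
  have f: "continuous_on (U \<times> UNIV) (\<lambda>z. F n (fst z) (snd z))" if "n \<le> 5" for n
    using F_continuous[OF that] by (simp add: split_beta)
  show "continuous_on (U \<times> UNIV) (\<lambda>(x, p). b1 x p)" "continuous_on (U \<times> UNIV) (\<lambda>(x, p). b2 x p)"
    unfolding b1_def b2_def split_beta by (intro continuous_intros M M_continuous f; simp)+
qed

lemma b_torus_fun: "torus_fun (b1 x)" "torus_fun (b2 x)"
  using F_torus_fun[of 0 x] F_torus_fun[of 1 x] F_torus_fun[of 2 x] F_torus_fun[of 3 x]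
  unfolding torus_fun_def b1_def b2_def by (simp_all del: One_nat_def)

lemma fb_derivs:
  "(fb 0 has_real_derivative fb 1 x) (at x within S)" "(fb 1 has_real_derivative fb 2 x) (at x within S)"
  "(fb 2 has_real_derivative fb 3 x) (at x within S)"
  using fb_deriv[of 0 x] fb_deriv[of 1 x] fb_deriv[of 2 x]
  by (auto intro!: has_field_derivative_at_within simp: eval_nat_numeral)

text \<open>\<open>fb 1 + M0 fb 0\<close> is constant by the choice of \<open>M0\<close>, and \<open>b1\<close>, \<open>b2\<close> average to its derivatives.\<close>

lemma b_mean_zero:
  assumes x: "x \<in> U"
  shows "torus_avg (b1 x) = 0" "torus_avg (b2 x) = 0"
proof -
  have ab1: "torus_avg (b1 x) = fb 2 x + M1 x * fb 0 x + M0 x * fb 1 x" for x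
    unfolding b1_def[abs_def] fb_def
    by (simp add: torus_avg_add torus_avg_cmult torus_cont_intros F_torus_cont del: One_nat_def)
  have ab2: "torus_avg (b2 x) = fb 3 x + M2 x * fb 0 x + 2 * M1 x * fb 1 x + M0 x * fb 2 x" for x
    unfolding b2_def[abs_def] fb_def
    by (simp add: torus_avg_add torus_avg_cmult torus_cont_intros F_torus_cont del: One_nat_def)
  have le: "pm < pM" using order pos by linarith
  \<comment> \<open>Both \<open>fb 0 y\<close> and \<open>fb 1 y - fb 1 0\<close> are
    \<open>y\<close> times a moment, and \<open>M0\<close> is minus the quotient of these
    moments.\<close>
  have const: "fb 1 y + M0 y * fb 0 y = fb 1 0" if "y \<in> U" for y
  proof -
    have nz: "mom 0 1 y \<noteq> 0" using mom_0_1_neg[OF that] by simp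
    have "fb 0 y = y * mom 0 1 y" "fb 1 y = fb 1 0 + y * mom 0 2 y"
      using mom_0[of 0 y] mom_0[of 1 y] fb_0_0 by (simp_all add: numeral_2_eq_2)
    then show ?thesis using nz by (simp add: M0_def)
  qed
  have z: "fb 2 x + (M1 x * fb 0 x + fb 1 x * M0 x) = 0" if "x \<in> U" for x
    by (rule deriv_of_constant_within[where g="\<lambda>y. fb 1 y + M0 y * fb 0 y", OF le that const])
      (assumption, rule DERIV_add[OF fb_derivs(2) DERIV_mult[OF M_derivs(1)[OF that] fb_derivs(1)]])
  have z2: "fb 2 x + M1 x * fb 0 x + M0 x * fb 1 x = 0" if "x \<in> U" for x
    using z[OF that] by (simp only: mult.commute[of "fb 1 x"] add.assoc)
  show "torus_avg (b1 x) = 0" unfolding ab1 by (rule z2[OF x])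
  have "fb 3 x + (M2 x * fb 0 x + fb 1 x * M1 x) + (M1 x * fb 1 x + fb 2 x * M0 x) = 0"
    by (rule deriv_of_constant_within[where g="\<lambda>x. fb 2 x + M1 x * fb 0 x + M0 x * fb 1 x", OF le x z2])
      (assumption, rule DERIV_add[OF DERIV_add[OF fb_derivs(3) DERIV_mult[OF M_derivs(2)[OF x] fb_derivs(1)]]
        DERIV_mult[OF M_derivs(1)[OF x] fb_derivs(2)]])
  then show "torus_avg (b2 x) = 0" using ab2 by (simp add: algebra_simps)
qed

text \<open>The factor 12 covers the coefficients \<open>2 * KM + 2\<close> and
  \<open>5 * KM + 6\<close> of the two remainder estimates.\<close>

definition Krem :: real where "Krem = 12 * K\<^sup>2 * (1 + KM)"

lemma Krem_pos: "0 \<le> Krem" using KM by (simp add: Krem_def)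

text \<open>One step along the orbit: the exact increments of the telescoping sums differ from their
  first-order parts \<open>\<rho> b1\<close>, \<open>\<rho> b2\<close> by \<open>O(\<rho>\<^sup>2)\<close>.\<close>

lemma M_step:
  assumes \<rho>: "small \<rho>" and x: "x \<in> U"
  shows "\<bar>M0 (x + \<rho> * F 0 x p) - M0 x - \<rho> * F 0 x p * M1 x\<bar> \<le> KM * K\<^sup>2 * \<rho>\<^sup>2"
    "\<bar>M1 (x + \<rho> * F 0 x p) - M1 x - \<rho> * F 0 x p * M2 x\<bar> \<le> KM * K\<^sup>2 * \<rho>\<^sup>2"
    "\<bar>M0 (x + \<rho> * F 0 x p) - M0 x\<bar> \<le> KM * K * \<rho>" "\<bar>M1 (x + \<rho> * F 0 x p) - M1 x\<bar> \<le> KM * K * \<rho>"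
proof -
  let ?y = "x + \<rho> * F 0 x p"
  note y = step_in_U[OF \<rho> x, of p]
  have d: "\<bar>\<rho> * F 0 x p\<bar> \<le> K * \<rho>"
    using mult_left_mono[OF F_bound[of 0 x p], of \<rho>] smallD(1)[OF \<rho>] by (simp add: abs_mult mult.commute)
  have d2: "(?y - x)\<^sup>2 \<le> K\<^sup>2 * \<rho>\<^sup>2"
    using abs_le_square_iff[of "\<rho> * F 0 x p" "K * \<rho>"] d pos smallD(1)[OF \<rho>] by (simp add: power_mult_distrib)
  have "\<bar>M0 ?y - M0 x - M1 x * (?y - x)\<bar> \<le> KM * (?y - x)\<^sup>2"
    by (rule deriv_bound_taylor[OF M_derivs(1,2) KM(4) x y])
  also have "\<dots> \<le> KM * (K\<^sup>2 * \<rho>\<^sup>2)" by (rule mult_left_mono[OF d2 KM(1)])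
  finally show "\<bar>M0 ?y - M0 x - \<rho> * F 0 x p * M1 x\<bar> \<le> KM * K\<^sup>2 * \<rho>\<^sup>2" by (simp add: mult_ac)
  have "\<bar>M1 ?y - M1 x - M2 x * (?y - x)\<bar> \<le> KM * (?y - x)\<^sup>2"
    by (rule deriv_bound_taylor[OF M_derivs(2,3) KM(5) x y])
  also have "\<dots> \<le> KM * (K\<^sup>2 * \<rho>\<^sup>2)" by (rule mult_left_mono[OF d2 KM(1)])
  finally show "\<bar>M1 ?y - M1 x - \<rho> * F 0 x p * M2 x\<bar> \<le> KM * K\<^sup>2 * \<rho>\<^sup>2" by (simp add: mult_ac)
  have "\<bar>M0 ?y - M0 x\<bar> \<le> KM * \<bar>?y - x\<bar>" by (rule deriv_bound_diff[OF M_derivs(1) KM(3) y x])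
  also have "\<dots> \<le> KM * (K * \<rho>)" using d by (intro mult_left_mono KM) auto
  finally show "\<bar>M0 ?y - M0 x\<bar> \<le> KM * K * \<rho>" by simp
  have "\<bar>M1 ?y - M1 x\<bar> \<le> KM * \<bar>?y - x\<bar>" by (rule deriv_bound_diff[OF M_derivs(2) KM(4) y x])
  also have "\<dots> \<le> KM * (K * \<rho>)" using d by (intro mult_left_mono KM) auto
  finally show "\<bar>M1 ?y - M1 x\<bar> \<le> KM * K * \<rho>" by simp
qed

lemma remainder_1:
  assumes \<rho>: "small \<rho>" and x: "x \<in> U"
  shows "\<bar>\<rho> * k0 \<rho> x p + M0 (x + \<rho> * F 0 x p) * (1 + \<rho> * F 1 x p) - M0 x - \<rho> * b1 x p\<bar> \<le> Krem * \<rho>\<^sup>2"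
proof -
  let ?y = "x + \<rho> * F 0 x p" and ?f = "F 1 x p"
  note r = smallD[OF \<rho>] and ms = M_step[OF \<rho> x, of p]
  have k: "F 2 x p - k0 \<rho> x p = k0 \<rho> x p * (\<rho> * ?f)"
    using growth_factor_nz[OF \<rho>, of x p] by (simp add: k0_def field_simps del: One_nat_def)
  \<comment> \<open>The three remainders are the second-order Taylor error of \<open>M0\<close>, a
    product of two first-order increments, and the error of replacing \<open>k0\<close> by
    \<open>F 2\<close>.\<close>
  have eq: "\<rho> * k0 \<rho> x p + M0 ?y * (1 + \<rho> * ?f) - M0 x - \<rho> * b1 x p =
      (M0 ?y - M0 x - \<rho> * F 0 x p * M1 x) + \<rho> * ?f * (M0 ?y - M0 x) - \<rho> * (F 2 x p - k0 \<rho> x p)"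
    by (simp add: b1_def algebra_simps del: One_nat_def)
  have "\<bar>\<rho> * k0 \<rho> x p + M0 ?y * (1 + \<rho> * ?f) - M0 x - \<rho> * b1 x p\<bar> \<le> KM * K\<^sup>2 * \<rho>\<^sup>2 + (\<rho> * K) * (KM * K * \<rho>) + \<rho> * ((2 * K) * (\<rho> * K))"
  proof -
    have 2: "\<bar>\<rho> * ?f * (M0 ?y - M0 x)\<bar> \<le> (\<rho> * K) * (KM * K * \<rho>)"
      unfolding abs_mult using r(1) F_bound[of 1 x p] pos KM(1) ms(3) by (intro mult_mono) auto
    have 3: "\<bar>\<rho> * (F 2 x p - k0 \<rho> x p)\<bar> \<le> \<rho> * ((2 * K) * (\<rho> * K))"
      unfolding k abs_mult using r(1) F_bound[of 1 x p] pos k0_bound[OF \<rho>] by (intro mult_mono) auto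
    show ?thesis unfolding eq using ms(1) 2 3 by linarith
  qed
  also have "\<dots> = (2 * KM + 2) * (K\<^sup>2 * \<rho>\<^sup>2)" by (simp add: power2_eq_square algebra_simps)
  also have "\<dots> \<le> (12 * (1 + KM)) * (K\<^sup>2 * \<rho>\<^sup>2)" using KM(1) by (intro mult_right_mono) auto
  finally show ?thesis unfolding Krem_def by (simp only: mult_ac)
qed

lemma remainder_2:
  assumes \<rho>: "small \<rho>" and x: "x \<in> U"
  shows "\<bar>\<rho> * k1 \<rho> x p + M1 (x + \<rho> * F 0 x p) * (1 + \<rho> * F 1 x p)\<^sup>2 - M1 x
      + \<rho> * M0 (x + \<rho> * F 0 x p) * F 2 x p - \<rho> * b2 x p\<bar> \<le> Krem * \<rho>\<^sup>2"
proof -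
  let ?y = "x + \<rho> * F 0 x p" and ?f = "F 1 x p" and ?g = "1 + \<rho> * F 1 x p"
  note r = smallD[OF \<rho>] and ms = M_step[OF \<rho> x, of p]
  note g = growth_factor_nz[OF \<rho>, of x p]
  have g4: "1 / 4 \<le> ?g\<^sup>2"
    using power_mono[OF growth_factor(1)[OF \<rho>, of x p], of 2] by (simp add: power2_eq_square)
  have k: "k1 \<rho> x p = F 3 x p - \<rho> * (F 3 x p * ?f / ?g) - \<rho> * ((F 2 x p)\<^sup>2 / ?g\<^sup>2)"
  proof -
    have "k1 \<rho> x p = F 3 x p / ?g - \<rho> * ((F 2 x p)\<^sup>2 / ?g\<^sup>2)"
      unfolding k1_def using g by (simp add: diff_divide_distrib power2_eq_square del: One_nat_def)
    moreover have "F 3 x p / ?g = F 3 x p - \<rho> * (F 3 x p * ?f / ?g)"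
      using g by (simp add: field_simps del: One_nat_def)
    ultimately show ?thesis by simp
  qed
  \<comment> \<open>A polynomial identity in real variables. The denominators are hidden in
    \<open>u\<close> and \<open>v\<close>, so that ring normalization settles it before the
    functions are inserted.\<close>
  have alg: "r * (f3 - r * u - r * v) + m1' * (1 + r * f1)\<^sup>2 - m1 + r * m0' * f2 - r * (f3 + m2 * f0 + 2 * m1 * f1 + m0 * f2)
      = (m1' - m1 - r * f0 * m2) + 2 * (r * f1 * (m1' - m1)) + r\<^sup>2 * (f1 * f1 * m1') + r * f2 * (m0' - m0)
        - r\<^sup>2 * u - r\<^sup>2 * v" for r f0 f1 f2 f3 u v m0 m1 m2 m0' m1' :: real
    by (simp add: power2_eq_square algebra_simps)
  have eq: "\<rho> * k1 \<rho> x p + M1 ?y * ?g\<^sup>2 - M1 x + \<rho> * M0 ?y * F 2 x p - \<rho> * b2 x p =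
      (M1 ?y - M1 x - \<rho> * F 0 x p * M2 x) + 2 * (\<rho> * ?f * (M1 ?y - M1 x)) + \<rho>\<^sup>2 * (?f * ?f * M1 ?y)
      + \<rho> * F 2 x p * (M0 ?y - M0 x) - \<rho>\<^sup>2 * (F 3 x p * ?f / ?g) - \<rho>\<^sup>2 * ((F 2 x p)\<^sup>2 / ?g\<^sup>2)"
    unfolding k b2_def
    by (rule alg[where ?f0.0="F 0 x p" and ?f1.0="F 1 x p" and ?f2.0="F 2 x p" and ?f3.0="F 3 x p" and r=\<rho> and m0'="M0 ?y" and m1'="M1 ?y"
          and ?m0.0="M0 x" and ?m1.0="M1 x" and ?m2.0="M2 x" and u="F 3 x p * ?f / ?g" and v="(F 2 x p)\<^sup>2 / ?g\<^sup>2"])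
  have "\<bar>\<rho> * k1 \<rho> x p + M1 ?y * ?g\<^sup>2 - M1 x + \<rho> * M0 ?y * F 2 x p - \<rho> * b2 x p\<bar> \<le> KM * K\<^sup>2 * \<rho>\<^sup>2 + 2 * ((\<rho> * K) * (KM * K * \<rho>)) + \<rho>\<^sup>2 * (K * K * KM)
      + (\<rho> * K) * (KM * K * \<rho>) + \<rho>\<^sup>2 * (K * K / (1 / 2)) + \<rho>\<^sup>2 * (K\<^sup>2 / (1 / 4))"
  proof -
    have 2: "\<bar>\<rho> * ?f * (M1 ?y - M1 x)\<bar> \<le> (\<rho> * K) * (KM * K * \<rho>)"
      unfolding abs_mult using r(1) F_bound[of 1 x p] pos KM(1) ms(4) by (intro mult_mono) auto
    have 3: "\<bar>\<rho>\<^sup>2 * (?f * ?f * M1 ?y)\<bar> \<le> \<rho>\<^sup>2 * (K * K * KM)"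
      unfolding abs_mult using r(1) F_bound[of 1 x p] pos KM(3)[OF step_in_U[OF \<rho> x]] by (intro mult_mono) auto
    have 4: "\<bar>\<rho> * F 2 x p * (M0 ?y - M0 x)\<bar> \<le> (\<rho> * K) * (KM * K * \<rho>)"
      unfolding abs_mult using r(1) F_bound[of 2 x p] pos KM(1) ms(3) by (intro mult_mono) auto
    have "\<bar>F 3 x p * ?f / ?g\<bar> \<le> K * K / (1 / 2)"
      unfolding abs_divide abs_mult using growth_factor(1)[OF \<rho>, of x p] pos F_bound[of 1 x p] F_bound[of 3 x p]
      by (intro frac_le mult_mono) auto
    then have 5: "\<bar>\<rho>\<^sup>2 * (F 3 x p * ?f / ?g)\<bar> \<le> \<rho>\<^sup>2 * (K * K / (1 / 2))"
      unfolding abs_mult by (intro mult_mono) auto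
    have "\<bar>F 2 x p\<bar>\<^sup>2 \<le> K\<^sup>2" using F_bound[of 2 x p] by (intro power_mono) auto
    then have "\<bar>(F 2 x p)\<^sup>2 / ?g\<^sup>2\<bar> \<le> K\<^sup>2 / (1 / 4)"
      unfolding abs_divide using g4 by (intro frac_le) auto
    then have 6: "\<bar>\<rho>\<^sup>2 * ((F 2 x p)\<^sup>2 / ?g\<^sup>2)\<bar> \<le> \<rho>\<^sup>2 * (K\<^sup>2 / (1 / 4))"
      unfolding abs_mult by (intro mult_mono) auto
    show ?thesis unfolding eq using ms(2) 2 3 4 5 6 by linarith
  qed
  also have "\<dots> = (5 * KM + 6) * (K\<^sup>2 * \<rho>\<^sup>2)" by (simp add: power2_eq_square algebra_simps)
  also have "\<dots> \<le> (12 * (1 + KM)) * (K\<^sup>2 * \<rho>\<^sup>2)" using KM(1) by (intro mult_right_mono) auto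
  finally show ?thesis unfolding Krem_def by (simp only: mult_ac)
qed

section \<open>Exact telescoping sums for R and T\<close>

definition D1 :: "real \<Rightarrow> real \<Rightarrow> real^2 \<Rightarrow> real" where
  "D1 \<rho> x p = \<rho> * k0 \<rho> x p + M0 (x + \<rho> * F 0 x p) * (1 + \<rho> * F 1 x p) - M0 x"

definition D2 :: "real \<Rightarrow> real \<Rightarrow> real^2 \<Rightarrow> real" where
  "D2 \<rho> x p = \<rho> * k1 \<rho> x p + M1 (x + \<rho> * F 0 x p) * (1 + \<rho> * F 1 x p)\<^sup>2 - M1 x
      + \<rho> * M0 (x + \<rho> * F 0 x p) * F 2 x p"

text \<open>Along the averaged flow the analogue of \<open>R + M0 * P\<close> would be constant;
  along the true orbit its increments are \<open>P * D1\<close>. The boundary term at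
  \<open>N\<close> dies with \<open>P\<close>, and the one at 0 is the value for the averaged
  flow.\<close>

lemma R_telescope:
  "R \<rho> N x \<psi> + M0 (X \<rho> N x \<psi>) * P \<rho> N x \<psi> - M0 x = (\<Sum>n<N. P \<rho> n x \<psi> * D1 \<rho> (X \<rho> n x \<psi>) (iter n \<psi>))"
  by (induction N) (auto simp: D1_def algebra_simps simp del: One_nat_def)

text \<open>The left side is the derivative of the left side of \<open>R_telescope\<close> in the
  initial value; its increments split into a part with \<open>D2\<close> and one that reuses
  \<open>D1\<close>.\<close>

lemma T_telescope:
  assumes \<rho>: "small \<rho>"
  shows "T \<rho> N x \<psi> + M1 (X \<rho> N x \<psi>) * (P \<rho> N x \<psi>)\<^sup>2 + M0 (X \<rho> N x \<psi>) * P \<rho> N x \<psi> * R \<rho> N x \<psi> - M1 x =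
    (\<Sum>n<N. (P \<rho> n x \<psi>)\<^sup>2 * D2 \<rho> (X \<rho> n x \<psi>) (iter n \<psi>)
      + P \<rho> n x \<psi> * R \<rho> n x \<psi> * D1 \<rho> (X \<rho> n x \<psi>) (iter n \<psi>))"
proof (induction N)
  case (Suc N)
  let ?x = "X \<rho> N x \<psi>" and ?q = "iter N \<psi>" and ?p = "P \<rho> N x \<psi>" and ?r = "R \<rho> N x \<psi>"
  let ?g = "1 + \<rho> * F 1 ?x ?q" and ?k = "k0 \<rho> ?x ?q" and ?y = "?x + \<rho> * F 0 ?x ?q"
  have k: "F 2 ?x ?q = ?k * ?g" using growth_factor_nz[OF \<rho>, of ?x ?q] by (simp add: k0_def)
  have "T \<rho> (Suc N) x \<psi> + M1 (X \<rho> (Suc N) x \<psi>) * (P \<rho> (Suc N) x \<psi>)\<^sup>2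
        + M0 (X \<rho> (Suc N) x \<psi>) * P \<rho> (Suc N) x \<psi> * R \<rho> (Suc N) x \<psi> - M1 x
      = (T \<rho> N x \<psi> + M1 ?x * ?p\<^sup>2 + M0 ?x * ?p * ?r - M1 x) + (?p\<^sup>2 * D2 \<rho> ?x ?q + ?p * ?r * D1 \<rho> ?x ?q)"
    unfolding D1_def D2_def k by (simp add: power_mult_distrib algebra_simps power2_eq_square del: One_nat_def)
  then show ?case unfolding Suc by simp
qed (simp)

section \<open>Concentration on the invariant graph and of the telescoping sums\<close>

text \<open>The regularity that \<open>observable_compose\<close> demands of a function of the slow
  and the fast variable, with a single constant.\<close>

definition nice :: "real \<Rightarrow> (real \<Rightarrow> real^2 \<Rightarrow> real) \<Rightarrow> bool" where
  "nice B g \<longleftrightarrow> (\<forall>x\<in>U. \<forall>p. \<bar>g x p\<bar> \<le> B) \<and> (\<forall>x\<in>U. holder (g x) B) \<and>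
     (\<forall>x\<in>U. \<forall>y\<in>U. \<forall>p. \<bar>g x p - g y p\<bar> \<le> B * \<bar>x - y\<bar>) \<and>
     (\<forall>x\<in>U. \<forall>y\<in>U. holder (\<lambda>p. g x p - g y p) (B * \<bar>x - y\<bar>)) \<and>
     (\<forall>x\<in>U. torus_fun (g x)) \<and> continuous_on (U \<times> UNIV) (\<lambda>(x, p). g x p)"

text \<open>The mixed bound follows from the mean value inequality in \<open>x\<close> for
  \<open>g x p - g x q\<close>, whose derivative is controlled by the Hoelder bound of
  \<open>g'\<close>.\<close>

lemma nice_from_deriv:
  assumes d: "\<And>x p. x \<in> U \<Longrightarrow> ((\<lambda>x. g x p) has_real_derivative g' x p) (at x within U)"
    and b: "\<And>x p. x \<in> U \<Longrightarrow> \<bar>g x p\<bar> \<le> B" and b': "\<And>x p. x \<in> U \<Longrightarrow> \<bar>g' x p\<bar> \<le> B"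
    and h: "\<And>x. x \<in> U \<Longrightarrow> holder (g x) B" and h': "\<And>x. x \<in> U \<Longrightarrow> holder (g' x) B"
    and t: "\<And>x. x \<in> U \<Longrightarrow> torus_fun (g x)" and c: "continuous_on (U \<times> UNIV) (\<lambda>(x, p). g x p)"
  shows "nice B g"
  unfolding nice_def
proof (intro conjI ballI allI b h t c)
  fix x y p assume x: "x \<in> U" and y: "y \<in> U"
  show "\<bar>g x p - g y p\<bar> \<le> B * \<bar>x - y\<bar>" by (rule deriv_bound_diff[OF d b' x y])
  show "holder (\<lambda>p. g x p - g y p) (B * \<bar>x - y\<bar>)"
    unfolding holder_def
  proof (intro allI)
    fix p q
    have "\<bar>(g x p - g x q) - (g y p - g y q)\<bar> \<le> (B * dist p q powr \<alpha>) * \<bar>x - y\<bar>"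
    proof (rule deriv_bound_diff[where g="\<lambda>x. g x p - g x q" and ?g1.0="\<lambda>x. g' x p - g' x q", OF _ _ x y])
      fix z assume z: "z \<in> U"
      show "((\<lambda>x. g x p - g x q) has_real_derivative g' z p - g' z q) (at z within U)"
        by (intro DERIV_diff d z)
      show "\<bar>g' z p - g' z q\<bar> \<le> B * dist p q powr \<alpha>" using h'[OF z] by (simp add: holder_def)
    qed
    then show "\<bar>g x p - g y p - (g x q - g y q)\<bar> \<le> B * \<bar>x - y\<bar> * dist p q powr \<alpha>"
      by (simp add: algebra_simps)
  qed
qed

lemma nice_b1: "nice Kb b1"
  by (rule nice_from_deriv[where g'=b2]) (intro b1_deriv b_bounds b_holder b_torus_fun b_continuous; assumption)+

lemma nice_b2: "nice Kb b2"
  by (rule nice_from_deriv[where g'=b3]) (intro b2_deriv b_bounds b_holder b_torus_fun b_continuous; assumption)+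

lemma nice_F0: "nice (2 * K) (\<lambda>x p. F 0 x p - fb 0 x)"
proof (rule nice_from_deriv[where g'="\<lambda>x p. F 1 x p - fb 1 x"])
  show "((\<lambda>x. F 0 x p - fb 0 x) has_real_derivative F 1 x p - fb 1 x) (at x within U)" for x p
    by (intro DERIV_diff F_derivs fb_derivs)
  show "\<bar>F 0 x p - fb 0 x\<bar> \<le> 2 * K" "\<bar>F 1 x p - fb 1 x\<bar> \<le> 2 * K" for x p
    using F_bound[of 0 x p] F_bound[of 1 x p] fb_bound[of 0 x] fb_bound[of 1 x] by linarith+
  have h: "holder (\<lambda>p. F n x p - fb n x) (2 * K)" if "n \<le> 5" for n x
    unfolding holder_def
  proof (intro allI)
    fix p q :: "real^2"
    have "K * dist p q powr \<alpha> \<le> 2 * K * dist p q powr \<alpha>" using pos by (intro mult_right_mono) auto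
    moreover have "\<bar>F n x p - F n x q\<bar> \<le> K * dist p q powr \<alpha>"
      using F_holder[OF that, of x] by (simp add: holder_def)
    ultimately show "\<bar>(F n x p - fb n x) - (F n x q - fb n x)\<bar> \<le> 2 * K * dist p q powr \<alpha>"
      by linarith
  qed
  then show "holder (\<lambda>p. F 0 x p - fb 0 x) (2 * K)" "holder (\<lambda>p. F 1 x p - fb 1 x) (2 * K)" for x by auto
  show "torus_fun (\<lambda>p. F 0 x p - fb 0 x)" for x using F_torus_fun[of 0 x] by (simp add: torus_fun_def)
  have "continuous_on (U \<times> UNIV) (\<lambda>z. F 0 (fst z) (snd z))"
    using F_continuous[of 0] by (simp add: split_beta)
  then show "continuous_on (U \<times> UNIV) (\<lambda>(x, p). F 0 x p - fb 0 x)"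
    unfolding split_beta by (intro continuous_intros continuous_on_compose2[OF fb_continuous[of 0 UNIV]]) auto
qed

lemma nice_observable:
  assumes g: "nice B g" and B: "0 \<le> B" and c0: "0 \<le> c0"
  obtains C where "0 \<le> C" "\<And>\<rho> X0. small \<rho> \<Longrightarrow> admissible c0 \<rho> X0 \<Longrightarrow>
      observable C \<rho> 1 (\<lambda>n \<psi> p. g (X \<rho> n (X0 \<psi>) \<psi>) p)"
proof -
  obtain D where D: "0 \<le> D"
    and sX: "\<And>\<rho> X0. small \<rho> \<Longrightarrow> admissible c0 \<rho> X0 \<Longrightarrow> slow D \<rho> 1 (\<lambda>n \<psi>. X \<rho> n (X0 \<psi>) \<psi>)"
    using slow_X[OF c0] by blast
  show ?thesis
  proof (rule that[of "B * (D + 1)"])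
    show "0 \<le> B * (D + 1)" using B D by simp
    fix \<rho> X0 assume \<rho>: "small \<rho>" and X0: "admissible c0 \<rho> X0"
    show "observable (B * (D + 1)) \<rho> 1 (\<lambda>n \<psi> p. g (X \<rho> n (X0 \<psi>) \<psi>) p)"
      by (rule observable_compose[where U=U, OF sX[OF \<rho> X0]])
        (use g B D smallD(1)[OF \<rho>] X_in_U[OF \<rho> admissibleD(2)[OF X0]] in \<open>auto simp: nice_def\<close>)
  qed
qed

lemma observable_b1:
  assumes c0: "0 \<le> c0"
  obtains C where "0 \<le> C" "\<And>\<rho> X0. small \<rho> \<Longrightarrow> admissible c0 \<rho> X0 \<Longrightarrow>
      observable C \<rho> (decay \<rho>) (\<lambda>n \<psi> p. P \<rho> n (X0 \<psi>) \<psi> * b1 (X \<rho> n (X0 \<psi>) \<psi>) p)"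
proof -
  obtain D where D: "0 \<le> D" and oD: "\<And>\<rho> X0. small \<rho> \<Longrightarrow> admissible c0 \<rho> X0 \<Longrightarrow>
      observable D \<rho> 1 (\<lambda>n \<psi> p. b1 (X \<rho> n (X0 \<psi>) \<psi>) p)"
    using nice_observable[OF nice_b1 Kb_pos c0] by blast
  obtain E where E: "0 \<le> E" and sP: "\<And>\<rho> X0. small \<rho> \<Longrightarrow> admissible c0 \<rho> X0 \<Longrightarrow>
      slow E \<rho> (decay \<rho>) (\<lambda>n \<psi>. P \<rho> n (X0 \<psi>) \<psi>)"
    using slow_P[OF c0] by blast
  show ?thesis
  proof (rule that[of "2 * E * D"])
    fix \<rho> X0 assume \<rho>: "small \<rho>" and X0: "admissible c0 \<rho> X0"
    show "observable (2 * E * D) \<rho> (decay \<rho>) (\<lambda>n \<psi> p. P \<rho> n (X0 \<psi>) \<psi> * b1 (X \<rho> n (X0 \<psi>) \<psi>) p)"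
      by (rule observable_mult[OF sP[OF \<rho> X0] oD[OF \<rho> X0] E D])
        (use decay(1)[OF \<rho>] smallD(1)[OF \<rho>] in auto)
  qed (use D E in simp)
qed

lemma observable_b2:
  assumes c0: "0 \<le> c0"
  obtains C where "0 \<le> C" "\<And>\<rho> X0. small \<rho> \<Longrightarrow> admissible c0 \<rho> X0 \<Longrightarrow>
      observable C \<rho> (decay \<rho>) (\<lambda>n \<psi> p. (P \<rho> n (X0 \<psi>) \<psi> * P \<rho> n (X0 \<psi>) \<psi>) * b2 (X \<rho> n (X0 \<psi>) \<psi>) p
        + (P \<rho> n (X0 \<psi>) \<psi> * R \<rho> n (X0 \<psi>) \<psi>) * b1 (X \<rho> n (X0 \<psi>) \<psi>) p)"
proof -
  obtain D1 where D1: "0 \<le> D1" and o1: "\<And>\<rho> X0. small \<rho> \<Longrightarrow> admissible c0 \<rho> X0 \<Longrightarrow>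
      observable D1 \<rho> 1 (\<lambda>n \<psi> p. b1 (X \<rho> n (X0 \<psi>) \<psi>) p)"
    using nice_observable[OF nice_b1 Kb_pos c0] by blast
  obtain D2 where D2: "0 \<le> D2" and o2: "\<And>\<rho> X0. small \<rho> \<Longrightarrow> admissible c0 \<rho> X0 \<Longrightarrow>
      observable D2 \<rho> 1 (\<lambda>n \<psi> p. b2 (X \<rho> n (X0 \<psi>) \<psi>) p)"
    using nice_observable[OF nice_b2 Kb_pos c0] by blast
  obtain E where E: "0 \<le> E" and sP: "\<And>\<rho> X0. small \<rho> \<Longrightarrow> admissible c0 \<rho> X0 \<Longrightarrow>
      slow E \<rho> (decay \<rho>) (\<lambda>n \<psi>. P \<rho> n (X0 \<psi>) \<psi>)"
    using slow_P[OF c0] by blast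
  obtain G where G: "0 \<le> G" and sR: "\<And>\<rho> X0. small \<rho> \<Longrightarrow> admissible c0 \<rho> X0 \<Longrightarrow>
      slow G \<rho> 1 (\<lambda>n \<psi>. R \<rho> n (X0 \<psi>) \<psi>)"
    using slow_R[OF c0] by blast
  let ?C = "2 * (2 * E * E) * D2 + 2 * (2 * E * G) * D1"
  show ?thesis
  proof (rule that[of ?C])
    fix \<rho> X0 assume \<rho>: "small \<rho>" and X0: "admissible c0 \<rho> X0"
    have r: "0 \<le> \<rho>" "0 \<le> decay \<rho>" "decay \<rho> \<le> 1" using decay[OF \<rho>] smallD(1)[OF \<rho>] by auto
    note P = sP[OF \<rho> X0]
    show "observable ?C \<rho> (decay \<rho>) (\<lambda>n \<psi> p. (P \<rho> n (X0 \<psi>) \<psi> * P \<rho> n (X0 \<psi>) \<psi>) * b2 (X \<rho> n (X0 \<psi>) \<psi>) p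
        + (P \<rho> n (X0 \<psi>) \<psi> * R \<rho> n (X0 \<psi>) \<psi>) * b1 (X \<rho> n (X0 \<psi>) \<psi>) p)"
      by (intro observable_add observable_mult slow_mult P slow_weaken[OF P] sR o1 o2 \<rho> X0)
        (use r D1 D2 E G in auto)
  qed (use D1 D2 E G in simp)
qed

text \<open>The sum may run up to any \<open>N i\<close>, since the three bounds on sums of
  observables do not involve the number of terms. They are used with
  \<open>c = \<gamma> / 2\<close>, as dictated by \<open>decay\<close>.\<close>

lemma concentrated_sum:
  assumes obs: "\<And>i. i \<in> I \<Longrightarrow> observable C (\<rho> i) (decay (\<rho> i)) (\<Gamma> i)" and C: "0 \<le> C"
    and mean: "\<And>i n \<psi>. i \<in> I \<Longrightarrow> torus_avg (\<Gamma> i n \<psi>) = 0" and \<rho>: "\<And>i. i \<in> I \<Longrightarrow> small (\<rho> i)"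
  shows "concentrated I \<rho> (\<lambda>i \<psi>. \<Sum>n<N i. \<rho> i * \<Gamma> i n \<psi> (iter n \<psi>)) (\<lambda>i. 0)"
proof (rule concentratedI)
  fix i assume i: "i \<in> I"
  note r = smallD[OF \<rho>[OF i]] and d = decay[OF \<rho>[OF i]]
  have g: "0 < \<gamma> / 2" "decay (\<rho> i) = 1 - \<gamma> / 2 * \<rho> i" using pos by (auto simp: decay_def)
  show "torus_cont (\<lambda>\<psi>. \<Sum>n<N i. \<rho> i * \<Gamma> i n \<psi> (iter n \<psi>))"
    by (intro torus_cont_intros observableD(2)[OF obs[OF i]])
  show "0 \<le> \<rho> i" "\<rho> i \<le> 1" using r by auto
  show "\<bar>torus_avg (\<lambda>\<psi>. \<Sum>n<N i. \<rho> i * \<Gamma> i n \<psi> (iter n \<psi>)) - 0\<bar>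
      \<le> corr_const * C * (1 / (\<gamma> / 2) + 1 / (1 - rate)) * \<rho> i"
    using observable_sum_mean[OF obs[OF i] mean[OF i] C r(1,2) g d(3), of "N i"] by simp
  show "torus_avg (\<lambda>\<psi>. ((\<Sum>n<N i. \<rho> i * \<Gamma> i n \<psi> (iter n \<psi>)) - 0)\<^sup>2)
      \<le> corr_const * C\<^sup>2 * (1 + norm eu powr \<alpha>) * (1 / (\<gamma> / 2)\<^sup>2 + 2 / (\<gamma> / 2 * (1 - rate))) * \<rho> i"
    using observable_sum_square[OF obs[OF i] mean[OF i] C r(1,2) g d(3), of "N i"] by simp
  show "\<bar>\<Sum>n<N i. \<rho> i * \<Gamma> i n \<psi> (iter n \<psi>)\<bar> \<le> C / (\<gamma> / 2)" for \<psi>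
    by (rule observable_sum_abs[OF obs[OF i] C r(1) g less_imp_le[OF d(1)]])
  show "\<bar>0\<bar> \<le> (0::real)" by simp
qed

text \<open>Collects everything over which the estimates must be uniform. The condition on
  \<open>N\<close> makes the boundary terms of the telescoping sums O(\<rho>).\<close>

definition params :: "(real \<times> (real^2 \<Rightarrow> real) \<times> nat \<times> real) set" where
  "params = {(\<rho>, W, N, \<phi>). small \<rho> \<and> invariant \<rho> W \<and> decay \<rho> ^ N \<le> \<rho> \<and> \<phi> \<in> U}"

abbreviation params1 :: "((real \<times> (real^2 \<Rightarrow> real) \<times> nat \<times> real) \<times> real) set" where
  "params1 \<equiv> {(j, t). j \<in> params \<and> t \<in> {0..1}}"

text \<open>The segment from the invariant graph to \<open>\<phi>\<close>, along which Taylor's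
  formula with integral remainder is taken.\<close>

definition start :: "(real^2 \<Rightarrow> real) \<Rightarrow> real \<Rightarrow> real \<Rightarrow> real^2 \<Rightarrow> real" where
  "start W \<phi> t \<psi> = W \<psi> + t * (\<phi> - W \<psi>)"

lemma invariantD:
  assumes "invariant \<rho> W"
  shows "W \<psi> \<in> {Sm..SM}" "W \<psi> \<in> U" "W (A *v \<psi>) = W \<psi> + \<rho> * F 0 (W \<psi>) \<psi>"
proof -
  show w: "W \<psi> \<in> {Sm..SM}" "W (A *v \<psi>) = W \<psi> + \<rho> * F 0 (W \<psi>) \<psi>" using assms by (auto simp: invariant_def)
  then show "W \<psi> \<in> U" using order pos by auto
qed

lemma start_in_U:
  assumes "invariant \<rho> W" "\<phi> \<in> U" "t \<in> {0..1}"
  shows "start W \<phi> t \<psi> \<in> U"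
proof -
  have "(1 - t) *\<^sub>R W \<psi> + t *\<^sub>R \<phi> \<in> U"
    using invariantD(2)[OF assms(1), of \<psi>] assms(2,3) convex_real_interval(5)[of pm pM]
    by (intro convexD) auto
  then show ?thesis by (simp add: start_def algebra_simps)
qed

lemma start_admissible:
  assumes \<rho>: "small \<rho>" and W: "invariant \<rho> W" and "\<phi> \<in> U" and t: "t \<in> {0..1}"
  shows "admissible cW \<rho> (start W \<phi> t)"
  unfolding admissible_def
proof (intro conjI allI)
  show "torus_cont (start W \<phi> t)"
    unfolding start_def[abs_def] by (intro torus_cont_intros invariant_torus_cont[OF \<rho> W])
  show "start W \<phi> t \<psi> \<in> U" for \<psi> by (rule start_in_U[OF W assms(3) t])
  fix \<psi> s
  have "\<bar>start W \<phi> t (\<psi> + s *\<^sub>R eu) - start W \<phi> t \<psi>\<bar> = (1 - t) * \<bar>W (\<psi> + s *\<^sub>R eu) - W \<psi>\<bar>"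
  proof -
    have "start W \<phi> t (\<psi> + s *\<^sub>R eu) - start W \<phi> t \<psi> = (1 - t) * (W (\<psi> + s *\<^sub>R eu) - W \<psi>)"
      by (simp add: start_def algebra_simps)
    then show ?thesis using t by (simp add: abs_mult)
  qed
  also have "\<dots> \<le> 1 * \<bar>W (\<psi> + s *\<^sub>R eu) - W \<psi>\<bar>" using t by (intro mult_right_mono) auto
  also have "\<dots> \<le> cW * \<rho> * \<bar>s\<bar> powr \<alpha>" using invariant_shift[OF \<rho> W] by simp
  finally show "\<bar>start W \<phi> t (\<psi> + s *\<^sub>R eu) - start W \<phi> t \<psi>\<bar> \<le> cW * \<rho> * \<bar>s\<bar> powr \<alpha>" .
qed

lemma invariant_admissible:
  assumes \<rho>: "small \<rho>" and W: "invariant \<rho> W"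
  shows "admissible cW \<rho> W"
  unfolding admissible_def
  by (intro conjI allI invariant_torus_cont[OF \<rho> W] invariantD(2)[OF W] invariant_shift[OF \<rho> W])

text \<open>
  By invariance the averages of \<open>W\<close> and \<open>W\<^sup>2\<close> do not change in one step, which gives
  \<open>avg (f (W, \<cdot>)) = 0\<close> and \<open>avg (W f (W, \<cdot>)) = O(\<rho>)\<close>; by decorrelation \<open>f\<close> may be replaced by its average.
\<close>

lemma invariant_decorrelation:
  obtains C where "0 \<le> C"
    "\<And>\<rho> W. small \<rho> \<Longrightarrow> invariant \<rho> W \<Longrightarrow> \<bar>torus_avg (\<lambda>\<psi>. F 0 (W \<psi>) \<psi> - fb 0 (W \<psi>))\<bar> \<le> C * \<rho>"
    "\<And>\<rho> W. small \<rho> \<Longrightarrow> invariant \<rho> W \<Longrightarrow> \<bar>torus_avg (\<lambda>\<psi>. W \<psi> * (F 0 (W \<psi>) \<psi> - fb 0 (W \<psi>)))\<bar> \<le> C * \<rho>"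
proof -
  obtain D where D: "0 \<le> D" and oD: "\<And>\<rho> X0. small \<rho> \<Longrightarrow> admissible cW \<rho> X0 \<Longrightarrow>
      observable D \<rho> 1 (\<lambda>n \<psi> p. F 0 (X \<rho> n (X0 \<psi>) \<psi>) p - fb 0 (X \<rho> n (X0 \<psi>) \<psi>))"
  proof -
    have "0 \<le> 2 * K" using pos by simp
    then show ?thesis using that nice_observable[OF nice_F0 _ cW_pos] by blast
  qed
  obtain E where E: "0 \<le> E"
    and sX: "\<And>\<rho> X0. small \<rho> \<Longrightarrow> admissible cW \<rho> X0 \<Longrightarrow> slow E \<rho> 1 (\<lambda>n \<psi>. X \<rho> n (X0 \<psi>) \<psi>)"
    using slow_X[OF cW_pos] by blast
  have key: "\<bar>torus_avg (\<lambda>\<psi>. g (W \<psi>) \<psi>)\<bar> \<le> corr_const * C * \<rho>"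
    if \<rho>: "small \<rho>" and W: "invariant \<rho> W" and C: "0 \<le> C"
      and obs: "observable C \<rho> 1 (\<lambda>n \<psi> p. g (X \<rho> n (W \<psi>) \<psi>) p)"
      and mean: "\<And>x. x \<in> U \<Longrightarrow> torus_avg (g x) = 0" for \<rho> W C g
  proof -
    note r = smallD[OF \<rho>]
    have tc: "torus_cont (\<lambda>\<psi>. g (W \<psi>) \<psi>)"
      using observableD(2)[OF obs, of 0 0] by simp
    \<comment> \<open>On the graph the average is the same at every time \<open>n\<close>.
      Evaluating it at late times lets the correlation with the initial point die out, so that only
      O(\<rho>) remains as \<open>n\<close> tends to infinity.\<close>
    have "\<bar>torus_avg (\<lambda>\<psi>. g (W \<psi>) \<psi>)\<bar> \<le> corr_const * C * (\<rho> + rate ^ (2 * n))" for n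
    proof -
      have "torus_avg (\<lambda>\<psi>. g (W \<psi>) \<psi>) = torus_avg (\<lambda>\<psi>. g (W (iter n \<psi>)) (iter n \<psi>))"
        using torus_avg_iter[OF tc, of n] by simp
      also have "\<dots> = torus_avg (\<lambda>\<psi>. 1 * g (X \<rho> n (W \<psi>) \<psi>) (iter n \<psi>))"
        by (simp add: X_invariant[OF W])
      also have "\<bar>\<dots>\<bar> \<le> corr_const * 1 * C * (\<rho> * 1 ^ n + 1 ^ 0 * rate ^ (2 * (n - 0)))"
        by (rule correlation_decay[where F="\<lambda>_. 1" and m=0 and \<Gamma>="\<lambda>n \<psi> p. g (X \<rho> n (W \<psi>) \<psi>) p", OF obs])
          (use r rate C mean X_in_U[OF \<rho> invariantD(2)[OF W]] in auto)
      finally show ?thesis by simp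
    qed
    moreover have "(\<lambda>n. corr_const * C * (\<rho> + rate ^ (2 * n))) \<longlonglongrightarrow> corr_const * C * (\<rho> + 0)"
    proof (intro tendsto_intros)
      have "(\<lambda>n. (rate\<^sup>2) ^ n) \<longlonglongrightarrow> 0"
        using rate by (intro LIMSEQ_realpow_zero) (auto simp: power_less_one_iff)
      then show "(\<lambda>n. rate ^ (2 * n)) \<longlonglongrightarrow> 0" by (simp add: power_mult)
    qed
    ultimately have "\<bar>torus_avg (\<lambda>\<psi>. g (W \<psi>) \<psi>)\<bar> \<le> corr_const * C * (\<rho> + 0)"
      by (intro LIMSEQ_le_const) auto
    then show ?thesis by simp
  qed
  let ?C = "corr_const * D + corr_const * (2 * E * D)"
  have CD: "0 \<le> corr_const * D" "0 \<le> corr_const * (2 * E * D)"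
    using corr_const_pos D E by auto
  have mean: "torus_avg (\<lambda>p. F 0 x p - fb 0 x) = 0" for x
    using torus_avg_dev[OF F_torus_cont[of 0 x], of "fb 0 x"] by (simp add: fb_def)
  show ?thesis
  proof (rule that[of ?C])
    fix \<rho> W assume \<rho>: "small \<rho>" and W: "invariant \<rho> W"
    note r = smallD[OF \<rho>] and a = invariant_admissible[OF \<rho> W]
    have "\<bar>torus_avg (\<lambda>\<psi>. F 0 (W \<psi>) \<psi> - fb 0 (W \<psi>))\<bar> \<le> corr_const * D * \<rho>"
      by (rule key[OF \<rho> W D oD[OF \<rho> a] mean])
    also have "\<dots> \<le> ?C * \<rho>" using CD r(1) by (intro mult_right_mono) auto
    finally show "\<bar>torus_avg (\<lambda>\<psi>. F 0 (W \<psi>) \<psi> - fb 0 (W \<psi>))\<bar> \<le> ?C * \<rho>" .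
    have obs: "observable (2 * E * D) \<rho> 1 (\<lambda>n \<psi> p. X \<rho> n (W \<psi>) \<psi> * (F 0 (X \<rho> n (W \<psi>) \<psi>) p - fb 0 (X \<rho> n (W \<psi>) \<psi>)))"
      by (rule observable_mult[OF sX[OF \<rho> a] oD[OF \<rho> a] E D]) (use r in auto)
    have "\<bar>torus_avg (\<lambda>\<psi>. W \<psi> * (F 0 (W \<psi>) \<psi> - fb 0 (W \<psi>)))\<bar> \<le> corr_const * (2 * E * D) * \<rho>"
    proof (rule key[where g="\<lambda>x p. x * (F 0 x p - fb 0 x)", OF \<rho> W _ obs])
      show "torus_avg (\<lambda>p. x * (F 0 x p - fb 0 x)) = 0" for x
        by (subst torus_avg_cmult) (auto simp: mean intro!: torus_cont_intros F_torus_cont)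
    qed (use D E in simp)
    also have "\<dots> \<le> ?C * \<rho>" using CD r(1) by (intro mult_right_mono) auto
    finally show "\<bar>torus_avg (\<lambda>\<psi>. W \<psi> * (F 0 (W \<psi>) \<psi> - fb 0 (W \<psi>)))\<bar> \<le> ?C * \<rho>" .
  qed (use CD in simp)
qed

text \<open>Since \<open>x * fb 0 x \<le> - \<gamma> * x\<^sup>2\<close> on
  [\<open>Sm\<close>, \<open>SM\<close>], the mean of \<open>W \<psi> * fb 0 (W \<psi>)\<close>
  controls the mean square of \<open>W\<close>. Linearizing \<open>fb 0\<close> at 0 then controls
  the mean of \<open>W\<close>, with a remainder bounded by that mean square.\<close>

lemma concentrated_W: "concentrated params fst (\<lambda>(\<rho>, W, N, \<phi>). W) (\<lambda>_. 0)"
proof -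
  obtain C where C: "0 \<le> C"
    "\<And>\<rho> W. small \<rho> \<Longrightarrow> invariant \<rho> W \<Longrightarrow> \<bar>torus_avg (\<lambda>\<psi>. F 0 (W \<psi>) \<psi> - fb 0 (W \<psi>))\<bar> \<le> C * \<rho>"
    "\<And>\<rho> W. small \<rho> \<Longrightarrow> invariant \<rho> W \<Longrightarrow> \<bar>torus_avg (\<lambda>\<psi>. W \<psi> * (F 0 (W \<psi>) \<psi> - fb 0 (W \<psi>)))\<bar> \<le> C * \<rho>"
    using invariant_decorrelation by blast
  \<comment> \<open>\<open>K\<^sup>2 / 2\<close> stems from the second-order term in the square of
    one step and \<open>C\<close> from decorrelation; the division by \<open>\<gamma>\<close> undoes
    the lower bound on the slope of \<open>- fb 0\<close>.\<close>
  define C2 where "C2 = (K\<^sup>2 / 2 + C) / \<gamma>"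
  define C1 where "C1 = (C + K * C2) / \<gamma>"
  have main: "torus_avg (\<lambda>\<psi>. (W \<psi>)\<^sup>2) \<le> C2 * \<rho>" "\<bar>torus_avg W\<bar> \<le> C1 * \<rho>"
    if \<rho>: "small \<rho>" and W: "invariant \<rho> W" for \<rho> W
  proof -
    note r = smallD[OF \<rho>] and w = invariantD[OF W]
    have tW: "torus_cont W" by (rule invariant_torus_cont[OF \<rho> W])
    have tF: "torus_cont (\<lambda>\<psi>. F 0 (W \<psi>) \<psi>)" using torus_cont_F_iter[OF _ tW, of 0 0] by simp
    have tfb: "torus_cont (\<lambda>\<psi>. fb 0 (W \<psi>))"
      by (rule torus_cont_comp[OF tW _ fb_continuous[of 0 UNIV]]) auto
    have "torus_avg (\<lambda>\<psi>. W (A *v \<psi>)) = torus_avg W" by (rule torus_avg_A[OF tW])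
    then have f0: "torus_avg (\<lambda>\<psi>. F 0 (W \<psi>) \<psi>) = 0"
      using r(1) by (simp add: w(3) torus_avg_add torus_avg_cmult torus_cont_intros tW tF)
    have "torus_avg (\<lambda>\<psi>. (W (A *v \<psi>))\<^sup>2) = torus_avg (\<lambda>\<psi>. (W \<psi>)\<^sup>2)"
      by (rule torus_avg_A[OF torus_cont_power[OF tW]])
    moreover have "(W (A *v \<psi>))\<^sup>2 = (W \<psi>)\<^sup>2 + (2 * \<rho> * (W \<psi> * F 0 (W \<psi>) \<psi>) + \<rho>\<^sup>2 * (F 0 (W \<psi>) \<psi>)\<^sup>2)" for \<psi>
      by (simp add: w(3) power2_eq_square algebra_simps)
    ultimately have "2 * \<rho> * torus_avg (\<lambda>\<psi>. W \<psi> * F 0 (W \<psi>) \<psi>) + \<rho>\<^sup>2 * torus_avg (\<lambda>\<psi>. (F 0 (W \<psi>) \<psi>)\<^sup>2) = 0"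
      by (simp add: torus_avg_add torus_avg_cmult torus_cont_intros tW tF)
    then have "\<rho> * (2 * torus_avg (\<lambda>\<psi>. W \<psi> * F 0 (W \<psi>) \<psi>) + \<rho> * torus_avg (\<lambda>\<psi>. (F 0 (W \<psi>) \<psi>)\<^sup>2)) = 0"
      by (simp add: power2_eq_square algebra_simps)
    then have Wf: "torus_avg (\<lambda>\<psi>. W \<psi> * F 0 (W \<psi>) \<psi>) = - (\<rho> * torus_avg (\<lambda>\<psi>. (F 0 (W \<psi>) \<psi>)\<^sup>2) / 2)"
      using r(1) by simp
    have "torus_avg (\<lambda>\<psi>. (F 0 (W \<psi>) \<psi>)\<^sup>2) \<le> K\<^sup>2"
    proof (rule torus_avg_le[OF torus_cont_power[OF tF]])
      fix \<psi>
      show "(F 0 (W \<psi>) \<psi>)\<^sup>2 \<le> K\<^sup>2"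
        using power_mono[OF F_bound[of 0 "W \<psi>" \<psi>], of 2] by simp
    qed
    then have "\<rho> * torus_avg (\<lambda>\<psi>. (F 0 (W \<psi>) \<psi>)\<^sup>2) \<le> \<rho> * K\<^sup>2" using r(1) by (intro mult_left_mono) auto
    then have Wf': "- torus_avg (\<lambda>\<psi>. W \<psi> * F 0 (W \<psi>) \<psi>) \<le> K\<^sup>2 / 2 * \<rho>" unfolding Wf by (simp add: mult.commute)
    have split: "torus_avg (\<lambda>\<psi>. W \<psi> * (F 0 (W \<psi>) \<psi> - fb 0 (W \<psi>)))
        = torus_avg (\<lambda>\<psi>. W \<psi> * F 0 (W \<psi>) \<psi>) - torus_avg (\<lambda>\<psi>. W \<psi> * fb 0 (W \<psi>))"
      unfolding right_diff_distrib by (intro torus_avg_diff torus_cont_intros tW tF tfb)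
    have "\<gamma> * torus_avg (\<lambda>\<psi>. (W \<psi>)\<^sup>2) = torus_avg (\<lambda>\<psi>. \<gamma> * (W \<psi>)\<^sup>2)"
      by (simp add: torus_avg_cmult torus_cont_intros tW)
    also have "\<dots> \<le> torus_avg (\<lambda>\<psi>. -1 * (W \<psi> * fb 0 (W \<psi>)))"
    proof (intro torus_avg_mono torus_cont_intros tW tfb)
      fix \<psi>
      have "mom 0 1 (W \<psi>) \<le> - \<gamma>" using w(1)[of \<psi>] pos by (intro mom_0_1_le) auto
      then have "mom 0 1 (W \<psi>) * (W \<psi>)\<^sup>2 \<le> - \<gamma> * (W \<psi>)\<^sup>2" by (rule mult_right_mono) simp
      moreover have "W \<psi> * fb 0 (W \<psi>) = mom 0 1 (W \<psi>) * (W \<psi>)\<^sup>2"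
        using mom_0[of 0 "W \<psi>"] fb_0_0 by (simp add: power2_eq_square mult.commute)
      ultimately show "\<gamma> * (W \<psi>)\<^sup>2 \<le> -1 * (W \<psi> * fb 0 (W \<psi>))" by simp
    qed
    also have "\<dots> = - torus_avg (\<lambda>\<psi>. W \<psi> * fb 0 (W \<psi>))"
      by (subst torus_avg_cmult) (auto intro!: torus_cont_intros tW tfb)
    also have "\<dots> \<le> (K\<^sup>2 / 2 + C) * \<rho>" using C(3)[OF \<rho> W] Wf' unfolding split by (simp add: algebra_simps)
    finally show W2: "torus_avg (\<lambda>\<psi>. (W \<psi>)\<^sup>2) \<le> C2 * \<rho>"
      using pos by (simp add: C2_def pos_le_divide_eq mult.commute)
    have fbW: "\<bar>torus_avg (\<lambda>\<psi>. fb 0 (W \<psi>))\<bar> \<le> C * \<rho>"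
      using C(2)[OF \<rho> W] f0 by (simp add: torus_avg_diff tF tfb)
    have tay: "\<bar>fb 0 (W \<psi>) - fb 1 0 * W \<psi>\<bar> \<le> K * (W \<psi>)\<^sup>2" for \<psi>
      using deriv_bound_taylor[where a=pm and b=pM and g="fb 0" and ?g1.0="fb 1" and ?g2.0="fb 2" and K=K
          and x=0 and y="W \<psi>"] fb_derivs fb_bound[of 2] w(2)[of \<psi>] order pos fb_0_0 by simp
    have tt: "torus_cont (\<lambda>\<psi>. fb 0 (W \<psi>) - fb 1 0 * W \<psi>)" by (intro torus_cont_intros tW tfb)
    have "torus_avg (\<lambda>\<psi>. fb 0 (W \<psi>) - fb 1 0 * W \<psi>) \<le> torus_avg (\<lambda>\<psi>. K * (W \<psi>)\<^sup>2)"
      by (rule torus_avg_mono[OF tt _ order_trans[OF abs_ge_self tay]]) (intro torus_cont_intros tW)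
    moreover have "torus_avg (\<lambda>\<psi>. -1 * (fb 0 (W \<psi>) - fb 1 0 * W \<psi>)) \<le> torus_avg (\<lambda>\<psi>. K * (W \<psi>)\<^sup>2)"
      by (rule torus_avg_mono[OF _ _ order_trans[OF neg_le_abs tay]]) (intro torus_cont_intros tW tfb)+
    moreover have "torus_avg (\<lambda>\<psi>. K * (W \<psi>)\<^sup>2) \<le> K * (C2 * \<rho>)"
      using W2 pos by (simp add: torus_avg_cmult torus_cont_intros tW)
    ultimately have "\<bar>torus_avg (\<lambda>\<psi>. fb 0 (W \<psi>) - fb 1 0 * W \<psi>)\<bar> \<le> K * (C2 * \<rho>)"
      unfolding torus_avg_cmult[OF tt] by linarith
    moreover have "torus_avg (\<lambda>\<psi>. fb 0 (W \<psi>) - fb 1 0 * W \<psi>) = torus_avg (\<lambda>\<psi>. fb 0 (W \<psi>)) - fb 1 0 * torus_avg W"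
      by (simp add: torus_avg_diff torus_avg_cmult torus_cont_intros tW tfb del: One_nat_def)
    ultimately have "\<bar>fb 1 0 * torus_avg W\<bar> \<le> (C + K * C2) * \<rho>"
      using fbW by (simp add: algebra_simps del: One_nat_def)
    moreover have "\<gamma> * \<bar>torus_avg W\<bar> \<le> \<bar>fb 1 0\<bar> * \<bar>torus_avg W\<bar>"
      using fb_1_le[of 0] order pos by (intro mult_right_mono) auto
    ultimately show "\<bar>torus_avg W\<bar> \<le> C1 * \<rho>"
      using pos by (simp add: C1_def pos_le_divide_eq abs_mult mult.commute del: One_nat_def)
  qed
  show ?thesis
  proof (rule concentratedI[where ?C1.0=C1 and ?C2.0=C2 and ?C3.0="\<bar>Sm\<bar> + \<bar>SM\<bar>" and ?C4.0=0])
    fix i assume i: "i \<in> params"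
    obtain \<rho> W N \<phi> where e: "i = (\<rho>, W, N, \<phi>)" and \<rho>: "small \<rho>" and W: "invariant \<rho> W"
      using i by (auto simp: params_def)
    show "torus_cont ((\<lambda>(\<rho>, W, N, \<phi>). W) i)" using invariant_torus_cont[OF \<rho> W] e by simp
    show "0 \<le> fst i" "fst i \<le> 1" using smallD[OF \<rho>] e by auto
    show "\<bar>torus_avg ((\<lambda>(\<rho>, W, N, \<phi>). W) i) - 0\<bar> \<le> C1 * fst i" using main[OF \<rho> W] e by simp
    show "torus_avg (\<lambda>\<psi>. ((\<lambda>(\<rho>, W, N, \<phi>). W) i \<psi> - 0)\<^sup>2) \<le> C2 * fst i" using main[OF \<rho> W] e by simp
    show "\<bar>(\<lambda>(\<rho>, W, N, \<phi>). W) i \<psi>\<bar> \<le> \<bar>Sm\<bar> + \<bar>SM\<bar>" for \<psi> using invariantD(1)[OF W, of \<psi>] e by auto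
  qed simp
qed

lemma params1_cases:
  assumes "i \<in> params1"
  obtains \<rho> W N \<phi> t where "i = ((\<rho>, W, N, \<phi>), t)" "small \<rho>" "invariant \<rho> W" "decay \<rho> ^ N \<le> \<rho>" "\<phi> \<in> U" "t \<in> {0..1}"
proof -
  obtain \<rho> W N \<phi> t where e: "i = ((\<rho>, W, N, \<phi>), t)" by (metis surj_pair)
  then show ?thesis using assms by (intro that[OF e]) (auto simp: params_def)
qed

lemma params1_rho:
  assumes "i \<in> params1"
  shows "0 \<le> fst (fst i)" "fst (fst i) \<le> 1"
proof -
  obtain \<rho> W N \<phi> t where "i = ((\<rho>, W, N, \<phi>), t)" "small \<rho>"
    using assms by (rule params1_cases)
  then show "0 \<le> fst (fst i)" "fst (fst i) \<le> 1" using smallD(1,2)[of \<rho>] by simp_all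
qed

lemma zero_in_U: "0 \<in> U" using order pos by simp

lemma scaled_in_U:
  assumes "\<phi> \<in> U" "t \<in> {0..1}"
  shows "t * \<phi> \<in> U"
proof -
  have "(1 - t) *\<^sub>R 0 + t *\<^sub>R \<phi> \<in> U"
    by (rule convexD[OF convex_real_interval(5) zero_in_U assms(1)]) (use assms(2) in auto)
  then show ?thesis by simp
qed

lemma start_params1:
  assumes "i \<in> params1"
  shows "(\<lambda>((\<rho>, W, N, \<phi>), t). start W \<phi> t) i \<psi> \<in> U" "(\<lambda>((\<rho>, W, N, \<phi>), t). t * \<phi>) i \<in> U"
proof -
  obtain \<rho> W N \<phi> t where e: "i = ((\<rho>, W, N, \<phi>), t)" "invariant \<rho> W" "\<phi> \<in> U" "t \<in> {0..1}"
    using assms by (rule params1_cases)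
  show "(\<lambda>((\<rho>, W, N, \<phi>), t). start W \<phi> t) i \<psi> \<in> U" "(\<lambda>((\<rho>, W, N, \<phi>), t). t * \<phi>) i \<in> U"
    using start_in_U[OF e(2-4), of \<psi>] scaled_in_U[OF e(3,4)] e(1) by simp_all
qed

lemma concentrated_start:
  "concentrated params1 (\<lambda>(j, t). fst j) (\<lambda>((\<rho>, W, N, \<phi>), t). start W \<phi> t) (\<lambda>((\<rho>, W, N, \<phi>), t). t * \<phi>)"
proof -
  have W: "concentrated params1 (\<lambda>i. fst (fst i)) (\<lambda>i. (\<lambda>(\<rho>, W, N, \<phi>). W) (fst i)) (\<lambda>_. 0)"
    by (rule concentrated_reindex[OF concentrated_W]) auto
  note r = params1_rho
  have c1: "concentrated params1 (\<lambda>i. fst (fst i)) (\<lambda>i \<psi>. 1 - snd i) (\<lambda>i. 1 - snd i)"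
  proof (rule concentrated_const[where C=1 and c="\<lambda>i. 1 - snd i"])
    fix i assume i: "i \<in> params1"
    show "0 \<le> fst (fst i)" "fst (fst i) \<le> 1" by (rule r[OF i])+
    show "\<bar>1 - snd i\<bar> \<le> 1" using i by (rule params1_cases) simp
  qed
  have c2: "concentrated params1 (\<lambda>i. fst (fst i)) (\<lambda>i \<psi>. snd i * snd (snd (snd (fst i)))) (\<lambda>i. snd i * snd (snd (snd (fst i))))"
  proof (rule concentrated_const[where C="\<bar>pm\<bar> + \<bar>pM\<bar>" and c="\<lambda>i. snd i * snd (snd (snd (fst i)))"])
    fix i assume i: "i \<in> params1"
    show "0 \<le> fst (fst i)" "fst (fst i) \<le> 1" by (rule r[OF i])+
    from i obtain \<rho> W N \<phi> t where e: "i = ((\<rho>, W, N, \<phi>), t)" "\<phi> \<in> U" "t \<in> {0..1}"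
      by (rule params1_cases)
    show "\<bar>snd i * snd (snd (snd (fst i)))\<bar> \<le> \<bar>pm\<bar> + \<bar>pM\<bar>"
      using scaled_in_U[OF e(2,3)] e(1) by auto
  qed
  show ?thesis
    by (rule concentrated_cong[OF concentrated_add[OF concentrated_mult[OF c1 W] c2]])
      (auto simp: start_def algebra_simps)
qed

section \<open>Expansions of R and T around their averaged values\<close>

lemma sum_decay_bound:
  assumes \<rho>: "small \<rho>" and B: "0 \<le> B" and z: "\<And>n. \<bar>z n\<bar> \<le> B * \<rho>\<^sup>2 * decay \<rho> ^ n"
  shows "\<bar>\<Sum>n<N. z n\<bar> \<le> 2 * B / \<gamma> * \<rho>"
proof -
  have "\<bar>\<Sum>n<N. z n\<bar> \<le> (\<Sum>n<N. B * \<rho>\<^sup>2 * decay \<rho> ^ n)"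
    by (rule order_trans[OF sum_abs sum_mono[OF z]])
  also have "\<dots> = B * \<rho>\<^sup>2 * (\<Sum>n<N. decay \<rho> ^ n)" by (simp add: sum_distrib_left)
  also have "\<dots> \<le> B * \<rho>\<^sup>2 * (1 / (1 - decay \<rho>))"
    using decay[OF \<rho>] B by (intro mult_left_mono sum_powers_le) auto
  also have "\<dots> = 2 * B / \<gamma> * \<rho>"
    unfolding decay(4)[OF \<rho>] using smallD(1)[OF \<rho>] pos by (simp add: power2_eq_square)
  finally show ?thesis .
qed

lemma P_power_le:
  assumes \<rho>: "small \<rho>" and x: "x \<in> U"
  shows "\<bar>P \<rho> n x \<psi>\<bar> \<le> lyap_max * decay \<rho> ^ n" "(P \<rho> n x \<psi>)\<^sup>2 \<le> lyap_max\<^sup>2 * decay \<rho> ^ n"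
proof -
  note p = P_pos[OF \<rho>, of n x \<psi>] P_le[OF \<rho> x, of n \<psi>] and d = decay_power[OF \<rho>, of n]
  show "\<bar>P \<rho> n x \<psi>\<bar> \<le> lyap_max * decay \<rho> ^ n" using p by simp
  have "P \<rho> n x \<psi> \<le> lyap_max * 1"
    using p(2) mult_left_mono[OF d(2), of lyap_max] lyap_max_ge by linarith
  then have "P \<rho> n x \<psi> * P \<rho> n x \<psi> \<le> (lyap_max * decay \<rho> ^ n) * (lyap_max * 1)"
    using p d lyap_max_ge by (intro mult_mono) auto
  then show "(P \<rho> n x \<psi>)\<^sup>2 \<le> lyap_max\<^sup>2 * decay \<rho> ^ n" by (simp add: power2_eq_square mult_ac)
qed

definition KR :: real where "KR = 2 * (lyap_max * Krem) / \<gamma> + KM * lyap_max"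

text \<open>Errors of order \<open>\<rho>\<^sup>2\<close> per step add up to O(\<rho>) because
  \<open>P\<close> decays at a rate proportional to \<rho>, and
  \<open>decay \<rho> ^ N \<le> \<rho>\<close> disposes of the boundary term.\<close>

lemma R_expansion:
  assumes \<rho>: "small \<rho>" and x: "x \<in> U" and N: "decay \<rho> ^ N \<le> \<rho>"
  shows "\<bar>R \<rho> N x \<psi> - (M0 x + (\<Sum>n<N. \<rho> * (P \<rho> n x \<psi> * b1 (X \<rho> n x \<psi>) (iter n \<psi>))))\<bar> \<le> KR * \<rho>"
proof -
  let ?z = "\<lambda>n. P \<rho> n x \<psi> * (D1 \<rho> (X \<rho> n x \<psi>) (iter n \<psi>) - \<rho> * b1 (X \<rho> n x \<psi>) (iter n \<psi>))"
  have eq: "R \<rho> N x \<psi> - (M0 x + (\<Sum>n<N. \<rho> * (P \<rho> n x \<psi> * b1 (X \<rho> n x \<psi>) (iter n \<psi>))))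
      = (\<Sum>n<N. ?z n) - M0 (X \<rho> N x \<psi>) * P \<rho> N x \<psi>"
    using R_telescope[of \<rho> N x \<psi>] by (simp add: sum_subtractf right_diff_distrib mult_ac)
  have "\<bar>?z n\<bar> \<le> (lyap_max * Krem) * \<rho>\<^sup>2 * decay \<rho> ^ n" for n
  proof -
    have "\<bar>?z n\<bar> \<le> (lyap_max * decay \<rho> ^ n) * (Krem * \<rho>\<^sup>2)"
      unfolding abs_mult D1_def using decay_power[OF \<rho>, of n] lyap_max_ge
      by (intro mult_mono P_power_le remainder_1 X_in_U \<rho> x) auto
    then show ?thesis by (simp add: mult_ac)
  qed
  then have 1: "\<bar>\<Sum>n<N. ?z n\<bar> \<le> 2 * (lyap_max * Krem) / \<gamma> * \<rho>"
    using lyap_max_ge Krem_pos by (intro sum_decay_bound \<rho>) auto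
  have "\<bar>M0 (X \<rho> N x \<psi>) * P \<rho> N x \<psi>\<bar> \<le> KM * (lyap_max * decay \<rho> ^ N)"
    unfolding abs_mult using KM(1) by (intro mult_mono KM(2) P_power_le X_in_U \<rho> x) auto
  also have "\<dots> \<le> KM * (lyap_max * \<rho>)"
    using KM(1) lyap_max_ge N by (intro mult_left_mono) auto
  finally show ?thesis unfolding eq KR_def distrib_right using 1 by simp
qed

definition KT :: real where
  "KT = 2 * ((lyap_max\<^sup>2 + lyap_max * CR) * Krem) / \<gamma> + (KM * lyap_max\<^sup>2 + KM * lyap_max * CR)"

lemma T_expansion:
  assumes \<rho>: "small \<rho>" and x: "x \<in> U" and N: "decay \<rho> ^ N \<le> \<rho>"
  shows "\<bar>T \<rho> N x \<psi> - (M1 x + (\<Sum>n<N. \<rho> * ((P \<rho> n x \<psi> * P \<rho> n x \<psi>) * b2 (X \<rho> n x \<psi>) (iter n \<psi>)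
      + (P \<rho> n x \<psi> * R \<rho> n x \<psi>) * b1 (X \<rho> n x \<psi>) (iter n \<psi>))))\<bar> \<le> KT * \<rho>"
proof -
  let ?d1 = "\<lambda>n. D1 \<rho> (X \<rho> n x \<psi>) (iter n \<psi>) - \<rho> * b1 (X \<rho> n x \<psi>) (iter n \<psi>)"
  let ?d2 = "\<lambda>n. D2 \<rho> (X \<rho> n x \<psi>) (iter n \<psi>) - \<rho> * b2 (X \<rho> n x \<psi>) (iter n \<psi>)"
  let ?z = "\<lambda>n. (P \<rho> n x \<psi>)\<^sup>2 * ?d2 n + (P \<rho> n x \<psi> * R \<rho> n x \<psi>) * ?d1 n"
  let ?X = "X \<rho> N x \<psi>" and ?P = "P \<rho> N x \<psi>" and ?R = "R \<rho> N x \<psi>"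
  have "(\<Sum>n<N. ?z n) = (\<Sum>n<N. (P \<rho> n x \<psi>)\<^sup>2 * D2 \<rho> (X \<rho> n x \<psi>) (iter n \<psi>)
      + P \<rho> n x \<psi> * R \<rho> n x \<psi> * D1 \<rho> (X \<rho> n x \<psi>) (iter n \<psi>))
      - (\<Sum>n<N. \<rho> * ((P \<rho> n x \<psi> * P \<rho> n x \<psi>) * b2 (X \<rho> n x \<psi>) (iter n \<psi>)
      + (P \<rho> n x \<psi> * R \<rho> n x \<psi>) * b1 (X \<rho> n x \<psi>) (iter n \<psi>)))"
    unfolding sum_subtractf[symmetric] by (rule sum.cong) (auto simp: power2_eq_square algebra_simps)
  then have eq: "T \<rho> N x \<psi> - (M1 x + (\<Sum>n<N. \<rho> * ((P \<rho> n x \<psi> * P \<rho> n x \<psi>) * b2 (X \<rho> n x \<psi>) (iter n \<psi>)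
      + (P \<rho> n x \<psi> * R \<rho> n x \<psi>) * b1 (X \<rho> n x \<psi>) (iter n \<psi>))))
      = (\<Sum>n<N. ?z n) - (M1 ?X * ?P\<^sup>2 + M0 ?X * ?P * ?R)"
    unfolding T_telescope[OF \<rho>, of N x \<psi>, symmetric] by linarith
  have "\<bar>?z n\<bar> \<le> ((lyap_max\<^sup>2 + lyap_max * CR) * Krem) * \<rho>\<^sup>2 * decay \<rho> ^ n" for n
  proof -
    have "\<bar>?d1 n\<bar> \<le> Krem * \<rho>\<^sup>2" "\<bar>?d2 n\<bar> \<le> Krem * \<rho>\<^sup>2"
      unfolding D1_def D2_def by (intro remainder_1 remainder_2 X_in_U \<rho> x)+
    moreover have "\<bar>P \<rho> n x \<psi> * R \<rho> n x \<psi>\<bar> \<le> (lyap_max * decay \<rho> ^ n) * CR"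
      unfolding abs_mult using lyap_max_ge decay_power[OF \<rho>, of n]
      by (intro mult_mono P_power_le R_bound \<rho> x) auto
    moreover have "\<bar>(P \<rho> n x \<psi>)\<^sup>2\<bar> \<le> lyap_max\<^sup>2 * decay \<rho> ^ n" using P_power_le(2)[OF \<rho> x, of n \<psi>] by simp
    ultimately have "\<bar>?z n\<bar> \<le> (lyap_max\<^sup>2 * decay \<rho> ^ n) * (Krem * \<rho>\<^sup>2) + ((lyap_max * decay \<rho> ^ n) * CR) * (Krem * \<rho>\<^sup>2)"
      using decay_power[OF \<rho>, of n] lyap_max_ge CR_pos
      by (intro order_trans[OF abs_mult_add_le] add_mono mult_mono) auto
    then show ?thesis by (simp add: algebra_simps)
  qed
  then have 1: "\<bar>\<Sum>n<N. ?z n\<bar> \<le> 2 * ((lyap_max\<^sup>2 + lyap_max * CR) * Krem) / \<gamma> * \<rho>"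
    using lyap_max_ge Krem_pos CR_pos by (intro sum_decay_bound \<rho>) auto
  have pl: "\<bar>?P\<bar> \<le> lyap_max * \<rho>" "\<bar>?P\<^sup>2\<bar> \<le> lyap_max\<^sup>2 * \<rho>"
    using order_trans[OF P_power_le(1)[OF \<rho> x, of N \<psi>] mult_left_mono[OF N, of lyap_max]]
      order_trans[OF P_power_le(2)[OF \<rho> x, of N \<psi>] mult_left_mono[OF N, of "lyap_max\<^sup>2"]]
      lyap_max_ge by auto
  have "\<bar>M1 ?X * ?P\<^sup>2 + (M0 ?X * ?P) * ?R\<bar> \<le> KM * (lyap_max\<^sup>2 * \<rho>) + (KM * (lyap_max * \<rho>)) * CR"
    unfolding abs_mult[of "M0 ?X" ?P]
    using KM(1) lyap_max_ge smallD(1)[OF \<rho>] pl X_in_U[OF \<rho> x, of N \<psi>]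
    by (intro order_trans[OF abs_mult_add_le] add_mono mult_mono KM(2,3) R_bound \<rho> x)
      (auto simp: abs_mult intro!: mult_mono KM(2))
  also have "\<dots> = (KM * lyap_max\<^sup>2 + KM * lyap_max * CR) * \<rho>" by (simp add: algebra_simps)
  finally show ?thesis
    unfolding eq KT_def distrib_right[of _ _ \<rho>] using 1 by linarith
qed

text \<open>\<open>M0\<close> at the starting point concentrates because the starting points do, the
  sum with zero mean is covered by \<open>concentrated_sum\<close>, and the rest of the expansion is
  a uniform O(\<rho>).\<close>

lemma concentrated_R:
  "concentrated params1 (\<lambda>(j, t). fst j) (\<lambda>((\<rho>, W, N, \<phi>), t) \<psi>. R \<rho> N (start W \<phi> t \<psi>) \<psi>)
     (\<lambda>((\<rho>, W, N, \<phi>), t). M0 (t * \<phi>))"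
proof -
  obtain C where C: "0 \<le> C" and obs: "\<And>\<rho> X0. small \<rho> \<Longrightarrow> admissible cW \<rho> X0 \<Longrightarrow>
      observable C \<rho> (decay \<rho>) (\<lambda>n \<psi> p. P \<rho> n (X0 \<psi>) \<psi> * b1 (X \<rho> n (X0 \<psi>) \<psi>) p)"
    using observable_b1[OF cW_pos] by blast
  define \<Gamma> where "\<Gamma> = (\<lambda>((\<rho>, W :: real^2 \<Rightarrow> real, N :: nat, \<phi>), t) n \<psi> p.
      P \<rho> n (start W \<phi> t \<psi>) \<psi> * b1 (X \<rho> n (start W \<phi> t \<psi>) \<psi>) p)"
  have S: "concentrated params1 (\<lambda>(j, t). fst j)
      (\<lambda>i \<psi>. \<Sum>n<(\<lambda>((\<rho>, W, N, \<phi>), t). N) i. (\<lambda>(j, t). fst j) i * \<Gamma> i n \<psi> (iter n \<psi>)) (\<lambda>i. 0)"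
  proof (rule concentrated_sum[OF _ C])
    fix i assume "i \<in> params1"
    then obtain \<rho> W N \<phi> t where e: "i = ((\<rho>, W, N, \<phi>), t)" "small \<rho>" "invariant \<rho> W" "\<phi> \<in> U" "t \<in> {0..1}"
      by (rule params1_cases)
    note a = start_admissible[OF e(2-5)]
    show "small ((\<lambda>(j, t). fst j) i)" using e by simp
    show "observable C ((\<lambda>(j, t). fst j) i) (decay ((\<lambda>(j, t). fst j) i)) (\<Gamma> i)"
      using obs[OF e(2) a] e(1) by (simp add: \<Gamma>_def)
    show "torus_avg (\<Gamma> i n \<psi>) = 0" for n \<psi>
    proof -
      have x: "X \<rho> n (start W \<phi> t \<psi>) \<psi> \<in> U" by (intro X_in_U e admissibleD(2)[OF a])
      have "torus_cont (b1 (X \<rho> n (start W \<phi> t \<psi>) \<psi>))"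
        using b_torus_fun holder_continuous[OF b_holder(1)[OF x]] by (simp add: torus_cont_def)
      then show ?thesis using b_mean_zero[OF x] e(1) by (simp add: \<Gamma>_def torus_avg_cmult)
    qed
  qed
  have M: "concentrated params1 (\<lambda>(j, t). fst j) (\<lambda>i \<psi>. M0 ((\<lambda>((\<rho>, W, N, \<phi>), t). start W \<phi> t) i \<psi>))
      (\<lambda>i. M0 ((\<lambda>((\<rho>, W, N, \<phi>), t). t * \<phi>) i))"
    by (rule concentrated_compose[OF concentrated_start M_derivs(1,2) KM(2-4) start_params1])
  show ?thesis
  proof (rule concentrated_perturb[OF concentrated_cong[OF concentrated_add[OF M S]], where K=KR])
    fix i assume "i \<in> params1"
    then obtain \<rho> W N \<phi> t where e: "i = ((\<rho>, W, N, \<phi>), t)" "small \<rho>" "invariant \<rho> W" "\<phi> \<in> U" "t \<in> {0..1}"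
        and N: "decay \<rho> ^ N \<le> \<rho>"
      by (rule params1_cases)
    note a = start_admissible[OF e(2-5)]
    show "torus_cont ((\<lambda>((\<rho>, W, N, \<phi>), t) \<psi>. R \<rho> N (start W \<phi> t \<psi>) \<psi>) i)"
      using torus_cont_R[OF e(2) admissibleD(1)[OF a]] e(1) by simp
    show "(\<lambda>((\<rho>, W, N, \<phi>), t). M0 (t * \<phi>)) i = M0 ((\<lambda>((\<rho>, W, N, \<phi>), t). t * \<phi>) i) + 0" using e(1) by simp
    show "\<bar>(\<lambda>((\<rho>, W, N, \<phi>), t) \<psi>. R \<rho> N (start W \<phi> t \<psi>) \<psi>) i \<psi> -
        (M0 ((\<lambda>((\<rho>, W, N, \<phi>), t). start W \<phi> t) i \<psi>) +
          (\<Sum>n<(\<lambda>((\<rho>, W, N, \<phi>), t). N) i. (\<lambda>(j, t). fst j) i * \<Gamma> i n \<psi> (iter n \<psi>)))\<bar>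
        \<le> KR * (\<lambda>(j, t). fst j) i" for \<psi>
      using R_expansion[OF e(2) admissibleD(2)[OF a] N, of \<psi> \<psi>] e(1) by (simp add: \<Gamma>_def)
  qed auto
qed

lemma concentrated_T:
  "concentrated params1 (\<lambda>(j, t). fst j) (\<lambda>((\<rho>, W, N, \<phi>), t) \<psi>. T \<rho> N (start W \<phi> t \<psi>) \<psi>)
     (\<lambda>((\<rho>, W, N, \<phi>), t). M1 (t * \<phi>))"
proof -
  obtain C where C: "0 \<le> C" and obs: "\<And>\<rho> X0. small \<rho> \<Longrightarrow> admissible cW \<rho> X0 \<Longrightarrow>
      observable C \<rho> (decay \<rho>) (\<lambda>n \<psi> p. (P \<rho> n (X0 \<psi>) \<psi> * P \<rho> n (X0 \<psi>) \<psi>) * b2 (X \<rho> n (X0 \<psi>) \<psi>) p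
        + (P \<rho> n (X0 \<psi>) \<psi> * R \<rho> n (X0 \<psi>) \<psi>) * b1 (X \<rho> n (X0 \<psi>) \<psi>) p)"
    using observable_b2[OF cW_pos] by blast
  define \<Gamma> where "\<Gamma> = (\<lambda>((\<rho>, W :: real^2 \<Rightarrow> real, N :: nat, \<phi>), t) n \<psi> p.
      (P \<rho> n (start W \<phi> t \<psi>) \<psi> * P \<rho> n (start W \<phi> t \<psi>) \<psi>) * b2 (X \<rho> n (start W \<phi> t \<psi>) \<psi>) p
        + (P \<rho> n (start W \<phi> t \<psi>) \<psi> * R \<rho> n (start W \<phi> t \<psi>) \<psi>) * b1 (X \<rho> n (start W \<phi> t \<psi>) \<psi>) p)"
  have S: "concentrated params1 (\<lambda>(j, t). fst j)
      (\<lambda>i \<psi>. \<Sum>n<(\<lambda>((\<rho>, W, N, \<phi>), t). N) i. (\<lambda>(j, t). fst j) i * \<Gamma> i n \<psi> (iter n \<psi>)) (\<lambda>i. 0)"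
  proof (rule concentrated_sum[OF _ C])
    fix i assume "i \<in> params1"
    then obtain \<rho> W N \<phi> t where e: "i = ((\<rho>, W, N, \<phi>), t)" "small \<rho>" "invariant \<rho> W" "\<phi> \<in> U" "t \<in> {0..1}"
      by (rule params1_cases)
    note a = start_admissible[OF e(2-5)]
    show "small ((\<lambda>(j, t). fst j) i)" using e by simp
    show "observable C ((\<lambda>(j, t). fst j) i) (decay ((\<lambda>(j, t). fst j) i)) (\<Gamma> i)"
      using obs[OF e(2) a] e(1) by (simp add: \<Gamma>_def)
    show "torus_avg (\<Gamma> i n \<psi>) = 0" for n \<psi>
    proof -
      have x: "X \<rho> n (start W \<phi> t \<psi>) \<psi> \<in> U" by (intro X_in_U e admissibleD(2)[OF a])
      have "torus_cont (b1 (X \<rho> n (start W \<phi> t \<psi>) \<psi>))" "torus_cont (b2 (X \<rho> n (start W \<phi> t \<psi>) \<psi>))"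
        using b_torus_fun holder_continuous[OF b_holder(1)[OF x]] holder_continuous[OF b_holder(2)[OF x]]
        by (simp_all add: torus_cont_def)
      then show ?thesis using b_mean_zero[OF x] e(1)
        by (simp add: \<Gamma>_def torus_avg_add torus_avg_cmult torus_cont_intros)
    qed
  qed
  have M: "concentrated params1 (\<lambda>(j, t). fst j) (\<lambda>i \<psi>. M1 ((\<lambda>((\<rho>, W, N, \<phi>), t). start W \<phi> t) i \<psi>))
      (\<lambda>i. M1 ((\<lambda>((\<rho>, W, N, \<phi>), t). t * \<phi>) i))"
    by (rule concentrated_compose[OF concentrated_start M_derivs(2,3) KM(3-5) start_params1])
  show ?thesis
  proof (rule concentrated_perturb[OF concentrated_cong[OF concentrated_add[OF M S]], where K=KT])
    fix i assume "i \<in> params1"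
    then obtain \<rho> W N \<phi> t where e: "i = ((\<rho>, W, N, \<phi>), t)" "small \<rho>" "invariant \<rho> W" "\<phi> \<in> U" "t \<in> {0..1}"
        and N: "decay \<rho> ^ N \<le> \<rho>"
      by (rule params1_cases)
    note a = start_admissible[OF e(2-5)]
    show "torus_cont ((\<lambda>((\<rho>, W, N, \<phi>), t) \<psi>. T \<rho> N (start W \<phi> t \<psi>) \<psi>) i)"
      using torus_cont_T[OF e(2) admissibleD(1)[OF a]] e(1) by simp
    show "(\<lambda>((\<rho>, W, N, \<phi>), t). M1 (t * \<phi>)) i = M1 ((\<lambda>((\<rho>, W, N, \<phi>), t). t * \<phi>) i) + 0" using e(1) by simp
    show "\<bar>(\<lambda>((\<rho>, W, N, \<phi>), t) \<psi>. T \<rho> N (start W \<phi> t \<psi>) \<psi>) i \<psi> -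
        (M1 ((\<lambda>((\<rho>, W, N, \<phi>), t). start W \<phi> t) i \<psi>) +
          (\<Sum>n<(\<lambda>((\<rho>, W, N, \<phi>), t). N) i. (\<lambda>(j, t). fst j) i * \<Gamma> i n \<psi> (iter n \<psi>)))\<bar>
        \<le> KT * (\<lambda>(j, t). fst j) i" for \<psi>
      using T_expansion[OF e(2) admissibleD(2)[OF a] N, of \<psi> \<psi>] e(1) by (simp add: \<Gamma>_def)
  qed auto
qed

section \<open>The conjugation and its derivative\<close>

text \<open>The derivative at \<open>x\<close> of the slow orbit, normalized at the graph point
  \<open>W \<psi>\<close>, where it equals 1.\<close>

definition EE :: "real \<Rightarrow> nat \<Rightarrow> (real^2 \<Rightarrow> real) \<Rightarrow> real \<Rightarrow> real^2 \<Rightarrow> real" where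
  "EE \<rho> N W x \<psi> = P \<rho> N x \<psi> / P \<rho> N (W \<psi>) \<psi>"

text \<open>The normalized second derivative of the slow orbit is \<open>R * EE\<close>, so this is
  the integral remainder in Taylor's formula at \<open>W \<psi>\<close>, divided by the square of
  \<open>\<phi> - W \<psi>\<close>.\<close>

definition hN :: "real \<Rightarrow> nat \<Rightarrow> (real^2 \<Rightarrow> real) \<Rightarrow> real \<Rightarrow> real^2 \<Rightarrow> real" where
  "hN \<rho> N W \<phi> \<psi> = integral {0..1} (\<lambda>t. (1 - t) *
     (R \<rho> N (start W \<phi> t \<psi>) \<psi> * EE \<rho> N W (start W \<phi> t \<psi>) \<psi>))"

text \<open>Differentiation of \<open>hN\<close> under the integral: \<open>(T + R * R) * EE\<close>
  is the normalized third derivative of the slow orbit, and the extra \<open>t\<close> is the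
  derivative of \<open>start\<close> in \<open>\<phi>\<close>.\<close>

definition hN' :: "real \<Rightarrow> nat \<Rightarrow> (real^2 \<Rightarrow> real) \<Rightarrow> real \<Rightarrow> real^2 \<Rightarrow> real" where
  "hN' \<rho> N W \<phi> \<psi> = integral {0..1} (\<lambda>t. ((1 - t) * t) *
     ((T \<rho> N (start W \<phi> t \<psi>) \<psi> + R \<rho> N (start W \<phi> t \<psi>) \<psi> * R \<rho> N (start W \<phi> t \<psi>) \<psi>)
       * EE \<rho> N W (start W \<phi> t \<psi>) \<psi>))"

text \<open>The integral of \<open>M0\<close> from 0 to \<open>y\<close>. Its exponential is the
  derivative of the map linearizing the averaged flow, so \<open>hc\<close> and \<open>hc'\<close>
  arise from \<open>hN\<close> and \<open>hN'\<close> by putting 0 for \<open>W\<close> and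
  \<open>M0\<close>, \<open>M1\<close>, \<open>exp (Lb y)\<close> for \<open>R\<close>,
  \<open>T\<close>, \<open>EE\<close>.\<close>

definition Lb :: "real \<Rightarrow> real" where
  "Lb y = y * integral {0..1} (\<lambda>s. M0 (s * y))"

definition hc :: "real \<Rightarrow> real" where
  "hc \<phi> = integral {0..1} (\<lambda>t. (1 - t) * (M0 (t * \<phi>) * exp (Lb (t * \<phi>))))"

definition hc' :: "real \<Rightarrow> real" where
  "hc' \<phi> = integral {0..1} (\<lambda>t. ((1 - t) * t) *
     ((M1 (t * \<phi>) + M0 (t * \<phi>) * M0 (t * \<phi>)) * exp (Lb (t * \<phi>))))"

lemma start_0: "start W \<phi> 0 \<psi> = W \<psi>" by (simp add: start_def)

lemma start_1: "start W \<phi> 1 \<psi> = \<phi>" by (simp add: start_def)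

lemma start_continuous:
  assumes "continuous_on UNIV (\<lambda>(x, \<psi>). G x \<psi>)" "continuous_on UNIV W" "continuous_on S u" "continuous_on S v"
  shows "continuous_on S (\<lambda>z. G (start W \<phi> (u z) (v z)) (v z))"
proof -
  have "continuous_on S (\<lambda>z. (\<lambda>(x, \<psi>). G x \<psi>) (start W \<phi> (u z) (v z), v z))"
    unfolding start_def
    by (rule continuous_on_compose2[OF assms(1)])
      (auto intro!: continuous_intros continuous_on_compose2[OF assms(2)] assms(3,4))
  then show ?thesis by simp
qed

lemma EE_start_continuous:
  assumes "small \<rho>" "continuous_on UNIV W" "continuous_on S u" "continuous_on S v"
  shows "continuous_on S (\<lambda>z. EE \<rho> N W (start W \<phi> (u z) (v z)) (v z))"
proof -
  have "continuous_on S (\<lambda>z. P \<rho> N (start W \<phi> 0 (v z)) (v z))"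
    by (rule start_continuous[OF P_continuous assms(2) _ assms(4)]) (intro continuous_intros)
  then show ?thesis
    unfolding EE_def start_0
    by (intro continuous_on_divide start_continuous[OF P_continuous] assms)
      (use P_pos[OF assms(1)] in \<open>auto simp: less_imp_neq[symmetric]\<close>)
qed

lemma ln_P_deriv:
  assumes "small \<rho>"
  shows "((\<lambda>x. ln (P \<rho> N x \<psi>)) has_real_derivative R \<rho> N x \<psi>) (at x within S)"
proof -
  have "((\<lambda>x. ln (P \<rho> N x \<psi>)) has_real_derivative 1 / P \<rho> N x \<psi> * (P \<rho> N x \<psi> * R \<rho> N x \<psi>)) (at x within S)"
    by (rule DERIV_chain2[OF DERIV_ln_divide[OF P_pos[OF assms]] has_field_derivative_at_within[OF P_deriv[OF assms]]])
  then show ?thesis using P_pos[OF assms, of N x \<psi>] by simp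
qed

text \<open>\<open>EE\<close> is a quotient of long products, out of reach of the concentration
  rules. As the exponential of an integral of \<open>R\<close>, the logarithmic derivative of
  \<open>P\<close>, it becomes accessible to them.\<close>

lemma EE_eq_exp:
  assumes \<rho>: "small \<rho>" and W: "continuous_on UNIV W"
  shows "EE \<rho> N W (start W \<phi> t \<psi>) \<psi> =
    exp ((start W \<phi> t \<psi> - W \<psi>) * integral {0..1} (\<lambda>s. R \<rho> N (start W \<phi> (s * t) \<psi>) \<psi>))"
proof -
  let ?d = "t * (\<phi> - W \<psi>)"
  have "((\<lambda>s. ?d * R \<rho> N (start W \<phi> (s * t) \<psi>) \<psi>) has_integral
      (ln (P \<rho> N (start W \<phi> (1 * t) \<psi>) \<psi>) - ln (P \<rho> N (start W \<phi> (0 * t) \<psi>) \<psi>))) {0..1}"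
  proof (rule fundamental_theorem_of_calculus)
    fix s :: real
    have "((\<lambda>s. start W \<phi> (s * t) \<psi>) has_real_derivative ?d) (at s within {0..1})"
      unfolding start_def by (auto intro!: derivative_eq_intros)
    from DERIV_chain2[OF ln_P_deriv[OF \<rho>] this]
    show "((\<lambda>s. ln (P \<rho> N (start W \<phi> (s * t) \<psi>) \<psi>)) has_vector_derivative
        ?d * R \<rho> N (start W \<phi> (s * t) \<psi>) \<psi>) (at s within {0..1})"
      by (simp add: has_real_derivative_iff_has_vector_derivative mult.commute)
  qed simp
  from integral_unique[OF this]
  have "?d * integral {0..1} (\<lambda>s. R \<rho> N (start W \<phi> (s * t) \<psi>) \<psi>)
      = ln (P \<rho> N (start W \<phi> t \<psi>) \<psi>) - ln (P \<rho> N (W \<psi>) \<psi>)"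
    by (simp add: start_0)
  moreover have "start W \<phi> t \<psi> - W \<psi> = ?d" by (simp add: start_def)
  ultimately show ?thesis using P_pos[OF \<rho>] by (simp add: EE_def exp_diff)
qed

lemma concentrated_EE:
  "concentrated params1 (\<lambda>(j, t). fst j) (\<lambda>((\<rho>, W, N, \<phi>), t) \<psi>. EE \<rho> N W (start W \<phi> t \<psi>) \<psi>)
     (\<lambda>((\<rho>, W, N, \<phi>), t). exp (Lb (t * \<phi>)))"
proof -
  let ?r = "\<lambda>(j :: real \<times> (real^2 \<Rightarrow> real) \<times> nat \<times> real, t :: real). fst j"
  define \<xi> where "\<xi> = (\<lambda>(((\<rho>, W, N, \<phi>), t), s) \<psi>. R \<rho> N (start W \<phi> (s * t) \<psi>) \<psi>)"
  define c where "c = (\<lambda>(((\<rho> :: real, W :: real^2 \<Rightarrow> real, N :: nat, \<phi>), t), s). M0 (s * (t * \<phi>)))"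
  \<comment> \<open>Reindexing by \<open>s * t\<close> makes the inner integration variable a
    parameter of the family for which \<open>R\<close> is already known to concentrate.\<close>
  define f where "f = (\<lambda>((j :: real \<times> (real^2 \<Rightarrow> real) \<times> nat \<times> real, t :: real), s :: real). (j, s * t))"
  have "concentrated {(i, s). i \<in> params1 \<and> s \<in> {0..1}} (\<lambda>i. ?r (f i))
      (\<lambda>i. (\<lambda>((\<rho>, W, N, \<phi>), t) \<psi>. R \<rho> N (start W \<phi> t \<psi>) \<psi>) (f i)) (\<lambda>i. (\<lambda>((\<rho>, W, N, \<phi>), t). M0 (t * \<phi>)) (f i))"
    by (rule concentrated_reindex[OF concentrated_R]) (auto simp: f_def mult_le_one)
  then have "concentrated {(i, s). i \<in> params1 \<and> s \<in> {0..1}} (\<lambda>(i, s). ?r i) \<xi> c"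
    by (rule concentrated_cong) (auto simp: f_def \<xi>_def c_def mult.assoc)
  then have I: "concentrated params1 ?r (\<lambda>i \<psi>. integral {0..1} (\<lambda>s. \<xi> (i, s) \<psi>)) (\<lambda>i. integral {0..1} (\<lambda>s. c (i, s)))"
  proof (rule concentrated_integral)
    fix i assume "i \<in> params1"
    then obtain \<rho> W N \<phi> t where e: "i = ((\<rho>, W, N, \<phi>), t)" "small \<rho>" "invariant \<rho> W" "\<phi> \<in> U" "t \<in> {0..1}"
      by (rule params1_cases)
    have W: "continuous_on UNIV W" using invariant_torus_cont[OF e(2,3)] by (simp add: torus_cont_def)
    have "continuous_on ({0..1} \<times> UNIV) (\<lambda>z. R \<rho> N (start W \<phi> (fst z * t) (snd z)) (snd z))"
      by (rule start_continuous[OF R_continuous[OF e(2)] W]) (intro continuous_intros)+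
    then show "continuous_on ({0..1} \<times> UNIV) (\<lambda>(s, \<psi>). \<xi> (i, s) \<psi>)" by (simp add: \<xi>_def e(1) split_beta)
    have "continuous_on {0..1} (\<lambda>s. M0 (s * (t * \<phi>)))"
      by (rule continuous_on_compose2[OF M_continuous(1)])
        (use scaled_in_U[OF scaled_in_U[OF e(4,5)]] in \<open>auto intro!: continuous_intros\<close>)
    then show "continuous_on {0..1} (\<lambda>s. c (i, s))" by (simp add: c_def e(1))
  qed
  have W: "concentrated params1 (\<lambda>i. fst (fst i)) (\<lambda>i. (\<lambda>(\<rho>, W, N, \<phi>). W) (fst i)) (\<lambda>_. 0)"
    by (rule concentrated_reindex[OF concentrated_W]) auto
  have m: "concentrated params1 (\<lambda>i. fst (fst i)) (\<lambda>i \<psi>. -1) (\<lambda>i. -1)"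
    by (rule concentrated_const[where C=1 and c="\<lambda>i. -1"]) (auto intro: params1_rho simp del: mem_Collect_eq)
  have u: "concentrated params1 ?r (\<lambda>i \<psi>. (\<lambda>((\<rho>, W, N, \<phi>), t). start W \<phi> t) i \<psi> + (-1 * (\<lambda>(\<rho>, W, N, \<phi>). W) (fst i) \<psi>))
      (\<lambda>i. (\<lambda>((\<rho>, W, N, \<phi>), t). t * \<phi>) i + (-1 * 0))"
    by (rule concentrated_add[OF concentrated_start concentrated_cong[OF concentrated_mult[OF m W]]]) auto
  have L: "concentrated params1 ?r (\<lambda>i \<psi>. ((\<lambda>((\<rho>, W, N, \<phi>), t). start W \<phi> t) i \<psi> + (-1 * (\<lambda>(\<rho>, W, N, \<phi>). W) (fst i) \<psi>))
        * integral {0..1} (\<lambda>s. \<xi> (i, s) \<psi>))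
      (\<lambda>i. ((\<lambda>((\<rho>, W, N, \<phi>), t). t * \<phi>) i + (-1 * 0)) * integral {0..1} (\<lambda>s. c (i, s)))"
    (is "concentrated _ _ ?L ?c")
    by (rule concentrated_mult[OF u I])
  \<comment> \<open>The bound confines the exponent to a compact interval, on which the exponential
    has the bounded derivatives required by \<open>concentrated_compose\<close>.\<close>
  obtain C where C: "\<And>i \<psi>. i \<in> params1 \<Longrightarrow> \<bar>?L i \<psi>\<bar> \<le> C" "\<And>i. i \<in> params1 \<Longrightarrow> \<bar>?c i\<bar> \<le> C"
    using L unfolding concentrated_def by meson
  have "concentrated params1 ?r (\<lambda>i \<psi>. exp (?L i \<psi>)) (\<lambda>i. exp (?c i))"
  proof (rule concentrated_compose[OF L, where a="- C" and b=C and ?g1.0=exp and ?g2.0=exp and K="exp C"])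
    show "?L i \<psi> \<in> {- C..C}" if "i \<in> params1" for i \<psi> using C(1)[OF that, of \<psi>] by (auto simp: abs_le_iff)
    show "?c i \<in> {- C..C}" if "i \<in> params1" for i using C(2)[OF that] by (auto simp: abs_le_iff)
  qed (auto intro!: has_field_derivative_at_within DERIV_exp)
  then show ?thesis
  proof (rule concentrated_cong)
    fix i \<psi> assume "i \<in> params1"
    then obtain \<rho> W N \<phi> t where e: "i = ((\<rho>, W, N, \<phi>), t)" "small \<rho>" "invariant \<rho> W" "\<phi> \<in> U" "t \<in> {0..1}"
      by (rule params1_cases)
    have W: "continuous_on UNIV W" using invariant_torus_cont[OF e(2,3)] by (simp add: torus_cont_def)
    show "(\<lambda>((\<rho>, W, N, \<phi>), t) \<psi>. EE \<rho> N W (start W \<phi> t \<psi>) \<psi>) i \<psi> = exp (?L i \<psi>)"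
      using EE_eq_exp[OF e(2) W, of N \<phi> t \<psi>] by (simp add: e(1) \<xi>_def)
    show "(\<lambda>((\<rho>, W, N, \<phi>), t). exp (Lb (t * \<phi>))) i = exp (?c i)"
      by (simp add: e(1) c_def Lb_def)
  qed simp
qed

lemma Lb_continuous: "continuous_on U Lb"
proof -
  have "continuous_on (U \<times> cbox 0 1) (\<lambda>z. M0 (snd z * fst z))"
    by (rule continuous_on_compose2[OF M_continuous(1)])
      (use scaled_in_U in \<open>auto intro!: continuous_intros simp del: atLeastAtMost_iff simp: box_real\<close>)
  then have "continuous_on U (\<lambda>y. integral (cbox 0 1) (\<lambda>s. M0 (s * y)))"
    by (intro integral_continuous_on_param) (simp add: split_beta)
  then show ?thesis unfolding Lb_def[abs_def] by (auto intro!: continuous_intros)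
qed

lemma scaled_continuous:
  assumes "continuous_on U g" "\<phi> \<in> U"
  shows "continuous_on {0..1} (\<lambda>t. g (t * \<phi>))"
  by (rule continuous_on_compose2[OF assms(1)]) (use scaled_in_U[OF assms(2)] in \<open>auto intro!: continuous_intros\<close>)

lemma concentrated_weight:
  assumes "continuous_on {0..1} w"
  shows "concentrated params1 (\<lambda>(j, t). fst j) (\<lambda>i \<psi>. w (snd i)) (\<lambda>i. w (snd i))"
proof -
  obtain C where "\<forall>t\<in>{0..1}. \<bar>w t\<bar> \<le> C"
    using compact_imp_bounded[OF compact_continuous_image[OF assms compact_Icc]] by (auto simp: bounded_iff)
  then show ?thesis
    unfolding split_beta
    by (intro concentrated_const[where C=C and c="\<lambda>i. w (snd i)"] params1_rho) auto
qed

lemma params_cases: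
  assumes "j \<in> params"
  obtains \<rho> W N \<phi> where "j = (\<rho>, W, N, \<phi>)" "small \<rho>" "invariant \<rho> W" "decay \<rho> ^ N \<le> \<rho>" "\<phi> \<in> U"
  using assms by (auto simp: params_def)

lemma concentrated_hN:
  "concentrated params fst (\<lambda>(\<rho>, W, N, \<phi>). hN \<rho> N W \<phi>) (\<lambda>(\<rho>, W, N, \<phi>). hc \<phi>)"
proof -
  let ?r = "\<lambda>(j :: real \<times> (real^2 \<Rightarrow> real) \<times> nat \<times> real, t :: real). fst j"
  have w: "continuous_on {0..1} (\<lambda>t::real. 1 - t)" by (intro continuous_intros)
  define \<xi> where "\<xi> = (\<lambda>((\<rho>, W, N, \<phi>), t) \<psi>. (1 - t) * (R \<rho> N (start W \<phi> t \<psi>) \<psi> * EE \<rho> N W (start W \<phi> t \<psi>) \<psi>))"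
  define c where "c = (\<lambda>((\<rho> :: real, W :: real^2 \<Rightarrow> real, N :: nat, \<phi>), t). (1 - t) * (M0 (t * \<phi>) * exp (Lb (t * \<phi>))))"
  have "concentrated params1 ?r \<xi> c"
    by (rule concentrated_cong[OF concentrated_mult[OF concentrated_weight[OF w] concentrated_mult[OF concentrated_R concentrated_EE]]])
      (auto simp: \<xi>_def c_def)
  then have "concentrated params fst (\<lambda>j \<psi>. integral {0..1} (\<lambda>t. \<xi> (j, t) \<psi>)) (\<lambda>j. integral {0..1} (\<lambda>t. c (j, t)))"
  proof (rule concentrated_integral)
    fix j assume "j \<in> params"
    then obtain \<rho> W N \<phi> where e: "j = (\<rho>, W, N, \<phi>)" "small \<rho>" "invariant \<rho> W" "\<phi> \<in> U"
      by (rule params_cases)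
    have W: "continuous_on UNIV W" using invariant_torus_cont[OF e(2,3)] by (simp add: torus_cont_def)
    show "continuous_on ({0..1} \<times> UNIV) (\<lambda>(t, \<psi>). \<xi> (j, t) \<psi>)"
      unfolding \<xi>_def e(1) split_beta fst_conv snd_conv
      by (intro continuous_intros start_continuous[OF R_continuous[OF e(2)] W] EE_start_continuous[OF e(2) W])
    show "continuous_on {0..1} (\<lambda>t. c (j, t))"
      unfolding c_def e(1) split_beta fst_conv snd_conv
      by (intro continuous_intros scaled_continuous[OF M_continuous(1) e(4)] scaled_continuous[OF Lb_continuous e(4)])
  qed
  then show ?thesis
    by (rule concentrated_cong) (auto simp: \<xi>_def c_def hN_def hc_def)
qed

lemma concentrated_hN':
  "concentrated params fst (\<lambda>(\<rho>, W, N, \<phi>). hN' \<rho> N W \<phi>) (\<lambda>(\<rho>, W, N, \<phi>). hc' \<phi>)"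
proof -
  let ?r = "\<lambda>(j :: real \<times> (real^2 \<Rightarrow> real) \<times> nat \<times> real, t :: real). fst j"
  have w: "continuous_on {0..1} (\<lambda>t::real. (1 - t) * t)" by (intro continuous_intros)
  define \<xi> where "\<xi> = (\<lambda>((\<rho>, W, N, \<phi>), t) \<psi>. ((1 - t) * t) *
     ((T \<rho> N (start W \<phi> t \<psi>) \<psi> + R \<rho> N (start W \<phi> t \<psi>) \<psi> * R \<rho> N (start W \<phi> t \<psi>) \<psi>) * EE \<rho> N W (start W \<phi> t \<psi>) \<psi>))"
  define c where "c = (\<lambda>((\<rho> :: real, W :: real^2 \<Rightarrow> real, N :: nat, \<phi>), t). ((1 - t) * t) *
     ((M1 (t * \<phi>) + M0 (t * \<phi>) * M0 (t * \<phi>)) * exp (Lb (t * \<phi>))))"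
  have "concentrated params1 ?r \<xi> c"
    by (rule concentrated_cong[OF concentrated_mult[OF concentrated_weight[OF w] concentrated_mult[OF
            concentrated_add[OF concentrated_T concentrated_mult[OF concentrated_R concentrated_R]] concentrated_EE]]])
      (auto simp: \<xi>_def c_def)
  then have "concentrated params fst (\<lambda>j \<psi>. integral {0..1} (\<lambda>t. \<xi> (j, t) \<psi>)) (\<lambda>j. integral {0..1} (\<lambda>t. c (j, t)))"
  proof (rule concentrated_integral)
    fix j assume "j \<in> params"
    then obtain \<rho> W N \<phi> where e: "j = (\<rho>, W, N, \<phi>)" "small \<rho>" "invariant \<rho> W" "\<phi> \<in> U"
      by (rule params_cases)
    have W: "continuous_on UNIV W" using invariant_torus_cont[OF e(2,3)] by (simp add: torus_cont_def)
    show "continuous_on ({0..1} \<times> UNIV) (\<lambda>(t, \<psi>). \<xi> (j, t) \<psi>)"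
      unfolding \<xi>_def e(1) split_beta fst_conv snd_conv
      by (intro continuous_intros start_continuous[OF R_continuous[OF e(2)] W]
          start_continuous[OF T_continuous[OF e(2)] W] EE_start_continuous[OF e(2) W])
    show "continuous_on {0..1} (\<lambda>t. c (j, t))"
      unfolding c_def e(1) split_beta fst_conv snd_conv
      by (intro continuous_intros scaled_continuous[OF M_continuous(1) e(4)] scaled_continuous[OF M_continuous(2) e(4)]
          scaled_continuous[OF Lb_continuous e(4)])
  qed
  then show ?thesis
    by (rule concentrated_cong) (auto simp: \<xi>_def c_def hN'_def hc'_def)
qed

section \<open>Convergence of the truncated remainders to the conjugation\<close>

definition CE :: real where "CE = exp (CR * (pM - pm))"

lemma CE_ge: "1 \<le> CE"
  using CR_pos order pos by (simp add: CE_def)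

lemma U_diff: "x \<in> U \<Longrightarrow> y \<in> U \<Longrightarrow> \<bar>x - y\<bar> \<le> pM - pm"
  by auto

text \<open>Bounded distortion: \<open>R\<close> is the derivative of \<open>ln P\<close> in the
  initial value and is bounded independently of the number of steps.\<close>

lemma P_ratio_le:
  assumes \<rho>: "small \<rho>" and x: "x \<in> U" and y: "y \<in> U"
  shows "P \<rho> n x \<psi> / P \<rho> n y \<psi> \<le> CE"
proof -
  have "\<bar>ln (P \<rho> n x \<psi>) - ln (P \<rho> n y \<psi>)\<bar> \<le> CR * \<bar>x - y\<bar>"
    by (rule deriv_bound_diff[OF ln_P_deriv[OF \<rho>] R_bound[OF \<rho>] x y])
  also have "\<dots> \<le> CR * (pM - pm)" by (rule mult_left_mono[OF U_diff[OF x y] CR_pos])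
  finally have "exp (ln (P \<rho> n x \<psi>) - ln (P \<rho> n y \<psi>)) \<le> CE" by (simp add: CE_def)
  then show ?thesis using P_pos[OF \<rho>] by (simp add: exp_diff)
qed

lemma EE_bound:
  assumes "small \<rho>" "invariant \<rho> W" "x \<in> U"
  shows "\<bar>EE \<rho> n W x \<psi>\<bar> \<le> CE"
proof -
  have "0 < EE \<rho> n W x \<psi>" unfolding EE_def by (intro divide_pos_pos P_pos assms)
  then show ?thesis
    using P_ratio_le[OF assms(1,3) invariantD(2)[OF assms(2)], of n \<psi> \<psi>] by (simp add: EE_def)
qed

lemma X_diff:
  assumes \<rho>: "small \<rho>" and x: "x \<in> U" and y: "y \<in> U"
  shows "\<bar>X \<rho> n x \<psi> - X \<rho> n y \<psi>\<bar> \<le> lyap_max * decay \<rho> ^ n * \<bar>x - y\<bar>"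
  by (rule deriv_bound_diff[OF has_field_derivative_at_within[OF X_deriv] P_power_le(1)[OF \<rho>] x y])

definition CEs :: real where "CEs = CE * (2 * K * lyap_max * (pM - pm))"

text \<open>The new factor is the quotient of the growth factors at the orbit of \<open>x\<close>
  and at the orbit on the graph. The two orbits approach each other like
  \<open>decay \<rho> ^ n\<close>, which brings the quotient close to 1.\<close>

lemma EE_step:
  assumes \<rho>: "small \<rho>" and W: "invariant \<rho> W" and x: "x \<in> U"
  shows "\<bar>EE \<rho> (Suc n) W x \<psi> - EE \<rho> n W x \<psi>\<bar> \<le> CEs * \<rho> * decay \<rho> ^ n"
proof -
  let ?x = "X \<rho> n x \<psi>" and ?w = "X \<rho> n (W \<psi>) \<psi>" and ?q = "iter n \<psi>"
  let ?g = "1 + \<rho> * F 1 ?x ?q" and ?h = "1 + \<rho> * F 1 ?w ?q"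
  note r = smallD[OF \<rho>] and w = invariantD(2)[OF W, of \<psi>]
  have h: "1 / 2 \<le> ?h" "0 < ?h" by (rule growth_factor[OF \<rho>] growth_factor_pos[OF \<rho>])+
  have p: "0 < P \<rho> n (W \<psi>) \<psi>" by (rule P_pos[OF \<rho>])
  have gen: "a * g / (b * h) - a / b = a / b * ((g - h) / h)" if "b > 0" "h > 0" for a b g h :: real
    using that by (simp add: field_simps)
  have eq: "EE \<rho> (Suc n) W x \<psi> - EE \<rho> n W x \<psi> = EE \<rho> n W x \<psi> * ((?g - ?h) / ?h)"
    using gen[OF p h(2), of "P \<rho> n x \<psi>" ?g] by (simp add: EE_def del: One_nat_def)
  have "\<bar>?g - ?h\<bar> = \<rho> * \<bar>F 1 ?x ?q - F 1 ?w ?q\<bar>"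
    using r(1) by (simp add: right_diff_distrib[symmetric] abs_mult del: One_nat_def)
  also have "\<dots> \<le> \<rho> * (K * \<bar>?x - ?w\<bar>)"
    using r(1) by (intro mult_left_mono F_lipschitz) auto
  also have "\<dots> \<le> \<rho> * (K * (lyap_max * decay \<rho> ^ n * (pM - pm)))"
    using r(1) pos lyap_max_ge decay_power[OF \<rho>, of n]
    by (intro mult_left_mono order_trans[OF X_diff[OF \<rho> x w]] U_diff x w) auto
  finally have "\<bar>(?g - ?h) / ?h\<bar> \<le> \<rho> * (K * (lyap_max * decay \<rho> ^ n * (pM - pm))) / (1 / 2)"
    using h unfolding abs_divide by (intro frac_le) auto
  then have "\<bar>EE \<rho> (Suc n) W x \<psi> - EE \<rho> n W x \<psi>\<bar> \<le> CE * (\<rho> * (K * (lyap_max * decay \<rho> ^ n * (pM - pm))) / (1 / 2))"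
    unfolding eq abs_mult[of "EE \<rho> n W x \<psi>"] using CE_ge by (intro mult_mono EE_bound \<rho> W x) auto
  then show ?thesis by (simp add: CEs_def mult_ac)
qed

definition Q1 :: "real \<Rightarrow> nat \<Rightarrow> (real^2 \<Rightarrow> real) \<Rightarrow> real \<Rightarrow> real^2 \<Rightarrow> real" where
  "Q1 \<rho> n W x \<psi> = (T \<rho> n x \<psi> + R \<rho> n x \<psi> * R \<rho> n x \<psi>) * EE \<rho> n W x \<psi>"

definition CQ :: real where
  "CQ = (CT + (2 * K * lyap_max * CR + CR * (2 * K * lyap_max))) * CE + (2 * CT / \<gamma> + CR * CR) * CEs"

lemma CEs_pos: "0 \<le> CEs" using CE_ge pos lyap_max_ge order by (simp add: CEs_def)

lemma CQ_pos: "0 \<le> CQ"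
  using CT_pos CR_pos CE_ge CEs_pos pos lyap_max_ge by (simp add: CQ_def)

lemma Q1_step:
  assumes \<rho>: "small \<rho>" and W: "invariant \<rho> W" and x: "x \<in> U"
  shows "\<bar>Q1 \<rho> (Suc n) W x \<psi> - Q1 \<rho> n W x \<psi>\<bar> \<le> CQ * \<rho> * decay \<rho> ^ n"
proof -
  let ?d = "\<rho> * decay \<rho> ^ n"
  let ?R = "\<lambda>n. R \<rho> n x \<psi>" and ?T = "\<lambda>n. T \<rho> n x \<psi>"
  have rr: "\<bar>?R (Suc n) * ?R (Suc n) - ?R n * ?R n\<bar> \<le> (2 * K * lyap_max * \<rho> * decay \<rho> ^ n) * CR + CR * (2 * K * lyap_max * \<rho> * decay \<rho> ^ n)"
    by (intro abs_diff_mult_le R_step R_bound \<rho> x)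
  have 1: "\<bar>(?T (Suc n) + ?R (Suc n) * ?R (Suc n)) - (?T n + ?R n * ?R n)\<bar>
      \<le> (CT + (2 * K * lyap_max * CR + CR * (2 * K * lyap_max))) * ?d"
  proof -
    have "(CT + (2 * K * lyap_max * CR + CR * (2 * K * lyap_max))) * ?d = CT * \<rho> * decay \<rho> ^ n +
        ((2 * K * lyap_max * \<rho> * decay \<rho> ^ n) * CR + CR * (2 * K * lyap_max * \<rho> * decay \<rho> ^ n))"
      by (simp add: algebra_simps)
    then show ?thesis using rr T_step[OF \<rho> x, of n \<psi>] by linarith
  qed
  have "\<bar>?R n * ?R n\<bar> \<le> CR * CR"
    unfolding abs_mult using CR_pos by (intro mult_mono R_bound \<rho> x) auto
  then have 2: "\<bar>?T n + ?R n * ?R n\<bar> \<le> 2 * CT / \<gamma> + CR * CR"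
    using T_bound[OF \<rho> x, of n \<psi>] by linarith
  have "\<bar>Q1 \<rho> (Suc n) W x \<psi> - Q1 \<rho> n W x \<psi>\<bar> \<le>
      (CT + (2 * K * lyap_max * CR + CR * (2 * K * lyap_max))) * ?d * CE + (2 * CT / \<gamma> + CR * CR) * (CEs * \<rho> * decay \<rho> ^ n)"
    unfolding Q1_def by (intro abs_diff_mult_le 1 2 EE_bound EE_step \<rho> W x)
  also have "\<dots> = CQ * \<rho> * decay \<rho> ^ n" by (simp add: CQ_def algebra_simps)
  finally show ?thesis .
qed

lemma invariant_continuous: "small \<rho> \<Longrightarrow> invariant \<rho> W \<Longrightarrow> continuous_on UNIV W"
  using invariant_torus_cont by (simp add: torus_cont_def)

lemma hN_integrands_continuous:
  assumes \<rho>: "small \<rho>" and W: "invariant \<rho> W"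
  shows "continuous_on {0..1} (\<lambda>t. (1 - t) * (R \<rho> n (start W \<phi> t \<psi>) \<psi> * EE \<rho> n W (start W \<phi> t \<psi>) \<psi>))"
    "continuous_on {0..1} (\<lambda>t. ((1 - t) * t) * Q1 \<rho> n W (start W \<phi> t \<psi>) \<psi>)"
  unfolding Q1_def
  by (intro continuous_intros start_continuous[OF R_continuous[OF \<rho>] invariant_continuous[OF \<rho> W]]
      start_continuous[OF T_continuous[OF \<rho>] invariant_continuous[OF \<rho> W]]
      EE_start_continuous[OF \<rho> invariant_continuous[OF \<rho> W]])+

lemma weight_bounds: "t \<in> {0..1} \<Longrightarrow> \<bar>1 - t\<bar> \<le> 1" "t \<in> {0..1} \<Longrightarrow> \<bar>(1 - t) * t\<bar> \<le> 1" for t :: real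
  by (auto simp: abs_mult intro!: mult_le_one)

lemma hN'_Q1: "hN' \<rho> n W \<phi> \<psi> = integral {0..1} (\<lambda>t. ((1 - t) * t) * Q1 \<rho> n W (start W \<phi> t \<psi>) \<psi>)"
  by (simp add: hN'_def Q1_def)

lemma hN'_step:
  assumes \<rho>: "small \<rho>" and W: "invariant \<rho> W" and \<phi>: "\<phi> \<in> U"
  shows "\<bar>hN' \<rho> (Suc n) W \<phi> \<psi> - hN' \<rho> n W \<phi> \<psi>\<bar> \<le> CQ * \<rho> * decay \<rho> ^ n"
proof -
  note c = hN_integrands_continuous(2)[OF \<rho> W, of _ \<phi> \<psi>]
  have "hN' \<rho> (Suc n) W \<phi> \<psi> - hN' \<rho> n W \<phi> \<psi> = integral {0..1} (\<lambda>t.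
      ((1 - t) * t) * Q1 \<rho> (Suc n) W (start W \<phi> t \<psi>) \<psi> - ((1 - t) * t) * Q1 \<rho> n W (start W \<phi> t \<psi>) \<psi>)"
    unfolding hN'_Q1 by (intro integral_diff[symmetric] integrable_continuous_real c)
  also have "\<bar>\<dots>\<bar> \<le> CQ * \<rho> * decay \<rho> ^ n"
  proof (rule integral_01_abs_le)
    fix t :: real assume t: "t \<in> {0..1}"
    have "\<bar>((1 - t) * t) * (Q1 \<rho> (Suc n) W (start W \<phi> t \<psi>) \<psi> - Q1 \<rho> n W (start W \<phi> t \<psi>) \<psi>)\<bar>
        \<le> 1 * (CQ * \<rho> * decay \<rho> ^ n)"
      unfolding abs_mult[of "(1 - t) * t"]
      by (intro mult_mono weight_bounds(2)[OF t] Q1_step \<rho> W start_in_U[OF W \<phi> t]) auto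
    then show "\<bar>((1 - t) * t) * Q1 \<rho> (Suc n) W (start W \<phi> t \<psi>) \<psi> - ((1 - t) * t) * Q1 \<rho> n W (start W \<phi> t \<psi>) \<psi>\<bar>
        \<le> CQ * \<rho> * decay \<rho> ^ n" by (simp add: right_diff_distrib)
  qed (intro continuous_on_diff c)
  finally show ?thesis .
qed

lemma hN_bound:
  assumes \<rho>: "small \<rho>" and W: "invariant \<rho> W" and \<phi>: "\<phi> \<in> U"
  shows "\<bar>hN \<rho> n W \<phi> \<psi>\<bar> \<le> CR * CE"
  unfolding hN_def
proof (rule integral_01_abs_le[OF hN_integrands_continuous(1)[OF \<rho> W]])
  fix t :: real assume t: "t \<in> {0..1}"
  have "\<bar>(1 - t) * (R \<rho> n (start W \<phi> t \<psi>) \<psi> * EE \<rho> n W (start W \<phi> t \<psi>) \<psi>)\<bar> \<le> 1 * (CR * CE)"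
    unfolding abs_mult using CR_pos CE_ge
    by (intro mult_mono weight_bounds(1)[OF t] R_bound EE_bound \<rho> W start_in_U[OF W \<phi> t]) auto
  then show "\<bar>(1 - t) * (R \<rho> n (start W \<phi> t \<psi>) \<psi> * EE \<rho> n W (start W \<phi> t \<psi>) \<psi>)\<bar> \<le> CR * CE" by simp
qed

lemma hN_deriv:
  assumes \<rho>: "small \<rho>" and W: "invariant \<rho> W" and \<phi>: "\<phi> \<in> U"
  shows "((\<lambda>\<phi>. hN \<rho> n W \<phi> \<psi>) has_real_derivative hN' \<rho> n W \<phi> \<psi>) (at \<phi> within U)"
proof -
  let ?f = "\<lambda>\<phi> t. (1 - t) * (R \<rho> n (start W \<phi> t \<psi>) \<psi> * EE \<rho> n W (start W \<phi> t \<psi>) \<psi>)"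
  let ?g = "\<lambda>\<phi> t. ((1 - t) * t) * Q1 \<rho> n W (start W \<phi> t \<psi>) \<psi>"
  let ?w = "P \<rho> n (W \<psi>) \<psi>"
  have w: "?w \<noteq> 0" using P_pos[OF \<rho>, of n "W \<psi>" \<psi>] by simp
  have "((\<lambda>\<phi>. integral (cbox 0 1) (?f \<phi>)) has_field_derivative integral (cbox 0 1) (?g \<phi>)) (at \<phi> within U)"
  proof (rule leibniz_rule_field_derivative[OF _ _ _ \<phi>])
    fix x t :: real
    let ?s = "start W x t \<psi>"
    have s: "((\<lambda>x. start W x t \<psi>) has_real_derivative t) (at x within U)"
      unfolding start_def by (auto intro!: derivative_eq_intros)
    note dR = DERIV_chain2[OF R_deriv[OF \<rho>, of n \<psi> ?s] s] and dP = DERIV_chain2[OF P_deriv[OF \<rho>, of n \<psi> ?s] s]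
    have "((\<lambda>x. (1 - t) * (R \<rho> n (start W x t \<psi>) \<psi> * (P \<rho> n (start W x t \<psi>) \<psi> / ?w))) has_real_derivative
        (1 - t) * (T \<rho> n ?s \<psi> * t * (P \<rho> n ?s \<psi> / ?w) + (P \<rho> n ?s \<psi> * R \<rho> n ?s \<psi> * t / ?w) * R \<rho> n ?s \<psi>)) (at x within U)"
      by (intro DERIV_cmult DERIV_mult DERIV_cdivide dR dP)
    moreover have "(1 - t) * (T \<rho> n ?s \<psi> * t * (P \<rho> n ?s \<psi> / ?w) + (P \<rho> n ?s \<psi> * R \<rho> n ?s \<psi> * t / ?w) * R \<rho> n ?s \<psi>)
        = ?g x t"
      using w by (simp add: Q1_def EE_def field_simps)
    ultimately show "((\<lambda>x. ?f x t) has_real_derivative ?g x t) (at x within U)"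
      unfolding EE_def by (simp only:)
  next
    show "?f x integrable_on cbox 0 1" for x
      using integrable_continuous_real[OF hN_integrands_continuous(1)[OF \<rho> W, of n x \<psi>]] by simp
    have sc: "continuous_on S (\<lambda>z. start W (fst z) (snd z) \<psi>)" for S
      unfolding start_def by (intro continuous_intros)
    have G: "continuous_on (U \<times> cbox 0 1) (\<lambda>z. G (start W (fst z) (snd z) \<psi>) \<psi>)"
      if "continuous_on UNIV (\<lambda>(x, \<psi>). G x \<psi>)" for G
    proof -
      have "continuous_on (U \<times> cbox 0 1) (\<lambda>z. (\<lambda>(x, \<psi>). G x \<psi>) (start W (fst z) (snd z) \<psi>, \<psi>))"
        by (rule continuous_on_compose2[OF that]) (auto intro!: continuous_intros sc)
      then show ?thesis by simp
    qed
    show "continuous_on (U \<times> cbox 0 1) (\<lambda>(x, t). ?g x t)"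
      unfolding split_beta Q1_def EE_def
      by (intro continuous_intros G R_continuous T_continuous P_continuous \<rho>) (use w in auto)
  qed auto
  then show ?thesis unfolding hN_def hN'_Q1 by simp
qed

lemma hN_taylor:
  assumes \<rho>: "small \<rho>" and W: "invariant \<rho> W"
  shows "X \<rho> n \<phi> \<psi> - X \<rho> n (W \<psi>) \<psi> =
    P \<rho> n (W \<psi>) \<psi> * ((\<phi> - W \<psi>) + (\<phi> - W \<psi>)\<^sup>2 * hN \<rho> n W \<phi> \<psi>)"
proof -
  let ?u = "\<phi> - W \<psi>" and ?w = "P \<rho> n (W \<psi>) \<psi>"
  let ?f = "\<lambda>t. (1 - t) * (R \<rho> n (start W \<phi> t \<psi>) \<psi> * EE \<rho> n W (start W \<phi> t \<psi>) \<psi>)"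
  \<comment> \<open>The antiderivative found by integrating the Taylor remainder by parts.\<close>
  let ?G = "\<lambda>t. (1 - t) * (P \<rho> n (start W \<phi> t \<psi>) \<psi> * ?u) + X \<rho> n (start W \<phi> t \<psi>) \<psi>"
  have w: "?w \<noteq> 0" using P_pos[OF \<rho>, of n "W \<psi>" \<psi>] by simp
  have "((\<lambda>t. ?w * ?u\<^sup>2 * ?f t) has_integral (?G 1 - ?G 0)) {0..1}"
  proof (rule fundamental_theorem_of_calculus)
    fix t :: real
    let ?s = "start W \<phi> t \<psi>"
    have s: "((\<lambda>t. start W \<phi> t \<psi>) has_real_derivative ?u) (at t within {0..1})"
      unfolding start_def by (auto intro!: derivative_eq_intros)
    note dX = DERIV_chain2[OF X_deriv[of \<rho> n \<psi> ?s] s] and dP = DERIV_chain2[OF P_deriv[OF \<rho>, of n \<psi> ?s] s]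
    have d1: "((\<lambda>t::real. 1 - t) has_real_derivative -1) (at t within {0..1})"
      by (auto intro!: derivative_eq_intros)
    have "(?G has_real_derivative (-1 * (P \<rho> n ?s \<psi> * ?u) + (P \<rho> n ?s \<psi> * R \<rho> n ?s \<psi> * ?u) * ?u * (1 - t))
        + P \<rho> n ?s \<psi> * ?u) (at t within {0..1})"
      by (intro DERIV_add DERIV_mult d1 DERIV_cmult_right dX dP)
    moreover have "(-1 * (P \<rho> n ?s \<psi> * ?u) + (P \<rho> n ?s \<psi> * R \<rho> n ?s \<psi> * ?u) * ?u * (1 - t)) + P \<rho> n ?s \<psi> * ?u
        = ?w * ?u\<^sup>2 * ?f t"
    proof -
      have a: "?w * EE \<rho> n W ?s \<psi> = P \<rho> n ?s \<psi>" using w by (simp add: EE_def)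
      have b: "?w * ?u\<^sup>2 * ?f t = ?u\<^sup>2 * ((1 - t) * (R \<rho> n ?s \<psi> * (?w * EE \<rho> n W ?s \<psi>)))"
        by (simp only: mult_ac)
      show ?thesis unfolding b a by (simp add: power2_eq_square mult_ac)
    qed
    ultimately show "(?G has_vector_derivative ?w * ?u\<^sup>2 * ?f t) (at t within {0..1})"
      unfolding has_real_derivative_iff_has_vector_derivative[symmetric] by (simp only:)
  qed simp
  from integral_unique[OF this] have "?w * ?u\<^sup>2 * hN \<rho> n W \<phi> \<psi> = X \<rho> n \<phi> \<psi> - (?w * ?u + X \<rho> n (W \<psi>) \<psi>)"
    by (simp add: hN_def start_0 start_1)
  then show ?thesis by (simp add: algebra_simps)
qed

definition conjugates :: "real \<Rightarrow> (real^2 \<Rightarrow> real) \<Rightarrow> (real \<Rightarrow> real^2 \<Rightarrow> real) \<Rightarrow> bool" where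
  "conjugates \<rho> W h \<longleftrightarrow> (\<forall>\<phi>\<in>U. \<forall>\<psi>. conj_map W h (\<phi> + \<rho> * F 0 \<phi> \<psi>, A *v \<psi>) =
     (1 + \<rho> * F 1 (W \<psi>) \<psi>) * conj_map W h (\<phi>, \<psi>))"

lemma conjugates_iter:
  assumes \<rho>: "small \<rho>" and W: "invariant \<rho> W" and h: "conjugates \<rho> W h" and \<phi>: "\<phi> \<in> U"
  shows "conj_map W h (X \<rho> n \<phi> \<psi>, iter n \<psi>) = P \<rho> n (W \<psi>) \<psi> * conj_map W h (\<phi>, \<psi>)"
proof (induction n)
  case (Suc n)
  have "conj_map W h (X \<rho> (Suc n) \<phi> \<psi>, iter (Suc n) \<psi>) =
      (1 + \<rho> * F 1 (W (iter n \<psi>)) (iter n \<psi>)) * conj_map W h (X \<rho> n \<phi> \<psi>, iter n \<psi>)"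
    using h X_in_U[OF \<rho> \<phi>, of n \<psi>] by (simp add: conjugates_def iter_Suc)
  also have "\<dots> = P \<rho> (Suc n) (W \<psi>) \<psi> * conj_map W h (\<phi>, \<psi>)"
    by (simp add: Suc X_invariant[OF W] mult_ac)
  finally show ?case .
qed simp

text \<open>Iterating the conjugacy expresses the linearized coordinate at time 0 through the one at
  time \<open>n\<close>, where the distance to the graph is of order \<open>P\<close> on the graph.
  The quadratic term with \<open>h\<close> is of order the square of this \<open>P\<close>; after
  division by \<open>P\<close>, the unknown \<open>h\<close> at time \<open>n\<close> enters only
  with a factor \<open>decay \<rho> ^ n\<close>. Cancelling the square of
  \<open>\<phi> - W \<psi>\<close> requires a point off the graph.\<close>

lemma hN_close:
  assumes \<rho>: "small \<rho>" and W: "invariant \<rho> W" and h: "conjugates \<rho> W h" and \<phi>: "\<phi> \<in> U"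
    and B: "\<And>\<phi> \<psi>. \<phi> \<in> U \<Longrightarrow> \<bar>h \<phi> \<psi>\<bar> \<le> B" and ne: "\<phi> \<noteq> W \<psi>"
  shows "\<bar>hN \<rho> n W \<phi> \<psi> - h \<phi> \<psi>\<bar> \<le> lyap_max * (1 + (pM - pm) * (CR * CE))\<^sup>2 * B * decay \<rho> ^ n"
proof -
  let ?u = "\<phi> - W \<psi>" and ?w = "P \<rho> n (W \<psi>) \<psi>" and ?X = "X \<rho> n \<phi> \<psi>"
  let ?v = "1 + ?u * hN \<rho> n W \<phi> \<psi>"
  have w: "0 < ?w" by (rule P_pos[OF \<rho>])
  have t: "?X - W (iter n \<psi>) = ?w * (?u * ?v)"
    using hN_taylor[OF \<rho> W, of n \<phi> \<psi>] X_invariant[OF W, of n \<psi>] by (simp add: power2_eq_square algebra_simps)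
  have "?w * (?u + ?u\<^sup>2 * h \<phi> \<psi>) = (?w * (?u * ?v)) + (?w * (?u * ?v))\<^sup>2 * h ?X (iter n \<psi>)"
    using conjugates_iter[OF \<rho> W h \<phi>, of n \<psi>] unfolding conj_map_def by (simp only: prod.case t)
  then have "?w * ?u\<^sup>2 * (h \<phi> \<psi> - hN \<rho> n W \<phi> \<psi>) = ?w * ?u\<^sup>2 * (?w * ?v\<^sup>2 * h ?X (iter n \<psi>))"
    by (simp add: power2_eq_square algebra_simps)
  then have e: "h \<phi> \<psi> - hN \<rho> n W \<phi> \<psi> = ?w * ?v\<^sup>2 * h ?X (iter n \<psi>)"
    using w ne by simp
  have v: "\<bar>?v\<bar> \<le> 1 + (pM - pm) * (CR * CE)"
  proof -
    have "\<bar>?u * hN \<rho> n W \<phi> \<psi>\<bar> \<le> (pM - pm) * (CR * CE)"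
      unfolding abs_mult using order pos
      by (intro mult_mono hN_bound U_diff \<rho> W \<phi> invariantD(2)[OF W]) auto
    then show ?thesis by linarith
  qed
  then have v2: "?v\<^sup>2 \<le> (1 + (pM - pm) * (CR * CE))\<^sup>2"
    using power_mono[OF v, of 2] by simp
  have "\<bar>hN \<rho> n W \<phi> \<psi> - h \<phi> \<psi>\<bar> = ?w * ?v\<^sup>2 * \<bar>h ?X (iter n \<psi>)\<bar>"
    using e w by (simp add: abs_mult abs_minus_commute[of "hN \<rho> n W \<phi> \<psi>"])
  also have "\<dots> \<le> (lyap_max * decay \<rho> ^ n) * (1 + (pM - pm) * (CR * CE))\<^sup>2 * B"
    using w lyap_max_ge decay_power[OF \<rho>, of n] v2
    by (intro mult_mono P_le B X_in_U \<rho> \<phi> invariantD(2)[OF W]) auto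
  finally show ?thesis by (simp add: mult_ac)
qed

text \<open>\<open>h\<close> is only given as continuous. Its derivative comes from uniform
  convergence of \<open>hN\<close> and \<open>hN'\<close>: the first by \<open>hN_close\<close>, the
  second because the increments of \<open>hN'\<close> are summable.\<close>

lemma conjugacy_limit:
  assumes \<rho>: "small \<rho>" and W: "invariant \<rho> W" and h: "conjugates \<rho> W h"
    and B: "\<And>\<phi> \<psi>. \<phi> \<in> U \<Longrightarrow> \<bar>h \<phi> \<psi>\<bar> \<le> B" and hc: "\<And>\<psi>. continuous_on U (\<lambda>\<phi>. h \<phi> \<psi>)"
  obtains C g where "\<And>n \<phi> \<psi>. \<phi> \<in> U \<Longrightarrow> \<bar>hN \<rho> n W \<phi> \<psi> - h \<phi> \<psi>\<bar> \<le> C * decay \<rho> ^ n"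
    "\<And>n \<phi> \<psi>. \<phi> \<in> U \<Longrightarrow> \<bar>hN' \<rho> n W \<phi> \<psi> - g \<phi> \<psi>\<bar> \<le> C * decay \<rho> ^ n"
    "\<And>\<phi> \<psi>. \<phi> \<in> U \<Longrightarrow> ((\<lambda>\<phi>. h \<phi> \<psi>) has_real_derivative g \<phi> \<psi>) (at \<phi> within U)"
proof -
  define C1 where "C1 = lyap_max * (1 + (pM - pm) * (CR * CE))\<^sup>2 * B"
  define C2 where "C2 = 2 * CQ / \<gamma>"
  have C2: "0 \<le> C2" using CQ_pos pos by (simp add: C2_def)
  have hNc: "continuous_on U (\<lambda>\<phi>. hN \<rho> n W \<phi> \<psi>)" for n \<psi>
    using hN_deriv[OF \<rho> W] by (rule DERIV_continuous_on)
  have near: "\<bar>hN \<rho> n W \<phi> \<psi> - h \<phi> \<psi>\<bar> \<le> C1 * decay \<rho> ^ n" if \<phi>: "\<phi> \<in> U" for n \<phi> \<psi>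
  proof (cases "\<phi> = W \<psi>")
    case False
    then show ?thesis using hN_close[OF \<rho> W h \<phi> B] by (simp add: C1_def)
  next
    case True
    let ?d = "\<lambda>x. \<bar>hN \<rho> n W x \<psi> - h x \<psi>\<bar>"
    \<comment> \<open>On the graph the estimate is the limit of the one at nearby points.
      \<open>W \<psi>\<close> is interior to \<open>U\<close>, so a whole punctured neighbourhood is
      available.\<close>
    have int: "pm < \<phi>" "\<phi> < pM" using invariantD(1)[OF W, of \<psi>] True order pos by auto
    have "(?d \<longlongrightarrow> ?d \<phi>) (at \<phi> within U)"
      using continuous_on_rabs[OF continuous_on_diff[OF hNc hc]] \<phi> by (auto simp: continuous_on_def)
    then have "(?d \<longlongrightarrow> ?d \<phi>) (at \<phi>)" using at_within_Icc_at[OF int] by simp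
    moreover have "\<forall>\<^sub>F x in at \<phi>. ?d x \<le> C1 * decay \<rho> ^ n"
    proof -
      have "\<forall>\<^sub>F x in at \<phi>. x \<in> {pm<..<pM}"
        by (rule eventually_at_in_open') (use int in auto)
      moreover have "\<forall>\<^sub>F x in at \<phi>. x \<noteq> \<phi>" by (simp add: eventually_at_filter)
      ultimately show ?thesis
      proof eventually_elim
        case (elim x)
        then show ?case using hN_close[OF \<rho> W h _ B, of x \<psi> n] True by (auto simp: C1_def)
      qed
    qed
    ultimately show ?thesis by (rule tendsto_upperbound) simp
  qed
  have lim: "\<exists>l. \<forall>n. \<bar>hN' \<rho> n W \<phi> \<psi> - l\<bar> \<le> C2 * decay \<rho> ^ n" if \<phi>: "\<phi> \<in> U" for \<phi> \<psi>
  proof -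
    let ?z = "\<lambda>n. hN' \<rho> n W \<phi> \<psi>"
    have tail: "\<bar>?z (n + k) - ?z n\<bar> \<le> C2 * decay \<rho> ^ n" for n k
      unfolding C2_def by (rule geometric_tail[OF \<rho> CQ_pos hN'_step[OF \<rho> W \<phi>]])
    have to0: "(\<lambda>n. C2 * decay \<rho> ^ n) \<longlonglongrightarrow> 0"
      using decay[OF \<rho>] by (intro tendsto_mult_right_zero LIMSEQ_realpow_zero) auto
    have "Cauchy ?z"
    proof (rule CauchyI')
      fix e :: real assume "e > 0"
      then obtain N where N: "\<And>n. n \<ge> N \<Longrightarrow> C2 * decay \<rho> ^ n < e"
        using order_tendstoD(2)[OF to0] by (auto simp: eventually_sequentially)
      have "dist (?z m) (?z n) < e" if "m \<ge> N" "n > m" for m n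
        using tail[of m "n - m"] N[OF that(1)] that by (simp add: dist_real_def abs_minus_commute)
      then show "\<exists>M. \<forall>m\<ge>M. \<forall>n>m. dist (?z m) (?z n) < e" by blast
    qed
    then obtain l where l: "?z \<longlonglongrightarrow> l" using Cauchy_convergent convergent_def by blast
    have "\<bar>?z n - l\<bar> \<le> C2 * decay \<rho> ^ n" for n
    proof -
      have "(\<lambda>k. \<bar>?z n - ?z (k + n)\<bar>) \<longlonglongrightarrow> \<bar>?z n - l\<bar>"
        by (intro tendsto_intros LIMSEQ_ignore_initial_segment l)
      then show ?thesis
        using tail[of n] by (intro LIMSEQ_le_const2) (auto simp: add.commute abs_minus_commute)
    qed
    then show ?thesis by blast
  qed
  define g where "g \<phi> \<psi> = (SOME l. \<forall>n. \<bar>hN' \<rho> n W \<phi> \<psi> - l\<bar> \<le> C2 * decay \<rho> ^ n)" for \<phi> \<psi>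
  have g: "\<bar>hN' \<rho> n W \<phi> \<psi> - g \<phi> \<psi>\<bar> \<le> C2 * decay \<rho> ^ n" if "\<phi> \<in> U" for n \<phi> \<psi>
    using someI_ex[OF lim[OF that, of \<psi>]] unfolding g_def by blast
  have to0: "(\<lambda>n. c * decay \<rho> ^ n) \<longlonglongrightarrow> 0" for c
    using decay[OF \<rho>] by (intro tendsto_mult_right_zero LIMSEQ_realpow_zero) auto
  have hlim: "(\<lambda>n. hN \<rho> n W \<phi> \<psi>) \<longlonglongrightarrow> h \<phi> \<psi>" if "\<phi> \<in> U" for \<phi> \<psi>
  proof -
    have "(\<lambda>n. hN \<rho> n W \<phi> \<psi> - h \<phi> \<psi>) \<longlonglongrightarrow> 0"
      by (rule Lim_null_comparison[OF _ to0[of C1]]) (use near[OF that] in auto)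
    then show ?thesis by (simp add: LIM_zero_iff)
  qed
  have deriv: "((\<lambda>\<phi>. h \<phi> \<psi>) has_real_derivative g \<phi> \<psi>) (at \<phi> within U)" if \<phi>: "\<phi> \<in> U" for \<phi> \<psi>
  proof -
    have "\<exists>k. \<forall>x\<in>U. (\<lambda>n. hN \<rho> n W x \<psi>) \<longlonglongrightarrow> k x \<and> (k has_derivative (*) (g x \<psi>)) (at x within U)"
    proof (rule has_derivative_sequence)
      show "convex U" by simp
      show "((\<lambda>x. hN \<rho> n W x \<psi>) has_derivative (*) (hN' \<rho> n W x \<psi>)) (at x within U)" if "x \<in> U" for n x
        using hN_deriv[OF \<rho> W that] by (simp add: has_field_derivative_def)
      show "\<forall>\<^sub>F n in sequentially. \<forall>x\<in>U. \<forall>d. norm (hN' \<rho> n W x \<psi> * d - g x \<psi> * d) \<le> e * norm d" if "e > 0" for e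
      proof -
        have "\<forall>\<^sub>F n in sequentially. C2 * decay \<rho> ^ n < e" by (rule order_tendstoD(2)[OF to0 that])
        then show ?thesis
        proof eventually_elim
          case (elim n)
          show ?case
          proof (intro ballI allI)
            fix x d assume "x \<in> U"
            then have "\<bar>hN' \<rho> n W x \<psi> - g x \<psi>\<bar> \<le> e" using g[of x n \<psi>] elim by linarith
            then show "norm (hN' \<rho> n W x \<psi> * d - g x \<psi> * d) \<le> e * norm d"
              by (simp add: left_diff_distrib[symmetric] abs_mult mult_right_mono)
          qed
        qed
      qed
      show "\<phi> \<in> U" by (rule \<phi>)
      show "(\<lambda>n. hN \<rho> n W \<phi> \<psi>) \<longlonglongrightarrow> h \<phi> \<psi>" by (rule hlim[OF \<phi>])
    qed
    then obtain k where k: "\<forall>x\<in>U. (\<lambda>n. hN \<rho> n W x \<psi>) \<longlonglongrightarrow> k x \<and> (k has_derivative (*) (g x \<psi>)) (at x within U)" ..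
    have kh: "k x = h x \<psi>" if "x \<in> U" for x
      using k that hlim[OF that, of \<psi>] LIMSEQ_unique by blast
    have "((\<lambda>\<phi>. h \<phi> \<psi>) has_derivative (*) (g \<phi> \<psi>)) (at \<phi> within U)"
      by (rule has_derivative_transform[OF \<phi> _ bspec[OF k \<phi>, THEN conjunct2]]) (simp add: kh)
    then show ?thesis by (simp add: has_field_derivative_def)
  qed
  have le: "C1 * decay \<rho> ^ n \<le> max C1 C2 * decay \<rho> ^ n" "C2 * decay \<rho> ^ n \<le> max C1 C2 * decay \<rho> ^ n" for n
    using decay_power[OF \<rho>, of n] by (auto intro!: mult_right_mono)
  show ?thesis
  proof (rule that[of "max C1 C2" g])
    fix n \<phi> \<psi> assume \<phi>: "\<phi> \<in> U"
    show "\<bar>hN \<rho> n W \<phi> \<psi> - h \<phi> \<psi>\<bar> \<le> max C1 C2 * decay \<rho> ^ n" by (rule order_trans[OF near[OF \<phi>] le(1)])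
    show "\<bar>hN' \<rho> n W \<phi> \<psi> - g \<phi> \<psi>\<bar> \<le> max C1 C2 * decay \<rho> ^ n" by (rule order_trans[OF g[OF \<phi>] le(2)])
  qed (rule deriv)
qed

end

section \<open>The averaging estimate\<close>

lemma vector_derivative_within_Icc:
  fixes g :: "real \<Rightarrow> real"
  assumes "a < b" "x \<in> {a..b}" "(g has_real_derivative d) (at x within {a..b})"
  shows "vector_derivative g (at x within {a..b}) = d"
  using vector_derivative_within_cbox[where a=a and b=b and x=x and f=g and f'=d] assms
  by (simp add: has_real_derivative_iff_has_vector_derivative)

lemma torus_cont_uniform_limit:
  assumes "\<And>n. n \<ge> n0 \<Longrightarrow> torus_cont (z n)" and bd: "\<And>n \<psi>. \<bar>z n \<psi> - l \<psi>\<bar> \<le> e n"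
    and e: "e \<longlonglongrightarrow> (0::real)"
  shows "torus_cont l"
proof (rule torus_contI)
  have ev: "\<forall>\<^sub>F n in sequentially. continuous_on UNIV (z n)"
    using eventually_ge_at_top[of n0] by eventually_elim (use assms(1) in \<open>auto simp: torus_cont_def\<close>)
  have "uniform_limit UNIV z l sequentially"
  proof (rule uniform_limitI)
    fix d :: real assume "d > 0"
    then have "\<forall>\<^sub>F n in sequentially. e n < d" by (rule order_tendstoD(2)[OF e])
    then show "\<forall>\<^sub>F n in sequentially. \<forall>\<psi>\<in>UNIV. dist (z n \<psi>) (l \<psi>) < d"
      by eventually_elim (use bd in \<open>auto simp: dist_real_def intro: le_less_trans\<close>)
  qed
  then show "continuous_on UNIV l" by (rule uniform_limit_theorem[OF ev]) simp
  have lim: "(\<lambda>n. z n \<psi>) \<longlonglongrightarrow> l \<psi>" for \<psi>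
  proof -
    have "(\<lambda>n. z n \<psi> - l \<psi>) \<longlonglongrightarrow> 0"
      by (rule Lim_null_comparison[OF _ e]) (use bd in auto)
    then show ?thesis by (simp add: LIM_zero_iff)
  qed
  show "torus_fun l"
    unfolding torus_fun_def
  proof (intro allI)
    fix \<psi> i
    have "\<forall>\<^sub>F n in sequentially. z n (\<psi> + axis i (2 * pi)) = z n \<psi>"
      using eventually_ge_at_top[of n0]
      by eventually_elim (use assms(1) in \<open>auto simp: torus_cont_def torus_fun_def\<close>)
    then have "(\<lambda>n. z n \<psi>) \<longlonglongrightarrow> l (\<psi> + axis i (2 * pi))"
      using lim[of "\<psi> + axis i (2 * pi)"] tendsto_cong by fast
    then show "l (\<psi> + axis i (2 * pi)) = l \<psi>" using lim LIMSEQ_unique by blast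
  qed
qed

text \<open>\<open>h\<close> and its averaged counterpart are compared with the same number
  \<open>c\<close>. Moving the centre by a deterministic O(\<rho>) adds O(\<rho>) to the mean; its
  own square, of order \<open>\<rho>\<^sup>2\<close>, enters the mean square.\<close>

lemma torus_avg_recentre:
  assumes \<xi>: "torus_cont \<xi>" and "\<bar>torus_avg \<xi> - c\<bar> \<le> C1 * \<rho>" "torus_avg (\<lambda>\<psi>. (\<xi> \<psi> - c)\<^sup>2) \<le> C1 * \<rho>"
    and b: "\<bar>b - c\<bar> \<le> C2 * \<rho>" and \<rho>: "0 \<le> \<rho>" "\<rho> \<le> 1" and C: "0 \<le> C1" "0 \<le> C2"
  shows "\<bar>torus_avg (\<lambda>\<psi>. \<xi> \<psi> - b)\<bar> \<le> (2 * C1 + C2 + 2 * C2\<^sup>2) * \<rho>"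
    "torus_avg (\<lambda>\<psi>. (\<xi> \<psi> - b)\<^sup>2) \<le> (2 * C1 + C2 + 2 * C2\<^sup>2) * \<rho>"
proof -
  let ?K = "2 * C1 + C2 + 2 * C2\<^sup>2"
  have "C1 * \<rho> + C2 * \<rho> \<le> ?K * \<rho>"
    unfolding distrib_right[symmetric] using C \<rho> by (intro mult_right_mono) auto
  then show "\<bar>torus_avg (\<lambda>\<psi>. \<xi> \<psi> - b)\<bar> \<le> ?K * \<rho>"
    using assms(2) b unfolding torus_avg_dev[OF \<xi>] by linarith
  have b2: "(b - c)\<^sup>2 \<le> C2\<^sup>2 * \<rho>"
  proof -
    have "(b - c)\<^sup>2 \<le> (C2 * \<rho>)\<^sup>2" using power_mono[OF b, of 2] by simp
    also have "\<dots> = C2\<^sup>2 * (\<rho> * \<rho>)" by (simp add: power2_eq_square)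
    also have "\<dots> \<le> C2\<^sup>2 * \<rho>" using \<rho> by (intro mult_left_mono mult_left_le) auto
    finally show ?thesis .
  qed
  have "torus_avg (\<lambda>\<psi>. (\<xi> \<psi> - b)\<^sup>2) \<le> torus_avg (\<lambda>\<psi>. 2 * (\<xi> \<psi> - c)\<^sup>2 + 2 * (b - c)\<^sup>2)"
  proof (intro torus_avg_mono torus_cont_intros \<xi>)
    fix \<psi>
    have "0 \<le> ((\<xi> \<psi> - c) + (b - c))\<^sup>2" by simp
    then show "(\<xi> \<psi> - b)\<^sup>2 \<le> 2 * (\<xi> \<psi> - c)\<^sup>2 + 2 * (b - c)\<^sup>2"
      by (simp add: power2_eq_square algebra_simps)
  qed
  also have "\<dots> = 2 * torus_avg (\<lambda>\<psi>. (\<xi> \<psi> - c)\<^sup>2) + 2 * (b - c)\<^sup>2"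
    by (simp add: torus_avg_add torus_avg_cmult torus_cont_intros \<xi>)
  also have "\<dots> \<le> 2 * (C1 * \<rho>) + 2 * (C2\<^sup>2 * \<rho>)" using assms(3) b2 by linarith
  also have "\<dots> \<le> ?K * \<rho>" using C \<rho> by (simp add: algebra_simps)
  finally show "torus_avg (\<lambda>\<psi>. (\<xi> \<psi> - b)\<^sup>2) \<le> ?K * \<rho>" .
qed

context slow_fast
begin

definition solution :: "real \<Rightarrow> (real^2 \<Rightarrow> real) \<Rightarrow> (real \<Rightarrow> real^2 \<Rightarrow> real) \<Rightarrow> bool" where
  "solution \<rho> W h \<longleftrightarrow> small \<rho> \<and> invariant \<rho> W \<and> conjugates \<rho> W h \<and> (\<forall>\<phi>\<in>U. torus_fun (h \<phi>)) \<and>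
     bounded ((\<lambda>(\<phi>, \<psi>). h \<phi> \<psi>) ` (U \<times> UNIV)) \<and> continuous_on (U \<times> UNIV) (\<lambda>(\<phi>, \<psi>). h \<phi> \<psi>)"

lemma U_nontrivial: "pm < pM" using order pos by linarith

text \<open>The constants in \<open>conjugacy_limit\<close> may depend on the bound of
  \<open>h\<close>. They influence only how large \<open>N\<close> is taken, and the concentration
  estimates are uniform in \<open>N\<close>; this keeps the final constant independent of the
  solution.\<close>

lemma solution_approx:
  assumes s: "solution \<rho> W h" and \<phi>: "\<phi> \<in> U"
  shows "\<exists>N. decay \<rho> ^ N \<le> \<rho> \<and> (\<forall>\<psi>. \<bar>h \<phi> \<psi> - hN \<rho> N W \<phi> \<psi>\<bar> \<le> \<rho>) \<and>
      (\<forall>\<psi>. \<bar>phi_deriv_within U h \<phi> \<psi> - hN' \<rho> N W \<phi> \<psi>\<bar> \<le> \<rho>)"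
    and "torus_cont (h \<phi>)" and "torus_cont (phi_deriv_within U h \<phi>)"
proof -
  have \<rho>: "small \<rho>" and W: "invariant \<rho> W" and cj: "conjugates \<rho> W h" and tf: "\<And>\<phi>. \<phi> \<in> U \<Longrightarrow> torus_fun (h \<phi>)"
    and bd: "bounded ((\<lambda>(\<phi>, \<psi>). h \<phi> \<psi>) ` (U \<times> UNIV))"
    and cont: "continuous_on (U \<times> UNIV) (\<lambda>(\<phi>, \<psi>). h \<phi> \<psi>)"
    using s by (auto simp: solution_def)
  note r = smallD[OF \<rho>]
  obtain B where B: "\<And>\<phi> \<psi>. \<phi> \<in> U \<Longrightarrow> \<bar>h \<phi> \<psi>\<bar> \<le> B"
  proof -
    obtain B where "\<forall>x\<in>(\<lambda>(\<phi>, \<psi>). h \<phi> \<psi>) ` (U \<times> UNIV). norm x \<le> B"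
      using bd by (auto simp: bounded_iff)
    then have "\<bar>h \<phi> \<psi>\<bar> \<le> B" if "\<phi> \<in> U" for \<phi> \<psi> using that by force
    then show ?thesis by (rule that)
  qed
  have hc: "continuous_on U (\<lambda>\<phi>. h \<phi> \<psi>)" for \<psi>
  proof -
    have "continuous_on U (\<lambda>\<phi>. (\<lambda>(\<phi>, \<psi>). h \<phi> \<psi>) (\<phi>, \<psi>))"
      by (rule continuous_on_compose2[OF cont]) (auto intro!: continuous_intros)
    then show ?thesis by simp
  qed
  have "continuous_on UNIV (\<lambda>\<psi>. (\<lambda>(\<phi>, \<psi>). h \<phi> \<psi>) (\<phi>, \<psi>))"
    by (rule continuous_on_compose2[OF cont]) (use \<phi> in \<open>auto intro!: continuous_intros\<close>)
  then show "torus_cont (h \<phi>)" using tf[OF \<phi>] by (simp add: torus_cont_def)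
  obtain C g where C: "\<And>n \<phi> \<psi>. \<phi> \<in> U \<Longrightarrow> \<bar>hN \<rho> n W \<phi> \<psi> - h \<phi> \<psi>\<bar> \<le> C * decay \<rho> ^ n"
    "\<And>n \<phi> \<psi>. \<phi> \<in> U \<Longrightarrow> \<bar>hN' \<rho> n W \<phi> \<psi> - g \<phi> \<psi>\<bar> \<le> C * decay \<rho> ^ n"
    and g: "\<And>\<phi> \<psi>. \<phi> \<in> U \<Longrightarrow> ((\<lambda>\<phi>. h \<phi> \<psi>) has_real_derivative g \<phi> \<psi>) (at \<phi> within U)"
    using conjugacy_limit[OF \<rho> W cj B hc] by blast
  have gd: "phi_deriv_within U h \<phi> \<psi> = g \<phi> \<psi>" for \<psi>
    unfolding phi_deriv_within_def by (rule vector_derivative_within_Icc[OF U_nontrivial \<phi> g[OF \<phi>]])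
  have to0: "(\<lambda>n. c * decay \<rho> ^ n) \<longlonglongrightarrow> 0" for c
    using decay[OF \<rho>] by (intro tendsto_mult_right_zero LIMSEQ_realpow_zero) auto
  have "\<forall>\<^sub>F n in sequentially. 1 * decay \<rho> ^ n < \<rho>" "\<forall>\<^sub>F n in sequentially. C * decay \<rho> ^ n < \<rho>"
    by (rule order_tendstoD(2)[OF to0 r(1)])+
  then have ev: "\<forall>\<^sub>F n in sequentially. decay \<rho> ^ n \<le> \<rho> \<and> C * decay \<rho> ^ n \<le> \<rho>"
    by eventually_elim simp
  then obtain n0 where n0: "\<And>n. n \<ge> n0 \<Longrightarrow> decay \<rho> ^ n \<le> \<rho> \<and> C * decay \<rho> ^ n \<le> \<rho>"
    by (auto simp: eventually_sequentially)
  show "\<exists>N. decay \<rho> ^ N \<le> \<rho> \<and> (\<forall>\<psi>. \<bar>h \<phi> \<psi> - hN \<rho> N W \<phi> \<psi>\<bar> \<le> \<rho>) \<and>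
      (\<forall>\<psi>. \<bar>phi_deriv_within U h \<phi> \<psi> - hN' \<rho> N W \<phi> \<psi>\<bar> \<le> \<rho>)"
  proof (intro exI[of _ n0] conjI allI)
    show "decay \<rho> ^ n0 \<le> \<rho>" using n0[of n0] by simp
    show "\<bar>h \<phi> \<psi> - hN \<rho> n0 W \<phi> \<psi>\<bar> \<le> \<rho>" for \<psi>
      using C(1)[OF \<phi>, of n0 \<psi>] n0[of n0] by (simp add: abs_minus_commute)
    show "\<bar>phi_deriv_within U h \<phi> \<psi> - hN' \<rho> n0 W \<phi> \<psi>\<bar> \<le> \<rho>" for \<psi>
      using C(2)[OF \<phi>, of n0 \<psi>] n0[of n0] by (simp add: gd abs_minus_commute)
  qed
  show "torus_cont (phi_deriv_within U h \<phi>)"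
  proof (rule torus_cont_uniform_limit[OF _ _ to0[of C]])
    fix n assume "n \<ge> n0"
    then have "(\<rho>, W, n, \<phi>) \<in> params" using n0 \<rho> W \<phi> by (simp add: params_def)
    then show "torus_cont (hN' \<rho> n W \<phi>)" using concentrated_hN' unfolding concentrated_def by fastforce
  next
    show "\<bar>hN' \<rho> n W \<phi> \<psi> - phi_deriv_within U h \<phi> \<psi>\<bar> \<le> C * decay \<rho> ^ n" for n \<psi>
      unfolding gd by (rule C(2)[OF \<phi>])
  qed
qed

lemma solution_concentrated:
  obtains C where "0 \<le> C"
    "\<And>\<rho> W h \<phi>. solution \<rho> W h \<Longrightarrow> \<phi> \<in> U \<Longrightarrow> \<bar>torus_avg (h \<phi>) - hc \<phi>\<bar> \<le> C * \<rho> \<and>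
       torus_avg (\<lambda>\<psi>. (h \<phi> \<psi> - hc \<phi>)\<^sup>2) \<le> C * \<rho> \<and>
       \<bar>torus_avg (phi_deriv_within U h \<phi>) - hc' \<phi>\<bar> \<le> C * \<rho> \<and>
       torus_avg (\<lambda>\<psi>. (phi_deriv_within U h \<phi> \<psi> - hc' \<phi>)\<^sup>2) \<le> C * \<rho>"
proof -
  define I where "I = {(\<rho>, W, h, \<phi>). solution \<rho> W h \<and> \<phi> \<in> U}"
  \<comment> \<open>Choosing a truncation for each solution and each \<open>\<phi>\<close> turns the
    family of solutions into a reindexing of \<open>params\<close>.\<close>
  define NN where "NN = (\<lambda>(\<rho>, W, h, \<phi>). SOME N. decay \<rho> ^ N \<le> \<rho> \<and> (\<forall>\<psi>. \<bar>h \<phi> \<psi> - hN \<rho> N W \<phi> \<psi>\<bar> \<le> \<rho>) \<and>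
      (\<forall>\<psi>. \<bar>phi_deriv_within U h \<phi> \<psi> - hN' \<rho> N W \<phi> \<psi>\<bar> \<le> \<rho>))"
  define f where "f = (\<lambda>(\<rho>, W, h, \<phi>). (\<rho>, W, NN (\<rho>, W, h, \<phi>), \<phi>))"
  have NN: "decay \<rho> ^ NN (\<rho>, W, h, \<phi>) \<le> \<rho> \<and> (\<forall>\<psi>. \<bar>h \<phi> \<psi> - hN \<rho> (NN (\<rho>, W, h, \<phi>)) W \<phi> \<psi>\<bar> \<le> \<rho>) \<and>
      (\<forall>\<psi>. \<bar>phi_deriv_within U h \<phi> \<psi> - hN' \<rho> (NN (\<rho>, W, h, \<phi>)) W \<phi> \<psi>\<bar> \<le> \<rho>)"
    if "solution \<rho> W h" "\<phi> \<in> U" for \<rho> W h \<phi>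
    unfolding NN_def prod.case by (rule someI_ex[OF solution_approx(1)[OF that]])
  have fI: "f i \<in> params" if "i \<in> I" for i
    using that NN by (auto simp: f_def I_def params_def solution_def)
  have 1: "concentrated I (\<lambda>i. fst (f i)) (\<lambda>(\<rho>, W, h, \<phi>). h \<phi>) (\<lambda>i. (\<lambda>(\<rho>, W, N, \<phi>). hc \<phi>) (f i))"
  proof (rule concentrated_perturb[OF concentrated_reindex[OF concentrated_hN fI], where K=1])
    fix i assume "i \<in> I"
    then obtain \<rho> W h \<phi> where e: "i = (\<rho>, W, h, \<phi>)" and s: "solution \<rho> W h" "\<phi> \<in> U" by (auto simp: I_def)
    show "torus_cont ((\<lambda>(\<rho>, W, h, \<phi>). h \<phi>) i)" using solution_approx(2)[OF s] e by simp
    show "\<bar>(\<lambda>(\<rho>, W, h, \<phi>). h \<phi>) i \<psi> - (\<lambda>(\<rho>, W, N, \<phi>). hN \<rho> N W \<phi>) (f i) \<psi>\<bar> \<le> 1 * fst (f i)" for \<psi>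
      using NN[OF s] by (simp add: e f_def)
  qed
  have 2: "concentrated I (\<lambda>i. fst (f i)) (\<lambda>(\<rho>, W, h, \<phi>). phi_deriv_within U h \<phi>) (\<lambda>i. (\<lambda>(\<rho>, W, N, \<phi>). hc' \<phi>) (f i))"
  proof (rule concentrated_perturb[OF concentrated_reindex[OF concentrated_hN' fI], where K=1])
    fix i assume "i \<in> I"
    then obtain \<rho> W h \<phi> where e: "i = (\<rho>, W, h, \<phi>)" and s: "solution \<rho> W h" "\<phi> \<in> U" by (auto simp: I_def)
    show "torus_cont ((\<lambda>(\<rho>, W, h, \<phi>). phi_deriv_within U h \<phi>) i)" using solution_approx(3)[OF s] e by simp
    show "\<bar>(\<lambda>(\<rho>, W, h, \<phi>). phi_deriv_within U h \<phi>) i \<psi> - (\<lambda>(\<rho>, W, N, \<phi>). hN' \<rho> N W \<phi>) (f i) \<psi>\<bar> \<le> 1 * fst (f i)" for \<psi>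
      using NN[OF s] by (simp add: e f_def)
  qed
  obtain C1 where C1: "0 \<le> C1" "\<forall>i\<in>I. \<bar>torus_avg ((\<lambda>(\<rho>, W, h, \<phi>). h \<phi>) i) - (\<lambda>(\<rho>, W, N, \<phi>). hc \<phi>) (f i)\<bar> \<le> C1 * fst (f i) \<and>
      torus_avg (\<lambda>\<psi>. ((\<lambda>(\<rho>, W, h, \<phi>). h \<phi>) i \<psi> - (\<lambda>(\<rho>, W, N, \<phi>). hc \<phi>) (f i))\<^sup>2) \<le> C1 * fst (f i)"
    using 1 unfolding concentrated_def by blast
  obtain C2 where C2: "0 \<le> C2" "\<forall>i\<in>I. \<bar>torus_avg ((\<lambda>(\<rho>, W, h, \<phi>). phi_deriv_within U h \<phi>) i) - (\<lambda>(\<rho>, W, N, \<phi>). hc' \<phi>) (f i)\<bar> \<le> C2 * fst (f i) \<and>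
      torus_avg (\<lambda>\<psi>. ((\<lambda>(\<rho>, W, h, \<phi>). phi_deriv_within U h \<phi>) i \<psi> - (\<lambda>(\<rho>, W, N, \<phi>). hc' \<phi>) (f i))\<^sup>2) \<le> C2 * fst (f i)"
    using 2 unfolding concentrated_def by blast
  show ?thesis
  proof (rule that[of "C1 + C2"])
    show "0 \<le> C1 + C2" using C1 C2 by simp
    fix \<rho> W h \<phi> assume s: "solution \<rho> W h" "\<phi> \<in> U"
    then have i: "(\<rho>, W, h, \<phi>) \<in> I" by (simp add: I_def)
    have "0 < \<rho>" using s(1) smallD(1) by (simp add: solution_def)
    then have "C1 * \<rho> \<le> (C1 + C2) * \<rho>" "C2 * \<rho> \<le> (C1 + C2) * \<rho>"
      using C1(1) C2(1) by (auto intro!: mult_right_mono)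
    then show "\<bar>torus_avg (h \<phi>) - hc \<phi>\<bar> \<le> (C1 + C2) * \<rho> \<and>
       torus_avg (\<lambda>\<psi>. (h \<phi> \<psi> - hc \<phi>)\<^sup>2) \<le> (C1 + C2) * \<rho> \<and>
       \<bar>torus_avg (phi_deriv_within U h \<phi>) - hc' \<phi>\<bar> \<le> (C1 + C2) * \<rho> \<and>
       torus_avg (\<lambda>\<psi>. (phi_deriv_within U h \<phi> \<psi> - hc' \<phi>)\<^sup>2) \<le> (C1 + C2) * \<rho>"
      using bspec[OF C1(2) i] bspec[OF C2(2) i] by (simp add: f_def)
  qed
qed

text \<open>Averaging preserves every condition with the same constants, and \<open>small\<close>
  involves only constants, so one smallness condition on \<rho> serves both systems.\<close>

lemma averaged_slow_fast:
  "slow_fast A lam mu eu es cu cs \<alpha> (\<lambda>n x p. fb n x) K pm pM Sm SM \<epsilon> \<kappa> \<gamma>"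
proof (intro slow_fast.intro slow_fast_axioms.intro hyperbolic_splitting_axioms)
  fix n :: nat and x y :: real
  show "n < 5 \<Longrightarrow> (fb n has_real_derivative fb (Suc n) x) (at x)" by (rule fb_deriv)
  show "n \<le> 5 \<Longrightarrow> \<bar>fb n x\<bar> \<le> K" by (rule fb_bound)
  show "n \<le> 5 \<Longrightarrow> \<bar>fb n x - fb n y\<bar> \<le> K * \<bar>x - y\<bar>" by (rule fb_lipschitz)
  show "holder (\<lambda>p. fb n x) K" using pos by (simp add: holder_def)
  show "torus_fun (\<lambda>p. fb n x)" by (simp add: torus_fun_def)
  show "x \<in> {pm..Sm} \<Longrightarrow> 0 \<le> fb 0 x"
    unfolding fb_def by (rule torus_avg_nonneg[OF F_torus_cont left]) auto
  show "x \<in> {SM..pM} \<Longrightarrow> fb 0 x \<le> 0"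
    unfolding fb_def by (rule torus_avg_le[OF F_torus_cont right]) auto
  show "x \<in> {pm..Sm - \<epsilon>} \<Longrightarrow> \<kappa> \<le> fb 0 x"
    unfolding fb_def using torus_avg_mono[OF torus_cont_const F_torus_cont far_left] by simp
  show "x \<in> {SM + \<epsilon>..pM} \<Longrightarrow> fb 0 x \<le> - \<kappa>"
    unfolding fb_def by (rule torus_avg_le[OF F_torus_cont far_right]) auto
  show "x \<in> {Sm - \<epsilon>..SM + \<epsilon>} \<Longrightarrow> fb 1 x \<le> - \<gamma>" by (rule fb_1_le)
  show "torus_avg (\<lambda>p. fb 0 0) = 0" using fb_0_0 by simp
qed (use order pos in auto)

lemma averaging_estimate:
  obtains C where "\<And>\<rho> W h hb \<phi>. solution \<rho> W h \<Longrightarrow> \<phi> \<in> U \<Longrightarrow> bounded (hb ` U) \<Longrightarrow> continuous_on U hb \<Longrightarrow>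
      (\<And>x. x \<in> U \<Longrightarrow> avg_conj_map hb (x + \<rho> * fb 0 x) = (1 + \<rho> * fb 1 0) * avg_conj_map hb x) \<Longrightarrow>
      \<bar>torus_avg (\<lambda>\<psi>. h \<phi> \<psi> - hb \<phi>)\<bar> \<le> C * \<rho> \<and> torus_avg (\<lambda>\<psi>. (h \<phi> \<psi> - hb \<phi>)\<^sup>2) \<le> C * \<rho> \<and>
      \<bar>torus_avg (\<lambda>\<psi>. phi_deriv_within U h \<phi> \<psi> - vector_derivative hb (at \<phi> within U))\<bar> \<le> C * \<rho> \<and>
      torus_avg (\<lambda>\<psi>. (phi_deriv_within U h \<phi> \<psi> - vector_derivative hb (at \<phi> within U))\<^sup>2) \<le> C * \<rho>"
proof -
  interpret av: slow_fast A lam mu eu es cu cs \<alpha> "\<lambda>n x p. fb n x" K pm pM Sm SM \<epsilon> \<kappa> \<gamma>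
    by (rule averaged_slow_fast)
  \<comment> \<open>Averaging a function of \<open>x\<close> alone changes nothing, so both systems
    have the same reference functions \<open>hc\<close> and \<open>hc'\<close>.\<close>
  have fb: "av.fb = fb" by (intro ext) (simp add: av.fb_def)
  have mom: "av.mom = mom" by (intro ext) (simp add: av.mom_def mom_def fb)
  have M: "av.M0 = M0" "av.M1 = M1"
    by (intro ext; simp add: av.M0_def M0_def av.M1_def M1_def mom)+
  have Lb: "av.Lb = Lb" by (intro ext) (simp add: av.Lb_def Lb_def M)
  have hc: "av.hc = hc" by (intro ext) (simp add: av.hc_def hc_def M Lb)
  have hc': "av.hc' = hc'" by (intro ext) (simp add: av.hc'_def hc'_def M Lb)
  obtain C1 where C1: "0 \<le> C1" "\<And>\<rho> W h \<phi>. solution \<rho> W h \<Longrightarrow> \<phi> \<in> U \<Longrightarrow> \<bar>torus_avg (h \<phi>) - hc \<phi>\<bar> \<le> C1 * \<rho> \<and>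
       torus_avg (\<lambda>\<psi>. (h \<phi> \<psi> - hc \<phi>)\<^sup>2) \<le> C1 * \<rho> \<and>
       \<bar>torus_avg (phi_deriv_within U h \<phi>) - hc' \<phi>\<bar> \<le> C1 * \<rho> \<and>
       torus_avg (\<lambda>\<psi>. (phi_deriv_within U h \<phi> \<psi> - hc' \<phi>)\<^sup>2) \<le> C1 * \<rho>"
    using solution_concentrated by blast
  obtain C2 where C2: "0 \<le> C2" "\<And>\<rho> W h \<phi>. av.solution \<rho> W h \<Longrightarrow> \<phi> \<in> U \<Longrightarrow> \<bar>torus_avg (h \<phi>) - hc \<phi>\<bar> \<le> C2 * \<rho> \<and>
       torus_avg (\<lambda>\<psi>. (h \<phi> \<psi> - hc \<phi>)\<^sup>2) \<le> C2 * \<rho> \<and>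
       \<bar>torus_avg (phi_deriv_within U h \<phi>) - hc' \<phi>\<bar> \<le> C2 * \<rho> \<and>
       torus_avg (\<lambda>\<psi>. (phi_deriv_within U h \<phi> \<psi> - hc' \<phi>)\<^sup>2) \<le> C2 * \<rho>"
    using av.solution_concentrated unfolding hc hc' by blast
  show ?thesis
  proof (rule that[of "2 * C1 + C2 + 2 * C2\<^sup>2"])
    fix \<rho> W h hb \<phi>
    assume s: "solution \<rho> W h" and \<phi>: "\<phi> \<in> U" and hb: "bounded (hb ` U)" "continuous_on U hb"
      and eq: "\<And>x. x \<in> U \<Longrightarrow> avg_conj_map hb (x + \<rho> * fb 0 x) = (1 + \<rho> * fb 1 0) * avg_conj_map hb x"
    have \<rho>: "small \<rho>" using s by (simp add: solution_def)
    \<comment> \<open>The invariant graph of the averaged system is the constant 0, and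
      \<open>hb\<close> is its conjugation remainder, regarded as constant in
      \<open>\<psi>\<close>.\<close>
    have sv: "av.solution \<rho> (\<lambda>_. 0) (\<lambda>\<phi> \<psi>. hb \<phi>)"
      unfolding av.solution_def
    proof (intro conjI ballI)
      show "small \<rho>" by (rule \<rho>)
      show "av.invariant \<rho> (\<lambda>_. 0)" using order fb_0_0 by (simp add: av.invariant_def torus_fun_def)
      show "av.conjugates \<rho> (\<lambda>_. 0) (\<lambda>\<phi> \<psi>. hb \<phi>)"
        using eq by (simp add: av.conjugates_def conj_map_def avg_conj_map_def)
      show "torus_fun (\<lambda>\<psi>. hb x)" for x by (simp add: torus_fun_def)
      have "(\<lambda>(\<phi>, \<psi> :: real^2). hb \<phi>) ` (U \<times> UNIV) = hb ` U" by force
      then show "bounded ((\<lambda>(\<phi>, \<psi> :: real^2). hb \<phi>) ` (U \<times> UNIV))" using hb(1) by simp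
      show "continuous_on (U \<times> UNIV) (\<lambda>(\<phi>, \<psi> :: real^2). hb \<phi>)"
        unfolding split_beta by (rule continuous_on_compose2[OF hb(2)]) (auto intro!: continuous_intros)
    qed
    have "phi_deriv_within U (\<lambda>\<phi> \<psi>. hb \<phi>) \<phi> = (\<lambda>\<psi>. vector_derivative hb (at \<phi> within U))"
      by (simp add: phi_deriv_within_def fun_eq_iff)
    then have b: "\<bar>hb \<phi> - hc \<phi>\<bar> \<le> C2 * \<rho>" "\<bar>vector_derivative hb (at \<phi> within U) - hc' \<phi>\<bar> \<le> C2 * \<rho>"
      using C2(2)[OF sv \<phi>] by simp_all
    have r: "0 \<le> \<rho>" "\<rho> \<le> 1" using smallD(1,2)[OF \<rho>] by auto
    have c: "\<bar>torus_avg (h \<phi>) - hc \<phi>\<bar> \<le> C1 * \<rho>" "torus_avg (\<lambda>\<psi>. (h \<phi> \<psi> - hc \<phi>)\<^sup>2) \<le> C1 * \<rho>"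
       "\<bar>torus_avg (phi_deriv_within U h \<phi>) - hc' \<phi>\<bar> \<le> C1 * \<rho>"
       "torus_avg (\<lambda>\<psi>. (phi_deriv_within U h \<phi> \<psi> - hc' \<phi>)\<^sup>2) \<le> C1 * \<rho>"
      using C1(2)[OF s \<phi>] by simp_all
    show "\<bar>torus_avg (\<lambda>\<psi>. h \<phi> \<psi> - hb \<phi>)\<bar> \<le> (2 * C1 + C2 + 2 * C2\<^sup>2) * \<rho> \<and>
        torus_avg (\<lambda>\<psi>. (h \<phi> \<psi> - hb \<phi>)\<^sup>2) \<le> (2 * C1 + C2 + 2 * C2\<^sup>2) * \<rho> \<and>
        \<bar>torus_avg (\<lambda>\<psi>. phi_deriv_within U h \<phi> \<psi> - vector_derivative hb (at \<phi> within U))\<bar> \<le> (2 * C1 + C2 + 2 * C2\<^sup>2) * \<rho> \<and>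
        torus_avg (\<lambda>\<psi>. (phi_deriv_within U h \<phi> \<psi> - vector_derivative hb (at \<phi> within U))\<^sup>2) \<le> (2 * C1 + C2 + 2 * C2\<^sup>2) * \<rho>"
      by (intro conjI torus_avg_recentre[OF solution_approx(2)[OF s \<phi>] c(1,2) b(1) r C1(1) C2(1)]
        torus_avg_recentre[OF solution_approx(3)[OF s \<phi>] c(3,4) b(2) r C1(1) C2(1)])
  qed
qed

lemma small_exists: "\<exists>\<rho>s>0. \<forall>\<rho>\<in>{0<..<\<rho>s}. small \<rho>"
proof -
  define x1 x2 x3 x4 x5 where x: "x1 = 1 / (2 * K)" "x2 = \<epsilon> / K" "x3 = 1 / \<gamma>"
      "x4 = (1 - rate) / (\<gamma> / 2)" "x5 = (\<bar>lam\<bar> powr \<alpha> - 1) / (8 * K)"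
  have x_pos: "0 < x1" "0 < x2" "0 < x3" "0 < x4" "0 < x5"
    using pos rate lam_powr_gt_1 by (simp_all add: x)
  define m where "m = min 1 (min x1 (min x2 (min x3 (min x4 x5))))"
  have "small \<rho>" if \<rho>: "\<rho> \<in> {0<..<m}" for \<rho>
  proof -
    have less: "0 < \<rho>" "\<rho> < 1" "\<rho> < x1" "\<rho> < x2" "\<rho> < x3" "\<rho> < x4" "\<rho> < x5"
      using \<rho> by (simp_all add: m_def)
    have "2 * K * \<rho> \<le> 1" using less(3) pos by (simp add: x pos_less_divide_eq mult_ac)
    moreover have "K * \<rho> \<le> \<epsilon>" using less(4) pos by (simp add: x pos_less_divide_eq mult_ac)
    moreover have "\<gamma> * \<rho> \<le> 1" using less(5) pos by (simp add: x pos_less_divide_eq mult_ac)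
    moreover have "\<gamma> / 2 * \<rho> \<le> 1 - rate" using less(6) pos by (simp add: x pos_less_divide_eq mult_ac)
    moreover have "8 * K * \<rho> \<le> \<bar>lam\<bar> powr \<alpha> - 1" using less(7) pos by (simp add: x pos_less_divide_eq mult_ac)
    ultimately show ?thesis using less(1,2) unfolding small_def by simp
  qed
  moreover have "0 < m" using x_pos by (simp add: m_def)
  ultimately show ?thesis by blast
qed

end

section \<open>From the hypotheses on f to the slow-fast system\<close>

lemma lattice_representative:
  fixes \<psi> :: "real^2"
  obtains \<psi>' where "\<psi>' \<in> cbox 0 periods" "\<And>g :: real^2 \<Rightarrow> real. torus_fun g \<Longrightarrow> g \<psi> = g \<psi>'"
proof -
  define k :: "2 \<Rightarrow> real" where "k i = of_int \<lfloor>\<psi> $ i / (2 * pi)\<rfloor>" for i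
  define \<psi>' where "\<psi>' = (\<chi> i. \<psi> $ i - 2 * pi * k i)"
  have "0 \<le> \<psi> $ i - 2 * pi * k i \<and> \<psi> $ i - 2 * pi * k i \<le> 2 * pi" for i
  proof -
    have "k i \<le> \<psi> $ i / (2 * pi)" "\<psi> $ i / (2 * pi) \<le> k i + 1" unfolding k_def by linarith+
    then show ?thesis by (simp add: pos_le_divide_eq pos_divide_le_eq algebra_simps)
  qed
  then have "\<psi>' \<in> cbox 0 periods" by (simp add: \<psi>'_def mem_box_cart)
  moreover have "g \<psi> = g \<psi>'" if "torus_fun g" for g :: "real^2 \<Rightarrow> real"
  proof -
    have e: "\<psi> = (\<psi>' + axis 1 (2 * pi * k 1)) + axis 2 (2 * pi * k 2)"
      by (simp add: \<psi>'_def vec_eq_iff axis_def forall_2)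
    show ?thesis by (subst e) (simp add: torus_fun_int_period[OF that] k_def)
  qed
  ultimately show ?thesis by (rule that)
qed

text \<open>Periodicity reduces the infimum to a compact box, where it is attained.\<close>

lemma torus_family_lower_bound:
  fixes G :: "real \<Rightarrow> real^2 \<Rightarrow> real"
  assumes c: "continuous_on UNIV (\<lambda>(x, p). G x p)" and t: "\<And>x. torus_fun (G x)"
    and p: "\<And>x \<psi>. x \<in> {a..b} \<Longrightarrow> 0 < G x \<psi>"
  shows "\<exists>c>0. \<forall>x\<in>{a..b}. \<forall>\<psi>. c \<le> G x \<psi>"
proof (cases "a \<le> b")
  case True
  let ?S = "{a..b} \<times> cbox 0 periods :: (real \<times> (real^2)) set"
  have "compact ?S" by (intro compact_Times) auto
  moreover have "(0::real^2) \<in> cbox 0 periods" by (simp add: mem_box_cart)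
  then have "?S \<noteq> {}" using True by auto
  ultimately obtain z where z: "z \<in> ?S" "\<forall>y\<in>?S. (\<lambda>(x, p). G x p) z \<le> (\<lambda>(x, p). G x p) y"
    using continuous_attains_inf[of ?S "\<lambda>(x, p). G x p"] continuous_on_subset[OF c] by blast
  have "G (fst z) (snd z) \<le> G x \<psi>" if "x \<in> {a..b}" for x \<psi>
  proof -
    obtain \<psi>' where "\<psi>' \<in> cbox 0 periods" "G x \<psi> = G x \<psi>'"
      using lattice_representative[of \<psi>] t[of x] by metis
    then show ?thesis using bspec[OF z(2), of "(x, \<psi>')"] that by (simp add: split_beta)
  qed
  moreover have "0 < G (fst z) (snd z)" using z(1) by (intro p) auto
  ultimately show ?thesis by blast
qed (auto intro: exI[of _ 1])

text \<open>All terms of the norm are nonnegative extended reals, so finiteness of the sum forces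
  each of them to be finite; \<open>0 < \<alpha>\<close> recovers the Hoelder seminorms from their
  weighted sum.\<close>

lemma B_space_bounds:
  assumes f: "f \<in> B_space \<alpha> k" and \<alpha>: "0 < \<alpha>"
  shows "\<exists>C. \<forall>n\<le>k. (\<forall>\<phi> \<psi>. \<bar>phi_deriv n f \<phi> \<psi>\<bar> \<le> C) \<and>
    (n < k \<longrightarrow> (\<forall>\<phi> \<psi> \<psi>'. \<bar>phi_deriv n f \<phi> \<psi> - phi_deriv n f \<phi> \<psi>'\<bar> \<le> C * dist \<psi> \<psi>' powr \<alpha>))"
proof -
  let ?s = "\<lambda>n. sup_norm (phi_deriv n f)" and ?h = "\<lambda>n. holder_seminorm \<alpha> (phi_deriv n f)"
  have s_ge: "ereal \<bar>phi_deriv n f \<phi> \<psi>\<bar> \<le> ?s n" for n \<phi> \<psi>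
    unfolding sup_norm_def by (rule SUP_upper2[of \<phi>, OF _ SUP_upper]) auto
  have h_ge: "ereal (\<bar>phi_deriv n f \<phi> \<psi>' - phi_deriv n f \<phi> \<psi>\<bar> / dist \<psi>' \<psi> powr \<alpha>) \<le> ?h n" if "\<psi>' \<noteq> \<psi>" for n \<phi> \<psi> \<psi>'
    unfolding holder_seminorm_def
    by (rule SUP_upper2[of \<phi>, OF _ SUP_upper2[of \<psi>, OF _ SUP_upper]]) (use that in auto)
  have s0: "0 \<le> ?s n" for n
    by (rule order_trans[OF _ s_ge[of n 0 0]]) simp
  have h0: "0 \<le> ?h n" for n
    by (rule order_trans[OF _ h_ge[of "axis 1 1" 0 n 0]]) (auto simp: axis_eq_0_iff)
  have fin: "B_norm \<alpha> k f < \<infinity>" using f by (simp add: B_space_def)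
  have S0: "0 \<le> (\<Sum>n\<le>k. ?s n)" and H0: "0 \<le> (\<Sum>n<k. ?h n)" by (auto intro!: sum_nonneg s0 h0)
  have aH: "0 \<le> ereal \<alpha> * (\<Sum>n<k. ?h n)" using H0 \<alpha> by simp
  have "(\<Sum>n\<le>k. ?s n) \<noteq> \<infinity>" "ereal \<alpha> * (\<Sum>n<k. ?h n) \<noteq> \<infinity>"
    using fin S0 aH unfolding B_norm_def by auto
  then have "(\<Sum>n\<le>k. ?s n) \<noteq> \<infinity>" "(\<Sum>n<k. ?h n) \<noteq> \<infinity>" using \<alpha> by auto
  then have sf: "?s n \<noteq> \<infinity>" if "n \<le> k" for n
    using that by (auto simp: sum_Pinfty)
  have hf: "?h n \<noteq> \<infinity>" if "n < k" for n
    using that \<open>(\<Sum>n<k. ?h n) \<noteq> \<infinity>\<close> by (auto simp: sum_Pinfty)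
  define C where "C = (\<Sum>n\<le>k. real_of_ereal (?s n)) + (\<Sum>n<k. real_of_ereal (?h n))"
  have r0: "0 \<le> real_of_ereal (?s n)" "0 \<le> real_of_ereal (?h n)" for n
    using s0 h0 by (auto intro: real_of_ereal_pos)
  have sC: "real_of_ereal (?s n) \<le> C" if "n \<le> k" for n
  proof -
    have "real_of_ereal (?s n) \<le> (\<Sum>n\<le>k. real_of_ereal (?s n))"
      using that r0 by (intro member_le_sum) auto
    moreover have "0 \<le> (\<Sum>n<k. real_of_ereal (?h n))" by (intro sum_nonneg r0)
    ultimately show ?thesis by (simp add: C_def)
  qed
  have hC: "real_of_ereal (?h n) \<le> C" if "n < k" for n
  proof -
    have "real_of_ereal (?h n) \<le> (\<Sum>n<k. real_of_ereal (?h n))"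
      using that r0 by (intro member_le_sum) auto
    moreover have "0 \<le> (\<Sum>n\<le>k. real_of_ereal (?s n))" by (intro sum_nonneg r0)
    ultimately show ?thesis by (simp add: C_def)
  qed
  show ?thesis
  proof (intro exI[of _ C] allI impI conjI)
    fix n \<phi> \<psi> assume n: "n \<le> k"
    have "ereal \<bar>phi_deriv n f \<phi> \<psi>\<bar> \<le> ereal (real_of_ereal (?s n))"
      using s_ge sf[OF n] s0[of n] by (simp add: ereal_real)
    then show "\<bar>phi_deriv n f \<phi> \<psi>\<bar> \<le> C" using sC[OF n] by simp
  next
    fix n \<phi> \<psi> \<psi>' assume n: "n < k"
    show "\<bar>phi_deriv n f \<phi> \<psi> - phi_deriv n f \<phi> \<psi>'\<bar> \<le> C * dist \<psi> \<psi>' powr \<alpha>"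
    proof (cases "\<psi> = \<psi>'")
      case False
      have "ereal (\<bar>phi_deriv n f \<phi> \<psi> - phi_deriv n f \<phi> \<psi>'\<bar> / dist \<psi> \<psi>' powr \<alpha>) \<le> ereal (real_of_ereal (?h n))"
        using h_ge[OF False] hf[OF n] h0[of n] by (simp add: ereal_real)
      then have "\<bar>phi_deriv n f \<phi> \<psi> - phi_deriv n f \<phi> \<psi>'\<bar> / dist \<psi> \<psi>' powr \<alpha> \<le> C" using hC[OF n] by simp
      then show ?thesis using False by (simp add: pos_divide_le_eq)
    qed simp
  qed
qed

lemma phi_deriv_Suc: "phi_deriv (Suc n) f \<phi> \<psi> = deriv (\<lambda>x. phi_deriv n f x \<psi>) \<phi>"
  by (simp add: phi_deriv_def)

lemma phi_deriv_0: "phi_deriv 0 f = f"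
  by (simp add: phi_deriv_def fun_eq_iff)

text \<open>The norm of order 6 contains Hoelder seminorms only up to order 5, and the bound on the
  sixth derivative supplies the Lipschitz bound of the fifth; hence the range of \<open>n\<close>.
  Adding 1 to the constant makes it positive.\<close>

lemma B_space_derivatives:
  assumes f: "f \<in> B_space \<alpha> 6" and split: "hyperbolic_splitting A lam mu eu es cu cs \<alpha>"
  obtains K where "0 < K"
    "\<And>n x \<psi>. n < 5 \<Longrightarrow> ((\<lambda>x. phi_deriv n f x \<psi>) has_real_derivative phi_deriv (Suc n) f x \<psi>) (at x)"
    "\<And>n x \<psi>. n \<le> 5 \<Longrightarrow> \<bar>phi_deriv n f x \<psi>\<bar> \<le> K"
    "\<And>n x y \<psi>. n \<le> 5 \<Longrightarrow> \<bar>phi_deriv n f x \<psi> - phi_deriv n f y \<psi>\<bar> \<le> K * \<bar>x - y\<bar>"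
    "\<And>n x. n \<le> 5 \<Longrightarrow> hyperbolic_splitting.holder \<alpha> (phi_deriv n f x) K"
    "\<And>n x. torus_fun (phi_deriv n f x)"
proof -
  interpret hyperbolic_splitting A lam mu eu es cu cs \<alpha> by (rule split)
  obtain C where C: "\<And>n \<phi> \<psi>. n \<le> 6 \<Longrightarrow> \<bar>phi_deriv n f \<phi> \<psi>\<bar> \<le> C"
    "\<And>n \<phi> \<psi> \<psi>'. n < 6 \<Longrightarrow> \<bar>phi_deriv n f \<phi> \<psi> - phi_deriv n f \<phi> \<psi>'\<bar> \<le> C * dist \<psi> \<psi>' powr \<alpha>"
  proof -
    from B_space_bounds[OF f alpha] obtain C where C: "\<forall>n\<le>6. (\<forall>\<phi> \<psi>. \<bar>phi_deriv n f \<phi> \<psi>\<bar> \<le> C) \<and>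
      (n < 6 \<longrightarrow> (\<forall>\<phi> \<psi> \<psi>'. \<bar>phi_deriv n f \<phi> \<psi> - phi_deriv n f \<phi> \<psi>'\<bar> \<le> C * dist \<psi> \<psi>' powr \<alpha>))" ..
    show ?thesis by (rule that[of C]) (use C in auto)
  qed
  have C0: "0 \<le> C" using C(1)[of 0 0 0] by linarith
  have d: "((\<lambda>x. phi_deriv n f x \<psi>) has_real_derivative phi_deriv (Suc n) f x \<psi>) (at x)" if "n < 6" for n x \<psi>
  proof -
    have "(\<lambda>x. phi_deriv n f x \<psi>) field_differentiable (at x)" using f that by (simp add: B_space_def)
    then show ?thesis unfolding phi_deriv_Suc by (simp add: DERIV_deriv_iff_field_differentiable)
  qed
  show ?thesis
  proof (rule that[of "C + 1"])
    show "\<bar>phi_deriv n f x \<psi>\<bar> \<le> C + 1" if "n \<le> 5" for n x \<psi> using C(1)[of n x \<psi>] that by linarith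
    show "\<bar>phi_deriv n f x \<psi> - phi_deriv n f y \<psi>\<bar> \<le> (C + 1) * \<bar>x - y\<bar>" if "n \<le> 5" for n x y \<psi>
    proof -
      have "norm (phi_deriv n f x \<psi> - phi_deriv n f y \<psi>) \<le> (C + 1) * norm (x - y)"
      proof (rule field_differentiable_bound[of UNIV])
        show "((\<lambda>x. phi_deriv n f x \<psi>) has_field_derivative phi_deriv (Suc n) f z \<psi>) (at z within UNIV)" for z
          using d[of n] that by simp
        show "norm (phi_deriv (Suc n) f z \<psi>) \<le> C + 1" for z using C(1)[of "Suc n" z \<psi>] that by simp
      qed auto
      then show ?thesis by simp
    qed
    show "holder (phi_deriv n f x) (C + 1)" if "n \<le> 5" for n x
      unfolding holder_def
    proof (intro allI)
      fix \<psi> \<psi>' :: "real^2"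
      have "C * dist \<psi> \<psi>' powr \<alpha> \<le> (C + 1) * dist \<psi> \<psi>' powr \<alpha>" by (intro mult_right_mono) auto
      then show "\<bar>phi_deriv n f x \<psi> - phi_deriv n f x \<psi>'\<bar> \<le> (C + 1) * dist \<psi> \<psi>' powr \<alpha>"
        using C(2)[of n x \<psi> \<psi>'] that by linarith
    qed
    show "torus_fun (phi_deriv n f x)" for n x
      using f by (auto simp: B_space_def torus_fun_def phi_deriv_def)
  qed (use d C0 in auto)
qed

theorem theorem5:
  fixes f :: "real \<Rightarrow> real^2 \<Rightarrow> real" and A\<^sub>0 :: "real^2^2"
    and \<alpha>\<^sub>0 \<phi>\<^sub>m \<phi>\<^sub>M S\<^sub>m S\<^sub>M :: real and S :: "real^2 \<Rightarrow> real" and U :: "real set"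
  assumes "anosov_automorphism A\<^sub>0"
    and "0 < \<alpha>\<^sub>0" and "\<alpha>\<^sub>0 \<le> 1"
    and "f \<in> B_space \<alpha>\<^sub>0 6" and "B_norm \<alpha>\<^sub>0 6 f = 1"
    and "\<phi>\<^sub>m < \<phi>\<^sub>M" and "\<phi>\<^sub>M - \<phi>\<^sub>m < 2 * pi" and "U = {\<phi>\<^sub>m..\<phi>\<^sub>M}"
    and "\<And>\<psi>. f \<phi>\<^sub>m \<psi> > 0" and "\<And>\<psi>. f \<phi>\<^sub>M \<psi> < 0"
    and "\<And>\<psi>. \<exists>!\<phi>. \<phi> \<in> interior U \<and> f \<phi> \<psi> = 0"
    and "\<And>\<psi>. S \<psi> \<in> interior U \<and> f (S \<psi>) \<psi> = 0"
    and "S\<^sub>m = (INF \<psi>. S \<psi>)" and "S\<^sub>M = (SUP \<psi>. S \<psi>)"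
    and "(SUP (\<phi>, \<psi>) \<in> {S\<^sub>m..S\<^sub>M} \<times> UNIV. phi_deriv 1 f \<phi> \<psi>) < 0"
    and "0 \<in> {S\<^sub>m..S\<^sub>M}" and "avg_field f 0 = 0"
    and "\<And>\<phi>. \<phi> \<in> U \<Longrightarrow> avg_field f \<phi> = 0 \<Longrightarrow> \<phi> = 0"
  shows "\<exists>\<rho>\<^sub>s>0. \<exists>C\<^sub>7. \<forall>\<rho>\<in>{0<..<\<rho>\<^sub>s}. \<forall>W h hb.
           invariant_graph f A\<^sub>0 \<rho> {S\<^sub>m..S\<^sub>M} W \<longrightarrow>
           conj_remainder f A\<^sub>0 \<rho> U W h \<longrightarrow>
           avg_conj_remainder f \<rho> U hb \<longrightarrow>
           (\<forall>\<phi>\<in>U.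
              \<bar>torus_avg (\<lambda>\<psi>. h \<phi> \<psi> - hb \<phi>)\<bar> \<le> C\<^sub>7 * \<rho> \<and>
              torus_avg (\<lambda>\<psi>. (h \<phi> \<psi> - hb \<phi>)\<^sup>2) \<le> C\<^sub>7 * \<rho> \<and>
              \<bar>torus_avg (\<lambda>\<psi>. phi_deriv_within U h \<phi> \<psi> -
                  vector_derivative hb (at \<phi> within U))\<bar> \<le> C\<^sub>7 * \<rho> \<and>
              torus_avg (\<lambda>\<psi>. (phi_deriv_within U h \<phi> \<psi> -
                  vector_derivative hb (at \<phi> within U))\<^sup>2) \<le> C\<^sub>7 * \<rho>)"
proof -
  obtain lam mu eu es cu cs where split: "hyperbolic_splitting A\<^sub>0 lam mu eu es cu cs \<alpha>\<^sub>0"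
    using anosov_hyperbolic_splitting[OF assms(1,2)] by blast
  interpret hs: hyperbolic_splitting A\<^sub>0 lam mu eu es cu cs \<alpha>\<^sub>0 by (rule split)
  let ?F = "\<lambda>n. phi_deriv n f"
  obtain K where K: "0 < K"
    and dF: "\<And>n x \<psi>. n < 5 \<Longrightarrow> ((\<lambda>x. ?F n x \<psi>) has_real_derivative ?F (Suc n) x \<psi>) (at x)"
    and bF: "\<And>n x \<psi>. n \<le> 5 \<Longrightarrow> \<bar>?F n x \<psi>\<bar> \<le> K"
    and lF: "\<And>n x y \<psi>. n \<le> 5 \<Longrightarrow> \<bar>?F n x \<psi> - ?F n y \<psi>\<bar> \<le> K * \<bar>x - y\<bar>"
    and hF: "\<And>n x. n \<le> 5 \<Longrightarrow> hs.holder (?F n x) K"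
    and tF: "\<And>n x. torus_fun (?F n x)"
    by (rule B_space_derivatives[OF assms(4) split]) (rule that; assumption)
  have lf: "\<bar>f x \<psi> - f y \<psi>\<bar> \<le> K * \<bar>x - y\<bar>" for x y \<psi> using lF[of 0 x \<psi> y] by (simp add: phi_deriv_0)
  have tf: "torus_fun (f x)" for x using tF[of 0 x] by (simp add: phi_deriv_0)
  have df: "((\<lambda>x. f x \<psi>) has_real_derivative ?F 1 x \<psi>) (at x)" for x \<psi>
    using dF[of 0 \<psi> x] by (simp add: phi_deriv_0)
  have cf: "continuous_on UNIV (\<lambda>(x, p). f x p)"
  proof -
    have h: "\<bar>f x p - f x q\<bar> \<le> K * dist p q powr \<alpha>\<^sub>0" for x p q
      using hF[of 0 x] by (simp add: hs.holder_def phi_deriv_0)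
    have "((\<lambda>z. f (fst z) (snd z)) \<longlongrightarrow> f (fst z0) (snd z0)) (at z0)" for z0 :: "real \<times> (real^2)"
    proof -
      have "((\<lambda>z. K * \<bar>fst z - fst z0\<bar> + K * dist (snd z) (snd z0) powr \<alpha>\<^sub>0)
          \<longlongrightarrow> K * \<bar>fst z0 - fst z0\<bar> + K * dist (snd z0) (snd z0) powr \<alpha>\<^sub>0) (at z0)"
        by (intro tendsto_intros tendsto_powr') (use assms(2) in auto)
      then have z: "((\<lambda>z. K * \<bar>fst z - fst z0\<bar> + K * dist (snd z) (snd z0) powr \<alpha>\<^sub>0) \<longlongrightarrow> 0) (at z0)" by simp
      have "((\<lambda>z. f (fst z) (snd z) - f (fst z0) (snd z0)) \<longlongrightarrow> 0) (at z0)"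
      proof (rule Lim_null_comparison[OF _ z], rule always_eventually, rule allI)
        fix z :: "real \<times> (real^2)"
        show "norm (f (fst z) (snd z) - f (fst z0) (snd z0)) \<le> K * \<bar>fst z - fst z0\<bar> + K * dist (snd z) (snd z0) powr \<alpha>\<^sub>0"
          using h[of "fst z0" "snd z" "snd z0"] lf[of "fst z" "snd z" "fst z0"] by simp
      qed
      then show ?thesis by (simp add: LIM_zero_iff)
    qed
    then show ?thesis by (simp add: continuous_on_def split_beta)
  qed
  have int: "interior U = {\<phi>\<^sub>m<..<\<phi>\<^sub>M}" by (simp add: assms(8))
  have S: "\<phi>\<^sub>m < S \<psi>" "S \<psi> < \<phi>\<^sub>M" "f (S \<psi>) \<psi> = 0" for \<psi> using assms(12)[of \<psi>] int by auto
  have uniq: "x = S \<psi>" if "\<phi>\<^sub>m < x" "x < \<phi>\<^sub>M" "f x \<psi> = 0" for x \<psi>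
    using assms(11)[of \<psi>] assms(12)[of \<psi>] that int by auto
  have fcont: "continuous_on X (\<lambda>x. f x \<psi>)" for X \<psi>
    by (rule DERIV_continuous_on[of X _ "\<lambda>x. ?F 1 x \<psi>"]) (rule has_field_derivative_at_within[OF df])
  \<comment> \<open>A nonpositive value would produce, by the intermediate value theorem, a zero to
    the left of \<open>S \<psi>\<close>, against uniqueness.\<close>
  have lpos: "0 < f x \<psi>" if x: "\<phi>\<^sub>m \<le> x" "x < S \<psi>" for x \<psi>
  proof (rule ccontr)
    assume "\<not> 0 < f x \<psi>"
    then obtain y where "\<phi>\<^sub>m \<le> y" "y \<le> x" "f y \<psi> = 0"
      using IVT2'[of "\<lambda>x. f x \<psi>" x 0 \<phi>\<^sub>m] assms(9)[of \<psi>] x fcont by auto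
    then show False using uniq[of y \<psi>] assms(9)[of \<psi>] x S[of \<psi>] by (cases "y = \<phi>\<^sub>m") auto
  qed
  have rneg: "f x \<psi> < 0" if x: "S \<psi> < x" "x \<le> \<phi>\<^sub>M" for x \<psi>
  proof (rule ccontr)
    assume "\<not> f x \<psi> < 0"
    then obtain y where "x \<le> y" "y \<le> \<phi>\<^sub>M" "f y \<psi> = 0"
      using IVT2'[of "\<lambda>x. f x \<psi>" \<phi>\<^sub>M 0 x] assms(10)[of \<psi>] x fcont by auto
    then show False using uniq[of y \<psi>] assms(10)[of \<psi>] x S[of \<psi>] by (cases "y = \<phi>\<^sub>M") auto
  qed
  have bdS: "bdd_below (range S)" "bdd_above (range S)" using S by (auto intro!: bdd_belowI bdd_aboveI less_imp_le)
  have SmS: "S\<^sub>m \<le> S \<psi>" "S \<psi> \<le> S\<^sub>M" for \<psi>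
    unfolding assms(13,14) using bdS by (auto intro: cINF_lower cSUP_upper)
  have cn: "continuous_on UNIV (\<lambda>(x, p). - f x p)"
    using continuous_on_minus[OF cf] by (simp add: split_beta)
  have tn: "torus_fun (\<lambda>p. - f x p)" for x using tf[of x] by (simp add: torus_fun_def)
  obtain c1 where c1: "0 < c1" "\<And>\<psi>. c1 \<le> f \<phi>\<^sub>m \<psi>"
    using torus_family_lower_bound[OF cf tf, of \<phi>\<^sub>m \<phi>\<^sub>m] assms(9) by auto
  obtain c2 where c2: "0 < c2" "\<And>\<psi>. f \<phi>\<^sub>M \<psi> \<le> - c2"
  proof -
    obtain c where "0 < c" "\<forall>x\<in>{\<phi>\<^sub>M..\<phi>\<^sub>M}. \<forall>\<psi>. c \<le> - f x \<psi>"
      using torus_family_lower_bound[OF cn tn, of \<phi>\<^sub>M \<phi>\<^sub>M] assms(10) by auto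
    then show ?thesis by (intro that[of c]) (auto simp: le_minus_iff)
  qed
  \<comment> \<open>Each \<open>S \<psi>\<close> lies inside \<open>U\<close>, but the infimum could
    touch the end point. The uniform lower bound \<open>c1\<close> there and the Lipschitz constant
    keep it away by \<open>c1 / K\<close>.\<close>
  have Sm_ge: "\<phi>\<^sub>m + c1 / K \<le> S\<^sub>m"
    unfolding assms(13)
  proof (rule cINF_greatest)
    fix \<psi>
    have "c1 \<le> K * (S \<psi> - \<phi>\<^sub>m)" using lf[of \<phi>\<^sub>m \<psi> "S \<psi>"] c1(2)[of \<psi>] S[of \<psi>] by simp
    then show "\<phi>\<^sub>m + c1 / K \<le> S \<psi>" using K by (simp add: field_simps)
  qed simp
  have SM_le: "S\<^sub>M \<le> \<phi>\<^sub>M - c2 / K"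
    unfolding assms(14)
  proof (rule cSUP_least)
    fix \<psi>
    have "c2 \<le> K * (\<phi>\<^sub>M - S \<psi>)" using lf[of \<phi>\<^sub>M \<psi> "S \<psi>"] c2(2)[of \<psi>] S[of \<psi>] by simp
    then show "S \<psi> \<le> \<phi>\<^sub>M - c2 / K" using K by (simp add: field_simps)
  qed simp
  define \<gamma> where "\<gamma> = - (SUP (\<phi>, \<psi>) \<in> {S\<^sub>m..S\<^sub>M} \<times> UNIV. phi_deriv 1 f \<phi> \<psi>)"
  have g: "0 < \<gamma>" using assms(15) by (simp add: \<gamma>_def)
  have F1: "?F 1 x \<psi> \<le> - \<gamma>" if "x \<in> {S\<^sub>m..S\<^sub>M}" for x \<psi>
  proof -
    have "bdd_above ((\<lambda>(\<phi>, \<psi>). ?F 1 \<phi> \<psi>) ` ({S\<^sub>m..S\<^sub>M} \<times> UNIV))"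
      using bF[of 1] by (auto intro!: bdd_aboveI[of _ K] simp: abs_le_iff)
    from cSUP_upper[OF _ this, of "(x, \<psi>)"] that show ?thesis by (simp add: \<gamma>_def)
  qed
  \<comment> \<open>The first term keeps the slope below \<open>- (\<gamma> / 2)\<close> on the
    enlarged strip, the other two keep that strip inside \<open>U\<close>; halving makes the
    inclusion strict.\<close>
  define \<epsilon> where "\<epsilon> = min (\<gamma> / (2 * K)) (min (c1 / (2 * K)) (c2 / (2 * K)))"
  have e: "0 < \<epsilon>" "\<epsilon> \<le> \<gamma> / (2 * K)" "\<epsilon> \<le> c1 / (2 * K)" "\<epsilon> \<le> c2 / (2 * K)"
    using g c1(1) c2(1) K by (auto simp: \<epsilon>_def)
  have half: "c / (2 * K) < c / K" if "0 < c" for c using that K by (simp add: field_simps)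
  have o1: "\<phi>\<^sub>m < S\<^sub>m - \<epsilon>" using Sm_ge e(3) half[OF c1(1)] by linarith
  have o2: "S\<^sub>M + \<epsilon> < \<phi>\<^sub>M" using SM_le e(4) half[OF c2(1)] by linarith
  obtain k1 where k1: "0 < k1" "\<And>x \<psi>. x \<in> {\<phi>\<^sub>m..S\<^sub>m - \<epsilon>} \<Longrightarrow> k1 \<le> f x \<psi>"
  proof -
    have "0 < f x \<psi>" if "x \<in> {\<phi>\<^sub>m..S\<^sub>m - \<epsilon>}" for x \<psi> using that e(1) SmS(1)[of \<psi>] by (intro lpos) auto
    from torus_family_lower_bound[OF cf tf this] show ?thesis using that by blast
  qed
  obtain k2 where k2: "0 < k2" "\<And>x \<psi>. x \<in> {S\<^sub>M + \<epsilon>..\<phi>\<^sub>M} \<Longrightarrow> k2 \<le> - f x \<psi>"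
  proof -
    have "0 < - f x \<psi>" if "x \<in> {S\<^sub>M + \<epsilon>..\<phi>\<^sub>M}" for x \<psi>
      using rneg[of \<psi> x] that e(1) SmS(2)[of \<psi>] by auto
    from torus_family_lower_bound[OF cn tn this] show ?thesis using that by blast
  qed
  \<comment> \<open>The contraction rate passed on is \<open>\<gamma> / 2\<close>, the part of the
    slope that survives on the enlarged strip.\<close>
  interpret sf: slow_fast A\<^sub>0 lam mu eu es cu cs \<alpha>\<^sub>0 ?F K \<phi>\<^sub>m \<phi>\<^sub>M S\<^sub>m S\<^sub>M \<epsilon> "min k1 k2" "\<gamma> / 2"
  proof (intro slow_fast.intro slow_fast_axioms.intro split)
    fix n :: nat and x y :: real and \<psi> :: "real^2"
    show "x \<in> {\<phi>\<^sub>m..S\<^sub>m} \<Longrightarrow> 0 \<le> ?F 0 x \<psi>"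
      using lpos[of x \<psi>] S(3)[of \<psi>] SmS(1)[of \<psi>] by (cases "x = S \<psi>") (auto simp: phi_deriv_0 intro: less_imp_le)
    show "x \<in> {S\<^sub>M..\<phi>\<^sub>M} \<Longrightarrow> ?F 0 x \<psi> \<le> 0"
      using rneg[of \<psi> x] S(3)[of \<psi>] SmS(2)[of \<psi>] by (cases "x = S \<psi>") (auto simp: phi_deriv_0 intro: less_imp_le)
    show "x \<in> {\<phi>\<^sub>m..S\<^sub>m - \<epsilon>} \<Longrightarrow> min k1 k2 \<le> ?F 0 x \<psi>" using k1(2)[of x \<psi>] by (simp add: phi_deriv_0)
    show "x \<in> {S\<^sub>M + \<epsilon>..\<phi>\<^sub>M} \<Longrightarrow> ?F 0 x \<psi> \<le> - min k1 k2" using k2(2)[of x \<psi>] by (simp add: phi_deriv_0)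
    show "?F 1 x \<psi> \<le> - (\<gamma> / 2)" if x: "x \<in> {S\<^sub>m - \<epsilon>..S\<^sub>M + \<epsilon>}"
    proof -
      \<comment> \<open>The nearest point of the original strip, where the slope bound
        \<open>- \<gamma>\<close> is available.\<close>
      define y where "y = max S\<^sub>m (min x S\<^sub>M)"
      have y: "y \<in> {S\<^sub>m..S\<^sub>M}" "\<bar>x - y\<bar> \<le> \<epsilon>" using x assms(16) e(1) by (auto simp: y_def)
      have "\<bar>?F 1 x \<psi> - ?F 1 y \<psi>\<bar> \<le> K * \<epsilon>"
        using order_trans[OF lF[of 1 x \<psi> y] mult_left_mono[OF y(2)]] K by simp
      also have "\<dots> \<le> \<gamma> / 2" using e(2) K by (simp add: field_simps)
      finally show ?thesis using F1[OF y(1), of \<psi>] by linarith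
    qed
    show "torus_avg (?F 0 0) = 0" using assms(17) by (simp add: phi_deriv_0 avg_field_def)
  qed (use dF bF lF hF tF o1 o2 e(1) k1(1) k2(1) g K assms(16) in auto)
  have fb0: "sf.fb 0 = avg_field f" by (simp add: fun_eq_iff sf.fb_def avg_field_def phi_deriv_0)
  have fb1: "sf.fb 1 0 = deriv (avg_field f) 0"
    using sf.fb_deriv[of 0 0] unfolding fb0 by (simp add: DERIV_imp_deriv)
  obtain \<rho>s where \<rho>s: "0 < \<rho>s" "\<And>\<rho>. \<rho> \<in> {0<..<\<rho>s} \<Longrightarrow> sf.small \<rho>" using sf.small_exists by blast
  obtain C where C: "\<And>\<rho> W h hb \<phi>. sf.solution \<rho> W h \<Longrightarrow> \<phi> \<in> {\<phi>\<^sub>m..\<phi>\<^sub>M} \<Longrightarrow> bounded (hb ` {\<phi>\<^sub>m..\<phi>\<^sub>M}) \<Longrightarrow>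
      continuous_on {\<phi>\<^sub>m..\<phi>\<^sub>M} hb \<Longrightarrow>
      (\<And>x. x \<in> {\<phi>\<^sub>m..\<phi>\<^sub>M} \<Longrightarrow> avg_conj_map hb (x + \<rho> * sf.fb 0 x) = (1 + \<rho> * sf.fb 1 0) * avg_conj_map hb x) \<Longrightarrow>
      \<bar>torus_avg (\<lambda>\<psi>. h \<phi> \<psi> - hb \<phi>)\<bar> \<le> C * \<rho> \<and> torus_avg (\<lambda>\<psi>. (h \<phi> \<psi> - hb \<phi>)\<^sup>2) \<le> C * \<rho> \<and>
      \<bar>torus_avg (\<lambda>\<psi>. phi_deriv_within {\<phi>\<^sub>m..\<phi>\<^sub>M} h \<phi> \<psi> - vector_derivative hb (at \<phi> within {\<phi>\<^sub>m..\<phi>\<^sub>M}))\<bar> \<le> C * \<rho> \<and>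
      torus_avg (\<lambda>\<psi>. (phi_deriv_within {\<phi>\<^sub>m..\<phi>\<^sub>M} h \<phi> \<psi> - vector_derivative hb (at \<phi> within {\<phi>\<^sub>m..\<phi>\<^sub>M}))\<^sup>2) \<le> C * \<rho>"
    using sf.averaging_estimate by blast
  show ?thesis
    unfolding assms(8)
  proof (rule exI[of _ \<rho>s], rule conjI[OF \<rho>s(1)], rule exI[of _ C], intro ballI allI impI conjI)
    fix \<rho> W h hb \<phi>
    assume r: "\<rho> \<in> {0<..<\<rho>s}" and W: "invariant_graph f A\<^sub>0 \<rho> {S\<^sub>m..S\<^sub>M} W"
      and h: "conj_remainder f A\<^sub>0 \<rho> {\<phi>\<^sub>m..\<phi>\<^sub>M} W h" and hb: "avg_conj_remainder f \<rho> {\<phi>\<^sub>m..\<phi>\<^sub>M} hb"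
      and \<phi>: "\<phi> \<in> {\<phi>\<^sub>m..\<phi>\<^sub>M}"
    have "sf.solution \<rho> W h"
      using \<rho>s(2)[OF r] W h
      by (auto simp: sf.solution_def sf.invariant_def sf.conjugates_def invariant_graph_def conj_remainder_def
          skew_map_def phi_deriv_0)
    from C[OF this \<phi>, of hb]
    show "\<bar>torus_avg (\<lambda>\<psi>. h \<phi> \<psi> - hb \<phi>)\<bar> \<le> C * \<rho>" "torus_avg (\<lambda>\<psi>. (h \<phi> \<psi> - hb \<phi>)\<^sup>2) \<le> C * \<rho>"
      "\<bar>torus_avg (\<lambda>\<psi>. phi_deriv_within {\<phi>\<^sub>m..\<phi>\<^sub>M} h \<phi> \<psi> - vector_derivative hb (at \<phi> within {\<phi>\<^sub>m..\<phi>\<^sub>M}))\<bar> \<le> C * \<rho>"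
      "torus_avg (\<lambda>\<psi>. (phi_deriv_within {\<phi>\<^sub>m..\<phi>\<^sub>M} h \<phi> \<psi> - vector_derivative hb (at \<phi> within {\<phi>\<^sub>m..\<phi>\<^sub>M}))\<^sup>2) \<le> C * \<rho>"
      using hb unfolding avg_conj_remainder_def avg_map_def fb0 fb1 by simp_all
  qed
qed

end
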